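(* Let $I_k=\{0,\dots,k\}$, let $\theta_i\in(0,1]$ for $i\in I_k$ with $\theta_0$ irrational, let $\nu=\sum_{i=0}^k\nu_i\delta_i$ be a probability measure on $I_k$, and let $r\in[0,\infty]\cup\{\omega\}$. Then there exists a $C^0$ open and $C^r$ dense subset of $(C^r(\mathbb{S}^1,SL_2(\mathbb{R})))^{k+1}$ such that for every $\hat A=(A_0,\dots,A_k)$ in this subset the random product $(\hat f,\hat A)$ of the quasi-periodic cocycles $(\theta_i,A_i)_{i\in I_k}$ has positive Lyapunov exponent and is a $C^0$-continuity point for the Lyapunov exponents.
   Context: $\mathbb{S}^1=\mathbb{R}/\mathbb{Z}$ with Lebesgue measure $\mathrm{Leb}$. $C^r$ denotes maps of class $C^r$ ($C^\omega$ = real analytic). The $C^s$ topology on a product $(C^r(\mathbb{S}^1,\cdot))^{k+1}$ is given by $d_{C^s}(\hat A,\hat B)=\max_{i}d_{C^s}(A_i,B_i)$, where $d_{C^s}$ on each factor is a distance generating the $C^s$ topology. Random product: let $X=I_k^{\mathbb{Z}}$, $\hat X=X\times\mathbb{S}^1$, and $\hat f:\hat X\to\hat X$, $\hat f((x_n)_{n\in\mathbb{Z}},t)=((x_{n+1})_{n\in\mathbb{Z}},t+\theta_{x_0})$. The measure $\hat\mu=\nu^{\mathbb{Z}}\times\mathrm{Leb}$ is $\hat f$-invariant, and, $\theta_0$ being irrational, $(\hat f,\hat\mu)$ is taken to be an ergodic system. For $A_0,\dots,A_k:\mathbb{S}^1\to GL_d(\mathbb{R})$, the random product of $(\theta_i,A_i)_{i\in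 I_k}$ is the linear cocycle over $\hat f$ generated by $\hat A(x,t)=A_{x_0}(t)$; the tuple $(A_0,\dots,A_k)$ is also denoted $\hat A$. Its iterates are $\hat A^n(\hat x)=\hat A(\hat f^{n-1}(\hat x))\cdots\hat A(\hat x)$, $n\ge1$. The Lyapunov exponents are those given by Oseledets' theorem with respect to $\hat\mu$. For $SL_2(\mathbb{R})$-valued cocycles they are $\lambda_+(\hat A)\ge 0\ge\lambda_-(\hat A)=-\lambda_+(\hat A)$, where $\lambda_+(\hat A)=\lim_n\frac1n\log\|\hat A^n(\hat x)\|$ for $\hat\mu$-a.e. $\hat x$; "positive Lyapunov exponent" means $\lambda_+(\hat A)>0$. $\hat A\in(C^r(\mathbb{S}^1,GL_d(\mathbb{R})))^{k+1}$ is a $C^0$-continuity point for the Lyapunov exponents if for every sequence $\hat A_n\in(C^r(\mathbb{S}^1,GL_d(\mathbb{R})))^{k+1}$ converging to $\hat A$ in the $C^0$ topology, the Lyapunov exponents of $\hat A_n$ converge to those of $\hat A$ (here $d=2$).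
   Formalization: The probability measure ν is assumed not to be a point mass (every ν_i < 1, so k ≥ 1); for a point mass the claim fails, since nonzero-degree quasi-periodic cocycles with positive exponent are never C^0-continuity points. *)

theory Defs
  imports "HOL-Probability.Probability"
begin

text \<open>
  The circle \<open>\<real>/\<int>\<close> is represented in two ways: maps defined on it are 1-periodic functions on
  \<^typ>\<open>real\<close>, while as a measure space it is \<open>{0..<1}\<close> with Lebesgue measure.
\<close>

datatype regularity = Order ennreal | Analytic

definition iter_deriv :: "nat \<Rightarrow> (real \<Rightarrow> 'a::real_normed_vector) \<Rightarrow> real \<Rightarrow> 'a" where
  "iter_deriv j f = ((\<lambda>g t. vector_derivative g (at t)) ^^ j) f"

text \<open>
  For a non-integer order \<open>s = n + \<alpha>\<close>, \<open>0 < \<alpha> < 1\<close>, class \<open>C\<^sup>s\<close> means \<open>C\<^sup>n\<close> with \<open>\<alpha>\<close>-Hoelder \<open>n\<close>-th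
  derivative. For 1-periodic functions, the Hoelder quotients over \<^typ>\<open>real\<close> and over the circle
  have the same supremum.
\<close>

definition finite_order :: "real \<Rightarrow> (real \<Rightarrow> 'a::real_normed_vector) \<Rightarrow> bool" where
  "finite_order s f \<longleftrightarrow>
     (\<forall>j<nat \<lfloor>s\<rfloor>. \<forall>t. iter_deriv j f differentiable (at t)) \<and>
     continuous_on UNIV (iter_deriv (nat \<lfloor>s\<rfloor>) f) \<and>
     (frac s > 0 \<longrightarrow>
       (\<exists>K. \<forall>t u. norm (iter_deriv (nat \<lfloor>s\<rfloor>) f t - iter_deriv (nat \<lfloor>s\<rfloor>) f u)
                  \<le> K * \<bar>t - u\<bar> powr frac s))"

definition real_analytic :: "(real \<Rightarrow> 'a::real_normed_vector) \<Rightarrow> bool" where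
  "real_analytic f \<longleftrightarrow>
     (\<forall>t0. \<exists>e>0. \<exists>a. \<forall>t. \<bar>t - t0\<bar> < e \<longrightarrow> (\<lambda>n. (t - t0) ^ n *\<^sub>R a n) sums f t)"

fun of_class :: "regularity \<Rightarrow> (real \<Rightarrow> 'a::real_normed_vector) \<Rightarrow> bool" where
  "of_class (Order r) f \<longleftrightarrow> (\<forall>s\<ge>0. ennreal s \<le> r \<longrightarrow> finite_order s f)"
| "of_class Analytic f \<longleftrightarrow> real_analytic f"

definition circle_maps :: "regularity \<Rightarrow> (real^2^2) set \<Rightarrow> (real \<Rightarrow> real^2^2) set" where
  "circle_maps r V = {f. (\<forall>t. f (t + 1) = f t) \<and> (\<forall>t. f t \<in> V) \<and> of_class r f}"

definition GL2 :: "(real^2^2) set" where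
  "GL2 = {M. invertible M}"

definition SL2 :: "(real^2^2) set" where
  "SL2 = {M. det M = 1}"

definition C_dist :: "real \<Rightarrow> (real \<Rightarrow> 'a::real_normed_vector) \<Rightarrow> (real \<Rightarrow> 'a) \<Rightarrow> real" where
  "C_dist s f g =
     (\<Sum>j\<le>nat \<lfloor>s\<rfloor>. SUP t. norm (iter_deriv j f t - iter_deriv j g t)) +
     (if frac s > 0 then
        (let h = (\<lambda>t. iter_deriv (nat \<lfloor>s\<rfloor>) f t - iter_deriv (nat \<lfloor>s\<rfloor>) g t)
         in SUP (t, u) \<in> {(t, u). t \<noteq> u}. norm (h t - h u) / \<bar>t - u\<bar> powr frac s)
      else 0)"

text \<open>
  \<open>holo_ext \<rho> f F\<close>: \<open>F\<close> is a bounded holomorphic extension of \<open>f\<close> to the strip \<open>|Im z| < \<rho>\<close>. Every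
  analytic 1-periodic \<open>f\<close> has one for some \<open>\<rho> > 0\<close>.
\<close>

definition strip :: "real \<Rightarrow> complex set" where
  "strip \<rho> = {z. \<bar>Im z\<bar> < \<rho>}"

definition holo_ext :: "real \<Rightarrow> (real \<Rightarrow> real^2^2) \<Rightarrow> (complex \<Rightarrow> complex^2^2) \<Rightarrow> bool" where
  "holo_ext \<rho> f F \<longleftrightarrow>
     (\<forall>i j. (\<lambda>z. F z $ i $ j) holomorphic_on strip \<rho>) \<and>
     bounded (F ` strip \<rho>) \<and>
     (\<forall>t i j. F (of_real t) $ i $ j = of_real (f t $ i $ j))"

text \<open>
  The analytic topology on a set \<open>M\<close> of analytic maps is the inductive limit, over all widths
  \<open>\<rho> > 0\<close>, of the topologies of uniform convergence on \<open>strip \<rho>\<close> of the extensions.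
\<close>

definition analytic_open :: "(real \<Rightarrow> real^2^2) set \<Rightarrow> (real \<Rightarrow> real^2^2) set \<Rightarrow> bool" where
  "analytic_open M U \<longleftrightarrow> U \<subseteq> M \<and>
     (\<forall>\<rho>>0. \<forall>f\<in>U. \<forall>F. holo_ext \<rho> f F \<longrightarrow>
        (\<exists>\<epsilon>>0. \<forall>g\<in>M. \<forall>G. holo_ext \<rho> g G \<and> (\<forall>z\<in>strip \<rho>. norm (F z - G z) < \<epsilon>) \<longrightarrow> g \<in> U))"

text \<open>
  For finite \<open>r\<close> the balls of \<^term>\<open>C_dist s\<close> with \<open>s < r\<close> are already open for \<^term>\<open>C_dist r\<close>, so
  the subbasis below generates the usual \<open>C\<^sup>r\<close> topology; for \<open>r = \<infinity>\<close> all finite orders are needed.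
  The order of the topology is independent of the regularity of the maps in \<open>M\<close>, so that
  \<open>C_topology (Order 0) (circle_maps r V)\<close> is the \<open>C\<^sup>0\<close> topology on \<open>C\<^sup>r\<close> maps.
\<close>

fun C_topology :: "regularity \<Rightarrow> (real \<Rightarrow> real^2^2) set \<Rightarrow> (real \<Rightarrow> real^2^2) topology" where
  "C_topology (Order r) M =
     topology_generated_by
       {{g \<in> M. C_dist s f g < \<epsilon>} | s f \<epsilon>. 0 \<le> s \<and> ennreal s \<le> r \<and> f \<in> M \<and> 0 < \<epsilon>}"
| "C_topology Analytic M = topology (analytic_open M)"

lemma topspace_C_topology_Order: "topspace (C_topology (Order r) M) = M"
proof -
  have "f \<in> {g \<in> M. C_dist 0 f g < 1}" if "f \<in> M" for f :: "real \<Rightarrow> real^2^2"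
    using that by (simp add: C_dist_def)
  moreover have "0 \<le> (0::real) \<and> ennreal 0 \<le> r \<and> (0::real) < 1" by simp
  ultimately show ?thesis
    unfolding C_topology.simps topology_generated_by_topspace by blast
qed

lemma istopology_analytic_open: "istopology (analytic_open M)"
  unfolding istopology_def
proof (intro conjI allI impI)
  fix S T assume S: "analytic_open M S" and T: "analytic_open M T"
  show "analytic_open M (S \<inter> T)"
    unfolding analytic_open_def
  proof (intro conjI allI impI ballI)
    show "S \<inter> T \<subseteq> M" using S by (auto simp: analytic_open_def)
    fix \<rho> f F assume a: "0 < (\<rho>::real)" "f \<in> S \<inter> T" "holo_ext \<rho> f F"
    obtain d where d: "d > 0" "\<And>g G. g \<in> M \<Longrightarrow> holo_ext \<rho> g G \<Longrightarrow>
        (\<forall>z\<in>strip \<rho>. norm (F z - G z) < d) \<Longrightarrow> g \<in> S"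
      using S a unfolding analytic_open_def by (metis IntD1)
    obtain e where e: "e > 0" "\<And>g G. g \<in> M \<Longrightarrow> holo_ext \<rho> g G \<Longrightarrow>
        (\<forall>z\<in>strip \<rho>. norm (F z - G z) < e) \<Longrightarrow> g \<in> T"
      using T a unfolding analytic_open_def by (metis IntD2)
    show "\<exists>\<epsilon>>0. \<forall>g\<in>M. \<forall>G. holo_ext \<rho> g G \<and>
        (\<forall>z\<in>strip \<rho>. norm (F z - G z) < \<epsilon>) \<longrightarrow> g \<in> S \<inter> T"
      using d e by (intro exI[of _ "min d e"]) auto
  qed
next
  fix K assume K: "\<forall>U\<in>K. analytic_open M U"
  show "analytic_open M (\<Union>K)"
    unfolding analytic_open_def
  proof (intro conjI allI impI ballI)
    show "\<Union>K \<subseteq> M" using K by (auto simp: analytic_open_def)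
    fix \<rho> f F assume a: "0 < (\<rho>::real)" "f \<in> \<Union>K" "holo_ext \<rho> f F"
    then obtain U where U: "U \<in> K" "f \<in> U" by blast
    then have "\<exists>\<epsilon>>0. \<forall>g\<in>M. \<forall>G. holo_ext \<rho> g G \<and>
        (\<forall>z\<in>strip \<rho>. norm (F z - G z) < \<epsilon>) \<longrightarrow> g \<in> U"
      using K a by (auto simp: analytic_open_def)
    then show "\<exists>\<epsilon>>0. \<forall>g\<in>M. \<forall>G. holo_ext \<rho> g G \<and>
        (\<forall>z\<in>strip \<rho>. norm (F z - G z) < \<epsilon>) \<longrightarrow> g \<in> \<Union>K"
      using U by blast
  qed
qed

lemma openin_C_topology_Analytic: "openin (C_topology Analytic M) = analytic_open M"
  by (simp add: istopology_analytic_open)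

lemma topspace_C_topology_Analytic: "topspace (C_topology Analytic M) = M"
proof
  show "topspace (C_topology Analytic M) \<subseteq> M"
    using openin_topspace[of "C_topology Analytic M"]
    unfolding openin_C_topology_Analytic analytic_open_def by simp
  have "analytic_open M M"
    unfolding analytic_open_def by (blast intro: zero_less_one)
  then show "M \<subseteq> topspace (C_topology Analytic M)"
    by (metis openin_C_topology_Analytic openin_subset)
qed

abbreviation tuples ::
    "nat \<Rightarrow> regularity \<Rightarrow> (real^2^2) set \<Rightarrow> (nat \<Rightarrow> real \<Rightarrow> real^2^2) set" where
  "tuples k r V \<equiv> PiE {..k} (\<lambda>_. circle_maps r V)"

text \<open>\<open>tuple_topology s k r V\<close> is the \<open>C\<^sup>s\<close> topology on \<open>(C\<^sup>r(S\<^sup>1, V))\<^sup>k\<^sup>+\<^sup>1\<close>.\<close>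

abbreviation tuple_topology ::
    "regularity \<Rightarrow> nat \<Rightarrow> regularity \<Rightarrow> (real^2^2) set \<Rightarrow> (nat \<Rightarrow> real \<Rightarrow> real^2^2) topology" where
  "tuple_topology s k r V \<equiv> product_topology (\<lambda>_. C_topology s (circle_maps r V)) {..k}"

lemma topspace_tuple_topology: "topspace (tuple_topology s k r V) = tuples k r V"
  by (cases s) (simp_all only: topspace_product_topology topspace_C_topology_Order
      topspace_C_topology_Analytic)

text \<open>
  Symbol sequences range over \<^typ>\<open>nat\<close>; for \<open>set_pmf \<nu> \<subseteq> {..k}\<close> those leaving \<open>{..k}\<close> form a
  null set.
\<close>

definition base_measure :: "nat pmf \<Rightarrow> ((int \<Rightarrow> nat) \<times> real) measure" where
  "base_measure \<nu> =
     PiM UNIV (\<lambda>_::int. measure_pmf \<nu>) \<Otimes>\<^sub>M restrict_space lborel {0..<1}"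

definition base_map ::
    "(nat \<Rightarrow> real) \<Rightarrow> (int \<Rightarrow> nat) \<times> real \<Rightarrow> (int \<Rightarrow> nat) \<times> real" where
  "base_map \<theta> = (\<lambda>(x, t). (\<lambda>n. x (n + 1), frac (t + \<theta> (x 0))))"

definition ergodic_system :: "'a measure \<Rightarrow> ('a \<Rightarrow> 'a) \<Rightarrow> bool" where
  "ergodic_system M T \<longleftrightarrow>
     prob_space M \<and> T \<in> measurable M M \<and> distr M M T = M \<and>
     (\<forall>B\<in>sets M. T -` B \<inter> space M = B \<longrightarrow> measure M B = 0 \<or> measure M B = 1)"

definition generator :: "(nat \<Rightarrow> real \<Rightarrow> real^2^2) \<Rightarrow> (int \<Rightarrow> nat) \<times> real \<Rightarrow> real^2^2" where
  "generator A = (\<lambda>(x, t). A (x 0) t)"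

fun iterate ::
    "(nat \<Rightarrow> real) \<Rightarrow> (nat \<Rightarrow> real \<Rightarrow> real^2^2) \<Rightarrow> nat \<Rightarrow> (int \<Rightarrow> nat) \<times> real \<Rightarrow> real^2^2" where
  "iterate \<theta> A 0 p = mat 1"
| "iterate \<theta> A (Suc n) p = generator A ((base_map \<theta> ^^ n) p) ** iterate \<theta> A n p"

text \<open>
  Oseledets' filtration in dimension 2: almost everywhere there is a line \<open>L\<close> whose non-zero vectors
  grow with rate \<open>l2\<close> while all other vectors grow with rate \<open>l1\<close>. If \<open>l1 = l2\<close>, any line will do, so
  exponents are counted with multiplicity.
\<close>

definition oseledets_exponents ::
    "(nat \<Rightarrow> real) \<Rightarrow> nat pmf \<Rightarrow> (nat \<Rightarrow> real \<Rightarrow> real^2^2) \<Rightarrow> real \<times> real \<Rightarrow> bool" where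
  "oseledets_exponents \<theta> \<nu> A = (\<lambda>(l1, l2). l2 \<le> l1 \<and>
     (AE p in base_measure \<nu>. \<exists>L. subspace L \<and> dim L = 1 \<and>
        (\<forall>v. v \<noteq> 0 \<longrightarrow>
           (\<lambda>n. ln (norm (iterate \<theta> A n p *v v)) / real n)
             \<longlonglongrightarrow> (if v \<in> L then l2 else l1))))"

definition lyapunov_exponents ::
    "(nat \<Rightarrow> real) \<Rightarrow> nat pmf \<Rightarrow> (nat \<Rightarrow> real \<Rightarrow> real^2^2) \<Rightarrow> real \<times> real" where
  "lyapunov_exponents \<theta> \<nu> A = (THE l. oseledets_exponents \<theta> \<nu> A l)"

text \<open>
  The top exponent through the growth of the norm. The limit does not depend on the choice of the
  matrix norm; \<^const>\<open>norm\<close> is the Frobenius norm.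
\<close>

definition lyapunov_plus ::
    "(nat \<Rightarrow> real) \<Rightarrow> nat pmf \<Rightarrow> (nat \<Rightarrow> real \<Rightarrow> real^2^2) \<Rightarrow> real" where
  "lyapunov_plus \<theta> \<nu> A =
     (THE l. AE p in base_measure \<nu>. (\<lambda>n. ln (norm (iterate \<theta> A n p)) / real n) \<longlonglongrightarrow> l)"

definition C0_continuity_point ::
    "(nat \<Rightarrow> real) \<Rightarrow> nat pmf \<Rightarrow> nat \<Rightarrow> regularity \<Rightarrow> (nat \<Rightarrow> real \<Rightarrow> real^2^2) \<Rightarrow> bool" where
  "C0_continuity_point \<theta> \<nu> k r A \<longleftrightarrow>
     (\<forall>B. (\<forall>n. B n \<in> tuples k r GL2) \<longrightarrow>
        limitin (tuple_topology (Order 0) k r GL2) B A sequentially \<longrightarrow>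
        (\<lambda>n. lyapunov_exponents \<theta> \<nu> (B n)) \<longlonglongrightarrow> lyapunov_exponents \<theta> \<nu> A)"

lemma prob_space_base_measure: "prob_space (base_measure \<nu>)"
proof -
  interpret X: product_prob_space "\<lambda>_::int. measure_pmf \<nu>" UNIV
    by unfold_locales
  interpret T: prob_space "restrict_space lborel {0..<1::real}"
    by (rule prob_spaceI) (simp add: space_restrict_space emeasure_restrict_space)
  interpret pair_prob_space "PiM UNIV (\<lambda>_::int. measure_pmf \<nu>)" "restrict_space lborel {0..<1::real}"
    by unfold_locales
  show ?thesis unfolding base_measure_def by unfold_locales
qed

lemma vector_outside_lines:
  fixes L L' :: "(real^2) set"
  assumes "subspace L" "dim L = 1" "subspace L'" "dim L' = 1"
  obtains v where "v \<notin> L" "v \<notin> L'"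
proof -
  have ne: "\<exists>v. v \<notin> K" if "dim K = 1" for K :: "(real^2) set"
  proof (rule ccontr)
    assume "\<nexists>v. v \<notin> K"
    then have "K = UNIV" by blast
    with that show False by simp
  qed
  obtain v w where v: "v \<notin> L" and w: "w \<notin> L'" using ne assms by meson
  show thesis
  proof (cases "v \<in> L' \<and> w \<in> L")
    case True
    have "v + w \<notin> L" using True v assms(1) by (metis add_diff_cancel_right' subspace_diff)
    moreover have "v + w \<notin> L'" using True w assms(3) by (metis add_diff_cancel_left' subspace_diff)
    ultimately show thesis using that by blast
  next
    case False
    then show thesis using that v w by blast
  qed
qed

lemma oseledets_exponents_unique:
  assumes l: "oseledets_exponents \<theta> \<nu> A l" and m: "oseledets_exponents \<theta> \<nu> A m"
  shows "l = m"
proof -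
  interpret prob_space "base_measure \<nu>" by (rule prob_space_base_measure)
  obtain l1 l2 m1 m2 where lm: "l = (l1, l2)" "m = (m1, m2)" by (cases l, cases m)
  define G where "G p v n = ln (norm (iterate \<theta> A n p *v v)) / real n" for p v n
  define R where "R a b p L \<longleftrightarrow> subspace L \<and> dim L = 1 \<and>
      (\<forall>v. v \<noteq> 0 \<longrightarrow> G p v \<longlonglongrightarrow> (if v \<in> L then b else a))"
    for a b :: real and p and L :: "(real^2) set"
  have "AE p in base_measure \<nu>. \<exists>L. R l1 l2 p L" "AE p in base_measure \<nu>. \<exists>L. R m1 m2 p L"
    using l m unfolding lm oseledets_exponents_def R_def G_def by auto
  then have "AE p in base_measure \<nu>. (\<exists>L. R l1 l2 p L) \<and> (\<exists>L. R m1 m2 p L)" by eventually_elim auto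
  then obtain p L L' where L: "R l1 l2 p L" "R m1 m2 p L'"
    using eventually_happens'[OF ae_filter_bot] by blast
  have sub: "subspace L" "subspace L'" "dim L = 1" "dim L' = 1" using L by (auto simp: R_def)
  have eq: "(if v \<in> L then l2 else l1) = (if v \<in> L' then m2 else m1)" if "v \<noteq> 0" for v
    using L that unfolding R_def by (blast intro: LIMSEQ_unique)
  obtain u where "u \<notin> L" "u \<notin> L'" using vector_outside_lines sub by metis
  then have 1: "l1 = m1" using eq[of u] sub subspace_0 by auto
  have nz: "\<exists>v\<in>K. v \<noteq> 0" if "dim K = 1" for K :: "(real^2) set"
    using that dim_eq_0 by (metis One_nat_def Suc_neq_Zero empty_subsetI insert_iff subsetI)
  obtain v v' where v: "v \<in> L" "v \<noteq> 0" and v': "v' \<in> L'" "v' \<noteq> 0" using nz sub by meson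
  have "l2 = m2"
    using eq[OF v(2)] eq[OF v'(2)] v v' 1 by (auto split: if_splits)
  with 1 lm show ?thesis by simp
qed

lemma lyapunov_exponents_eq:
  "oseledets_exponents \<theta> \<nu> A l \<Longrightarrow> lyapunov_exponents \<theta> \<nu> A = l"
  unfolding lyapunov_exponents_def by (blast intro: oseledets_exponents_unique)

lemma lyapunov_plus_eq:
  assumes l: "AE p in base_measure \<nu>. (\<lambda>n. ln (norm (iterate \<theta> A n p)) / real n) \<longlonglongrightarrow> l"
  shows "lyapunov_plus \<theta> \<nu> A = l"
  unfolding lyapunov_plus_def
proof (rule the_equality[where P = "\<lambda>l. AE p in base_measure \<nu>. _ p \<longlonglongrightarrow> l", OF l])
  interpret prob_space "base_measure \<nu>" by (rule prob_space_base_measure)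
  fix m assume "AE p in base_measure \<nu>. (\<lambda>n. ln (norm (iterate \<theta> A n p)) / real n) \<longlonglongrightarrow> m"
  with l have "AE p in base_measure \<nu>. m = l"
    by eventually_elim (rule LIMSEQ_unique)
  then show "m = l" by simp
qed

end

theory Submission
  imports Defs "HOL-Complex_Analysis.Conformal_Mappings"
begin

text \<open>
  Call a tuple \<^emph>\<open>contracting\<close> if, for some length and some small power \<open>s\<close>, the expectation over
  random words of the \<open>s\<close>-th power of the expansion rate on the projective line is below \<open>1\<close>,
  uniformly in the fibre and the direction. This is stable under \<open>C\<^sup>0\<close>-small perturbations, also into
  \<open>GL\<^sub>2\<close>. Together with an irrational rotation in the support of \<open>\<nu>\<close> (which ergodicity provides) it
  makes the mean growth of vectors independent of fibre and direction up to \<open>o(n)\<close>, uniformly in the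
  tuple; hence the exponents exist, are simple and depend continuously on the tuple.

  A tuple is contracting as soon as at one fibre the group generated by the returns
  \<open>X\<^sub>i = U\<^sub>0\<^sup>-\<^sup>1 U\<^sub>i\<close>, where \<open>U\<^sub>i\<close> is the product along the word \<open>a\<^sup>i b a\<^sup>3\<^sup>-\<^sup>i\<close>, contains two elements
  \<open>g\<close>, \<open>h\<close> in ping-pong position. These words have a common end point, so that the four products act
  over the same fibre. Ping-pong gives a spectral gap on \<open>L\<^sup>2(\<real>\<^sup>2)\<close> for the differences
  \<open>f \<circ> U\<^sub>i - f \<circ> U\<^sub>0\<close>, in the manner of Furstenberg and Virtser, and no common invariant line; the gap
  forces exponential growth of vectors.

  Since the points \<open>i \<theta>\<^sub>a\<close> are distinct on the circle, multiplying \<open>A\<^sub>b\<close> by \<open>1 + \<delta> \<phi> N\<close>, with \<open>N\<close>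
  nilpotent and \<open>\<phi>\<close> a trigonometric polynomial, moves a single \<open>X\<^sub>i\<close> by a \<open>C\<^sup>r\<close>-small (even analytically
  small) change. A few such moves reach ping-pong position, which gives density.
\<close>

subsection \<open>Two-by-two matrices\<close>

text \<open>The matrices depend on the fibre, so the theory of products of independent matrices does
  not apply directly: averaging over words mixes functions that live over different fibres. Two
  devices repair this. Words that permute the same letters end over the same fibre, so their
  products can be compared there; and the L2 norm is summed over all fibres reached, of which words
  of length \<open>n\<close> produce at most \<open>(n + 1) ^ (k + 1)\<close>, because rotations
  commute. This polynomial factor loses against an exponential gap.

  Non-degeneracy at one fibre suffices: a prefix of letters \<open>a\<close> steers every fibre into
  a window around it, and a suffix of \<open>a\<close> equalises the lengths. Three returns are used
  because \<open>X 1\<close>, or else its commutator with \<open>X 2\<close>, supplies a hyperbolic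
  matrix, and \<open>X 3\<close> conjugates it into a second one.

  All estimates concern finite expectations over words, uniform in fibre and direction. Almost sure
  limits follow from exponential tail bounds and Borel-Cantelli, and continuity follows because the
  exponent of a nearby tuple is squeezed between its own extremal means at one fixed word
  length.\<close>

definition cross :: "real^2 \<Rightarrow> real^2 \<Rightarrow> real" where
  "cross x y = x$1 * y$2 - x$2 * y$1"

lemma mv2: "((M::real^2^2) *v x)$1 = M$1$1 * x$1 + M$1$2 * x$2"
  "(M *v x)$2 = M$2$1 * x$1 + M$2$2 * x$2"
  by (simp_all add: matrix_vector_mult_def sum_2)

lemma cross_mv: "cross (M *v x) (M *v y) = det M * cross x y"
  by (simp add: cross_def mv2 det_2 algebra_simps)

lemma norm2_sq: "(norm (x::real^2))\<^sup>2 = (x$1)\<^sup>2 + (x$2)\<^sup>2"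
  by (simp add: norm_eq_sqrt_inner inner_vec_def sum_2 power2_eq_square)

lemma inner2: "(x::real^2) \<bullet> y = x$1 * y$1 + x$2 * y$2"
  by (simp add: inner_vec_def sum_2)

lemma lagrange2: "(x \<bullet> y)\<^sup>2 + (cross x y)\<^sup>2 = (norm x)\<^sup>2 * (norm y)\<^sup>2"
  unfolding norm2_sq by (simp add: cross_def inner2 power2_eq_square algebra_simps)

lemma abs_cross_le: "\<bar>cross x y\<bar> \<le> norm x * norm y"
proof -
  have "\<bar>cross x y\<bar>\<^sup>2 \<le> (norm x * norm y)\<^sup>2"
    using lagrange2[of x y] zero_le_power2[of "x \<bullet> y"] unfolding power_mult_distrib power2_abs by linarith
  then show ?thesis by (rule power2_le_imp_le) simp
qed

text \<open>Cramer's rule without division: when \<open>cross x y = 1\<close>, the coordinates of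
  \<open>z\<close> in the basis \<open>x\<close>, \<open>y\<close> can be read off.\<close>

lemma cross_decomp: "cross x y *\<^sub>R z = cross z y *\<^sub>R x + cross x z *\<^sub>R y"
  by (simp add: vec_eq_iff forall_2 cross_def algebra_simps)

lemma cross_scale: "cross (a *\<^sub>R x) z = a * cross x z" "cross z (a *\<^sub>R x) = a * cross z x"
  by (simp_all add: cross_def algebra_simps)

lemma cross_swap: "cross y x = - cross x y"
  by (simp add: cross_def)

lemma cross_self [simp]: "cross x x = 0"
  by (simp add: cross_def)

lemma mv_norm_le: "norm ((M::real^2^2) *v x) \<le> norm M * norm x"
proof -
  have s: "(norm M)\<^sup>2 = (M$1$1)\<^sup>2 + (M$1$2)\<^sup>2 + (M$2$1)\<^sup>2 + (M$2$2)\<^sup>2"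
    by (simp add: norm_eq_sqrt_inner inner_vec_def sum_2 power2_eq_square)
  have "(norm M * norm x)\<^sup>2 - (norm (M *v x))\<^sup>2
      = (M$1$1 * x$2 - M$1$2 * x$1)\<^sup>2 + (M$2$1 * x$2 - M$2$2 * x$1)\<^sup>2"
    unfolding power_mult_distrib s norm2_sq mv2 by (simp add: power2_eq_square algebra_simps)
  then have "(norm (M *v x))\<^sup>2 \<le> (norm M * norm x)\<^sup>2"
    by (smt (verit) zero_le_power2)
  then show ?thesis by (rule power2_le_imp_le) simp
qed

text \<open>The adjugate, which is the inverse on determinant one. Unlike an inverse it is linear in
  the matrix, and it keeps the Frobenius norm.\<close>

definition adj2 :: "real^2^2 \<Rightarrow> real^2^2" where
  "adj2 M = vector [vector [M$2$2, - M$1$2], vector [- M$2$1, M$1$1]]"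

lemma adj2_nth [simp]: "adj2 M $1$1 = M$2$2" "adj2 M $1$2 = - M$1$2"
  "adj2 M $2$1 = - M$2$1" "adj2 M $2$2 = M$1$1"
  by (simp_all add: adj2_def)

lemma mm2: "((A::real^2^2) ** B)$i$j = A$i$1 * B$1$j + A$i$2 * B$2$j"
  by (simp add: matrix_matrix_mult_def sum_2)

lemma mat1_nth [simp]: "(mat 1 :: real^2^2)$1$1 = 1" "(mat 1 :: real^2^2)$1$2 = 0"
  "(mat 1 :: real^2^2)$2$1 = 0" "(mat 1 :: real^2^2)$2$2 = 1"
  by (simp_all add: mat_def)

lemma mat2_eqI:
  assumes "(A::real^2^2)$1$1 = B$1$1" "A$1$2 = B$1$2" "A$2$1 = B$2$1" "A$2$2 = B$2$2"
  shows "A = B"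
  using assms by (simp add: vec_eq_iff forall_2)

lemma adj2_left: "det M = 1 \<Longrightarrow> adj2 M ** M = mat 1"
  and adj2_right: "det M = 1 \<Longrightarrow> M ** adj2 M = mat 1"
  by (auto intro!: mat2_eqI simp: mm2 det_2 algebra_simps)

lemma det_adj2 [simp]: "det (adj2 M) = det M"
  by (simp add: det_2 algebra_simps)

lemma norm_adj2 [simp]: "norm (adj2 M) = norm M"
  by (simp add: norm_eq_sqrt_inner inner_vec_def sum_2 add_ac)

text \<open>The adjugate undoes \<open>M\<close> up to the factor \<open>det M\<close> and has the
  same norm, so the upper bound for it turns into a lower bound for \<open>M\<close>.\<close>

lemma mv_norm_ge: "\<bar>det M\<bar> * norm x \<le> norm M * norm ((M::real^2^2) *v x)"
proof -
  have "adj2 M *v (M *v x) = det M *\<^sub>R x"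
    by (simp add: vec_eq_iff forall_2 mv2 det_2 algebra_simps)
  then have "\<bar>det M\<bar> * norm x = norm (adj2 M *v (M *v x))" by simp
  also have "\<dots> \<le> norm M * norm (M *v x)" using mv_norm_le[of "adj2 M"] by simp
  finally show ?thesis .
qed

lemma det_nz_mv: "det (M::real^2^2) \<noteq> 0 \<Longrightarrow> x \<noteq> 0 \<Longrightarrow> M *v x \<noteq> 0"
  by (metis mv_norm_ge mult_zero_right norm_zero not_le zero_less_abs_iff zero_less_mult_iff zero_less_norm_iff)

subsection \<open>Words\<close>

definition words :: "nat \<Rightarrow> nat \<Rightarrow> nat list set" where
  "words k n = {w. set w \<subseteq> {..k} \<and> length w = n}"

definition wt :: "nat pmf \<Rightarrow> nat list \<Rightarrow> real" where
  "wt \<nu> w = prod_list (map (pmf \<nu>) w)"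

text \<open>The expectation over random words as a finite sum: measurability in the symbols plays no
  part until almost sure statements are made.\<close>

definition EW :: "nat \<Rightarrow> nat pmf \<Rightarrow> nat \<Rightarrow> (nat list \<Rightarrow> real) \<Rightarrow> real" where
  "EW k \<nu> n F = (\<Sum>w\<in>words k n. wt \<nu> w * F w)"

fun wmat :: "(nat \<Rightarrow> real) \<Rightarrow> (nat \<Rightarrow> real \<Rightarrow> real^2^2) \<Rightarrow> real \<Rightarrow> nat list \<Rightarrow> real^2^2" where
  "wmat \<theta> A t [] = mat 1"
| "wmat \<theta> A t (i # w) = wmat \<theta> A (t + \<theta> i) w ** A i t"

text \<open>Fibres are reals that are never reduced modulo 1, which keeps end points additive;
  periodicity is invoked only where points of the circle have to be compared.\<close>

definition wend :: "(nat \<Rightarrow> real) \<Rightarrow> real \<Rightarrow> nat list \<Rightarrow> real" where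
  "wend \<theta> t w = t + sum_list (map \<theta> w)"

lemma wend_simps [simp]: "wend \<theta> t [] = t" "wend \<theta> t (i # w) = wend \<theta> (t + \<theta> i) w"
  "wend \<theta> t (u @ w) = wend \<theta> (wend \<theta> t u) w"
  by (simp_all add: wend_def add_ac)

lemma wmat_append: "wmat \<theta> A t (u @ w) = wmat \<theta> A (wend \<theta> t u) w ** wmat \<theta> A t u"
  by (induction u arbitrary: t) (simp_all add: matrix_mul_assoc)

lemma finite_words [simp]: "finite (words k n)"
  unfolding words_def by (rule finite_lists_length_eq) simp

lemma words_0 [simp]: "words k 0 = {[]}"
  by (auto simp: words_def)

lemma words_Suc: "words k (Suc n) = (\<lambda>(i, w). i # w) ` ({..k} \<times> words k n)"
  by (auto simp: words_def length_Suc_conv image_iff)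

lemma words_append: "u \<in> words k m \<Longrightarrow> w \<in> words k n \<Longrightarrow> u @ w \<in> words k (m + n)"
  by (auto simp: words_def)

lemma wt_nonneg [simp]: "0 \<le> wt \<nu> w"
  unfolding wt_def by (induction w) auto

lemma wt_simps [simp]: "wt \<nu> [] = 1" "wt \<nu> (i # w) = pmf \<nu> i * wt \<nu> w"
  "wt \<nu> (u @ w) = wt \<nu> u * wt \<nu> w"
  by (simp_all add: wt_def)

lemma EW_0 [simp]: "EW k \<nu> 0 F = F []"
  by (simp add: EW_def)

lemma EW_Suc: "EW k \<nu> (Suc n) F = (\<Sum>i\<le>k. pmf \<nu> i * EW k \<nu> n (\<lambda>w. F (i # w)))"
proof -
  have inj: "inj_on (\<lambda>(i, w). i # w) ({..k} \<times> words k n)" by (auto simp: inj_on_def)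
  show ?thesis
    unfolding EW_def words_Suc sum.reindex[OF inj] o_def
    by (simp add: sum.cartesian_product sum_distrib_left case_prod_unfold mult_ac)
qed

lemma EW_cong: "(\<And>w. w \<in> words k n \<Longrightarrow> F w = G w) \<Longrightarrow> EW k \<nu> n F = EW k \<nu> n G"
  by (simp add: EW_def)

lemma EW_mono: "(\<And>w. w \<in> words k n \<Longrightarrow> F w \<le> G w) \<Longrightarrow> EW k \<nu> n F \<le> EW k \<nu> n G"
  by (auto simp: EW_def intro!: sum_mono mult_left_mono)

lemma EW_add: "EW k \<nu> n (\<lambda>w. F w + G w) = EW k \<nu> n F + EW k \<nu> n G"
  by (simp add: EW_def sum.distrib algebra_simps)

lemma EW_diff: "EW k \<nu> n (\<lambda>w. F w - G w) = EW k \<nu> n F - EW k \<nu> n G"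
  by (simp add: EW_def sum_subtractf algebra_simps)

lemma EW_cmult: "EW k \<nu> n (\<lambda>w. c * F w) = c * EW k \<nu> n F"
  by (simp add: EW_def sum_distrib_left mult_ac)

text \<open>The Markov property in finite form: conditioning on the first \<open>m\<close>
  letters.\<close>

lemma EW_append: "EW k \<nu> (m + n) F = EW k \<nu> m (\<lambda>u. EW k \<nu> n (\<lambda>w. F (u @ w)))"
  by (induction m arbitrary: F) (simp_all add: EW_Suc)

lemma EW_nonneg: "(\<And>w. w \<in> words k n \<Longrightarrow> 0 \<le> F w) \<Longrightarrow> 0 \<le> EW k \<nu> n F"
  by (auto simp: EW_def intro!: sum_nonneg)

lemma wt_le_EW:
  assumes "\<And>w. w \<in> words k n \<Longrightarrow> 0 \<le> F w" "u \<in> words k n"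
  shows "wt \<nu> u * F u \<le> EW k \<nu> n F"
  unfolding EW_def using assms by (intro member_le_sum) auto

locale walk =
  fixes k :: nat and \<theta> :: "nat \<Rightarrow> real" and \<nu> :: "nat pmf"
  assumes supp: "set_pmf \<nu> \<subseteq> {..k}"
begin

abbreviation "E \<equiv> EW k \<nu>"

lemma sum_pmf: "(\<Sum>i\<le>k. pmf \<nu> i) = 1"
  using supp by (intro sum_pmf_eq_1) auto

lemma E_const [simp]: "E n (\<lambda>w. c) = c"
  by (induction n) (simp_all add: EW_Suc sum_distrib_right[symmetric] sum_pmf)

lemma sum_wt: "(\<Sum>w\<in>words k n. wt \<nu> w) = 1"
  using E_const[of n 1] by (simp add: EW_def)

lemma E_le: "(\<And>w. w \<in> words k n \<Longrightarrow> F w \<le> c) \<Longrightarrow> E n F \<le> c"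
  by (rule order_trans[OF EW_mono E_const[THEN eq_refl]])

lemma E_ge: "(\<And>w. w \<in> words k n \<Longrightarrow> c \<le> F w) \<Longrightarrow> c \<le> E n F"
  using EW_mono[of k n "\<lambda>_. c" F \<nu>] by simp

lemma E_abs_le: "(\<And>w. w \<in> words k n \<Longrightarrow> \<bar>F w\<bar> \<le> c) \<Longrightarrow> \<bar>E n F\<bar> \<le> c"
  unfolding abs_le_iff using E_le[of n F c] E_ge[of n "-c" F] by (smt (verit) abs_le_iff)

definition Prob :: "nat \<Rightarrow> (nat list \<Rightarrow> bool) \<Rightarrow> real" where
  "Prob n P = E n (\<lambda>w. of_bool (P w))"

lemma Prob_nonneg: "0 \<le> Prob n P"
  unfolding Prob_def by (rule EW_nonneg) simp

lemma Prob_mono: "(\<And>w. w \<in> words k n \<Longrightarrow> P w \<Longrightarrow> Q w) \<Longrightarrow> Prob n P \<le> Prob n Q"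
  unfolding Prob_def by (rule EW_mono) auto

lemma Prob_disj: "Prob n (\<lambda>w. P w \<or> Q w) \<le> Prob n P + Prob n Q"
  unfolding Prob_def EW_add[symmetric] by (rule EW_mono) auto

lemma Prob_markov:
  assumes "\<And>w. w \<in> words k n \<Longrightarrow> 0 \<le> F w" "\<And>w. w \<in> words k n \<Longrightarrow> P w \<Longrightarrow> c \<le> F w" "0 < c"
  shows "Prob n P \<le> E n F / c"
proof -
  have "c * Prob n P \<le> E n F"
    unfolding Prob_def EW_cmult[symmetric] by (rule EW_mono) (use assms in auto)
  then show ?thesis using \<open>0 < c\<close> by (simp add: field_simps)
qed

end

subsection \<open>Periodic functions\<close>

lemma periodic_int:
  fixes f :: "real \<Rightarrow> 'a"
  assumes "\<And>t. f (t + 1) = f t"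
  shows "f (t + of_int z) = f t"
proof -
  have n: "f (s + of_nat n) = f s" for s n
  proof (induction n)
    case (Suc n)
    then show ?case using assms[of "s + of_nat n"] by (simp add: add_ac)
  qed simp
  show ?thesis
  proof (cases "z \<ge> 0")
    case True then show ?thesis using n[of t "nat z"] by simp
  next
    case False then show ?thesis using n[of "t + of_int z" "nat (- z)"] by simp
  qed
qed

lemma periodic_bounded:
  fixes f :: "real \<Rightarrow> 'a::metric_space"
  assumes "continuous_on UNIV f" and per: "\<And>t. f (t + 1) = f t"
  shows "bounded (range f)"
proof -
  have "f t \<in> f ` {0..1}" for t
  proof (rule image_eqI)
    show "f t = f (frac t)" using periodic_int[of f "frac t" "\<lfloor>t\<rfloor>", OF per] by (simp add: frac_def)
  qed (auto simp: frac_lt_1 less_imp_le)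
  then have "range f \<subseteq> f ` {0..1}" by auto
  moreover have "bounded (f ` {0..1})"
    using assms(1) by (intro compact_imp_bounded compact_continuous_image) (auto intro: continuous_on_subset)
  ultimately show ?thesis by (rule bounded_subset[rotated])
qed

lemma periodic_uniformly_continuous:
  fixes f :: "real \<Rightarrow> 'a::metric_space"
  assumes "continuous_on UNIV f" and per: "\<And>t. f (t + 1) = f t" and "e > 0"
  obtains d where "d > 0" "\<And>t u. \<bar>t - u\<bar> < d \<Longrightarrow> dist (f t) (f u) < e"
proof -
  have "uniformly_continuous_on {-1..2} f"
    using assms(1) by (intro compact_uniformly_continuous) (auto intro: continuous_on_subset)
  then obtain d where d: "d > 0" "\<And>t u. t \<in> {-1..2} \<Longrightarrow> u \<in> {-1..2} \<Longrightarrow> dist u t < d \<Longrightarrow> dist (f u) (f t) < e"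
    using \<open>e > 0\<close> unfolding uniformly_continuous_on_def by metis
  show thesis
  proof (rule that[of "min d 1"])
    fix t u :: real assume a: "\<bar>t - u\<bar> < min d 1"
    have "dist (f (t + of_int (- \<lfloor>t\<rfloor>))) (f (u + of_int (- \<lfloor>t\<rfloor>))) < e"
    proof (rule d(2))
      have "of_int \<lfloor>t\<rfloor> \<le> t" "t < of_int \<lfloor>t\<rfloor> + 1" by linarith+
      then show "t + of_int (- \<lfloor>t\<rfloor>) \<in> {-1..2}" "u + of_int (- \<lfloor>t\<rfloor>) \<in> {-1..2}"
        using a unfolding atLeastAtMost_iff of_int_minus by linarith+
      show "dist (t + of_int (- \<lfloor>t\<rfloor>)) (u + of_int (- \<lfloor>t\<rfloor>)) < d" using a by (simp add: dist_real_def)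
    qed
    then show "dist (f t) (f u) < e" unfolding periodic_int[of f, OF per] .
  qed (use d in auto)
qed

text \<open>Dirichlet's theorem yields a multiple of \<open>\<alpha>\<close> at non-zero distance
  \<open>\<bar>d\<bar> < \<delta>\<close> from an integer, and multiples of \<open>d\<close> walk
  around the circle with mesh below \<open>\<delta>\<close>. The bound \<open>J\<close> depends
  neither on the start nor on the target, which later makes word lengths uniform.\<close>

lemma irrational_orbit_dense:
  fixes \<alpha> \<delta> :: real
  assumes "\<alpha> \<notin> \<rat>" "\<delta> > 0"
  obtains J :: nat where "\<And>s t. \<exists>j\<le>J. \<exists>z::int. \<bar>s + real j * \<alpha> - of_int z - t\<bar> < \<delta>"
proof -
  obtain N :: nat where N: "N > 0" "1 / real N < \<delta>"
    using \<open>\<delta> > 0\<close> by (metis nat_approx_posE of_nat_0_less_iff zero_less_Suc inverse_eq_divide)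
  obtain h q where hq: "0 < q" "\<bar>of_int q * \<alpha> - of_int h\<bar> < 1 / real N"
    using Dirichlet_approx[OF N(1)] by metis
  define d where "d = of_int q * \<alpha> - of_int h"
  have d0: "d \<noteq> 0"
  proof
    assume "d = 0"
    then have "\<alpha> = of_int h / of_int q" using hq by (simp add: d_def field_simps)
    then show False using assms(1) by simp
  qed
  have dd: "\<bar>d\<bar> < \<delta>" using hq N unfolding d_def by linarith
  \<comment> \<open>About \<open>1 / \<bar>d\<bar>\<close> steps, each consisting of
    \<open>q\<close> rotations, make a full turn.\<close>
  define J where "J = nat q * nat \<lceil>1 / \<bar>d\<bar>\<rceil>"
  show thesis
  proof (rule that[of J])
    fix s t :: real
    \<comment> \<open>The way from \<open>s\<close> to \<open>t\<close> on the circle, in the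
      direction in which \<open>d\<close> moves.\<close>
    define c where "c = (if d > 0 then frac (t - s) else 1 - frac (t - s))"
    have c: "0 \<le> c" "c \<le> 1" by (auto simp: c_def frac_lt_1 less_imp_le)
    define i where "i = nat \<lfloor>c / \<bar>d\<bar>\<rfloor>"
    have i: "real i \<le> c / \<bar>d\<bar>" "c / \<bar>d\<bar> < real i + 1"
      using c d0 by (auto simp: i_def)
    have "real i \<le> 1 / \<bar>d\<bar>" using i(1) c(2) d0 by (smt (verit) divide_right_mono abs_ge_zero)
    then have iJ: "i \<le> nat \<lceil>1 / \<bar>d\<bar>\<rceil>" by linarith
    have i2: "real i * \<bar>d\<bar> \<le> c" "c < real i * \<bar>d\<bar> + \<bar>d\<bar>"
      using i d0 by (auto simp: field_simps)
    obtain y :: int where y: "\<bar>real i * d - of_int y - (t - s)\<bar> < \<delta>"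
    proof (cases "d > 0")
      case True
      have "\<bar>real i * d - of_int (- \<lfloor>t - s\<rfloor>) - (t - s)\<bar> < \<delta>"
        using i2 True dd by (simp add: c_def frac_def)
      then show thesis using that by blast
    next
      case False
      have "\<bar>real i * d - of_int (- \<lfloor>t - s\<rfloor> - 1) - (t - s)\<bar> < \<delta>"
        using i2 False dd d0 by (simp add: c_def frac_def)
      then show thesis using that by blast
    qed
    have "\<bar>s + real (nat q * i) * \<alpha> - of_int (int i * h + y) - t\<bar> < \<delta>"
      using y hq(1) by (simp add: d_def algebra_simps)
    moreover have "nat q * i \<le> J" using iJ by (simp add: J_def)
    ultimately show "\<exists>j\<le>J. \<exists>z::int. \<bar>s + real j * \<alpha> - of_int z - t\<bar> < \<delta>" by blast
  qed
qed

subsection \<open>Additive cocycles\<close>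

text \<open>The Birkhoff sum of \<open>f\<close> along the random walk on fibres and directions.
  Directions are carried as unnormalised vectors, so no projective space has to be
  constructed.\<close>

fun addc :: "(nat \<Rightarrow> real) \<Rightarrow> (nat \<Rightarrow> real \<Rightarrow> real^2^2) \<Rightarrow> (nat \<Rightarrow> real \<Rightarrow> real^2 \<Rightarrow> real)
    \<Rightarrow> real \<Rightarrow> real^2 \<Rightarrow> nat list \<Rightarrow> real" where
  "addc \<theta> B f t v [] = 0"
| "addc \<theta> B f t v (i # w) = f i t v + addc \<theta> B f (t + \<theta> i) (B i t *v v) w"

text \<open>The sine of the angle between two lines. As a distance on the projective line it has the
  advantage that \<open>cross_mv\<close> gives its distortion by a matrix exactly.\<close>

definition pd :: "real^2 \<Rightarrow> real^2 \<Rightarrow> real" where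
  "pd x y = \<bar>cross x y\<bar> / (norm x * norm y)"

lemma pd_nonneg [simp]: "0 \<le> pd x y"
  by (simp add: pd_def)

lemma pd_le_1: "pd x y \<le> 1"
  using abs_cross_le[of x y] by (cases "x = 0 \<or> y = 0") (auto simp: pd_def divide_le_eq_1)

lemma pd_diff_le: "y \<noteq> 0 \<Longrightarrow> pd x y \<le> norm (y - x) / norm y"
proof -
  assume y: "y \<noteq> 0"
  have "cross x y = cross x (y - x)" by (simp add: cross_def algebra_simps)
  then have "\<bar>cross x y\<bar> \<le> norm x * norm (y - x)" using abs_cross_le by metis
  then show ?thesis using y by (cases "x = 0") (auto simp: pd_def field_simps)
qed

lemma exp_quadratic_bound:
  fixes x :: real
  assumes "\<bar>x\<bar> \<le> 1"
  shows "exp x \<le> 1 + x + x\<^sup>2"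
proof (cases "x \<ge> 0")
  case True then show ?thesis using assms exp_bound by simp
next
  case False
  define y where "y = - x"
  have y: "y \<ge> 0" using False by (simp add: y_def)
  \<comment> \<open>This inverts the lower Taylor bound for \<open>exp y\<close>: the second factor
    dominates the reciprocal of the first, hence also \<open>exp (- y)\<close>.\<close>
  have "1 \<le> (1 + y + y\<^sup>2 / 2) * (1 - y + y\<^sup>2)"
  proof -
    have "(1 + y + y\<^sup>2 / 2) * (1 - y + y\<^sup>2) = 1 + y^2/2 + y^3/2 + y^4/2"
      by (simp add: field_simps power2_eq_square power3_eq_cube power4_eq_xxxx)
    then show ?thesis using y by simp
  qed
  also have "\<dots> \<le> exp y * (1 - y + y\<^sup>2)"
  proof (rule mult_right_mono)
    show "1 + y + y\<^sup>2 / 2 \<le> exp y" by (rule exp_lower_Taylor_quadratic[OF y])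
    have "0 \<le> (y - 1/2)^2 + 3/4" by simp
    then show "0 \<le> 1 - y + y\<^sup>2" by (simp add: power2_eq_square algebra_simps)
  qed
  finally have "exp (-y) * 1 \<le> exp (-y) * (exp y * (1 - y + y\<^sup>2))"
    by (intro mult_left_mono) auto
  also have "\<dots> = 1 - y + y\<^sup>2" by (simp add: mult.assoc[symmetric] exp_minus)
  finally show ?thesis by (simp add: y_def)
qed

text \<open>The quotient is the derivative of the projective action at the line of \<open>v\<close>.
  The determinant makes it invariant under scaling of the matrices, so the notion is meaningful in
  \<open>GL2\<close> as well.\<close>

definition contracting :: "nat \<Rightarrow> (nat \<Rightarrow> real) \<Rightarrow> nat pmf \<Rightarrow> (nat \<Rightarrow> real \<Rightarrow> real^2^2) \<Rightarrow> bool" where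
  "contracting k \<theta> \<nu> B \<longleftrightarrow> (\<exists>m s \<kappa>. 0 < s \<and> s \<le> 1 \<and> \<kappa> < 1 \<and> (\<forall>t v. v \<noteq> 0 \<longrightarrow>
     EW k \<nu> m (\<lambda>w. (\<bar>det (wmat \<theta> B t w)\<bar> * (norm v)\<^sup>2 / (norm (wmat \<theta> B t w *v v))\<^sup>2) powr s) \<le> \<kappa>))"

locale cocycle = walk +
  fixes B :: "nat \<Rightarrow> real \<Rightarrow> real^2^2"
  assumes B_cont: "\<And>i. i \<le> k \<Longrightarrow> continuous_on UNIV (B i)"
    and B_per: "\<And>i t. i \<le> k \<Longrightarrow> B i (t + 1) = B i t"
    and B_det: "\<And>i t. i \<le> k \<Longrightarrow> det (B i t) \<noteq> 0"
begin

abbreviation "M \<equiv> wmat \<theta> B"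
abbreviation "T \<equiv> wend \<theta>"
abbreviation "S \<equiv> addc \<theta> B"
abbreviation "ES f n t v \<equiv> E n (S f t v)"

lemma B_bounds_ex: "\<exists>\<Lambda>\<ge>1. \<forall>i\<le>k. \<forall>t x. norm (B i t *v x) \<le> \<Lambda> * norm x \<and> norm x \<le> \<Lambda> * norm (B i t *v x)"
proof -
  have "\<exists>c\<ge>1. \<forall>t x. norm (B i t *v x) \<le> c * norm x \<and> norm x \<le> c * norm (B i t *v x)" if i: "i \<le> k" for i
  proof -
    have dc: "continuous_on UNIV (\<lambda>t. det (B i t))"
      unfolding det_2 using B_cont[OF i] by (intro continuous_intros)
    obtain b where b: "\<And>t. norm (B i t) \<le> b"
      using periodic_bounded[of "B i", OF B_cont[OF i] B_per[OF i]] unfolding bounded_iff by (metis rangeI)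
    have "bounded (range (\<lambda>t. 1 / det (B i t)))"
      by (rule periodic_bounded) (use i B_per B_det in \<open>auto intro!: continuous_intros dc\<close>)
    then obtain e where e: "\<And>t. norm (1 / det (B i t)) \<le> e"
      unfolding bounded_iff by (metis rangeI)
    have b0: "0 \<le> b" using norm_ge_zero b order_trans by metis
    \<comment> \<open>\<open>b\<close> bounds the matrices, and \<open>e * b\<close> bounds their
      inverses, since the adjugate has the same norm and \<open>e\<close> bounds the reciprocal of
      the determinant.\<close>
    show ?thesis
    proof (intro exI[of _ "1 + b + e * b"] conjI allI)
      have e0: "0 \<le> e" using norm_ge_zero e order_trans by metis
      show "1 \<le> 1 + b + e * b" using b0 e0 by simp
      fix t x
      show "norm (B i t *v x) \<le> (1 + b + e * b) * norm x"
        by (rule order_trans[OF mv_norm_le mult_right_mono]) (use b[of t] b0 e0 in \<open>auto intro: order_trans\<close>)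
      have d: "\<bar>det (B i t)\<bar> > 0" using B_det i by simp
      have "\<bar>det (B i t)\<bar> * norm x \<le> b * norm (B i t *v x)"
        using mv_norm_ge[of "B i t" x] mult_right_mono[OF b[of t] norm_ge_zero[of "B i t *v x"]] by linarith
      then have "norm x \<le> (1 / \<bar>det (B i t)\<bar>) * (b * norm (B i t *v x))" using d by (simp add: field_simps)
      also have "\<dots> \<le> e * (b * norm (B i t *v x))" using e[of t] b0 by (intro mult_right_mono) auto
      also have "\<dots> \<le> (1 + b + e * b) * norm (B i t *v x)" using b0 by (simp add: algebra_simps)
      finally show "norm x \<le> (1 + b + e * b) * norm (B i t *v x)" .
    qed
  qed
  then obtain c where c: "\<And>i. i \<le> k \<Longrightarrow> c i \<ge> 1" "\<And>i t x. i \<le> k \<Longrightarrow> norm (B i t *v x) \<le> c i * norm x"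
    "\<And>i t x. i \<le> k \<Longrightarrow> norm x \<le> c i * norm (B i t *v x)" by metis
  have le: "c i \<le> (\<Sum>i\<le>k. c i)" if "i \<le> k" for i
    using c(1) that by (intro member_le_sum) (auto intro: order_trans[OF zero_le_one])
  show ?thesis
  proof (intro exI[of _ "\<Sum>i\<le>k. c i"] conjI allI impI)
    show "1 \<le> (\<Sum>i\<le>k. c i)" using le[of 0] c(1)[of 0] by simp
  next
    fix i t x assume i: "i \<le> k"
    show "norm (B i t *v x) \<le> (\<Sum>i\<le>k. c i) * norm x"
      using order_trans[OF c(2)[OF i] mult_right_mono[OF le[OF i]]] by simp
    show "norm x \<le> (\<Sum>i\<le>k. c i) * norm (B i t *v x)"
      using order_trans[OF c(3)[OF i] mult_right_mono[OF le[OF i]]] by simp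
  qed
qed

definition "Lam = (SOME \<Lambda>. \<Lambda> \<ge> 1 \<and> (\<forall>i\<le>k. \<forall>t x. norm (B i t *v x) \<le> \<Lambda> * norm x \<and> norm x \<le> \<Lambda> * norm (B i t *v x)))"

lemma Lam_ge_1: "1 \<le> Lam"
  and B_le: "i \<le> k \<Longrightarrow> norm (B i t *v x) \<le> Lam * norm x"
  and B_ge: "i \<le> k \<Longrightarrow> norm x \<le> Lam * norm (B i t *v x)"
  using someI_ex[OF B_bounds_ex] unfolding Lam_def by auto

lemma M_det: "w \<in> words k n \<Longrightarrow> det (M t w) \<noteq> 0"
proof (induction w arbitrary: n t)
  case (Cons i w)
  then have "i \<le> k" "w \<in> words k (length w)" by (auto simp: words_def)
  then show ?case using Cons.IH B_det by (simp add: det_mul)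
qed simp

lemma M_nz: "w \<in> words k n \<Longrightarrow> v \<noteq> 0 \<Longrightarrow> M t w *v v \<noteq> 0"
  by (rule det_nz_mv[OF M_det])

lemma M_bounds:
  assumes "w \<in> words k n"
  shows "norm (M t w *v x) \<le> Lam ^ n * norm x" "norm x \<le> Lam ^ n * norm (M t w *v x)"
proof -
  have "norm (M t w *v x) \<le> Lam ^ n * norm x \<and> norm x \<le> Lam ^ n * norm (M t w *v x)"
    using assms
  proof (induction w arbitrary: n t x)
    case (Cons i w)
    then have i: "i \<le> k" and w: "w \<in> words k (n - 1)" and n: "n = Suc (n - 1)" by (auto simp: words_def)
    have eq: "M t (i # w) *v x = M (t + \<theta> i) w *v (B i t *v x)" by (simp add: matrix_vector_mul_assoc)
    note IH = Cons.IH[OF w, of "t + \<theta> i" "B i t *v x"]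
    have L0: "0 \<le> Lam ^ (n - 1)" using Lam_ge_1 by simp
    have "norm (M t (i # w) *v x) \<le> Lam ^ (n - 1) * (Lam * norm x)"
      unfolding eq using IH mult_left_mono[OF B_le[OF i, of t x] L0] by linarith
    moreover have "norm x \<le> Lam * (Lam ^ (n - 1) * norm (M t (i # w) *v x))"
      unfolding eq using B_ge[OF i, of x t] IH mult_left_mono[of "norm (B i t *v x)" _ Lam] Lam_ge_1
      by (smt (verit))
    moreover have "Lam ^ n = Lam * Lam ^ (n - 1)" by (subst n) simp
    ultimately show ?case by (simp add: mult_ac)
  qed (auto simp: words_def)
  then show "norm (M t w *v x) \<le> Lam ^ n * norm x" "norm x \<le> Lam ^ n * norm (M t w *v x)" by auto
qed

lemma M_append_mv: "M t (u @ w) *v v = M (T t u) w *v (M t u *v v)"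
  by (simp add: wmat_append matrix_vector_mul_assoc)

lemma S_append: "S f t v (u @ w) = S f t v u + S f (T t u) (M t u *v v) w"
  by (induction u arbitrary: t v) (simp_all add: matrix_vector_mul_assoc)

lemma ES_0 [simp]: "ES f 0 t v = 0" by simp

lemma ES_Suc: "ES f (Suc n) t v = (\<Sum>i\<le>k. pmf \<nu> i * (f i t v + ES f n (t + \<theta> i) (B i t *v v)))"
  by (simp add: EW_Suc EW_add)

lemma ES_add: "ES f (m + n) t v = ES f m t v + E m (\<lambda>u. ES f n (T t u) (M t u *v v))"
  by (simp add: EW_append S_append EW_add)

text \<open>Logarithms of norms telescope along a word, so the growth of a vector is a Birkhoff
  sum.\<close>

lemma S_ln: "w \<in> words k n \<Longrightarrow> v \<noteq> 0 \<Longrightarrow> S (\<lambda>i t v. ln (norm (B i t *v v) / norm v)) t v w = ln (norm (M t w *v v) / norm v)"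
proof (induction w arbitrary: n t v)
  case (Cons i w)
  then have i: "i \<le> k" and w: "w \<in> words k (n - 1)" by (auto simp: words_def)
  have nz: "B i t *v v \<noteq> 0" using B_det[OF i] Cons.prems(2) det_nz_mv by blast
  then show ?case using Cons.IH[OF w nz, of "t + \<theta> i"] Cons.prems(2) M_nz[OF w nz, of "t + \<theta> i"]
    by (simp add: ln_div matrix_vector_mul_assoc)
qed simp

lemma S_det: "w \<in> words k n \<Longrightarrow> S (\<lambda>i t v. ln \<bar>det (B i t)\<bar>) t v w = ln \<bar>det (M t w)\<bar>"
proof (induction w arbitrary: n t v)
  case (Cons i w)
  then have i: "i \<le> k" and w: "w \<in> words k (n - 1)" by (auto simp: words_def)
  show ?case using Cons.IH[OF w, of "t + \<theta> i"] B_det[OF i, of t] M_det[OF w, of "t + \<theta> i"]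
    by (simp add: det_mul abs_mult ln_mult)
qed simp

lemma S_uminus: "S (\<lambda>i t v. - f i t v) t v w = - S f t v w"
  by (induction w arbitrary: t v) auto

lemma S_bound:
  assumes fb: "\<And>i t v. i \<le> k \<Longrightarrow> v \<noteq> 0 \<Longrightarrow> \<bar>f i t v\<bar> \<le> F"
  shows "w \<in> words k n \<Longrightarrow> v \<noteq> 0 \<Longrightarrow> \<bar>S f t v w\<bar> \<le> real n * F"
proof (induction w arbitrary: n t v)
  case (Cons i w)
  then have i: "i \<le> k" and w: "w \<in> words k (n - 1)" and n: "n = Suc (n - 1)" by (auto simp: words_def)
  have nz: "B i t *v v \<noteq> 0" using B_det[OF i] Cons.prems(2) det_nz_mv by blast
  have "\<bar>S f t v (i # w)\<bar> \<le> F + real (n - 1) * F"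
    using Cons.IH[OF w nz, of "t + \<theta> i"] fb[OF i Cons.prems(2), of t] by simp
  also have "\<dots> = real n * F" by (subst (2) n) (simp add: algebra_simps)
  finally show ?case .
qed (auto simp: words_def)

text \<open>Over one block of \<open>N\<close> letters the quadratic bound for \<open>exp\<close>
  turns the lower bound on the mean into a bound on the exponential moment; the second-order term is
  what \<open>\<epsilon>\<close> pays for. The bound is uniform in fibre and direction, so by the
  Markov property it multiplies over blocks.\<close>

lemma moment_bound:
  assumes fb: "\<And>i t v. i \<le> k \<Longrightarrow> v \<noteq> 0 \<Longrightarrow> \<bar>f i t v\<bar> \<le> F"
    and N: "N \<ge> 1" and mean: "\<And>t v. v \<noteq> 0 \<Longrightarrow> real N * a \<le> ES f N t v" and \<epsilon>: "\<epsilon> > 0"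
  obtains \<sigma> C where "0 < \<sigma>" "\<sigma> \<le> 1" "0 < C"
    "\<And>n t v. v \<noteq> 0 \<Longrightarrow> E n (\<lambda>w. exp (- \<sigma> * S f t v w)) \<le> C * exp (- \<sigma> * (a - \<epsilon>) * real n)"
proof -
  have "(axis 1 1 :: real^2) \<noteq> 0" by (simp add: axis_eq_0_iff)
  then have F0: "0 \<le> F" using fb[of 0 "axis 1 1" 0] by (meson abs_ge_zero le0 order_trans)
  define G where "G = real N * F + 1"
  have G: "G \<ge> 1" using F0 by (simp add: G_def)
  \<comment> \<open>\<open>\<sigma> * G \<le> 1\<close> admits the quadratic bound for
    \<open>exp\<close> on block sums, which are at most \<open>G\<close>;
    \<open>\<sigma> * G^2 \<le> \<epsilon> * N\<close> keeps the second-order term below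
    \<open>\<epsilon>\<close> per letter.\<close>
  define \<sigma> where "\<sigma> = min 1 (min (1 / G) (\<epsilon> * N / G\<^sup>2))"
  have \<sigma>: "0 < \<sigma>" "\<sigma> \<le> 1" "\<sigma> \<le> 1 / G" "\<sigma> \<le> \<epsilon> * N / G\<^sup>2"
    using G \<epsilon> N by (auto simp: \<sigma>_def)
  have \<sigma>G: "\<sigma> * G \<le> 1" "\<sigma> * G\<^sup>2 \<le> \<epsilon> * N" using \<sigma> G by (auto simp: field_simps)
  have block: "E N (\<lambda>w. exp (- \<sigma> * S f t v w)) \<le> exp (- \<sigma> * (a - \<epsilon>) * real N)" if v: "v \<noteq> 0" for t v
  proof -
    have "E N (\<lambda>w. exp (- \<sigma> * S f t v w)) \<le> E N (\<lambda>w. (1 + \<sigma>\<^sup>2 * G\<^sup>2) + (- \<sigma>) * S f t v w)"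
    proof (rule EW_mono)
      fix w assume w: "w \<in> words k N"
      have s: "\<bar>S f t v w\<bar> \<le> G" using S_bound[of f F, OF fb w v, of t] by (simp add: G_def)
      then have "\<bar>- \<sigma> * S f t v w\<bar> \<le> \<sigma> * G" using \<sigma>(1) by (simp add: abs_mult)
      then have "\<bar>- \<sigma> * S f t v w\<bar> \<le> 1" using \<sigma>G(1) by linarith
      then have "exp (- \<sigma> * S f t v w) \<le> 1 + (- \<sigma> * S f t v w) + (- \<sigma> * S f t v w)\<^sup>2"
        by (rule exp_quadratic_bound)
      moreover have "(S f t v w)\<^sup>2 \<le> G\<^sup>2" using s G by (intro abs_le_square_iff[THEN iffD1]) linarith
      then have "(- \<sigma> * S f t v w)\<^sup>2 \<le> \<sigma>\<^sup>2 * G\<^sup>2" by (simp add: power_mult_distrib mult_left_mono)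
      ultimately show "exp (- \<sigma> * S f t v w) \<le> (1 + \<sigma>\<^sup>2 * G\<^sup>2) + (- \<sigma>) * S f t v w" by linarith
    qed
    also have "\<dots> = 1 + (\<sigma>\<^sup>2 * G\<^sup>2 - \<sigma> * ES f N t v)"
      unfolding EW_add EW_cmult by simp
    also have "\<dots> \<le> exp (\<sigma>\<^sup>2 * G\<^sup>2 - \<sigma> * ES f N t v)" by (rule exp_ge_add_one_self)
    also have "\<dots> \<le> exp (- \<sigma> * (a - \<epsilon>) * real N)"
    proof -
      have "\<sigma> * (real N * a) \<le> \<sigma> * ES f N t v" using mean[OF v] \<sigma>(1) by (intro mult_left_mono) auto
      moreover have "\<sigma> * (\<sigma> * G\<^sup>2) \<le> \<sigma> * (\<epsilon> * N)" using \<sigma>G(2) \<sigma>(1) by (intro mult_left_mono) auto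
      ultimately show ?thesis by (simp add: power2_eq_square algebra_simps)
    qed
    finally show ?thesis .
  qed
  \<comment> \<open>Pays for the last, incomplete block of fewer than \<open>N\<close>
    letters.\<close>
  define C where "C = exp (real N * (F + \<bar>a - \<epsilon>\<bar>))"
  have "E n (\<lambda>w. exp (- \<sigma> * S f t v w)) \<le> C * exp (- \<sigma> * (a - \<epsilon>) * real n)" if "v \<noteq> 0" for n t v
    using that
  proof (induction n arbitrary: t v rule: less_induct)
    case (less n)
    show ?case
    proof (cases "n < N")
      case True
      have "E n (\<lambda>w. exp (- \<sigma> * S f t v w)) \<le> exp (\<sigma> * (real n * F))"
      proof (rule E_le)
        fix w assume w: "w \<in> words k n"
        have "\<bar>S f t v w\<bar> \<le> real n * F" using S_bound[of f F, OF fb w less.prems] by simp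
        then have "\<sigma> * (- S f t v w) \<le> \<sigma> * (real n * F)" using \<sigma>(1) by (intro mult_left_mono) auto
        then show "exp (- \<sigma> * S f t v w) \<le> exp (\<sigma> * (real n * F))" by simp
      qed
      also have "\<dots> \<le> exp (real N * (F + \<bar>a - \<epsilon>\<bar>) - \<sigma> * (a - \<epsilon>) * real n)"
      proof -
        have "\<sigma> * (real n * F) \<le> 1 * (real N * F)" using \<sigma> True F0 by (intro mult_mono) auto
        moreover have "(\<sigma> * real n) * (a - \<epsilon>) \<le> (1 * real N) * \<bar>a - \<epsilon>\<bar>"
          using \<sigma> True by (intro order_trans[OF mult_left_mono[OF abs_ge_self] mult_right_mono[OF mult_mono]]) auto
        ultimately show ?thesis by (simp add: algebra_simps)
      qed
      finally show ?thesis by (simp add: C_def exp_add[symmetric] algebra_simps)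
    next
      case False
      then have n: "n = N + (n - N)" by simp
      have "E n (\<lambda>w. exp (- \<sigma> * S f t v w))
        = E N (\<lambda>u. exp (- \<sigma> * S f t v u) * E (n - N) (\<lambda>w. exp (- \<sigma> * S f (T t u) (M t u *v v) w)))"
        by (subst n, unfold EW_append) (simp add: S_append exp_add[symmetric] EW_cmult[symmetric] algebra_simps)
      also have "\<dots> \<le> E N (\<lambda>u. (C * exp (- \<sigma> * (a - \<epsilon>) * real (n - N))) * exp (- \<sigma> * S f t v u))"
      proof (rule EW_mono)
        fix u assume "u \<in> words k N"
        then have "E (n - N) (\<lambda>w. exp (- \<sigma> * S f (T t u) (M t u *v v) w)) \<le> C * exp (- \<sigma> * (a - \<epsilon>) * real (n - N))"
          using less.IH[of "n - N" "M t u *v v"] M_nz less.prems False N by simp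
        then show "exp (- \<sigma> * S f t v u) * E (n - N) (\<lambda>w. exp (- \<sigma> * S f (T t u) (M t u *v v) w))
          \<le> (C * exp (- \<sigma> * (a - \<epsilon>) * real (n - N))) * exp (- \<sigma> * S f t v u)"
          by (subst mult.commute, intro mult_right_mono) auto
      qed
      also have "\<dots> \<le> (C * exp (- \<sigma> * (a - \<epsilon>) * real (n - N))) * exp (- \<sigma> * (a - \<epsilon>) * real N)"
        unfolding EW_cmult by (intro mult_left_mono block less.prems) (simp add: C_def)
      also have "\<dots> = C * exp (- \<sigma> * (a - \<epsilon>) * real n)"
        using False by (simp add: exp_add[symmetric] of_nat_diff algebra_simps)
      finally show ?thesis .
    qed
  qed
  then show thesis using that[of \<sigma> C] \<sigma> by (simp add: C_def)
qed

end

subsection \<open>Contracting cocycles\<close>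

context cocycle
begin

lemma ES_mult_le:
  assumes "\<And>t v. v \<noteq> 0 \<Longrightarrow> ES f n t v \<le> c"
  shows "v \<noteq> 0 \<Longrightarrow> ES f (j * n) t v \<le> real j * c"
proof (induction j arbitrary: t v)
  case (Suc j)
  have "E n (\<lambda>u. ES f (j * n) (T t u) (M t u *v v)) \<le> real j * c"
    by (rule E_le) (use Suc M_nz in auto)
  then show ?case using assms[OF Suc.prems, of t] ES_add[where f=f and m=n and n="j * n" and t=t and v=v] by (simp add: algebra_simps)
qed simp

lemma ES_mult_ge:
  assumes "\<And>t v. v \<noteq> 0 \<Longrightarrow> c \<le> ES f n t v"
  shows "v \<noteq> 0 \<Longrightarrow> real j * c \<le> ES f (j * n) t v"
proof (induction j arbitrary: t v)
  case (Suc j)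
  have "real j * c \<le> E n (\<lambda>u. ES f (j * n) (T t u) (M t u *v v))"
    by (rule E_ge) (use Suc M_nz in auto)
  then show ?case using assms[OF Suc.prems, of t] ES_add[where f=f and m=n and n="j * n" and t=t and v=v] by (simp add: algebra_simps)
qed simp

end

text \<open>Instances are the logarithmic growth of vectors and the logarithm of the determinant. By
  \<open>f_lip\<close> an observable takes equal values on parallel vectors, so it is really a
  function on the projective bundle.\<close>

locale observable = cocycle +
  fixes f :: "nat \<Rightarrow> real \<Rightarrow> real^2 \<Rightarrow> real" and F K :: real
  assumes f_bound: "\<And>i t v. i \<le> k \<Longrightarrow> v \<noteq> 0 \<Longrightarrow> \<bar>f i t v\<bar> \<le> F"
    and f_per: "\<And>i t v. i \<le> k \<Longrightarrow> f i (t + 1) v = f i t v"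
    and f_lip: "\<And>i t v v'. i \<le> k \<Longrightarrow> v \<noteq> 0 \<Longrightarrow> v' \<noteq> 0 \<Longrightarrow> \<bar>f i t v - f i t v'\<bar> \<le> K * pd v v'"
    and f_ucont: "\<And>e. e > 0 \<Longrightarrow> \<exists>d>0. \<forall>i\<le>k. \<forall>t t' v. v \<noteq> 0 \<longrightarrow> \<bar>t - t'\<bar> < d \<longrightarrow> \<bar>f i t v - f i t' v\<bar> \<le> e"
    and f_meas: "\<And>i. i \<le> k \<Longrightarrow> (\<lambda>p. f i (fst p) (snd p)) \<in> borel_measurable borel"
    and K_nonneg: "0 \<le> K"
begin

lemma ex_vec: "(axis 1 1 :: real^2) \<noteq> 0"
  by (simp add: axis_eq_0_iff)

lemma F_nonneg: "0 \<le> F"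
  using f_bound[of 0 "axis 1 1" 0] ex_vec by (meson abs_ge_zero le0 order_trans)

lemma B_nz: "i \<le> k \<Longrightarrow> v \<noteq> 0 \<Longrightarrow> B i t *v v \<noteq> 0"
  using B_det det_nz_mv by blast

text \<open>The distortion of \<open>pd\<close> is the determinant times two ratios of norms. The
  determinant is at most \<open>Lam^2\<close>, being the area spanned by the images of the basis,
  and each ratio is at most \<open>Lam\<close>.\<close>

lemma pd_B:
  assumes "i \<le> k" "v \<noteq> 0" "v' \<noteq> 0"
  shows "pd (B i t *v v) (B i t *v v') \<le> Lam ^ 4 * pd v v'"
proof -
  have "\<bar>det (B i t)\<bar> = \<bar>cross (B i t *v axis 1 1) (B i t *v axis 2 1)\<bar>"
    unfolding cross_mv by (simp add: cross_def axis_def)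
  also have "\<dots> \<le> norm (B i t *v axis 1 1) * norm (B i t *v axis 2 1)" by (rule abs_cross_le)
  also have "\<dots> \<le> (Lam * 1) * (Lam * 1)"
    using B_le[OF assms(1), of t "axis 1 1"] B_le[OF assms(1), of t "axis 2 1"] Lam_ge_1
    by (intro mult_mono) (auto simp: norm_axis_1)
  finally have d: "\<bar>det (B i t)\<bar> \<le> Lam * Lam" by simp
  have L0: "0 \<le> Lam" using Lam_ge_1 by simp
  have nz: "norm (B i t *v v) > 0" "norm (B i t *v v') > 0" using B_nz assms by auto
  have "norm v * norm v' \<le> (Lam * norm (B i t *v v)) * (Lam * norm (B i t *v v'))"
    using B_ge[OF assms(1), of v t] B_ge[OF assms(1), of v' t] L0 by (intro mult_mono) auto
  then have *: "1 / (norm (B i t *v v) * norm (B i t *v v')) \<le> Lam * Lam / (norm v * norm v')"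
    using nz assms by (simp add: field_simps)
  have "pd (B i t *v v) (B i t *v v') = (\<bar>det (B i t)\<bar> * \<bar>cross v v'\<bar>) * (1 / (norm (B i t *v v) * norm (B i t *v v')))"
    by (simp add: pd_def cross_mv abs_mult)
  also have "\<dots> \<le> (Lam * Lam * \<bar>cross v v'\<bar>) * (Lam * Lam / (norm v * norm v'))"
    using d * L0 by (intro mult_mono) auto
  also have "\<dots> = Lam ^ 4 * pd v v'" by (simp add: pd_def power4_eq_xxxx)
  finally show ?thesis .
qed

text \<open>Lipschitz constants in the direction that grow exponentially with \<open>n\<close>; they
  serve only for the bounded lengths at which contraction has not yet set in.\<close>

fun Hn :: "nat \<Rightarrow> real" where
  "Hn 0 = 0" | "Hn (Suc n) = K + Hn n * Lam ^ 4"

lemma Hn_nonneg: "0 \<le> Hn n"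
  using K_nonneg Lam_ge_1 by (induction n) auto

lemma weighted_diff:
  assumes "\<And>i. i \<le> k \<Longrightarrow> \<bar>x i - y i\<bar> \<le> c"
  shows "\<bar>(\<Sum>i\<le>k. pmf \<nu> i * x i) - (\<Sum>i\<le>k. pmf \<nu> i * y i)\<bar> \<le> c"
proof -
  have "\<bar>(\<Sum>i\<le>k. pmf \<nu> i * x i) - (\<Sum>i\<le>k. pmf \<nu> i * y i)\<bar> = \<bar>\<Sum>i\<le>k. pmf \<nu> i * (x i - y i)\<bar>"
    by (simp add: sum_subtractf algebra_simps)
  also have "\<dots> \<le> (\<Sum>i\<le>k. pmf \<nu> i * c)"
    by (rule order_trans[OF sum_abs sum_mono]) (use assms in \<open>auto simp: abs_mult intro!: mult_left_mono\<close>)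
  also have "\<dots> = c" by (simp add: sum_distrib_right[symmetric] sum_pmf)
  finally show ?thesis .
qed

lemma E_diff_le:
  assumes "\<And>w. w \<in> words k n \<Longrightarrow> \<bar>g w - h w\<bar> \<le> c w"
  shows "\<bar>E n g - E n h\<bar> \<le> E n c"
proof -
  have "E n (\<lambda>w. g w - h w) \<le> E n c" by (rule EW_mono) (use assms in force)
  moreover have "E n (\<lambda>w. h w - g w) \<le> E n c" by (rule EW_mono) (use assms in force)
  ultimately show ?thesis by (auto simp: EW_diff)
qed

lemma ES_lip: "v \<noteq> 0 \<Longrightarrow> v' \<noteq> 0 \<Longrightarrow> \<bar>ES f n t v - ES f n t v'\<bar> \<le> Hn n * pd v v'"
proof (induction n arbitrary: t v v')
  case (Suc n)
  show ?case
    unfolding ES_Suc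
  proof (rule weighted_diff)
    fix i assume i: "i \<le> k"
    have "\<bar>ES f n (t + \<theta> i) (B i t *v v) - ES f n (t + \<theta> i) (B i t *v v')\<bar> \<le> Hn n * (Lam ^ 4 * pd v v')"
      by (rule order_trans[OF Suc.IH mult_left_mono[OF pd_B]]) (use i Suc.prems B_nz Hn_nonneg in auto)
    moreover have "\<bar>f i t v - f i t v'\<bar> \<le> K * pd v v'" using f_lip i Suc.prems by auto
    ultimately show "\<bar>f i t v + ES f n (t + \<theta> i) (B i t *v v) - (f i t v' + ES f n (t + \<theta> i) (B i t *v v'))\<bar>
      \<le> Hn (Suc n) * pd v v'"
      by (simp add: algebra_simps abs_le_iff)
  qed
qed simp

lemma ES_bound: "v \<noteq> 0 \<Longrightarrow> \<bar>ES f n t v\<bar> \<le> real n * F"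
  by (rule E_abs_le) (rule S_bound[OF f_bound])

lemma M_per: "w \<in> words k n \<Longrightarrow> M (t + of_int z) w = M t w"
proof (induction w arbitrary: n t)
  case (Cons i w)
  then have i: "i \<le> k" "w \<in> words k (length w)" by (auto simp: words_def)
  have "B i (t + of_int z) = B i t" using periodic_int[of "B i", OF B_per[OF i(1)]] .
  then show ?case using Cons.IH[OF i(2), of "t + \<theta> i"] by (simp add: add_ac)
qed simp

lemma S_per: "w \<in> words k n \<Longrightarrow> S f (t + of_int z) v w = S f t v w"
proof (induction w arbitrary: n t v)
  case (Cons i w)
  then have i: "i \<le> k" "w \<in> words k (length w)" by (auto simp: words_def)
  have "B i (t + of_int z) = B i t" using periodic_int[of "B i", OF B_per[OF i(1)]] .
  moreover have "f i (t + of_int z) v = f i t v" using periodic_int[of "\<lambda>t. f i t v", OF f_per[OF i(1)]] .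
  ultimately show ?case using Cons.IH[OF i(2), of "t + \<theta> i"] by (simp add: add_ac)
qed simp

lemma ES_per: "ES f n (t + of_int z) v = ES f n t v"
  by (rule EW_cong) (rule S_per)

end

locale contracting_observable = observable +
  assumes contr: "contracting k \<theta> \<nu> B"
begin

text \<open>Splitting off the first \<open>m\<close> letters bounds the Hoelder constant for length
  \<open>n\<close> by \<open>H1\<close> plus \<open>\<kappa>\<close> times the one for length
  \<open>n - m\<close>. The fixed point \<open>H1 / (1 - \<kappa>)\<close> of this recursion
  therefore bounds it for all \<open>n\<close>.\<close>

lemma ES_hoelder:
  obtains H s where "0 \<le> H" "0 < s" "s \<le> 1"
    "\<And>n t v v'. v \<noteq> 0 \<Longrightarrow> v' \<noteq> 0 \<Longrightarrow> \<bar>ES f n t v - ES f n t v'\<bar> \<le> H * pd v v' powr s"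
proof -
  define q where "q t v w = \<bar>det (M t w)\<bar> * (norm v)\<^sup>2 / (norm (M t w *v v))\<^sup>2" for t v w
  obtain m s \<kappa> where ms: "0 < s" "s \<le> 1" "\<kappa> < 1"
    and \<kappa>: "\<And>t v. v \<noteq> 0 \<Longrightarrow> E m (\<lambda>w. q t v w powr s) \<le> \<kappa>"
    using contr unfolding contracting_def q_def by blast
  have q0: "0 \<le> q t v w" for t v w by (simp add: q_def)
  have \<kappa>0: "0 \<le> \<kappa>" by (rule order_trans[OF EW_nonneg \<kappa>[OF ex_vec, of 0]]) simp
  have m: "m \<ge> 1"
  proof (rule ccontr)
    assume "\<not> m \<ge> 1"
    then have "m = 0" by simp
    then show False using \<kappa>[OF ex_vec, of 0] ms by (simp add: q_def)
  qed
  define H1 where "H1 = (\<Sum>j\<le>m. Hn j)"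
  have H1: "Hn j \<le> H1" if "j \<le> m" for j
    unfolding H1_def using that Hn_nonneg by (intro member_le_sum) auto
  have H10: "0 \<le> H1" unfolding H1_def using Hn_nonneg by (intro sum_nonneg) auto
  define H where "H = H1 / (1 - \<kappa>)"
  have H: "H1 + \<kappa> * H = H" "H1 \<le> H" "0 \<le> H"
    using ms \<kappa>0 H10 by (auto simp: H_def field_simps mult_left_le)
  have pdp: "pd v v' \<le> pd v v' powr s" for v v'
  proof (cases "pd v v' = 0")
    case False
    then have "pd v v' powr 1 \<le> pd v v' powr s"
      using pd_le_1[of v v'] pd_nonneg[of v v'] ms by (intro powr_mono') auto
    then show ?thesis using False pd_nonneg[of v v'] by simp
  qed simp
  \<comment> \<open>The distortion of \<open>pd\<close> is the geometric mean of the derivatives at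
    the two lines. Passing to the arithmetic mean lets the contraction hypothesis be applied to each
    line separately.\<close>
  have pdM: "pd (M t w *v v) (M t w *v v') powr s \<le> pd v v' powr s * (1/2 * (q t v w powr s + q t v' w powr s))"
    if "w \<in> words k n" "v \<noteq> 0" "v' \<noteq> 0" for t w n v v'
  proof -
    have nz: "norm (M t w *v v) > 0" "norm (M t w *v v') > 0" using M_nz that by auto
    have "pd (M t w *v v) (M t w *v v') = pd v v' * sqrt (q t v w * q t v' w)"
      using nz that by (simp add: pd_def q_def cross_mv abs_mult real_sqrt_mult real_sqrt_divide)
    then have "pd (M t w *v v) (M t w *v v') powr s = pd v v' powr s * sqrt (q t v w powr s * q t v' w powr s)"
      using q0 by (simp add: powr_mult powr_half_sqrt[symmetric] powr_powr mult.commute)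
    also have "\<dots> \<le> pd v v' powr s * ((q t v w powr s + q t v' w powr s) / 2)"
      by (intro mult_left_mono arith_geo_mean_sqrt) auto
    finally show ?thesis by simp
  qed
  have "\<bar>ES f n t v - ES f n t v'\<bar> \<le> H * pd v v' powr s" if "v \<noteq> 0" "v' \<noteq> 0" for n t v v'
    using that
  proof (induction n arbitrary: t v v' rule: less_induct)
    case (less n)
    show ?case
    proof (cases "n \<le> m")
      case True
      have "\<bar>ES f n t v - ES f n t v'\<bar> \<le> Hn n * pd v v'" by (rule ES_lip[OF less.prems])
      also have "\<dots> \<le> H * pd v v' powr s"
        using H1[OF True] H Hn_nonneg[of n] pdp by (intro mult_mono) auto
      finally show ?thesis .
    next
      case False
      define j where "j = n - m"
      have n: "n = m + j" "j < n" using False m by (auto simp: j_def)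
      have 1: "\<bar>ES f m t v - ES f m t v'\<bar> \<le> H1 * pd v v' powr s"
        by (rule order_trans[OF ES_lip[OF less.prems] mult_mono]) (use H1[of m] pdp H10 in auto)
      have "\<bar>E m (\<lambda>u. ES f j (T t u) (M t u *v v)) - E m (\<lambda>u. ES f j (T t u) (M t u *v v'))\<bar>
        \<le> E m (\<lambda>u. (H * pd v v' powr s * (1/2)) * (q t v u powr s + q t v' u powr s))"
      proof (rule E_diff_le)
        fix u assume u: "u \<in> words k m"
        have "\<bar>ES f j (T t u) (M t u *v v) - ES f j (T t u) (M t u *v v')\<bar>
          \<le> H * pd (M t u *v v) (M t u *v v') powr s"
          using less.IH[OF n(2)] M_nz[OF u] less.prems by blast
        also have "\<dots> \<le> H * (pd v v' powr s * (1/2 * (q t v u powr s + q t v' u powr s)))"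
          by (intro mult_left_mono pdM[OF u] less.prems H)
        finally show "\<bar>ES f j (T t u) (M t u *v v) - ES f j (T t u) (M t u *v v')\<bar> \<le> (H * pd v v' powr s * (1/2)) * (q t v u powr s + q t v' u powr s)"
          by simp
      qed
      also have "\<dots> \<le> (H * pd v v' powr s * (1/2)) * (\<kappa> + \<kappa>)"
        unfolding EW_cmult EW_add using \<kappa>[OF less.prems(1)] \<kappa>[OF less.prems(2)] H
        by (intro mult_left_mono add_mono) auto
      finally have 2: "\<bar>E m (\<lambda>u. ES f j (T t u) (M t u *v v)) - E m (\<lambda>u. ES f j (T t u) (M t u *v v'))\<bar> \<le> \<kappa> * H * pd v v' powr s"
        by (simp add: mult_ac)
      have "\<bar>ES f n t v - ES f n t v'\<bar> \<le> (H1 + \<kappa> * H) * pd v v' powr s"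
        using 1 2 unfolding n(1) ES_add by (simp add: algebra_simps abs_le_iff)
      then show ?thesis using H by simp
    qed
  qed
  then show thesis using that H ms by blast
qed

text \<open>Moving the fibre changes the first summand by at most \<open>e / 2\<close> and turns the
  image vector by a small angle. By \<open>ES_hoelder\<close> the turn costs at most
  \<open>e / 2\<close> however many letters follow, so the errors add up linearly in
  \<open>n\<close>, with a single \<open>d\<close> for all \<open>n\<close>.\<close>

lemma ES_equicont:
  assumes "e > 0"
  obtains d where "d > 0" "\<And>n t t' v. v \<noteq> 0 \<Longrightarrow> \<bar>t - t'\<bar> < d \<Longrightarrow> \<bar>ES f n t v - ES f n t' v\<bar> \<le> real n * e"
proof -
  obtain H s where H: "0 \<le> H" "0 < s" "s \<le> 1"
    and hol: "\<And>n t v v'. v \<noteq> 0 \<Longrightarrow> v' \<noteq> 0 \<Longrightarrow> \<bar>ES f n t v - ES f n t v'\<bar> \<le> H * pd v v' powr s"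
    using ES_hoelder by blast
  obtain d1 where d1: "d1 > 0" "\<And>i t t' v. i \<le> k \<Longrightarrow> v \<noteq> 0 \<Longrightarrow> \<bar>t - t'\<bar> < d1 \<Longrightarrow> \<bar>f i t v - f i t' v\<bar> \<le> e / 2"
    using f_ucont[of "e / 2"] assms by auto
  \<comment> \<open>Matrices closer than \<open>h\<close> send a vector to lines with
    \<open>pd\<close> at most \<open>Lam * h\<close>, and \<open>h\<close> is chosen to make
    \<open>(H + 1) * (Lam * h) powr s\<close> equal to \<open>e / 2\<close>.\<close>
  define h where "h = (e / 2 / (H + 1)) powr (1 / s) / Lam"
  have h: "h > 0" "(Lam * h) powr s = e / 2 / (H + 1)"
    using assms H Lam_ge_1 by (auto simp: h_def powr_powr)
  have "\<exists>d>0. \<forall>t t'. \<bar>t - t'\<bar> < d \<longrightarrow> norm (B i t - B i t') < h" if i: "i \<le> k" for i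
    using periodic_uniformly_continuous[OF B_cont[OF i] B_per[OF i] h(1)] unfolding dist_norm by metis
  then obtain dd where dd: "\<And>i. i \<le> k \<Longrightarrow> dd i > 0" "\<And>i t t'. i \<le> k \<Longrightarrow> \<bar>t - t'\<bar> < dd i \<Longrightarrow> norm (B i t - B i t') < h"
    by metis
  define d2 where "d2 = Min (dd ` {..k})"
  have d2: "d2 > 0" "\<And>i. i \<le> k \<Longrightarrow> d2 \<le> dd i" using dd(1) by (auto simp: d2_def)
  have "\<bar>ES f n t v - ES f n t' v\<bar> \<le> real n * e" if "v \<noteq> 0" "\<bar>t - t'\<bar> < min d1 d2" for n t t' v
    using that
  proof (induction n arbitrary: t t' v)
    case (Suc n)
    show ?case
      unfolding ES_Suc
    proof (rule weighted_diff)
      fix i assume i: "i \<le> k"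
      have 1: "\<bar>f i t v - f i t' v\<bar> \<le> e / 2" using d1 i Suc.prems by auto
      have 2: "\<bar>ES f n (t + \<theta> i) (B i t *v v) - ES f n (t' + \<theta> i) (B i t *v v)\<bar> \<le> real n * e"
        using Suc.IH Suc.prems B_nz[OF i] by simp
      have "pd (B i t *v v) (B i t' *v v) \<le> norm ((B i t' - B i t) *v v) / norm (B i t' *v v)"
        using pd_diff_le[of "B i t' *v v" "B i t *v v"] B_nz[OF i Suc.prems(1)] by (simp add: matrix_vector_mult_diff_rdistrib)
      also have "\<dots> \<le> (h * norm v) / (norm v / Lam)"
      proof (rule frac_le)
        have "norm ((B i t' - B i t) *v v) \<le> norm (B i t' - B i t) * norm v" by (rule mv_norm_le)
        also have "\<dots> \<le> h * norm v"
          using dd(2)[OF i, of t' t] d2(2)[OF i] Suc.prems(2) by (intro mult_right_mono) (auto simp: abs_minus_commute)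
        finally show "norm ((B i t' - B i t) *v v) \<le> h * norm v" .
        show "norm v / Lam \<le> norm (B i t' *v v)" using B_ge[OF i, of v t'] Lam_ge_1 by (simp add: field_simps)
      qed (use h Suc.prems Lam_ge_1 in auto)
      also have "\<dots> = Lam * h" using Suc.prems by simp
      finally have "pd (B i t *v v) (B i t' *v v) powr s \<le> e / 2 / (H + 1)"
        using H h(2) powr_mono2[of s "pd (B i t *v v) (B i t' *v v)" "Lam * h"] by simp
      then have "H * pd (B i t *v v) (B i t' *v v) powr s \<le> (H + 1) * (e / 2 / (H + 1))"
        using H by (intro mult_mono) auto
      also have "\<dots> = e / 2"
      proof -
        have "H + 1 \<noteq> 0" using H by simp
        then show ?thesis using nonzero_eq_divide_eq[of "H + 1" "e / 2 / (H + 1)" "e / 2"] by (metis mult.commute)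
      qed
      finally have 3: "\<bar>ES f n (t' + \<theta> i) (B i t *v v) - ES f n (t' + \<theta> i) (B i t' *v v)\<bar> \<le> e / 2"
        using hol[of "B i t *v v" "B i t' *v v" n "t' + \<theta> i"] B_nz[OF i Suc.prems(1)] by fastforce
      show "\<bar>f i t v + ES f n (t + \<theta> i) (B i t *v v) - (f i t' v + ES f n (t' + \<theta> i) (B i t' *v v))\<bar> \<le> real (Suc n) * e"
        using 1 2 3 unfolding of_nat_Suc distrib_right mult_1_left by linarith
    qed
  qed simp
  then show thesis using that[of "min d1 d2"] d1 d2 by auto
qed

text \<open>Up to bounded errors, \<open>t \<mapsto> ES f n t v\<close> satisfies the mean value property along the random
  rotation, so values close to the maximum propagate along the orbit of an irrational rotation.\<close>

lemma ES_osc: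
  assumes a: "a \<in> set_pmf \<nu>" "\<theta> a \<notin> \<rat>" and e: "e > 0"
  obtains n0 where "\<And>n t t' v v'. n \<ge> n0 \<Longrightarrow> v \<noteq> 0 \<Longrightarrow> v' \<noteq> 0 \<Longrightarrow> \<bar>ES f n t v - ES f n t' v'\<bar> \<le> real n * e"
proof -
  obtain H s where H: "0 \<le> H" "0 < s" "s \<le> 1"
    and hol: "\<And>n t v v'. v \<noteq> 0 \<Longrightarrow> v' \<noteq> 0 \<Longrightarrow> \<bar>ES f n t v - ES f n t v'\<bar> \<le> H * pd v v' powr s"
    using ES_hoelder by blast
  have hol1: "\<bar>ES f n t v - ES f n t v'\<bar> \<le> H" if "v \<noteq> 0" "v' \<noteq> 0" for n t v v'
  proof -
    have "pd v v' powr s \<le> 1" using pd_le_1 pd_nonneg H by (intro powr_le1) auto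
    then show ?thesis using hol[OF that, of n t] mult_left_mono[of "pd v v' powr s" 1 H] H by linarith
  qed
  define x0 :: "real^2" where "x0 = axis 1 1"
  have x0: "x0 \<noteq> 0" using ex_vec by (simp add: x0_def)
  define G where "G n t = ES f n t x0" for n t
  define C where "C = F + F + H"
  have C0: "0 \<le> C" using F_nonneg H by (simp add: C_def)
  have ak: "a \<le> k" and pa: "pmf \<nu> a > 0" using a supp by (auto simp: pmf_positive)
  \<comment> \<open>A letter added in front replaces \<open>G n\<close> by its mean over the rotated
    fibres, up to \<open>F + H\<close>; a letter added at the end changes \<open>G n\<close> by at
    most \<open>F\<close>. Comparing the two gives the mean value property up to
    \<open>C\<close>.\<close>
  have near: "\<bar>(\<Sum>i\<le>k. pmf \<nu> i * G n (t + \<theta> i)) - G n t\<bar> \<le> C" for n t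
  proof -
    have "\<bar>(\<Sum>i\<le>k. pmf \<nu> i * G n (t + \<theta> i)) - ES f (Suc n) t x0\<bar> \<le> F + H"
      unfolding ES_Suc
    proof (rule weighted_diff)
      fix i assume i: "i \<le> k"
      show "\<bar>G n (t + \<theta> i) - (f i t x0 + ES f n (t + \<theta> i) (B i t *v x0))\<bar> \<le> F + H"
        using f_bound[OF i x0, of t] hol1[OF x0 B_nz[OF i x0], of n "t + \<theta> i" t] by (simp add: G_def)
    qed
    moreover have "\<bar>ES f (Suc n) t x0 - G n t\<bar> \<le> F"
    proof -
      have "\<bar>E n (\<lambda>u. ES f 1 (T t u) (M t u *v x0))\<bar> \<le> F"
        by (rule E_abs_le) (use ES_bound[of _ 1] M_nz x0 in auto)
      then show ?thesis using ES_add[where f=f and m=n and n=1 and t=t and v=x0] by (simp add: G_def)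
    qed
    ultimately show ?thesis by (simp add: C_def)
  qed
  obtain d where d: "d > 0" and eq: "\<And>n t t' v. v \<noteq> 0 \<Longrightarrow> \<bar>t - t'\<bar> < d \<Longrightarrow> \<bar>ES f n t v - ES f n t' v\<bar> \<le> real n * (e / 4)"
    using ES_equicont[of "e / 4"] e by (metis zero_less_divide_iff zero_less_numeral)
  obtain J :: nat where J: "\<And>s t. \<exists>j\<le>J. \<exists>z::int. \<bar>s + real j * \<theta> a - of_int z - t\<bar> < d"
    using irrational_orbit_dense[OF a(2) d] by blast
  \<comment> \<open>Bounds the deficit from the supremum after \<open>j\<close> rotations by
    \<open>\<theta> a\<close>. All deficits are non-negative, so the one at the rotation by
    \<open>\<theta> a\<close> is at most the mean deficit divided by the weight of
    \<open>a\<close>.\<close>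
  define c where "c j = ((\<lambda>y. (y + C) / pmf \<nu> a) ^^ j) 1" for j
  have c_Suc: "c (Suc j) = (c j + C) / pmf \<nu> a" for j by (simp add: c_def)
  have c0: "0 \<le> c j" for j by (induction j) (use C0 pa in \<open>auto simp: c_Suc\<close>, simp add: c_def)
  define cJ where "cJ = (\<Sum>j\<le>J. c j)"
  have cJ: "c j \<le> cJ" if "j \<le> J" for j unfolding cJ_def using that c0 by (intro member_le_sum) auto
  have low: "G n t \<ge> G n t' - 0 - cJ - real n * (e / 4)" for n t t'
  proof -
    have bdd: "bdd_above (range (G n))"
      by (rule bdd_aboveI[of _ "real n * F"]) (use ES_bound[OF x0, of n] in \<open>auto simp: G_def abs_le_iff\<close>)
    define m where "m = (SUP t. G n t)"
    have le_m: "G n u \<le> m" for u unfolding m_def using bdd by (rule cSUP_upper[OF UNIV_I])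
    \<comment> \<open>The supremum need not be attained; the slack 1 is the initial value of
      \<open>c\<close>.\<close>
    obtain u where u: "m - 1 < G n u"
      using less_cSUP_iff[OF _ bdd, of "m - 1"] unfolding m_def by (auto simp: m_def[symmetric])
    have step: "m - G n (u + real j * \<theta> a) \<le> c j" for j
    proof (induction j)
      case 0 then show ?case using u by (simp add: c_def)
    next
      case (Suc j)
      define y where "y = u + real j * \<theta> a"
      have "pmf \<nu> a * (m - G n (y + \<theta> a)) \<le> (\<Sum>i\<le>k. pmf \<nu> i * (m - G n (y + \<theta> i)))"
        using ak le_m by (intro member_le_sum[of a "{..k}" "\<lambda>i. pmf \<nu> i * (m - G n (y + \<theta> i))"]) auto
      also have "\<dots> = m - (\<Sum>i\<le>k. pmf \<nu> i * G n (y + \<theta> i))"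
        by (simp add: algebra_simps sum_subtractf sum_distrib_left[symmetric] sum_pmf)
      also have "\<dots> \<le> c j + C" using Suc near[where n=n and t=y] by (simp add: y_def)
      finally have "m - G n (y + \<theta> a) \<le> (c j + C) / pmf \<nu> a" using pa by (simp add: field_simps)
      then show ?case by (simp add: c_Suc y_def algebra_simps)
    qed
    obtain j z where jz: "j \<le> J" "\<bar>u + real j * \<theta> a - of_int z - t\<bar> < d" using J by blast
    have "G n (u + real j * \<theta> a) = G n (u + real j * \<theta> a - of_int z)"
      using ES_per[of n "u + real j * \<theta> a" "- z" x0] by (simp add: G_def)
    then have "\<bar>G n (u + real j * \<theta> a) - G n t\<bar> \<le> real n * (e / 4)"
      using eq[OF x0 jz(2)] by (simp add: G_def)
    then show ?thesis using step[of j] cJ[OF jz(1)] le_m[of t'] by linarith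
  qed
  define n0 where "n0 = nat \<lceil>(cJ + 2 * H) / (e / 4)\<rceil>"
  show thesis
  proof (rule that[of n0])
    fix n t t' v v' assume n: "n \<ge> n0" and v: "v \<noteq> (0::real^2)" "v' \<noteq> (0::real^2)"
    have "(cJ + 2 * H) / (e / 4) \<le> real n" using n unfolding n0_def by linarith
    then have "cJ + 2 * H \<le> real n * (e / 4)" using e by (simp add: field_simps)
    then show "\<bar>ES f n t v - ES f n t' v'\<bar> \<le> real n * e"
      using low[of n t t'] low[of n t' t] hol1[OF v(1) x0, of n t] hol1[OF v(2) x0, of n t'] e
      unfolding G_def abs_le_iff by (simp add: algebra_simps)
  qed
qed

text \<open>Over all fibres and directions, the maxima of the means are subadditive in
  \<open>n\<close> and the minima superadditive, so every normalised minimum is below every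
  normalised maximum; \<open>l\<close> is the supremum of the minima, and \<open>ES_osc\<close>
  closes the gap. The first two properties hold at each single \<open>n\<close>, which is the form
  needed to compare neighbouring cocycles.\<close>

lemma ES_limit:
  assumes a: "a \<in> set_pmf \<nu>" "\<theta> a \<notin> \<rat>"
  obtains l where
    "\<And>n c. (\<And>t v. v \<noteq> 0 \<Longrightarrow> ES f n t v \<le> c) \<Longrightarrow> real n * l \<le> c"
    "\<And>n c. (\<And>t v. v \<noteq> 0 \<Longrightarrow> c \<le> ES f n t v) \<Longrightarrow> c \<le> real n * l"
    "\<And>e. e > 0 \<Longrightarrow> \<exists>n0. \<forall>n\<ge>n0. \<forall>t v. v \<noteq> 0 \<longrightarrow> \<bar>ES f n t v - real n * l\<bar> \<le> real n * e"
proof -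
  define L where "L = {c / real n | n c. n \<ge> 1 \<and> (\<forall>t v. v \<noteq> 0 \<longrightarrow> c \<le> ES f n t v)}"
  define l where "l = Sup L"
  have cmp: "c / real n \<le> c' / real m"
    if nm: "n \<ge> 1" "m \<ge> 1" and c: "\<And>t v. v \<noteq> 0 \<Longrightarrow> c \<le> ES f n t v" and c': "\<And>t v. v \<noteq> 0 \<Longrightarrow> ES f m t v \<le> c'" for c c' n m
  proof -
    have "real m * c \<le> ES f (m * n) 0 (axis 1 1)" by (rule ES_mult_ge[OF c ex_vec])
    also have "\<dots> \<le> real n * c'" using ES_mult_le[OF c' ex_vec, of n 0] by (simp add: mult.commute)
    finally show ?thesis using nm by (simp add: field_simps)
  qed
  have bF: "- F \<le> ES f 1 t v" "ES f 1 t v \<le> F" if "v \<noteq> 0" for t v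
    using ES_bound[OF that, of 1 t] by linarith+
  have "- F / real 1 \<in> L" unfolding L_def using bF(1) by blast
  then have ne: "L \<noteq> {}" by blast
  have bdd: "bdd_above L" by (rule bdd_aboveI[of _ "F / real 1"]) (use cmp[OF _ _ _ bF(2)] in \<open>auto simp: L_def\<close>)
  have up: "real n * l \<le> c" if c: "\<And>t v. v \<noteq> 0 \<Longrightarrow> ES f n t v \<le> c" for n c
  proof (cases "n = 0")
    case True then show ?thesis using c[OF ex_vec, of 0] by simp
  next
    case False
    have "l \<le> c / real n" unfolding l_def
      by (rule cSup_least[OF ne]) (use cmp[OF _ _ _ c] False in \<open>auto simp: L_def\<close>)
    then show ?thesis using False by (simp add: field_simps)
  qed
  have lo: "c \<le> real n * l" if c: "\<And>t v. v \<noteq> 0 \<Longrightarrow> c \<le> ES f n t v" for n c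
  proof (cases "n = 0")
    case True then show ?thesis using c[OF ex_vec, of 0] by simp
  next
    case False
    then have "c / real n \<in> L" unfolding L_def using c by (intro CollectI exI[of _ n] exI[of _ c]) auto
    then have "c / real n \<le> l" unfolding l_def using bdd by (rule cSup_upper)
    then show ?thesis using False by (simp add: field_simps)
  qed
  have "\<exists>n0. \<forall>n\<ge>n0. \<forall>t v. v \<noteq> 0 \<longrightarrow> \<bar>ES f n t v - real n * l\<bar> \<le> real n * e" if "e > 0" for e
  proof -
    obtain n0 where n0: "\<And>n t t' v v'. n \<ge> n0 \<Longrightarrow> v \<noteq> 0 \<Longrightarrow> v' \<noteq> 0 \<Longrightarrow> \<bar>ES f n t v - ES f n t' v'\<bar> \<le> real n * e"
      using ES_osc[OF a \<open>e > 0\<close>] by blast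
    have "\<bar>ES f n t v - real n * l\<bar> \<le> real n * e" if n: "n \<ge> n0" and v: "v \<noteq> 0" for n t v
    proof -
      have "real n * l \<le> ES f n t v + real n * e"
      proof (rule up)
        fix t' v' assume "v' \<noteq> (0::real^2)"
        then show "ES f n t' v' \<le> ES f n t v + real n * e" using n0[OF n _ v, of v' t' t] by linarith
      qed
      moreover have "ES f n t v - real n * e \<le> real n * l"
      proof (rule lo)
        fix t' v' assume "v' \<noteq> (0::real^2)"
        then show "ES f n t v - real n * e \<le> ES f n t' v'" using n0[OF n _ v, of v' t' t] by linarith
      qed
      ultimately show ?thesis by (simp add: abs_le_iff)
    qed
    then show ?thesis by blast
  qed
  then show thesis using that[of l] up lo by blast
qed

text \<open>Chernoff's bound for \<open>f\<close> and for \<open>- f\<close>. Of the deviation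
  \<open>e\<close>, one quarter covers the error of the mean at length \<open>N\<close>, one quarter
  the loss in \<open>moment_bound\<close>, and the remaining half becomes the exponential
  rate.\<close>

lemma large_deviations:
  assumes l: "\<And>e. e > 0 \<Longrightarrow> \<exists>n0. \<forall>n\<ge>n0. \<forall>t v. v \<noteq> 0 \<longrightarrow> \<bar>ES f n t v - real n * l\<bar> \<le> real n * e" and e: "e > 0"
  obtains C \<rho> where "0 < C" "0 < \<rho>" "\<rho> < 1"
    "\<And>n t v. v \<noteq> 0 \<Longrightarrow> Prob n (\<lambda>w. \<bar>S f t v w - real n * l\<bar> > real n * e) \<le> C * \<rho> ^ n"
proof -
  obtain n0 where n0: "\<And>n t v. n \<ge> n0 \<Longrightarrow> v \<noteq> 0 \<Longrightarrow> \<bar>ES f n t v - real n * l\<bar> \<le> real n * (e / 4)"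
    using l[of "e / 4"] e by auto
  define N where "N = max n0 1"
  have N: "N \<ge> 1" "N \<ge> n0" by (auto simp: N_def)
  have one: "\<exists>C \<rho>. 0 < C \<and> 0 < \<rho> \<and> \<rho> < 1 \<and> (\<forall>n t v. v \<noteq> 0 \<longrightarrow> Prob n (\<lambda>w. S g t v w < real n * (a - e)) \<le> C * \<rho> ^ n)"
    if gb: "\<And>i t v. i \<le> k \<Longrightarrow> v \<noteq> 0 \<Longrightarrow> \<bar>g i t v\<bar> \<le> F" and mean: "\<And>t v. v \<noteq> 0 \<Longrightarrow> real N * (a - e / 4) \<le> ES g N t v" for g a
  proof -
    have e4: "e / 4 > 0" using e by simp
    obtain \<sigma> C where \<sigma>: "0 < \<sigma>" "\<sigma> \<le> 1" "0 < C"
      "\<And>n t v. v \<noteq> 0 \<Longrightarrow> E n (\<lambda>w. exp (- \<sigma> * S g t v w)) \<le> C * exp (- \<sigma> * (a - e / 4 - e / 4) * real n)"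
      using moment_bound[OF gb N(1) mean e4] by metis
    show ?thesis
    proof (rule exI[of _ C], rule exI[of _ "exp (- \<sigma> * (e / 2))"], intro conjI allI impI)
      fix n t v assume v: "v \<noteq> (0::real^2)"
      have "Prob n (\<lambda>w. S g t v w < real n * (a - e)) \<le> E n (\<lambda>w. exp (- \<sigma> * S g t v w)) / exp (- \<sigma> * (real n * (a - e)))"
        by (rule Prob_markov) (use \<sigma>(1) in auto)
      also have "\<dots> \<le> C * exp (- \<sigma> * (a - e / 4 - e / 4) * real n) / exp (- \<sigma> * (real n * (a - e)))"
        by (intro divide_right_mono \<sigma>(4)[OF v]) simp
      also have "\<dots> = C * exp (- \<sigma> * (e / 2)) ^ n"
      proof -
        have "exp (- \<sigma> * (a - e / 4 - e / 4) * real n) = exp (- \<sigma> * (e / 2)) ^ n * exp (- \<sigma> * (real n * (a - e)))"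
          by (simp add: exp_of_nat_mult[symmetric] exp_add[symmetric] algebra_simps)
        then show ?thesis by simp
      qed
      finally show "Prob n (\<lambda>w. S g t v w < real n * (a - e)) \<le> C * exp (- \<sigma> * (e / 2)) ^ n" .
    qed (use \<sigma> e in auto)
  qed
  have "real N * (l - e / 4) \<le> ES f N t v" if "v \<noteq> 0" for t v
    using n0[OF N(2) that, of t] unfolding right_diff_distrib by linarith
  then obtain C1 r1 where 1: "0 < C1" "0 < r1" "r1 < 1"
    "\<And>n t v. v \<noteq> 0 \<Longrightarrow> Prob n (\<lambda>w. S f t v w < real n * (l - e)) \<le> C1 * r1 ^ n"
    using one[where g=f and a=l, OF f_bound] by blast
  have "real N * (- l - e / 4) \<le> ES (\<lambda>i t v. - f i t v) N t v" if "v \<noteq> 0" for t v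
    using n0[OF N(2) that, of t] EW_cmult[of k \<nu> N "-1" "S f t v"]     unfolding S_uminus right_diff_distrib by (simp only: mult_minus1 mult_minus_right)
  then obtain C2 r2 where 2: "0 < C2" "0 < r2" "r2 < 1"
    "\<And>n t v. v \<noteq> 0 \<Longrightarrow> Prob n (\<lambda>w. S (\<lambda>i t v. - f i t v) t v w < real n * (- l - e)) \<le> C2 * r2 ^ n"
    using one[where g="\<lambda>i t v. - f i t v" and a="- l"] f_bound by fastforce
  show thesis
  proof (rule that[of "C1 + C2" "max r1 r2"])
    fix n t v assume v: "v \<noteq> (0::real^2)"
    have "Prob n (\<lambda>w. \<bar>S f t v w - real n * l\<bar> > real n * e)
      \<le> Prob n (\<lambda>w. S f t v w < real n * (l - e) \<or> S (\<lambda>i t v. - f i t v) t v w < real n * (- l - e))"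
      by (rule Prob_mono) (auto simp: S_uminus algebra_simps abs_if split: if_splits)
    also have "\<dots> \<le> C1 * r1 ^ n + C2 * r2 ^ n"
      by (rule order_trans[OF Prob_disj add_mono]) (use 1 2 v in auto)
    also have "\<dots> \<le> C1 * max r1 r2 ^ n + C2 * max r1 r2 ^ n"
      using 1 2 by (intro add_mono mult_left_mono power_mono) auto
    finally show "Prob n (\<lambda>w. \<bar>S f t v w - real n * l\<bar> > real n * e) \<le> (C1 + C2) * max r1 r2 ^ n"
      by (simp add: algebra_simps)
  qed (use 1 2 in auto)
qed

end

subsection \<open>Oseledets lines\<close>

text \<open>The component of \<open>q\<close> along \<open>p\<close> in units of \<open>p\<close>,
  that is, the quotient of the two entries in the first row of the triangular factor when the matrix
  with columns \<open>p\<close>, \<open>q\<close> is written in QR form.\<close>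

definition slope :: "real^2 \<Rightarrow> real^2 \<Rightarrow> real" where
  "slope p q = (p \<bullet> q) / (norm p)\<^sup>2"

definition rot2 :: "real^2 \<Rightarrow> real^2" where
  "rot2 x = vector [- x$2, x$1]"

lemma rot2 [simp]: "norm (rot2 x) = norm x" "rot2 x $ 1 = - x$2" "rot2 x $ 2 = x$1"
  by (simp_all add: rot2_def norm_eq_sqrt_inner inner2)

lemma slope_decomp:
  assumes "p \<noteq> 0"
  shows "q = slope p q *\<^sub>R p + (cross p q / (norm p)\<^sup>2) *\<^sub>R rot2 p"
proof -
  have pp: "(norm p)\<^sup>2 \<noteq> 0" using assms by simp
  have "(norm p)\<^sup>2 *\<^sub>R q = (p \<bullet> q) *\<^sub>R p + cross p q *\<^sub>R rot2 p"
    unfolding norm2_sq by (simp add: vec_eq_iff forall_2 cross_def inner2 power2_eq_square algebra_simps)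
  then have "(1 / (norm p)\<^sup>2) *\<^sub>R ((norm p)\<^sup>2 *\<^sub>R q) = (1 / (norm p)\<^sup>2) *\<^sub>R ((p \<bullet> q) *\<^sub>R p + cross p q *\<^sub>R rot2 p)"
    by simp
  then show ?thesis using pp by (simp add: slope_def scaleR_add_right)
qed

text \<open>Multiples of \<open>p\<close> shift the slope by the same amount before and after
  \<open>A\<close>; only the part of \<open>q\<close> orthogonal to \<open>p\<close>, of length
  \<open>\<bar>cross p q\<bar> / norm p\<close>, can change it.\<close>

lemma slope_step:
  assumes \<Lambda>: "\<And>x. norm (A *v x) \<le> \<Lambda> * norm x" and p: "p \<noteq> 0" "A *v p \<noteq> 0"
  shows "\<bar>slope (A *v p) (A *v q) - slope p q\<bar> \<le> \<Lambda> * \<bar>cross p q\<bar> / (norm p * norm (A *v p))"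
proof -
  have "A *v q = slope p q *\<^sub>R (A *v p) + (cross p q / (norm p)\<^sup>2) *\<^sub>R (A *v rot2 p)"
    by (subst slope_decomp[OF p(1), of q]) (simp add: matrix_vector_right_distrib matrix_vector_mult_scaleR)
  then have "(A *v p) \<bullet> (A *v q) = slope p q * (norm (A *v p))\<^sup>2 + (cross p q / (norm p)\<^sup>2) * ((A *v p) \<bullet> (A *v rot2 p))"
    by (simp add: inner_add_right power2_norm_eq_inner)
  then have "slope (A *v p) (A *v q) - slope p q = (cross p q / (norm p)\<^sup>2) * ((A *v p) \<bullet> (A *v rot2 p)) / (norm (A *v p))\<^sup>2"
    using p by (simp add: slope_def[of "A *v p"] add_divide_distrib)
  then have "\<bar>slope (A *v p) (A *v q) - slope p q\<bar> = (\<bar>cross p q\<bar> / (norm p)\<^sup>2) * \<bar>(A *v p) \<bullet> (A *v rot2 p)\<bar> / (norm (A *v p))\<^sup>2"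
    by (simp add: abs_mult)
  also have "\<dots> \<le> (\<bar>cross p q\<bar> / (norm p)\<^sup>2) * (norm (A *v p) * (\<Lambda> * norm p)) / (norm (A *v p))\<^sup>2"
  proof (intro divide_right_mono mult_left_mono)
    show "\<bar>(A *v p) \<bullet> (A *v rot2 p)\<bar> \<le> norm (A *v p) * (\<Lambda> * norm p)"
      using order_trans[OF Cauchy_Schwarz_ineq2 mult_left_mono[OF \<Lambda>[of "rot2 p"]]] by simp
  qed auto
  also have "\<dots> = \<Lambda> * \<bar>cross p q\<bar> / (norm p * norm (A *v p))"
    using p by (simp add: power2_eq_square)
  finally show ?thesis .
qed

lemma norm_le_slope:
  assumes "p \<noteq> 0"
  shows "norm q \<le> \<bar>slope p q\<bar> * norm p + \<bar>cross p q\<bar> / norm p"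
proof -
  have "norm q \<le> norm (slope p q *\<^sub>R p) + norm ((cross p q / (norm p)\<^sup>2) *\<^sub>R rot2 p)"
    by (subst slope_decomp[OF assms, of q]) (rule norm_triangle_ineq)
  also have "\<dots> = \<bar>slope p q\<bar> * norm p + \<bar>cross p q\<bar> / norm p" using assms by (simp add: power2_eq_square)
  finally show ?thesis .
qed

lemma rate_bounds:
  fixes x :: "nat \<Rightarrow> real"
  assumes "(\<lambda>n. ln (x n) / real n) \<longlonglongrightarrow> a" "\<And>n. x n > 0" "e > 0"
  shows "eventually (\<lambda>n. exp ((a - e) * real n) \<le> x n \<and> x n \<le> exp ((a + e) * real n)) sequentially"
proof -
  have "eventually (\<lambda>n. dist (ln (x n) / real n) a < e) sequentially"
    using assms tendstoD by blast
  then show ?thesis using eventually_gt_at_top[of 0]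
  proof eventually_elim
    case (elim n)
    then have "(a - e) * real n \<le> ln (x n)" "ln (x n) \<le> (a + e) * real n"
      by (auto simp: dist_real_def abs_less_iff field_simps)
    then show ?case using assms(2)[of n] by (metis exp_le_cancel_iff exp_ln)
  qed
qed

lemma rateI:
  fixes x :: "nat \<Rightarrow> real"
  assumes "\<And>e. e > 0 \<Longrightarrow> \<exists>K>0. eventually (\<lambda>n. K * exp ((a - e) * real n) \<le> x n) sequentially"
    and "\<And>e. e > 0 \<Longrightarrow> \<exists>K>0. eventually (\<lambda>n. x n \<le> K * exp ((a + e) * real n)) sequentially"
  shows "(\<lambda>n. ln (x n) / real n) \<longlonglongrightarrow> a"
proof (rule tendstoI)
  fix e :: real assume e: "e > 0"
  then have e2: "e / 2 > 0" by simp
  obtain K1 where K1: "K1 > 0" "eventually (\<lambda>n. K1 * exp ((a - e/2) * real n) \<le> x n) sequentially"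
    using assms(1)[OF e2] by blast
  obtain K2 where K2: "K2 > 0" "eventually (\<lambda>n. x n \<le> K2 * exp ((a + e/2) * real n)) sequentially"
    using assms(2)[OF e2] by blast
  have lim: "(\<lambda>n. c / real n) \<longlonglongrightarrow> 0" for c by (rule lim_const_over_n)
  have "eventually (\<lambda>n. dist (ln K1 / real n) 0 < e/2) sequentially" "eventually (\<lambda>n. dist (ln K2 / real n) 0 < e/2) sequentially"
    using tendstoD[OF lim e2] by auto
  then show "eventually (\<lambda>n. dist (ln (x n) / real n) a < e) sequentially"
    using K1(2) K2(2) eventually_gt_at_top[of 0]
  proof eventually_elim
    case (elim n)
    have x: "x n > 0" using elim K1(1) by (smt (verit) exp_gt_zero mult_pos_pos)
    have "ln (K1 * exp ((a - e/2) * real n)) \<le> ln (x n)" using elim K1(1) x by (intro ln_mono) auto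
    then have l: "ln K1 + (a - e/2) * real n \<le> ln (x n)" using K1(1) by (simp add: ln_mult)
    have "ln (x n) \<le> ln (K2 * exp ((a + e/2) * real n))" using elim x by (intro ln_mono) auto
    then have u: "ln (x n) \<le> ln K2 + (a + e/2) * real n" using K2(1) by (simp add: ln_mult)
    have n: "real n > 0" using elim by simp
    have "ln (x n) / real n \<ge> ln K1 / real n + (a - e/2)" "ln (x n) / real n \<le> ln K2 / real n + (a + e/2)"
      using divide_right_mono[OF l less_imp_le[OF n]] divide_right_mono[OF u less_imp_le[OF n]] n
      by (simp_all add: add_divide_distrib)
    then show ?case using elim(1,2) unfolding dist_real_def diff_0_right abs_less_iff by linarith
  qed
qed

lemma geometric_cauchy:
  fixes c :: "nat \<Rightarrow> real"
  assumes r: "0 < r" "r < 1" and step: "\<And>n. n \<ge> N \<Longrightarrow> \<bar>c (Suc n) - c n\<bar> \<le> K * r ^ n"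
  shows "\<exists>l. c \<longlonglongrightarrow> l \<and> (\<forall>n\<ge>N. \<bar>c n - l\<bar> \<le> K * r ^ n / (1 - r))"
proof -
  have K: "0 \<le> K"     using order_trans[OF abs_ge_zero step[of N]] zero_less_power[OF r(1), of N]
    by (metis linorder_not_le mult_neg_pos order.refl)
  have tel: "\<bar>c (n + m) - c n\<bar> \<le> K * r ^ n / (1 - r)" if "n \<ge> N" for n m
  proof -
    have "\<bar>c (n + m) - c n\<bar> \<le> (K * r ^ n) * (1 - r ^ m) / (1 - r)"
    proof (induction m)
      case (Suc m)
      have "\<bar>c (Suc (n + m)) - c (n + m)\<bar> \<le> K * r ^ (n + m)" using step[of "n + m"] that by simp
      then have "\<bar>c (n + Suc m) - c n\<bar> \<le> K * r ^ (n + m) + (K * r ^ n) * (1 - r ^ m) / (1 - r)"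
        using Suc by simp
      also have "\<dots> = (K * r ^ n) * (1 - r ^ Suc m) / (1 - r)" using r by (simp add: field_simps power_add)
      finally show ?case .
    qed simp
    also have "\<dots> \<le> (K * r ^ n) * 1 / (1 - r)" using r K by (intro divide_right_mono mult_left_mono) auto
    finally show ?thesis by simp
  qed
  have "Cauchy c"
  proof (rule metric_CauchyI)
    fix e :: real assume e: "e > 0"
    have "(\<lambda>n. K * r ^ n / (1 - r)) \<longlonglongrightarrow> K * 0 / (1 - r)"
      using r by (intro tendsto_intros LIMSEQ_realpow_zero) auto
    then have "eventually (\<lambda>n. K * r ^ n / (1 - r) < e / 2) sequentially"
      using e by (intro order_tendstoD(2)[where a = "e / 2"]) auto
    then obtain n0 where n0: "\<And>n. n \<ge> n0 \<Longrightarrow> K * r ^ n / (1 - r) < e / 2" unfolding eventually_sequentially by blast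
    define m where "m = max n0 N"
    have "dist (c i) (c m) < e / 2" if "i \<ge> m" for i
    proof -
      have "\<bar>c i - c m\<bar> \<le> K * r ^ m / (1 - r)" using tel[of m "i - m"] that by (simp add: m_def)
      also have "\<dots> < e / 2" by (rule n0) (simp add: m_def)
      finally show ?thesis by (simp only: dist_real_def)
    qed
    then show "\<exists>M. \<forall>m\<ge>M. \<forall>n\<ge>M. dist (c m) (c n) < e"
      by (metis dist_triangle_half_r dist_commute)
  qed
  then obtain l where l: "c \<longlonglongrightarrow> l" using Cauchy_convergent convergent_def by blast
  have "\<bar>c n - l\<bar> \<le> K * r ^ n / (1 - r)" if "n \<ge> N" for n
  proof (rule LIMSEQ_le_const2)
    show "(\<lambda>m. \<bar>c n - c (m + n)\<bar>) \<longlonglongrightarrow> \<bar>c n - l\<bar>" by (intro tendsto_intros LIMSEQ_ignore_initial_segment l)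
    show "\<exists>N. \<forall>m\<ge>N. \<bar>c n - c (m + n)\<bar> \<le> K * r ^ n / (1 - r)"
      using tel[OF that] by (metis abs_minus_commute add.commute)
  qed
  with l show ?thesis by blast
qed

text \<open>The slopes of the images of the two basis vectors form an exponentially convergent
  sequence, since their steps are of size \<open>\<bar>det\<bar> / norm^2\<close> and
  \<open>D < 2 * l\<close>. The limiting slope singles out the combination \<open>u\<close> of the
  basis vectors whose images lose their dominant component, and \<open>u\<close> spans the slow
  line.\<close>

lemma oseledets_line:
  fixes M A :: "nat \<Rightarrow> real^2^2"
  assumes M0: "M 0 = mat 1" and MS: "\<And>n. M (Suc n) = A n ** M n"
    and \<Lambda>: "\<And>n x. norm (A n *v x) \<le> \<Lambda> * norm x" and det: "\<And>n. det (M n) \<noteq> 0"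
    and r1: "(\<lambda>n. ln (norm (M n *v axis 1 1)) / real n) \<longlonglongrightarrow> l"
    and rd: "(\<lambda>n. ln \<bar>det (M n)\<bar> / real n) \<longlonglongrightarrow> D" and gap: "D < 2 * l"
  shows "\<exists>L. subspace L \<and> dim L = 1 \<and> (\<forall>v. v \<noteq> 0 \<longrightarrow>
      (\<lambda>n. ln (norm (M n *v v)) / real n) \<longlonglongrightarrow> (if v \<in> L then D - l else l))"
    and "(\<lambda>n. ln (norm (M n)) / real n) \<longlonglongrightarrow> l"
proof -
  define e1 e2 :: "real^2" where "e1 = axis 1 1" and "e2 = axis 2 1"
  have e: "e1 \<noteq> 0" "cross e1 e2 = 1" "norm e1 = 1" by (simp_all add: e1_def e2_def cross_def axis_def axis_eq_0_iff)
     (simp_all flip: axis_def)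
  define p q d where "p n = M n *v e1" and "q n = M n *v e2" and "d n = det (M n)" for n
  have p0: "p n \<noteq> 0" for n unfolding p_def using det_nz_mv[OF det] e by blast
  have pn: "norm (p n) > 0" for n using p0 by simp
  have d: "d n = cross (p n) (q n)" for n by (simp add: d_def p_def q_def cross_mv e)
  have dn: "\<bar>d n\<bar> > 0" for n using det by (simp add: d_def)
  define c where "c n = slope (p n) (q n)" for n
  have dec: "q n = c n *\<^sub>R p n + (d n / (norm (p n))\<^sup>2) *\<^sub>R rot2 (p n)" for n
    unfolding c_def d by (rule slope_decomp[OF p0])
  have pS: "p (Suc n) = A n *v p n" and qS: "q (Suc n) = A n *v q n" for n
    by (simp_all add: p_def q_def MS matrix_vector_mul_assoc)
  have \<Lambda>0: "0 \<le> \<Lambda>"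
    using order_trans[OF norm_ge_zero \<Lambda>[of 0 e1]] e by simp
  have cstep: "\<bar>c (Suc n) - c n\<bar> \<le> \<Lambda> * \<bar>d n\<bar> / (norm (p n) * norm (p (Suc n)))" for n
    using p0[of "Suc n"] unfolding c_def d pS qS by (rule slope_step[OF \<Lambda> p0])
  define g where "g = 2 * l - D"
  have g: "g > 0" using gap by (simp add: g_def)
  have rp: "(\<lambda>n. ln (norm (p n)) / real n) \<longlonglongrightarrow> l" using r1 by (simp add: p_def e1_def)
  note bp = rate_bounds[OF rp pn]
  have rd': "(\<lambda>n. ln \<bar>d n\<bar> / real n) \<longlonglongrightarrow> D" using rd by (simp add: d_def)
  note bd = rate_bounds[OF rd' dn]
  \<comment> \<open>One \<open>e\<close> is lost in the determinant and two in the norms of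
    consecutive images, which leaves the rate \<open>g - 3 * e\<close>.\<close>
  have ex_c: "\<exists>lim K. c \<longlonglongrightarrow> lim \<and> K > 0 \<and> eventually (\<lambda>n. \<bar>c n - lim\<bar> \<le> K * exp ((3 * e - g) * real n)) sequentially"
    if e: "e > 0" "3 * e < g" for e
  proof -
    obtain N1 where N1: "\<And>n. n \<ge> N1 \<Longrightarrow> exp ((l - e) * real n) \<le> norm (p n)"
      using bp[OF e(1)] unfolding eventually_sequentially by blast
    obtain N2 where N2: "\<And>n. n \<ge> N2 \<Longrightarrow> \<bar>d n\<bar> \<le> exp ((D + e) * real n)"
      using bd[OF e(1)] unfolding eventually_sequentially by blast
    define K where "K = \<Lambda> * exp (- (l - e))"
    define r where "r = exp (3 * e - g)"
    have r: "0 < r" "r < 1" using e by (auto simp: r_def)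
    have "\<bar>c (Suc n) - c n\<bar> \<le> K * r ^ n" if n: "n \<ge> max N1 N2" for n
    proof -
      have "\<bar>c (Suc n) - c n\<bar> \<le> \<Lambda> * exp ((D + e) * real n) / (exp ((l - e) * real n) * exp ((l - e) * real (Suc n)))"
        by (rule order_trans[OF cstep frac_le]) (use N1[of n] N1[of "Suc n"] N2[of n] n \<Lambda>0 in \<open>auto intro!: mult_left_mono mult_mono\<close>)
      also have "\<dots> = K * r ^ n"
        by (simp add: K_def r_def g_def exp_of_nat_mult[symmetric] exp_add[symmetric] exp_diff[symmetric] exp_minus divide_inverse algebra_simps
            flip: exp_minus)
      finally show ?thesis .
    qed
    from geometric_cauchy[OF r this] obtain lim where lim: "c \<longlonglongrightarrow> lim" "\<And>n. n \<ge> max N1 N2 \<Longrightarrow> \<bar>c n - lim\<bar> \<le> K * r ^ n / (1 - r)"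
      by blast
    have "\<bar>c n - lim\<bar> \<le> ((K + 1) / (1 - r)) * exp ((3 * e - g) * real n)" if "n \<ge> max N1 N2" for n
    proof -
      have "K * r ^ n / (1 - r) \<le> (K + 1) * r ^ n / (1 - r)" using r by (intro divide_right_mono mult_right_mono) auto
      then show ?thesis using lim(2)[OF that] by (simp add: r_def exp_of_nat_mult[symmetric] mult.commute)
    qed
    moreover have "(K + 1) / (1 - r) > 0" using r \<Lambda>0 by (auto simp: K_def intro!: divide_pos_pos add_nonneg_pos)
    ultimately show ?thesis using lim(1) unfolding eventually_sequentially by blast
  qed
  obtain cl where cl: "c \<longlonglongrightarrow> cl" using ex_c[of "g / 4"] g by auto
  have cb: "\<exists>K>0. eventually (\<lambda>n. \<bar>c n - cl\<bar> \<le> K * exp ((3 * e - g) * real n)) sequentially" if "e > 0" "3 * e < g" for e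
    using ex_c[OF that] LIMSEQ_unique[OF cl] by blast
  \<comment> \<open>With this choice the coefficient of \<open>p n\<close> in the image of
    \<open>u\<close> is \<open>c n - cl\<close>, which decays exponentially.\<close>
  define u where "u = e2 - cl *\<^sub>R e1"
  have ce: "cross e1 u = 1" using e by (simp add: u_def cross_def algebra_simps)
  have Mu: "M n *v u = (c n - cl) *\<^sub>R p n + (d n / (norm (p n))\<^sup>2) *\<^sub>R rot2 (p n)" for n
    using dec[of n] by (simp add: u_def matrix_vector_mult_diff_distrib matrix_vector_mult_scaleR p_def q_def algebra_simps)
  have u0: "u \<noteq> 0" using ce by (auto simp: cross_def)
  have Mu0: "norm (M n *v u) > 0" for n
    using det_nz_mv[OF det u0, of n] by simp
  have ru: "(\<lambda>n. ln (norm (M n *v u)) / real n) \<longlonglongrightarrow> D - l"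
  proof (rule rateI)
    fix e :: real assume e: "e > 0"
    have "eventually (\<lambda>n. 1 * exp ((D - l - e) * real n) \<le> norm (M n *v u)) sequentially"
      using bp[of "e / 2"] bd[of "e / 2"] half_gt_zero[OF e]
    proof -
      have "eventually (\<lambda>n. exp ((l - e/2) * real n) \<le> norm (p n) \<and> norm (p n) \<le> exp ((l + e/2) * real n)) sequentially"
        "eventually (\<lambda>n. exp ((D - e/2) * real n) \<le> \<bar>d n\<bar> \<and> \<bar>d n\<bar> \<le> exp ((D + e/2) * real n)) sequentially"
        using bp bd half_gt_zero[OF e] by blast+
      then show ?thesis
      proof eventually_elim
        case (elim n)
        \<comment> \<open>The area spanned by the images of \<open>e1\<close> and \<open>u\<close>
          is the determinant; an upper bound on one side of the parallelogram gives a lower bound on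
          the other.\<close>
        have "d n = cross (p n) (M n *v u)" by (simp add: p_def cross_mv ce d_def)
        then have "exp ((D - e/2) * real n) \<le> norm (p n) * norm (M n *v u)"
          using elim abs_cross_le[of "p n" "M n *v u"] by linarith
        also have "\<dots> \<le> exp ((l + e/2) * real n) * norm (M n *v u)" using elim by (intro mult_right_mono) auto
        finally have "exp ((D - e/2) * real n) * exp (- ((l + e/2) * real n)) \<le> exp ((l + e/2) * real n) * norm (M n *v u) * exp (- ((l + e/2) * real n))"
          by (intro mult_right_mono) auto
        also have "\<dots> = norm (M n *v u)" by (simp add: exp_minus)
        finally show ?case by (simp add: exp_add[symmetric] algebra_simps)
      qed
    qed
    then show "\<exists>K>0. eventually (\<lambda>n. K * exp ((D - l - e) * real n) \<le> norm (M n *v u)) sequentially"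
      using zero_less_one by blast
    define e' where "e' = min (e / 4) (g / 4)"
    have e': "e' > 0" "3 * e' < g" "4 * e' \<le> e" using e g by (auto simp: e'_def)
    obtain K where K: "K > 0" "eventually (\<lambda>n. \<bar>c n - cl\<bar> \<le> K * exp ((3 * e' - g) * real n)) sequentially"
      using cb[OF e'(1,2)] by blast
    have "eventually (\<lambda>n. norm (M n *v u) \<le> (K + 1) * exp ((D - l + e) * real n)) sequentially"
      using K(2) bp[OF e'(1)] bd[OF e'(1)]
    proof eventually_elim
      case (elim n)
      have 1: "\<bar>c n - cl\<bar> * norm (p n) \<le> (K * exp ((3 * e' - g) * real n)) * exp ((l + e') * real n)"
        using elim K by (intro mult_mono) auto
      also have "\<dots> = K * exp ((D - l + 4 * e') * real n)" by (simp add: g_def exp_add[symmetric] algebra_simps)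
      finally have 1: "\<bar>c n - cl\<bar> * norm (p n) \<le> K * exp ((D - l + 4 * e') * real n)" .
      have "\<bar>d n\<bar> / norm (p n) \<le> exp ((D + e') * real n) / exp ((l - e') * real n)"
        using elim by (intro frac_le) auto
      also have "\<dots> = exp ((D - l + 2 * e') * real n)" by (simp add: exp_diff[symmetric] algebra_simps)
      also have "\<dots> \<le> exp ((D - l + 4 * e') * real n)" using e' by (simp add: mult_right_mono)
      finally have 2: "\<bar>d n\<bar> / norm (p n) \<le> exp ((D - l + 4 * e') * real n)" .
      have "norm (M n *v u) \<le> \<bar>c n - cl\<bar> * norm (p n) + \<bar>d n\<bar> / (norm (p n))\<^sup>2 * norm (p n)"
        unfolding Mu by (rule order_trans[OF norm_triangle_ineq]) simp
      also have "\<dots> = \<bar>c n - cl\<bar> * norm (p n) + \<bar>d n\<bar> / norm (p n)" using pn[of n] by (simp add: power2_eq_square)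
      also have "\<dots> \<le> (K + 1) * exp ((D - l + 4 * e') * real n)" using 1 2 by (simp add: algebra_simps)
      also have "\<dots> \<le> (K + 1) * exp ((D - l + e) * real n)" using e' K by (intro mult_left_mono) (auto intro!: mult_right_mono)
      finally show ?case .
    qed
    then show "\<exists>K>0. eventually (\<lambda>n. norm (M n *v u) \<le> K * exp ((D - l + e) * real n)) sequentially"
      using K(1) by (intro exI[of _ "K + 1"]) auto
  qed
  have small: "eventually (\<lambda>n. a * norm (M n *v u) \<le> b * norm (p n)) sequentially" if "a \<ge> 0" "b > 0" for a b
  proof -
    have g4: "g / 4 > 0" using g by simp
    have "(\<lambda>n. a * exp (- (g / 2)) ^ n) \<longlonglongrightarrow> a * 0" using g by (intro tendsto_intros LIMSEQ_realpow_zero) auto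
    then have "eventually (\<lambda>n. a * exp (- (g / 2)) ^ n < b) sequentially"
      using that by (intro order_tendstoD(2)[where a = b]) auto
    then show ?thesis using bp[OF g4] rate_bounds[OF ru Mu0 g4]
    proof eventually_elim
      case (elim n)
      have "a * norm (M n *v u) \<le> a * exp ((D - l + g / 4) * real n)" using elim that by (intro mult_left_mono) auto
      also have "\<dots> = (a * exp (- (g / 2)) ^ n) * exp ((l - g / 4) * real n)"
        by (simp add: g_def exp_of_nat_mult[symmetric] exp_add[symmetric] field_simps)
      also have "\<dots> \<le> b * norm (p n)" using elim that by (intro mult_mono) auto
      finally show ?case .
    qed
  qed
  define L where "L = span {u}"
  have "(\<lambda>n. ln (norm (M n *v v)) / real n) \<longlonglongrightarrow> (if v \<in> L then D - l else l)" if v: "v \<noteq> 0" for v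
  proof -
    define a b where "a = cross e1 v" and "b = cross v u"
    have vd: "v = b *\<^sub>R e1 + a *\<^sub>R u"
      using cross_decomp[of e1 u v] unfolding ce by (simp add: a_def b_def)
    have Mv: "M n *v v = b *\<^sub>R p n + a *\<^sub>R (M n *v u)" for n
      by (subst vd) (simp add: matrix_vector_right_distrib matrix_vector_mult_scaleR p_def)
    show ?thesis
    proof (cases "b = 0")
      case True
      then have a: "a \<noteq> 0" using vd v by auto
      have "v \<in> L" using vd True by (simp add: L_def span_mul span_base)
      moreover have "(\<lambda>n. ln (norm (M n *v v)) / real n) \<longlonglongrightarrow> D - l"
      proof -
        have "ln (norm (M n *v v)) / real n = ln \<bar>a\<bar> / real n + ln (norm (M n *v u)) / real n" for n
          using Mu0[of n] a True by (simp add: Mv ln_mult add_divide_distrib)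
        moreover have "(\<lambda>n. ln \<bar>a\<bar> / real n + ln (norm (M n *v u)) / real n) \<longlonglongrightarrow> 0 + (D - l)"
          by (intro tendsto_add lim_const_over_n ru)
        ultimately show ?thesis by simp
      qed
      ultimately show ?thesis by simp
    next
      case False
      have "v \<notin> L"
      proof
        assume "v \<in> L"
        then obtain c where "v = c *\<^sub>R u" unfolding L_def by (auto simp: span_singleton)
        then show False using False by (simp add: b_def cross_scale)
      qed
      moreover have "(\<lambda>n. ln (norm (M n *v v)) / real n) \<longlonglongrightarrow> l"
      proof (rule rateI)
        have sm: "eventually (\<lambda>n. \<bar>a\<bar> * norm (M n *v u) \<le> (\<bar>b\<bar> / 2) * norm (p n)) sequentially"
          by (rule small) (use False in auto)
        fix e :: real assume e: "e > 0"
        have "eventually (\<lambda>n. (\<bar>b\<bar> / 2) * exp ((l - e) * real n) \<le> norm (M n *v v)) sequentially"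
          using sm bp[OF e]
        proof eventually_elim
          case (elim n)
          have "\<bar>b\<bar> * norm (p n) \<le> norm (M n *v v) + \<bar>a\<bar> * norm (M n *v u)"
            using norm_triangle_ineq4[of "M n *v v" "a *\<^sub>R (M n *v u)"] by (simp add: Mv)
          moreover have "(\<bar>b\<bar> / 2) * exp ((l - e) * real n) \<le> (\<bar>b\<bar> / 2) * norm (p n)" using elim by (intro mult_left_mono) auto
          ultimately show ?case using elim by (simp add: field_simps)
        qed
        then show "\<exists>K>0. eventually (\<lambda>n. K * exp ((l - e) * real n) \<le> norm (M n *v v)) sequentially"
          using False by (intro exI[of _ "\<bar>b\<bar> / 2"]) auto
        have "eventually (\<lambda>n. norm (M n *v v) \<le> (2 * \<bar>b\<bar>) * exp ((l + e) * real n)) sequentially"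
          using sm bp[OF e]
        proof eventually_elim
          case (elim n)
          have "norm (M n *v v) \<le> \<bar>b\<bar> * norm (p n) + \<bar>a\<bar> * norm (M n *v u)"
            using norm_triangle_ineq[of "b *\<^sub>R p n" "a *\<^sub>R (M n *v u)"] by (simp add: Mv)
          also have "\<dots> \<le> (2 * \<bar>b\<bar>) * norm (p n)"
          proof -
            have "\<bar>b\<bar> / 2 * norm (p n) \<le> \<bar>b\<bar> * norm (p n)" by (intro mult_right_mono) auto
            then show ?thesis using elim(1) by linarith
          qed
          also have "\<dots> \<le> (2 * \<bar>b\<bar>) * exp ((l + e) * real n)" using elim by (intro mult_left_mono) auto
          finally show ?case .
        qed
        then show "\<exists>K>0. eventually (\<lambda>n. norm (M n *v v) \<le> K * exp ((l + e) * real n)) sequentially"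
          using False by (intro exI[of _ "2 * \<bar>b\<bar>"]) auto
      qed
      ultimately show ?thesis by simp
    qed
  qed
  moreover have "subspace L" "dim L = 1" using u0 by (simp_all add: L_def dim_span dim_singleton)
  ultimately show "\<exists>L. subspace L \<and> dim L = 1 \<and> (\<forall>v. v \<noteq> 0 \<longrightarrow>
      (\<lambda>n. ln (norm (M n *v v)) / real n) \<longlonglongrightarrow> (if v \<in> L then D - l else l))" by blast
  show "(\<lambda>n. ln (norm (M n)) / real n) \<longlonglongrightarrow> l"
  proof (rule rateI)
    fix e :: real assume e0: "e > 0"
    have "eventually (\<lambda>n. 1 * exp ((l - e) * real n) \<le> norm (M n)) sequentially"
      using bp[OF e0]
    proof eventually_elim
      case (elim n)
      then show ?case using mv_norm_le[of "M n" e1] e by (simp add: p_def)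
    qed
    then show "\<exists>K>0. eventually (\<lambda>n. K * exp ((l - e) * real n) \<le> norm (M n)) sequentially"
      using zero_less_one by blast
    have sm: "eventually (\<lambda>n. 1 * norm (M n *v u) \<le> 1 * norm (p n)) sequentially"
      by (rule small) auto
    have "eventually (\<lambda>n. norm (M n) \<le> (2 + \<bar>cl\<bar>) * exp ((l + e) * real n)) sequentially"
      using sm bp[OF e0]
    proof eventually_elim
      case (elim n)
      have c1: "p n $ 1 = M n $1$1" "p n $ 2 = M n $2$1" "q n $ 1 = M n $1$2" "q n $ 2 = M n $2$2"
        by (simp_all add: p_def q_def e1_def e2_def mv2 axis_def)
      have "(norm (M n))\<^sup>2 = (norm (p n))\<^sup>2 + (norm (q n))\<^sup>2"
        unfolding norm2_sq c1 by (simp add: norm_eq_sqrt_inner inner_vec_def sum_2 power2_eq_square)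
      also have "\<dots> \<le> (norm (p n) + norm (q n))\<^sup>2" by (simp add: power2_eq_square algebra_simps)
      finally have "norm (M n) \<le> norm (p n) + norm (q n)" by (rule power2_le_imp_le) simp
      moreover have "q n = M n *v u + cl *\<^sub>R p n"
        by (simp add: u_def matrix_vector_mult_diff_distrib matrix_vector_mult_scaleR p_def q_def)
      then have "norm (q n) \<le> norm (M n *v u) + \<bar>cl\<bar> * norm (p n)" using norm_triangle_ineq[of "M n *v u" "cl *\<^sub>R p n"] by simp
      ultimately have "norm (M n) \<le> (2 + \<bar>cl\<bar>) * norm (p n)" using elim by (simp add: algebra_simps)
      also have "\<dots> \<le> (2 + \<bar>cl\<bar>) * exp ((l + e) * real n)" using elim by (intro mult_left_mono) auto
      finally show ?case .
    qed
    then show "\<exists>K>0. eventually (\<lambda>n. norm (M n) \<le> K * exp ((l + e) * real n)) sequentially"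
      by (intro exI[of _ "2 + \<bar>cl\<bar>"]) auto
  qed
qed

subsection \<open>Almost sure convergence\<close>

definition pre :: "(int \<Rightarrow> nat) \<Rightarrow> nat \<Rightarrow> nat list" where
  "pre x n = map (\<lambda>j. x (int j)) [0..<n]"

lemma pre_simps: "pre x 0 = []" "pre x (Suc n) = pre x n @ [x (int n)]" "length (pre x n) = n"
  by (simp_all add: pre_def)

lemma pre_words: "(\<And>j. x j \<le> k) \<Longrightarrow> pre x n \<in> words k n"
  by (auto simp: pre_def words_def)

text \<open>For \<open>n = 0\<close> the fibre has not been reduced modulo 1, hence the case
  distinction.\<close>

lemma base_map_pow:
  "(base_map \<theta> ^^ n) (x, t) = (\<lambda>m. x (m + int n), if n = 0 then t else frac (wend \<theta> t (pre x n)))"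
proof (induction n)
  case (Suc n)
  have "frac (frac s + c) = frac (s + c)" for s c :: real
    by (simp add: frac_def floor_add_int flip: of_int_add add_diff_eq) (simp add: algebra_simps)
  with Suc show ?case by (cases "n = 0") (auto simp: base_map_def pre_simps add_ac)
qed (simp add: pre_simps)

lemma pre_eq_iff: "length w = n \<Longrightarrow> pre x n = w \<longleftrightarrow> (\<forall>i\<in>int ` {..<n}. x i \<in> {w ! nat i})"
  by (auto simp: pre_def list_eq_iff_nth_eq)

lemma prefix_cylinder:
  fixes \<nu> :: "nat pmf"
  assumes "length w = n"
  shows "{x. pre x n = w} \<in> sets (PiM UNIV (\<lambda>_::int. measure_pmf \<nu>))"
    and "emeasure (PiM UNIV (\<lambda>_::int. measure_pmf \<nu>)) {x. pre x n = w} = ennreal (wt \<nu> w)"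
proof -
  interpret X: product_prob_space "\<lambda>_::int. measure_pmf \<nu>" UNIV by unfold_locales
  let ?P = "PiM UNIV (\<lambda>_::int. measure_pmf \<nu>)"
  have sp: "space ?P = UNIV" by (simp add: space_PiM)
  have eq: "{x. pre x n = w} = {x\<in>space ?P. \<forall>i\<in>int ` {..<n}. x i \<in> {w ! nat i}}"
    unfolding sp using pre_eq_iff[OF assms] by auto
  show "{x. pre x n = w} \<in> sets ?P"
    unfolding eq by (intro sets.sets_Collect_finite_All sets_Collect_single') auto
  have "emeasure ?P {x. pre x n = w} = (\<Prod>i\<in>int ` {..<n}. emeasure (measure_pmf \<nu>) {w ! nat i})"
    unfolding eq by (rule X.emeasure_PiM_Collect) auto
  also have "\<dots> = (\<Prod>j<n. ennreal (pmf \<nu> (w ! j)))"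
    by (subst prod.reindex) (auto simp: emeasure_pmf_single)
  also have "\<dots> = ennreal (\<Prod>j<n. pmf \<nu> (w ! j))" by (rule prod_ennreal) simp
  also have "(\<Prod>j<n. pmf \<nu> (w ! j)) = wt \<nu> w"
    using prod.list_conv_set_nth[of "map (pmf \<nu>) w"] assms by (simp add: wt_def atLeast0LessThan)
  finally show "emeasure ?P {x. pre x n = w} = ennreal (wt \<nu> w)" .
qed

abbreviation "circ \<equiv> restrict_space lborel {0..<1::real}"

lemma prob_circ: "prob_space circ"
  by (rule prob_spaceI) (simp add: space_restrict_space emeasure_restrict_space)

context walk
begin

lemma AE_symbols: "AE p in base_measure \<nu>. \<forall>j. fst p j \<le> k"
proof -
  interpret X: product_prob_space "\<lambda>_::int. measure_pmf \<nu>" UNIV by unfold_locales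
  interpret T: prob_space circ by (rule prob_circ)
  interpret P: pair_prob_space "PiM UNIV (\<lambda>_::int. measure_pmf \<nu>)" circ by unfold_locales
  have "AE x in PiM UNIV (\<lambda>_::int. measure_pmf \<nu>). x j \<le> k" for j
    using supp by (intro X.AE_component) (auto simp: AE_measure_pmf_iff)
  then have "AE x in PiM UNIV (\<lambda>_::int. measure_pmf \<nu>). \<forall>j. x j \<le> k" unfolding AE_all_countable by blast
  then have "AE x in distr (base_measure \<nu>) (PiM UNIV (\<lambda>_::int. measure_pmf \<nu>)) fst. \<forall>j. x j \<le> k"
    unfolding base_measure_def T.distr_pair_fst .
  then show ?thesis
    by (rule AE_distrD[rotated]) (auto simp: base_measure_def)
qed

text \<open>The event is a finite union of rectangles, each a cylinder times a set of fibres.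
  Integrating the weighted indicators over the fibre recovers \<open>Prob\<close>, which is bounded
  fibre by fibre.\<close>

lemma bad_event:
  assumes meas: "\<And>w. w \<in> words k n \<Longrightarrow> {t\<in>{0..<1}. Q w t} \<in> sets circ"
    and small: "\<And>t. t \<in> {0..<1} \<Longrightarrow> Prob n (\<lambda>w. Q w t) \<le> e"
  defines "Bad \<equiv> {p\<in>space (base_measure \<nu>). pre (fst p) n \<in> words k n \<and> Q (pre (fst p) n) (snd p)}"
  shows "Bad \<in> sets (base_measure \<nu>)" "measure (base_measure \<nu>) Bad \<le> e"
proof -
  let ?P = "PiM UNIV (\<lambda>_::int. measure_pmf \<nu>)"
  interpret X: product_prob_space "\<lambda>_::int. measure_pmf \<nu>" UNIV by unfold_locales
  interpret T: prob_space circ by (rule prob_circ)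
  interpret P: pair_prob_space ?P circ by unfold_locales
  have sp: "space (base_measure \<nu>) = UNIV \<times> {0..<1}"
    by (simp add: base_measure_def space_pair_measure space_PiM space_restrict_space)
  let ?R = "\<lambda>w. {x. pre x n = w} \<times> {t\<in>{0..<1}. Q w t}"
  have Bad: "Bad = (\<Union>w\<in>words k n. ?R w)"
    unfolding Bad_def sp by auto
  have len: "length w = n" if "w \<in> words k n" for w using that by (simp add: words_def)
  have R: "?R w \<in> sets (base_measure \<nu>)" if "w \<in> words k n" for w
    unfolding base_measure_def using prefix_cylinder(1)[OF len[OF that]] meas[OF that] by (intro pair_measureI)
  show "Bad \<in> sets (base_measure \<nu>)" unfolding Bad using R by (intro sets.finite_UN) auto
  have eR: "emeasure (base_measure \<nu>) (?R w) = ennreal (wt \<nu> w * measure circ {t\<in>{0..<1}. Q w t})" if "w \<in> words k n" for w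
    unfolding base_measure_def using prefix_cylinder[OF len[OF that], of \<nu>] meas[OF that]
    by (subst T.emeasure_pair_measure_Times) (auto simp: T.emeasure_eq_measure ennreal_mult')
  have int: "integrable circ (\<lambda>t. wt \<nu> w * indicator {t\<in>{0..<1}. Q w t} t)" if "w \<in> words k n" for w
    using meas[OF that] by (intro integrable_mult_right) (auto simp: T.emeasure_eq_measure)
  have "emeasure (base_measure \<nu>) Bad \<le> (\<Sum>w\<in>words k n. emeasure (base_measure \<nu>) (?R w))"
    unfolding Bad using R by (intro emeasure_subadditive_finite) auto
  also have "\<dots> = (\<Sum>w\<in>words k n. ennreal (wt \<nu> w * measure circ {t\<in>{0..<1}. Q w t}))"
    by (intro sum.cong refl eR)
  also have "\<dots> = ennreal (\<Sum>w\<in>words k n. wt \<nu> w * measure circ {t\<in>{0..<1}. Q w t})"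
    by (rule sum_ennreal) simp
  finally have le1: "emeasure (base_measure \<nu>) Bad \<le> ennreal (\<Sum>w\<in>words k n. wt \<nu> w * measure circ {t\<in>{0..<1}. Q w t})" .
  have "(\<Sum>w\<in>words k n. wt \<nu> w * measure circ {t\<in>{0..<1}. Q w t})
      = (\<Sum>w\<in>words k n. (\<integral>t. wt \<nu> w * indicator {t\<in>{0..<1}. Q w t} t \<partial>circ))"
  proof (intro sum.cong refl)
    fix w assume "w \<in> words k n"
    have "{t\<in>{0..<1}. Q w t} \<inter> {0..<1} = {t\<in>{0..<1}. Q w t}" by auto
    then show "wt \<nu> w * measure circ {t\<in>{0..<1}. Q w t} = (\<integral>t. wt \<nu> w * indicator {t\<in>{0..<1}. Q w t} t \<partial>circ)"
      by simp
  qed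
  also have "\<dots> = (\<integral>t. (\<Sum>w\<in>words k n. wt \<nu> w * indicator {t\<in>{0..<1}. Q w t} t) \<partial>circ)"
    using int by (intro Bochner_Integration.integral_sum[symmetric])
  also have "\<dots> \<le> (\<integral>t. e \<partial>circ)"
  proof (rule integral_mono)
    show "integrable circ (\<lambda>t. \<Sum>w\<in>words k n. wt \<nu> w * indicator {t\<in>{0..<1}. Q w t} t)"
      using int by (intro Bochner_Integration.integrable_sum)
    fix t assume "t \<in> space circ"
    then have t: "t \<in> {0..<1}" by (simp add: space_restrict_space)
    have "(\<Sum>w\<in>words k n. wt \<nu> w * indicator {t\<in>{0..<1}. Q w t} t) = Prob n (\<lambda>w. Q w t)"
      unfolding Prob_def EW_def using t by (intro sum.cong) (auto simp: indicator_def)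
    then show "(\<Sum>w\<in>words k n. wt \<nu> w * indicator {t\<in>{0..<1}. Q w t} t) \<le> e" using small[OF t] by simp
  qed simp
  also have "\<dots> = e" using T.prob_space by simp
  finally have le: "emeasure (base_measure \<nu>) Bad \<le> ennreal e" using le1 by (meson ennreal_leI order_trans)
  have "0 \<le> e" using order_trans[OF Prob_nonneg small[of 0]] by simp
  then show "measure (base_measure \<nu>) Bad \<le> e"
    unfolding measure_def using le enn2real_mono[OF le] by simp
qed

end

context observable
begin

lemma S_measurable: "w \<in> words k n \<Longrightarrow> (\<lambda>p. S f (fst p) (snd p) w) \<in> borel_measurable borel"
proof (induction w arbitrary: n)
  case (Cons i w)
  then have i: "i \<le> k" and w: "w \<in> words k (n - 1)" by (auto simp: words_def)
  have "continuous_on UNIV (\<lambda>p::real \<times> (real^2). (fst p + \<theta> i, B i (fst p) *v snd p))"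
    unfolding matrix_vector_mult_def
    by (intro continuous_intros continuous_on_vec_lambda continuous_on_compose2[OF B_cont[OF i]]) auto
  then have "(\<lambda>p. (fst p + \<theta> i, B i (fst p) *v snd p)) \<in> borel \<rightarrow>\<^sub>M borel"
    by (rule borel_measurable_continuous_onI)
  from measurable_compose[OF this Cons.IH[OF w]] f_meas[OF i] show ?case by simp
qed simp

lemma S_meas_set:
  assumes "w \<in> words k n"
  shows "{t\<in>{0..<1}. \<bar>S f t v w - c\<bar> > e} \<in> sets circ"
proof -
  have "(\<lambda>t::real. (t, v)) \<in> borel \<rightarrow>\<^sub>M borel"
    by (intro borel_measurable_continuous_onI continuous_intros)
  from measurable_compose[OF this S_measurable[OF assms]] have [measurable]: "(\<lambda>t. S f t v w) \<in> borel_measurable borel" by simp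
  have "{t \<in> space borel. t \<in> {0..<1} \<and> \<bar>S f t v w - c\<bar> > e} \<in> sets borel" by measurable
  moreover have "{t \<in> space borel. t \<in> {0..<1} \<and> \<bar>S f t v w - c\<bar> > e} = {t\<in>{0..<1}. \<bar>S f t v w - c\<bar> > e}" by simp
  ultimately show ?thesis by (subst sets_restrict_space_iff) auto
qed

end

text \<open>The tail bounds of \<open>large_deviations\<close> are summable, so Borel-Cantelli
  applies for each of the countably many tolerances \<open>1 / (m + 1)\<close>.\<close>

lemma (in contracting_observable) AE_rate:
  assumes l: "\<And>e. e > 0 \<Longrightarrow> \<exists>n0. \<forall>n\<ge>n0. \<forall>t v. v \<noteq> 0 \<longrightarrow> \<bar>ES f n t v - real n * l\<bar> \<le> real n * e" and v: "v \<noteq> 0"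
  shows "AE p in base_measure \<nu>. (\<lambda>n. S f (snd p) v (pre (fst p) n) / real n) \<longlonglongrightarrow> l"
proof -
  interpret BM: prob_space "base_measure \<nu>" by (rule prob_space_base_measure)
  have "AE p in base_measure \<nu>. eventually (\<lambda>n. \<bar>S f (snd p) v (pre (fst p) n) - real n * l\<bar> \<le> real n * e) sequentially"
    if e: "e > 0" for e
  proof -
    obtain C \<rho> where C: "0 < C" "0 < \<rho>" "\<rho> < 1"
      "\<And>n t v. v \<noteq> 0 \<Longrightarrow> Prob n (\<lambda>w. \<bar>S f t v w - real n * l\<bar> > real n * e) \<le> C * \<rho> ^ n"
      using large_deviations[OF l e] by blast
    define Bad where "Bad n = {p\<in>space (base_measure \<nu>). pre (fst p) n \<in> words k n \<and>
        \<bar>S f (snd p) v (pre (fst p) n) - real n * l\<bar> > real n * e}" for n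
    have Bad: "Bad n \<in> sets (base_measure \<nu>)" "measure (base_measure \<nu>) (Bad n) \<le> C * \<rho> ^ n" for n
      using bad_event[where n=n and Q="\<lambda>w t. \<bar>S f t v w - real n * l\<bar> > real n * e", OF S_meas_set C(4)[OF v]]
      by (simp_all add: Bad_def)
    have "summable (\<lambda>n. measure (base_measure \<nu>) (Bad n))"
      by (rule summable_comparison_test'[of "\<lambda>n. C * \<rho> ^ n" 0])
        (use Bad C in \<open>auto intro!: summable_mult summable_geometric\<close>)
    then have "AE p in base_measure \<nu>. eventually (\<lambda>n. p \<in> space (base_measure \<nu>) - Bad n) sequentially"
      using Bad by (intro borel_cantelli_AE1) (auto simp: BM.emeasure_eq_measure)
    then show ?thesis using AE_symbols
    proof eventually_elim
      case (elim p)
      from elim(1) show ?case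
      proof eventually_elim
        case (elim n)
        then show ?case using pre_words[of "fst p" k n] \<open>\<forall>j. fst p j \<le> k\<close> by (auto simp: Bad_def)
      qed
    qed
  qed
  then have "AE p in base_measure \<nu>. \<forall>m::nat. eventually (\<lambda>n. \<bar>S f (snd p) v (pre (fst p) n) - real n * l\<bar> \<le> real n * inverse (Suc m)) sequentially"
    unfolding AE_all_countable by simp
  then show ?thesis
  proof eventually_elim
    case (elim p)
    show ?case
    proof (rule tendstoI)
      fix e :: real assume "e > 0"
      then obtain m where m: "inverse (real (Suc m)) < e" using reals_Archimedean by blast
      have "eventually (\<lambda>n. \<bar>S f (snd p) v (pre (fst p) n) - real n * l\<bar> \<le> real n * inverse (Suc m)) sequentially"
        using elim by blast
      then show "eventually (\<lambda>n. dist (S f (snd p) v (pre (fst p) n) / real n) l < e) sequentially"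
        using eventually_gt_at_top[of 0]
      proof eventually_elim
        case (elim n)
        define x where "x = S f (snd p) v (pre (fst p) n)"
        have "\<bar>x / real n - l\<bar> = \<bar>x - real n * l\<bar> / real n" using elim by (simp add: field_simps abs_divide[symmetric])
        also have "\<dots> \<le> (real n * inverse (Suc m)) / real n" using elim by (intro divide_right_mono) (auto simp: x_def)
        also have "\<dots> < e" using m elim by simp
        finally show ?case by (simp add: dist_real_def x_def)
      qed
    qed
  qed
qed

text \<open>The base map reduces the fibre modulo 1 at every step and \<open>wmat\<close> never
  does; periodicity of the matrices reconciles the two.\<close>

lemma (in cocycle) iterate_eq:
  assumes "\<And>j. x j \<le> k"
  shows "iterate \<theta> B n (x, t) = M t (pre x n)"
proof (induction n)
  case (Suc n)
  have per: "B i (frac s) = B i s" if "i \<le> k" for i s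
    using periodic_int[of "B i" s "- \<lfloor>s\<rfloor>", OF B_per[OF that]] by (simp add: frac_def)
  have "generator B ((base_map \<theta> ^^ n) (x, t)) = B (x (int n)) (T t (pre x n))"
    unfolding base_map_pow using per[OF assms] by (auto simp: generator_def pre_simps)
  then show ?case using Suc by (simp add: pre_simps wmat_append)
qed (simp add: pre_simps)

subsection \<open>Exponents of contracting cocycles\<close>

lemma abs_ln_diff_le:
  fixes a b m :: real
  assumes "0 < m" "m \<le> a" "m \<le> b"
  shows "\<bar>ln a - ln b\<bar> \<le> \<bar>a - b\<bar> / m"
proof -
  have 1: "ln x - ln y \<le> \<bar>x - y\<bar> / m" if "m \<le> x" "m \<le> y" for x y
  proof -
    have "ln x - ln y = ln (x / y)" using that assms by (simp add: ln_div)
    also have "\<dots> \<le> x / y - 1" using that assms by (intro ln_le_minus_one) auto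
    also have "\<dots> = (x - y) / y" using that assms by (simp add: field_simps)
    also have "\<dots> \<le> \<bar>x - y\<bar> / m" using that assms by (intro frac_le) auto
    finally show ?thesis .
  qed
  show ?thesis using 1[of a b] 1[of b a] assms by (simp add: abs_le_iff abs_minus_commute)
qed

text \<open>With \<open>s\<close> the sign of the inner product and \<open>a\<close> its modulus,
  the squared distance is \<open>2 - 2 * a\<close>. By Lagrange's identity
  \<open>a^2 = 1 - pd^2\<close>, and \<open>a^2 \<le> a\<close> finishes the estimate.\<close>

lemma unit_representatives:
  fixes v v' :: "real^2"
  assumes "v \<noteq> 0" "v' \<noteq> 0"
  obtains s where "\<bar>s\<bar> = 1" "norm (v /\<^sub>R norm v - s *\<^sub>R (v' /\<^sub>R norm v')) \<le> 2 * pd v v'"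
proof -
  define x y where "x = v /\<^sub>R norm v" and "y = v' /\<^sub>R norm v'"
  have n: "norm x = 1" "norm y = 1" using assms by (auto simp: x_def y_def)
  have p: "\<bar>cross x y\<bar> = pd v v'" by (simp add: pd_def x_def y_def cross_scale abs_mult divide_inverse)
  define s where "s = (if x \<bullet> y \<ge> 0 then 1 else - 1 :: real)"
  define a where "a = \<bar>x \<bullet> y\<bar>"
  have a: "0 \<le> a" "a \<le> 1" using Cauchy_Schwarz_ineq2[of x y] n by (auto simp: a_def)
  have "a\<^sup>2 + (pd v v')\<^sup>2 = 1" using lagrange2[of x y] n by (simp add: a_def p[symmetric])
  moreover have "a\<^sup>2 \<le> a" using a by (simp add: power2_eq_square mult_left_le)
  ultimately have "2 - 2 * a \<le> 4 * (pd v v')\<^sup>2" using zero_le_power2[of "pd v v'"] by linarith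
  moreover have "(norm (x - s *\<^sub>R y))\<^sup>2 = 2 - 2 * a"
  proof -
    have "(norm (x - s *\<^sub>R y))\<^sup>2 = (norm x)\<^sup>2 + s\<^sup>2 * (norm y)\<^sup>2 - 2 * (s * (x \<bullet> y))"
      unfolding power2_norm_eq_inner by (simp add: inner_diff_left inner_diff_right inner_commute power2_eq_square)
    then show ?thesis using n by (auto simp: s_def a_def)
  qed
  ultimately have "(norm (x - s *\<^sub>R y))\<^sup>2 \<le> (2 * pd v v')\<^sup>2" by (simp add: power_mult_distrib)
  then have "norm (x - s *\<^sub>R y) \<le> 2 * pd v v'" by (rule power2_le_imp_le) simp
  then show thesis using that[of s] by (auto simp: s_def x_def y_def)
qed

context cocycle
begin

abbreviation "lf \<equiv> \<lambda>i t v. ln (norm (B i t *v v) / norm v)"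
abbreviation "df \<equiv> \<lambda>i t (v::real^2). ln \<bar>det (B i t)\<bar>"

lemma B_equicont:
  assumes "e > 0"
  obtains d where "d > 0" "\<And>i t t'. i \<le> k \<Longrightarrow> \<bar>t - t'\<bar> < d \<Longrightarrow> norm (B i t - B i t') < e"
proof -
  have "\<exists>d>0. \<forall>t t'. \<bar>t - t'\<bar> < d \<longrightarrow> norm (B i t - B i t') < e" if i: "i \<le> k" for i
    using periodic_uniformly_continuous[OF B_cont[OF i] B_per[OF i] assms] unfolding dist_norm by metis
  then obtain dd where dd: "\<And>i. i \<le> k \<Longrightarrow> dd i > 0" "\<And>i t t'. i \<le> k \<Longrightarrow> \<bar>t - t'\<bar> < dd i \<Longrightarrow> norm (B i t - B i t') < e"
    by metis
  have "Min (dd ` {..k}) > 0" "\<And>i. i \<le> k \<Longrightarrow> Min (dd ` {..k}) \<le> dd i" using dd(1) by auto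
  then show thesis using that[of "Min (dd ` {..k})"] dd(2) by (meson order_less_le_trans)
qed

lemma B_scaled:
  assumes "i \<le> k" "v \<noteq> 0" "\<bar>s\<bar> = 1"
  shows "norm (B i t *v v) / norm v = norm (B i t *v (s *\<^sub>R (v /\<^sub>R norm v)))"
    and "1 / Lam \<le> norm (B i t *v v) / norm v" "norm (B i t *v v) / norm v \<le> Lam"
  using assms B_le[OF assms(1), of t v] B_ge[OF assms(1), of v t] Lam_ge_1
  by (simp_all add: matrix_vector_mult_scaleR field_simps)

lemma observable_ln: "observable k \<nu> B lf (ln Lam) (2 * Lam\<^sup>2)"
proof unfold_locales
  fix i t v assume i: "i \<le> k" and v: "v \<noteq> (0::real^2)"
  have "1 / Lam > 0" using Lam_ge_1 by simp
  moreover have "1 / Lam \<le> norm (B i t *v v) / norm v" "norm (B i t *v v) / norm v \<le> Lam"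
    using B_scaled(2,3)[OF i v, of 1 t] by simp_all
  ultimately have "ln (1 / Lam) \<le> lf i t v" "lf i t v \<le> ln Lam"
    by (meson ln_mono order_less_le_trans)+
  then show "\<bar>lf i t v\<bar> \<le> ln Lam" using Lam_ge_1 by (simp add: ln_div)
next
  fix i t and v :: "real^2" assume "i \<le> k"
  then show "lf i (t + 1) v = lf i t v" by (simp add: B_per)
next
  fix i t v v' assume i: "i \<le> k" and v: "v \<noteq> (0::real^2)" "v' \<noteq> (0::real^2)"
  obtain s where s: "\<bar>s\<bar> = 1" "norm (v /\<^sub>R norm v - s *\<^sub>R (v' /\<^sub>R norm v')) \<le> 2 * pd v v'"
    using unit_representatives[OF v] by blast
  define x y where "x = v /\<^sub>R norm v" and "y = s *\<^sub>R (v' /\<^sub>R norm v')"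
  have ex: "norm (B i t *v v) / norm v = norm (B i t *v x)" using B_scaled(1)[OF i v(1), of 1 t] by (simp add: x_def)
  have ey: "norm (B i t *v v') / norm v' = norm (B i t *v y)" using B_scaled(1)[OF i v(2) s(1), of t] by (simp add: y_def)
  have "\<bar>lf i t v - lf i t v'\<bar> \<le> \<bar>norm (B i t *v x) - norm (B i t *v y)\<bar> / (1 / Lam)"
    unfolding ex ey
    by (rule abs_ln_diff_le) (use Lam_ge_1 B_scaled(2)[OF i v(1), of 1 t] B_scaled(2)[OF i v(2) s(1), of t] ex ey in auto)
  also have "\<dots> \<le> norm (B i t *v x - B i t *v y) / (1 / Lam)"
    using norm_triangle_ineq3 Lam_ge_1 by (intro divide_right_mono) auto
  also have "\<dots> = Lam * norm (B i t *v (x - y))" by (simp add: matrix_vector_mult_diff_distrib)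
  also have "\<dots> \<le> Lam * (Lam * (2 * pd v v'))"
    using Lam_ge_1 s(2) by (intro mult_left_mono order_trans[OF B_le[OF i]]) (auto simp: x_def y_def)
  also have "\<dots> = 2 * Lam\<^sup>2 * pd v v'" by (simp add: power2_eq_square)
  finally show "\<bar>lf i t v - lf i t v'\<bar> \<le> 2 * Lam\<^sup>2 * pd v v'" .
next
  fix e :: real assume e: "e > 0"
  obtain d where d: "d > 0" "\<And>i t t'. i \<le> k \<Longrightarrow> \<bar>t - t'\<bar> < d \<Longrightarrow> norm (B i t - B i t') < e / Lam"
    using B_equicont[of "e / Lam"] e Lam_ge_1 by auto
  have "\<bar>lf i t v - lf i t' v\<bar> \<le> e" if i: "i \<le> k" and v: "v \<noteq> 0" and t: "\<bar>t - t'\<bar> < d" for i t t' v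
  proof -
    define x where "x = v /\<^sub>R norm v"
    have nx: "norm x = 1" using v by (simp add: x_def)
    have ex: "norm (B i t *v v) / norm v = norm (B i t *v x)" for t using B_scaled(1)[OF i v(1), of 1 t] by (simp add: x_def)
    have "\<bar>lf i t v - lf i t' v\<bar> \<le> \<bar>norm (B i t *v x) - norm (B i t' *v x)\<bar> / (1 / Lam)"
      unfolding ex by (rule abs_ln_diff_le) (use Lam_ge_1 B_scaled(2)[OF i v(1), of 1] ex in auto)
    also have "\<dots> \<le> norm (B i t *v x - B i t' *v x) / (1 / Lam)"
      using norm_triangle_ineq3 Lam_ge_1 by (intro divide_right_mono) auto
    also have "\<dots> = Lam * norm ((B i t - B i t') *v x)" by (simp add: matrix_vector_mult_diff_rdistrib)
    also have "\<dots> \<le> Lam * (e / Lam * 1)"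
    proof (rule mult_left_mono)
      have "norm ((B i t - B i t') *v x) \<le> norm (B i t - B i t') * norm x" by (rule mv_norm_le)
      also have "\<dots> \<le> e / Lam * 1" unfolding nx using d(2)[OF i t] by simp
      finally show "norm ((B i t - B i t') *v x) \<le> e / Lam * 1" .
    qed (use Lam_ge_1 in auto)
    also have "\<dots> = e" using Lam_ge_1 by simp
    finally show ?thesis .
  qed
  then show "\<exists>d>0. \<forall>i\<le>k. \<forall>t t' v. v \<noteq> 0 \<longrightarrow> \<bar>t - t'\<bar> < d \<longrightarrow> \<bar>lf i t v - lf i t' v\<bar> \<le> e"
    using d(1) by blast
next
  fix i assume i: "i \<le> k"
  have "continuous_on UNIV (\<lambda>p::real \<times> (real^2). B i (fst p) *v snd p)"
    unfolding matrix_vector_mult_def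
    by (intro continuous_intros continuous_on_vec_lambda continuous_on_compose2[OF B_cont[OF i]]) auto
  then have [measurable]: "(\<lambda>p::real \<times> (real^2). B i (fst p) *v snd p) \<in> borel \<rightarrow>\<^sub>M borel"
    by (rule borel_measurable_continuous_onI)
  have [measurable]: "(\<lambda>p::real \<times> (real^2). snd p) \<in> borel \<rightarrow>\<^sub>M borel"
    by (intro borel_measurable_continuous_onI continuous_intros)
  show "(\<lambda>p. lf i (fst p) (snd p)) \<in> borel_measurable borel" by measurable
qed (use Lam_ge_1 in auto)

lemma observable_det: "\<exists>F. observable k \<nu> B df F 0"
proof -
  have cont: "continuous_on UNIV (\<lambda>t. ln \<bar>det (B i t)\<bar>)" if "i \<le> k" for i
    unfolding det_2 using B_cont[OF that] B_det[OF that] by (intro continuous_intros) (auto simp: det_2)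
  have per: "ln \<bar>det (B i (t + 1))\<bar> = ln \<bar>det (B i t)\<bar>" if "i \<le> k" for i t using B_per[OF that] by simp
  have "\<exists>F. \<forall>t. \<bar>ln \<bar>det (B i t)\<bar>\<bar> \<le> F" if i: "i \<le> k" for i
    using periodic_bounded[OF cont[OF i] per[OF i]] unfolding bounded_iff by auto
  then obtain Fi where Fi: "\<And>i t. i \<le> k \<Longrightarrow> \<bar>ln \<bar>det (B i t)\<bar>\<bar> \<le> Fi i" by metis
  define F where "F = (\<Sum>i\<le>k. \<bar>Fi i\<bar>)"
  have F: "Fi i \<le> F" if "i \<le> k" for i
    using member_le_sum[of i "{..k}" "\<lambda>i. \<bar>Fi i\<bar>"] that unfolding F_def by simp
  have "observable k \<nu> B df F 0"
  proof unfold_locales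
    fix e :: real assume e: "e > 0"
    have "\<exists>d>0. \<forall>t t'. \<bar>t - t'\<bar> < d \<longrightarrow> dist (ln \<bar>det (B i t)\<bar>) (ln \<bar>det (B i t')\<bar>) < e" if i: "i \<le> k" for i
      using periodic_uniformly_continuous[OF cont[OF i] per[OF i] e] by metis
    then obtain dd where dd: "\<And>i. i \<le> k \<Longrightarrow> dd i > 0"
      "\<And>i t t'. i \<le> k \<Longrightarrow> \<bar>t - t'\<bar> < dd i \<Longrightarrow> dist (ln \<bar>det (B i t)\<bar>) (ln \<bar>det (B i t')\<bar>) < e"
      by metis
    have "Min (dd ` {..k}) > 0" "\<And>i. i \<le> k \<Longrightarrow> Min (dd ` {..k}) \<le> dd i" using dd(1) by auto
    then show "\<exists>d>0. \<forall>i\<le>k. \<forall>t t' v. (v::real^2) \<noteq> 0 \<longrightarrow> \<bar>t - t'\<bar> < d \<longrightarrow> \<bar>df i t v - df i t' v\<bar> \<le> e"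
      using dd(2) unfolding dist_real_def by (meson order_less_le_trans less_imp_le)
  next
    fix i assume i: "i \<le> k"
    show "(\<lambda>p. df i (fst p) (snd p)) \<in> borel_measurable borel"
      by (intro borel_measurable_continuous_onI continuous_on_compose2[OF cont[OF i]] continuous_intros) auto
  qed (use Fi F per in \<open>auto intro: order_trans\<close>)
  then show ?thesis by blast
qed

text \<open>\<open>l\<close> is the upper exponent and \<open>D\<close> the sum of both. The
  one-sided bounds for each single \<open>n\<close> are recorded along with the limits because
  continuity is proved at one fixed word length.\<close>

definition exps :: "real \<Rightarrow> real \<Rightarrow> bool" where
  "exps l D \<longleftrightarrow> (\<forall>n c. (\<forall>t v. v \<noteq> 0 \<longrightarrow> ES lf n t v \<le> c) \<longrightarrow> real n * l \<le> c) \<and>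
     (\<forall>n c. (\<forall>t v. v \<noteq> 0 \<longrightarrow> c \<le> ES lf n t v) \<longrightarrow> c \<le> real n * l) \<and>
     (\<forall>e>0. \<exists>n0. \<forall>n\<ge>n0. \<forall>t v. v \<noteq> 0 \<longrightarrow> \<bar>ES lf n t v - real n * l\<bar> \<le> real n * e) \<and>
     (\<forall>n c. (\<forall>t v. v \<noteq> 0 \<longrightarrow> ES df n t v \<le> c) \<longrightarrow> real n * D \<le> c) \<and>
     (\<forall>n c. (\<forall>t v. v \<noteq> 0 \<longrightarrow> c \<le> ES df n t v) \<longrightarrow> c \<le> real n * D) \<and>
     D < 2 * l \<and> oseledets_exponents \<theta> \<nu> B (l, D - l) \<and>
     (AE p in base_measure \<nu>. (\<lambda>n. ln (norm (iterate \<theta> B n p)) / real n) \<longlonglongrightarrow> l)"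

lemma expsD:
  assumes "exps l D"
  shows "(\<And>t v. v \<noteq> 0 \<Longrightarrow> ES lf n t v \<le> c) \<Longrightarrow> real n * l \<le> c"
    and "(\<And>t v. v \<noteq> 0 \<Longrightarrow> c \<le> ES lf n t v) \<Longrightarrow> c \<le> real n * l"
    and "e > 0 \<Longrightarrow> \<exists>n0. \<forall>n\<ge>n0. \<forall>t v. v \<noteq> 0 \<longrightarrow> \<bar>ES lf n t v - real n * l\<bar> \<le> real n * e"
    and "(\<And>t v. v \<noteq> 0 \<Longrightarrow> ES df n t v \<le> c) \<Longrightarrow> real n * D \<le> c"
    and "(\<And>t v. v \<noteq> 0 \<Longrightarrow> c \<le> ES df n t v) \<Longrightarrow> c \<le> real n * D"
    and "D < 2 * l" and "oseledets_exponents \<theta> \<nu> B (l, D - l)"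
    and "AE p in base_measure \<nu>. (\<lambda>n. ln (norm (iterate \<theta> B n p)) / real n) \<longlonglongrightarrow> l"
  using assms unfolding exps_def by blast+

text \<open>The existence of \<open>l\<close> and \<open>D\<close> is \<open>ES_limit\<close>. The
  gap \<open>D < 2 * l\<close> comes from \<open>ln x \<le> x - 1\<close>: if the mean of a power of
  the projective derivative is below 1, its mean logarithm is negative. With the gap, the almost
  sure rates along \<open>axis 1 1\<close> and of the determinant feed
  \<open>oseledets_line\<close>.\<close>

lemma contracting_exponents:
  assumes contr: "contracting k \<theta> \<nu> B" and a: "a \<in> set_pmf \<nu>" "\<theta> a \<notin> \<rat>"
  shows "\<exists>l D. exps l D"
proof -
  interpret L: contracting_observable k \<theta> \<nu> B lf "ln Lam" "2 * Lam\<^sup>2"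
    unfolding contracting_observable_def contracting_observable_axioms_def using observable_ln contr by blast
  obtain F where F: "observable k \<nu> B df F 0" using observable_det by blast
  interpret D: contracting_observable k \<theta> \<nu> B df F 0
    unfolding contracting_observable_def contracting_observable_axioms_def using F contr by blast
  obtain l where l: "\<And>n c. (\<And>t v. v \<noteq> 0 \<Longrightarrow> ES lf n t v \<le> c) \<Longrightarrow> real n * l \<le> c"
    "\<And>n c. (\<And>t v. v \<noteq> 0 \<Longrightarrow> c \<le> ES lf n t v) \<Longrightarrow> c \<le> real n * l"
    "\<And>e. e > 0 \<Longrightarrow> \<exists>n0. \<forall>n\<ge>n0. \<forall>t v. v \<noteq> 0 \<longrightarrow> \<bar>ES lf n t v - real n * l\<bar> \<le> real n * e"
    using L.ES_limit[OF a] by blast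
  obtain D where D: "\<And>n c. (\<And>t v. v \<noteq> 0 \<Longrightarrow> ES df n t v \<le> c) \<Longrightarrow> real n * D \<le> c"
    "\<And>n c. (\<And>t v. v \<noteq> 0 \<Longrightarrow> c \<le> ES df n t v) \<Longrightarrow> c \<le> real n * D"
    "\<And>e. e > 0 \<Longrightarrow> \<exists>n0. \<forall>n\<ge>n0. \<forall>t v. v \<noteq> 0 \<longrightarrow> \<bar>ES df n t v - real n * D\<bar> \<le> real n * e"
    using D.ES_limit[OF a] by blast
  \<comment> \<open>The logarithm of the projective derivative, as an additive observable.\<close>
  define gf where "gf i t v = df i t v + (-2) * lf i t v" for i t v
  have Sg: "S gf t v w = S df t v w + (-2) * S lf t v w" for t v w
    by (induction w arbitrary: t v) (simp_all add: gf_def algebra_simps)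
  have Eg: "ES gf n t v = ES df n t v + (-2) * ES lf n t v" for n t v
    unfolding Sg EW_add EW_cmult ..
  have gap: "D < 2 * l"
  proof -
    obtain m s \<kappa> where ms: "0 < s" "s \<le> 1" "\<kappa> < 1"
      and \<kappa>: "\<And>t v. v \<noteq> 0 \<Longrightarrow> E m (\<lambda>w. (\<bar>det (M t w)\<bar> * (norm v)\<^sup>2 / (norm (M t w *v v))\<^sup>2) powr s) \<le> \<kappa>"
      using contr unfolding contracting_def by blast
    have mean: "ES gf m t v \<le> - ((1 - \<kappa>) / s)" if v: "v \<noteq> 0" for t v
    proof -
      have "ES gf m t v \<le> E m (\<lambda>w. (1 / s) * ((\<bar>det (M t w)\<bar> * (norm v)\<^sup>2 / (norm (M t w *v v))\<^sup>2) powr s + (- 1)))"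
      proof (rule EW_mono)
        fix w assume w: "w \<in> words k m"
        have nz: "norm (M t w *v v) > 0" "\<bar>det (M t w)\<bar> > 0" using M_nz[OF w v] M_det[OF w] by auto
        define q where "q = \<bar>det (M t w)\<bar> * (norm v)\<^sup>2 / (norm (M t w *v v))\<^sup>2"
        have q: "q > 0" using nz v by (simp add: q_def)
        have "S gf t v w = ln q"
          unfolding Sg S_ln[OF w v] S_det[OF w] using nz v by (simp add: q_def ln_div ln_mult ln_realpow)
        then have "s * S gf t v w = ln (q powr s)" using q by (simp add: ln_powr)
        also have "\<dots> \<le> q powr s - 1" using q by (intro ln_le_minus_one) simp
        finally show "S gf t v w \<le> (1 / s) * (q powr s + (- 1))" using ms by (simp add: field_simps)
      qed
      also have "\<dots> \<le> (1 / s) * (\<kappa> + (- 1))"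
        unfolding EW_cmult EW_add using \<kappa>[OF v, of t] ms by (intro mult_left_mono add_mono) auto
      also have "\<dots> = - ((1 - \<kappa>) / s)" using ms by (simp add: field_simps)
      finally show ?thesis .
    qed
    define c where "c = (1 - \<kappa>) / s"
    have c: "c > 0" using ms by (simp add: c_def)
    have m: "m \<ge> 1"
    proof (rule ccontr)
      assume "\<not> m \<ge> 1"
      then have "m = 0" by simp
      then show False using mean[OF L.ex_vec, of 0] c by (simp add: c_def)
    qed
    \<comment> \<open>One error \<open>e\<close> per letter from \<open>df\<close> and two from
      \<open>lf\<close> together consume only half of the decrease \<open>c\<close> per block of
      \<open>m\<close> letters.\<close>
    define e where "e = c / (6 * m)"
    have e: "e > 0" using c m by (simp add: e_def)
    obtain n1 where n1: "\<And>n t v. n \<ge> n1 \<Longrightarrow> v \<noteq> 0 \<Longrightarrow> \<bar>ES lf n t v - real n * l\<bar> \<le> real n * e" using l(3)[OF e] by blast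
    obtain n2 where n2: "\<And>n t v. n \<ge> n2 \<Longrightarrow> v \<noteq> 0 \<Longrightarrow> \<bar>ES df n t v - real n * D\<bar> \<le> real n * e" using D(3)[OF e] by blast
    define j where "j = max (max n1 n2) 1"
    have j: "j \<ge> 1" "j * m \<ge> n1" "j * m \<ge> n2"
      using m mult_le_mono2[of 1 m j] by (auto simp: j_def)
    have "ES gf (j * m) 0 (axis 1 1) \<le> real j * (- c)"
      using ES_mult_le[OF mean L.ex_vec] by (simp add: c_def)
    then have "ES df (j * m) 0 (axis 1 1) - 2 * ES lf (j * m) 0 (axis 1 1) \<le> - (real j * c)" unfolding Eg by simp
    then have "real (j * m) * D - 2 * (real (j * m) * l) \<le> - (real j * c) + 3 * (real (j * m) * e)"
      using n1[OF j(2) L.ex_vec, of 0] n2[OF j(3) L.ex_vec, of 0] by linarith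
    also have "3 * (real (j * m) * e) = real j * c / 2" using m by (simp add: e_def)
    finally have "real (j * m) * (D - 2 * l) \<le> - (real j * c / 2)" by (simp add: algebra_simps)
    also have "\<dots> < 0" using j c by simp
    finally show ?thesis using j m by (simp add: mult_less_0_iff)
  qed
  have LA: "AE p in base_measure \<nu>. (\<lambda>n. S lf (snd p) (axis 1 1) (pre (fst p) n) / real n) \<longlonglongrightarrow> l"
    by (rule L.AE_rate[OF _ L.ex_vec]) (rule l(3))
  have DA: "AE p in base_measure \<nu>. (\<lambda>n. S df (snd p) (axis 1 1) (pre (fst p) n) / real n) \<longlonglongrightarrow> D"
    by (rule D.AE_rate[OF _ L.ex_vec]) (rule D(3))
  have "AE p in base_measure \<nu>.
      (\<exists>L. subspace L \<and> dim L = 1 \<and> (\<forall>v. v \<noteq> 0 \<longrightarrow>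
           (\<lambda>n. ln (norm (iterate \<theta> B n p *v v)) / real n) \<longlonglongrightarrow> (if v \<in> L then D - l else l)))
      \<and> (\<lambda>n. ln (norm (iterate \<theta> B n p)) / real n) \<longlonglongrightarrow> l"
    using AE_symbols LA DA
  proof eventually_elim
    case (elim p)
    obtain x t where p: "p = (x, t)" by (cases p)
    have x: "\<And>j. x j \<le> k" using elim(1) p by simp
    define P where "P n = M t (pre x n)" for n
    have it: "iterate \<theta> B n p = P n" for n using iterate_eq[OF x] by (simp add: p P_def)
    have w: "pre x n \<in> words k n" for n by (rule pre_words[OF x])
    have r1: "(\<lambda>n. ln (norm (P n *v axis 1 1)) / real n) \<longlonglongrightarrow> l"
      using elim(2) unfolding p fst_conv snd_conv S_ln[OF w L.ex_vec] by (simp add: P_def norm_axis_1)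
    have r2: "(\<lambda>n. ln \<bar>det (P n)\<bar> / real n) \<longlonglongrightarrow> D"
      using elim(3) unfolding p fst_conv snd_conv S_det[OF w] by (simp add: P_def)
    have PS: "P (Suc n) = B (x (int n)) (T t (pre x n)) ** P n" for n
      by (simp add: P_def pre_simps wmat_append)
    note o = oseledets_line[of P "\<lambda>n. B (x (int n)) (T t (pre x n))" Lam, OF _ PS B_le[OF x] _ r1 r2 gap]
    have "P 0 = mat 1" "\<And>n. det (P n) \<noteq> 0" using M_det[OF w] by (simp_all add: P_def pre_simps)
    from o[OF this] show ?case unfolding it by blast
  qed
  then have AE1: "AE p in base_measure \<nu>. \<exists>L. subspace L \<and> dim L = 1 \<and> (\<forall>v. v \<noteq> 0 \<longrightarrow>
           (\<lambda>n. ln (norm (iterate \<theta> B n p *v v)) / real n) \<longlonglongrightarrow> (if v \<in> L then D - l else l))"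
    and AE2: "AE p in base_measure \<nu>. (\<lambda>n. ln (norm (iterate \<theta> B n p)) / real n) \<longlonglongrightarrow> l"
    by auto
  have "oseledets_exponents \<theta> \<nu> B (l, D - l)"
    using AE1 gap unfolding oseledets_exponents_def by simp
  then have "exps l D"
    unfolding exps_def using l D(1,2) gap AE2 by (intro conjI allI impI) blast+
  then show ?thesis by blast
qed

subsection \<open>Stability under perturbations\<close>

lemma wmat_perturb:
  "\<exists>c\<ge>0. \<forall>\<delta> B'. 0 \<le> \<delta> \<longrightarrow> \<delta> \<le> 1 \<longrightarrow> (\<forall>i\<le>k. \<forall>t. norm (B' i t - B i t) \<le> \<delta>) \<longrightarrow>
     (\<forall>w\<in>words k n. \<forall>t v. norm (wmat \<theta> B' t w *v v - M t w *v v) \<le> c * \<delta> * norm v)"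
proof (induction n)
  case 0
  then show ?case by (intro exI[of _ 0]) auto
next
  case (Suc n)
  then obtain c where c: "c \<ge> 0" "\<And>\<delta> B' w t v. 0 \<le> \<delta> \<Longrightarrow> \<delta> \<le> 1 \<Longrightarrow> (\<forall>i\<le>k. \<forall>t. norm (B' i t - B i t) \<le> \<delta>) \<Longrightarrow>
     w \<in> words k n \<Longrightarrow> norm (wmat \<theta> B' t w *v v - M t w *v v) \<le> c * \<delta> * norm v" by metis
  have L: "0 \<le> Lam" using Lam_ge_1 by simp
  show ?case
  proof (rule exI[of _ "c * (Lam + 1) + Lam ^ n"], intro conjI allI impI ballI)
    show "0 \<le> c * (Lam + 1) + Lam ^ n" using c L by simp
    fix \<delta> B' w t and v :: "real^2"
    assume \<delta>: "0 \<le> \<delta>" "\<delta> \<le> 1" and B': "\<forall>i\<le>k. \<forall>t. norm (B' i t - B i t) \<le> \<delta>" and w: "w \<in> words k (Suc n)"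
    obtain i u where iu: "w = i # u" "i \<le> k" "u \<in> words k n" using w unfolding words_Suc by auto
    define x y where "x = B i t *v v" and "y = B' i t *v v"
    have yx: "norm (y - x) \<le> \<delta> * norm v"
    proof -
      have "norm ((B' i t - B i t) *v v) \<le> norm (B' i t - B i t) * norm v" by (rule mv_norm_le)
      also have "\<dots> \<le> \<delta> * norm v" using B' iu(2) by (intro mult_right_mono) auto
      finally show ?thesis by (simp add: x_def y_def matrix_vector_mult_diff_rdistrib)
    qed
    have x: "norm x \<le> Lam * norm v" unfolding x_def by (rule B_le[OF iu(2)])
    have y: "norm y \<le> (Lam + 1) * norm v"
    proof -
      have "norm y \<le> norm x + norm (y - x)" by (rule norm_triangle_sub)
      also have "\<dots> \<le> Lam * norm v + 1 * norm v" using x yx \<delta> mult_right_mono[of \<delta> 1 "norm v"] by simp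
      finally show ?thesis by (simp add: algebra_simps)
    qed
    let ?N = "wmat \<theta> B' (t + \<theta> i) u" and ?M = "M (t + \<theta> i) u"
    have "wmat \<theta> B' t w *v v - M t w *v v = (?N *v y - ?M *v y) + ?M *v (y - x)"
      by (simp add: iu x_def y_def matrix_vector_mul_assoc[symmetric] matrix_vector_mult_diff_distrib)
    then have "norm (wmat \<theta> B' t w *v v - M t w *v v) \<le> norm (?N *v y - ?M *v y) + norm (?M *v (y - x))"
      by (simp add: norm_triangle_ineq)
    also have "\<dots> \<le> c * \<delta> * ((Lam + 1) * norm v) + Lam ^ n * (\<delta> * norm v)"
    proof (rule add_mono)
      have "norm (?N *v y - ?M *v y) \<le> c * \<delta> * norm y" by (rule c(2)[OF \<delta> B' iu(3)])
      also have "\<dots> \<le> c * \<delta> * ((Lam + 1) * norm v)" using y c \<delta> by (intro mult_left_mono) auto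
      finally show "norm (?N *v y - ?M *v y) \<le> c * \<delta> * ((Lam + 1) * norm v)" .
      show "norm (?M *v (y - x)) \<le> Lam ^ n * (\<delta> * norm v)"
        using order_trans[OF M_bounds(1)[OF iu(3)] mult_left_mono[OF yx]] L by simp
    qed
    also have "\<dots> = (c * (Lam + 1) + Lam ^ n) * \<delta> * norm v" by (simp add: algebra_simps)
    finally show "norm (wmat \<theta> B' t w *v v - M t w *v v) \<le> (c * (Lam + 1) + Lam ^ n) * \<delta> * norm v" .
  qed
qed

text \<open>By \<open>M_bounds\<close> an error of \<open>c * \<delta> * norm v\<close> is a
  relative error of at most \<open>c * \<delta> * Lam ^ n\<close>, which makes the estimate of
  logarithms uniform in fibre and direction.\<close>

lemma ln_wmat_perturb:
  assumes SL: "\<And>i t. i \<le> k \<Longrightarrow> det (B i t) = 1" and \<eta>: "\<eta> > 0"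
  obtains \<delta> where "\<delta> > 0" "\<And>B' w t v. (\<And>i t. i \<le> k \<Longrightarrow> norm (B' i t - B i t) < \<delta>) \<Longrightarrow> w \<in> words k n \<Longrightarrow> v \<noteq> 0 \<Longrightarrow>
      det (wmat \<theta> B' t w) \<noteq> 0 \<and>
      \<bar>ln (norm (wmat \<theta> B' t w *v v) / norm v) - ln (norm (M t w *v v) / norm v)\<bar> \<le> \<eta> \<and> \<bar>ln \<bar>det (wmat \<theta> B' t w)\<bar>\<bar> \<le> \<eta>"
proof -
  obtain c where c: "c \<ge> 0" "\<And>\<delta> B' w t v. 0 \<le> \<delta> \<Longrightarrow> \<delta> \<le> 1 \<Longrightarrow> (\<forall>i\<le>k. \<forall>t. norm (B' i t - B i t) \<le> \<delta>) \<Longrightarrow>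
     w \<in> words k n \<Longrightarrow> norm (wmat \<theta> B' t w *v v - M t w *v v) \<le> c * \<delta> * norm v" using wmat_perturb by metis
  define Q where "Q = Lam ^ n"
  have Q: "Q \<ge> 1" using Lam_ge_1 by (simp add: Q_def)
  define r where "r = min (\<eta> / 2) (1 / 2)"
  have r: "r > 0" "r \<le> 1 / 2" "r \<le> \<eta> / 2" using \<eta> by (auto simp: r_def)
  \<comment> \<open>Ensures \<open>c * \<delta> * (3 * Q) \<le> r\<close>; the factor
    \<open>3 * Q\<close> is the cost of the determinant as a product of two perturbed columns, and
    it also covers the norms.\<close>
  define \<delta> where "\<delta> = min 1 (r / (3 * Q * (c + 1)))"
  have \<delta>0: "\<delta> > 0" "\<delta> \<le> 1" "\<delta> \<le> r / (3 * Q * (c + 1))" using r Q c(1) by (auto simp: \<delta>_def)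
  have "(c * \<delta>) * (3 * Q) \<le> ((c + 1) * \<delta>) * (3 * Q)" using Q \<delta>0 by (intro mult_right_mono) auto
  also have "\<dots> \<le> r"
  proof -
    have "3 * Q * (c + 1) > 0" using Q c(1) by simp
    then have "\<delta> * (3 * Q * (c + 1)) \<le> r" using \<delta>0(3) by (simp only: pos_le_divide_eq)
    then show ?thesis by (simp add: mult_ac)
  qed
  finally have cd: "c * \<delta> * (3 * Q) \<le> r" .
  have lnr: "\<bar>ln (1 + x)\<bar> \<le> \<eta>" if "\<bar>x\<bar> \<le> r" for x
    using abs_ln_diff_le[of "1/2" "1 + x" 1] that r by (auto simp: abs_le_iff)
  have SLw: "det (M t w) = 1" if "w \<in> words k m" for w t m
    using that
  proof (induction w arbitrary: m t)
    case (Cons i w)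
    then have "i \<le> k" "w \<in> words k (length w)" by (auto simp: words_def)
    then show ?case using Cons.IH SL by (simp add: det_mul)
  qed simp
  show thesis
  proof (rule that[OF \<delta>0(1)])
    fix B' w t and v :: "real^2"
    assume B': "\<And>i t. i \<le> k \<Longrightarrow> norm (B' i t - B i t) < \<delta>" and w: "w \<in> words k n" and v: "v \<noteq> 0"
    let ?N = "wmat \<theta> B' t w" and ?M = "M t w"
    have cl: "norm (?N *v x - ?M *v x) \<le> c * \<delta> * norm x" for x
      by (rule c(2)) (use \<delta>0 B' w in \<open>auto intro: less_imp_le\<close>)
    have nM: "norm (?M *v v) > 0" using M_nz[OF w v] by simp
    define y where "y = norm (?N *v v) / norm (?M *v v) - 1"
    have "\<bar>norm (?N *v v) - norm (?M *v v)\<bar> \<le> c * \<delta> * norm v" using cl[of v] norm_triangle_ineq3 order_trans by blast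
    also have "\<dots> \<le> c * \<delta> * (Q * norm (?M *v v))" using M_bounds(2)[OF w, of v t] c \<delta>0 by (intro mult_left_mono) (auto simp: Q_def)
    also have "\<dots> \<le> c * \<delta> * (3 * Q) * norm (?M *v v)" using c \<delta>0 Q by (simp add: mult_right_mono)
    also have "\<dots> \<le> r * norm (?M *v v)" using cd by (intro mult_right_mono) auto
    finally have "\<bar>y\<bar> \<le> r" using nM by (simp add: y_def field_simps abs_le_iff)
    then have 1: "\<bar>ln (1 + y)\<bar> \<le> \<eta>" "1 + y > 0" using lnr r by (auto simp: abs_le_iff)
    have nN: "norm (?N *v v) > 0" using 1(2) nM by (simp add: y_def zero_less_divide_iff)
    have "ln (norm (?N *v v) / norm v) - ln (norm (?M *v v) / norm v) = ln (1 + y)"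
      using nM nN v by (simp add: y_def ln_div)
    moreover have "\<bar>det ?N - 1\<bar> \<le> r"
    proof -
      define e1 e2 :: "real^2" where "e1 = axis 1 1" and "e2 = axis 2 1"
      have e: "norm e1 = 1" "norm e2 = 1" "cross e1 e2 = 1" by (simp_all add: e1_def e2_def norm_axis_1) (simp add: cross_def axis_def)
      have "det ?N - 1 = cross (?N *v e1) (?N *v e2) - cross (?M *v e1) (?M *v e2)"
        unfolding cross_mv using e SLw[OF w] by simp
      also have "\<dots> = cross (?N *v e1 - ?M *v e1) (?N *v e2) + cross (?M *v e1) (?N *v e2 - ?M *v e2)"
        by (simp add: cross_def algebra_simps)
      finally have "\<bar>det ?N - 1\<bar> \<le> \<bar>cross (?N *v e1 - ?M *v e1) (?N *v e2)\<bar> + \<bar>cross (?M *v e1) (?N *v e2 - ?M *v e2)\<bar>"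
        by simp
      also have "\<dots> \<le> (c * \<delta>) * (2 * Q) + Q * (c * \<delta>)"
      proof (rule add_mono; rule order_trans[OF abs_cross_le mult_mono])
        have "norm (?N *v e2) \<le> norm (?M *v e2) + norm (?N *v e2 - ?M *v e2)" by (rule norm_triangle_sub)
        moreover have "c * \<delta> \<le> Q"
        proof -
          have "c * \<delta> * 1 \<le> c * \<delta> * (3 * Q)" using c \<delta>0 Q by (intro mult_left_mono) auto
          then show ?thesis using cd r Q by linarith
        qed
        ultimately show "norm (?N *v e2) \<le> 2 * Q" using cl[of e2] M_bounds(1)[OF w, of t e2] e by (simp add: Q_def)
      qed (use cl[of e1] cl[of e2] M_bounds(1)[OF w, of t e1] e c \<delta>0 Q in \<open>auto simp: Q_def\<close>)
      also have "\<dots> = c * \<delta> * (3 * Q)" by simp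
      also have "\<dots> \<le> r" by (rule cd)
      finally show ?thesis .
    qed
    moreover from this have "det ?N > 0" using r by (simp add: abs_le_iff)
    moreover have "\<bar>ln (1 + (det ?N - 1))\<bar> \<le> \<eta>" using calculation(2) by (rule lnr)
    ultimately show "det ?N \<noteq> 0 \<and> \<bar>ln (norm (?N *v v) / norm v) - ln (norm (?M *v v) / norm v)\<bar> \<le> \<eta> \<and> \<bar>ln \<bar>det ?N\<bar>\<bar> \<le> \<eta>"
      using 1(1) by simp
  qed
qed

text \<open>Only words of the one length \<open>m\<close> enter the condition, and their
  determinants and norms vary continuously, uniformly in fibre and direction. The perturbed tuple
  may leave determinant one.\<close>

lemma contracting_stable:
  assumes SL: "\<And>i t. i \<le> k \<Longrightarrow> det (B i t) = 1" and contr: "contracting k \<theta> \<nu> B"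
  obtains \<delta> where "\<delta> > 0" "\<And>B'. (\<And>i t. i \<le> k \<Longrightarrow> norm (B' i t - B i t) < \<delta>) \<Longrightarrow> contracting k \<theta> \<nu> B'"
proof -
  obtain m s \<kappa>0 where ms: "0 < s" "s \<le> 1" "\<kappa>0 < 1"
    and \<kappa>0: "\<And>t v. v \<noteq> 0 \<Longrightarrow> E m (\<lambda>w. (\<bar>det (M t w)\<bar> * (norm v)\<^sup>2 / (norm (M t w *v v))\<^sup>2) powr s) \<le> \<kappa>0"
    using contr unfolding contracting_def by blast
  \<comment> \<open>The maximum with \<open>1 / 2\<close> makes \<open>ln \<kappa>\<close>
    meaningful.\<close>
  define \<kappa> where "\<kappa> = max \<kappa>0 (1 / 2)"
  have \<kappa>: "0 < \<kappa>" "\<kappa> < 1" "\<kappa>0 \<le> \<kappa>" using ms by (auto simp: \<kappa>_def)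
  \<comment> \<open>The logarithm of the quotient changes by at most \<open>4 * \<eta>\<close>, two
    from the determinants and two from the squared norms, and \<open>4 * \<eta>\<close> is less than
    \<open>- ln \<kappa>\<close>.\<close>
  define \<eta> where "\<eta> = - ln \<kappa> / 6"
  have \<eta>: "\<eta> > 0" using \<kappa> by (simp add: \<eta>_def)
  obtain \<delta> where \<delta>: "\<delta> > 0" "\<And>B' w t v. (\<And>i t. i \<le> k \<Longrightarrow> norm (B' i t - B i t) < \<delta>) \<Longrightarrow> w \<in> words k m \<Longrightarrow> v \<noteq> 0 \<Longrightarrow>
      det (wmat \<theta> B' t w) \<noteq> 0 \<and>
      \<bar>ln (norm (wmat \<theta> B' t w *v v) / norm v) - ln (norm (M t w *v v) / norm v)\<bar> \<le> \<eta> \<and> \<bar>ln \<bar>det (wmat \<theta> B' t w)\<bar>\<bar> \<le> \<eta>"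
    using ln_wmat_perturb[OF SL \<eta>, of m] by metis
  show thesis
  proof (rule that[OF \<delta>(1)])
    fix B' assume B': "\<And>i t. i \<le> k \<Longrightarrow> norm (B' i t - B i t) < \<delta>"
    have "EW k \<nu> m (\<lambda>w. (\<bar>det (wmat \<theta> B' t w)\<bar> * (norm v)\<^sup>2 / (norm (wmat \<theta> B' t w *v v))\<^sup>2) powr s) \<le> exp (4 * \<eta>) * \<kappa>"
      if v: "v \<noteq> 0" for t v
    proof -
      have "E m (\<lambda>w. (\<bar>det (wmat \<theta> B' t w)\<bar> * (norm v)\<^sup>2 / (norm (wmat \<theta> B' t w *v v))\<^sup>2) powr s)
        \<le> E m (\<lambda>w. exp (4 * \<eta>) * (\<bar>det (M t w)\<bar> * (norm v)\<^sup>2 / (norm (M t w *v v))\<^sup>2) powr s)"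
      proof (rule EW_mono)
        fix w assume w: "w \<in> words k m"
        let ?N = "wmat \<theta> B' t w"
        note d = \<delta>(2)[OF B' w v, of t]
        have dM: "\<bar>ln \<bar>det (M t w)\<bar>\<bar> \<le> \<eta>" using \<delta>(2)[of B, OF _ w v] \<delta>(1) by simp
        have nN: "norm (?N *v v) > 0" using det_nz_mv[of ?N v] d v by auto
        have nM: "norm (M t w *v v) > 0" "\<bar>det (M t w)\<bar> > 0" using M_nz[OF w v] M_det[OF w] by auto
        define x y where "x = \<bar>det ?N\<bar> * (norm v)\<^sup>2 / (norm (?N *v v))\<^sup>2" and "y = \<bar>det (M t w)\<bar> * (norm v)\<^sup>2 / (norm (M t w *v v))\<^sup>2"
        have x: "x > 0" "ln x = ln \<bar>det ?N\<bar> - 2 * ln (norm (?N *v v) / norm v)" using nN d v by (auto simp: x_def ln_div ln_mult ln_realpow)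
        have y: "y > 0" "ln y = ln \<bar>det (M t w)\<bar> - 2 * ln (norm (M t w *v v) / norm v)" using nM v by (auto simp: y_def ln_div ln_mult ln_realpow)
        have "ln x \<le> 4 * \<eta> + ln y" using x(2) y(2) d dM by (auto simp: abs_le_iff)
        then have "s * ln x \<le> 4 * \<eta> + s * ln y"
          using mult_left_mono[of "ln x" "4 * \<eta> + ln y" s] mult_right_mono[of s 1 "4 * \<eta>"] ms \<eta>
          unfolding distrib_left by linarith
        then have "exp (s * ln x) \<le> exp (4 * \<eta> + s * ln y)" by simp
        then show "x powr s \<le> exp (4 * \<eta>) * y powr s" using x(1) y(1) by (simp add: powr_def exp_add)
      qed
      also have "\<dots> \<le> exp (4 * \<eta>) * \<kappa>" unfolding EW_cmult using \<kappa>0[OF v, of t] \<kappa> by (intro mult_left_mono) auto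
      finally show ?thesis .
    qed
    moreover have "exp (4 * \<eta>) * \<kappa> < 1"
    proof -
      have "exp (4 * \<eta>) * \<kappa> = exp (4 * \<eta> + ln \<kappa>)" using \<kappa> by (simp add: exp_add)
      also have "\<dots> < exp 0" using \<kappa> unfolding exp_less_cancel_iff by (simp add: \<eta>_def)
      finally show ?thesis by simp
    qed
    ultimately show "contracting k \<theta> \<nu> B'" unfolding contracting_def using ms by blast
  qed
qed

text \<open>At a fixed length \<open>N\<close> the means of \<open>B\<close> are all within
  \<open>N * e / 2\<close> of \<open>N * l\<close>. Those of a nearby cocycle differ from them by at
  most \<open>e / 2\<close>, uniformly, and its own exponent lies between its own extremal means at
  length \<open>N\<close>. The same argument controls the determinant.\<close>

lemma lyapunov_exponents_continuous:
  assumes SL: "\<And>i t. i \<le> k \<Longrightarrow> det (B i t) = 1" and contr: "contracting k \<theta> \<nu> B"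
    and a: "a \<in> set_pmf \<nu>" "\<theta> a \<notin> \<rat>"
    and C: "\<And>n. cocycle k \<nu> (C n)"
    and conv: "\<And>\<delta>. \<delta> > 0 \<Longrightarrow> eventually (\<lambda>n. \<forall>i\<le>k. \<forall>t. norm (C n i t - B i t) < \<delta>) sequentially"
  shows "(\<lambda>n. lyapunov_exponents \<theta> \<nu> (C n)) \<longlonglongrightarrow> lyapunov_exponents \<theta> \<nu> B"
proof -
  obtain l D where lD: "exps l D" using contracting_exponents[OF contr a] by blast
  note l = expsD(3)[OF lD] and D = expsD(4,5)[OF lD] and ex = expsD(7)[OF lD]
  have ES_det: "ES df n t v = 0" for n t and v :: "real^2"
  proof -
    have "ES df n t v = E n (\<lambda>w. 0)"
    proof (rule EW_cong)
      fix w assume "w \<in> words k n"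
      then show "S df t v w = 0"
      proof (induction w arbitrary: n t v)
        case (Cons i w)
        then have "i \<le> k" "w \<in> words k (length w)" by (auto simp: words_def)
        then show ?case using Cons.IH SL by simp
      qed simp
    qed
    then show ?thesis by simp
  qed
  \<comment> \<open>The means of \<open>df\<close> vanish for determinant one, and the two one-sided
    bounds at \<open>n = 1\<close> pin down \<open>D\<close>.\<close>
  have D0: "D = 0" using D(1)[where n=1 and c=0] D(2)[where n=1 and c=0] unfolding ES_det by simp
  have lim: "eventually (\<lambda>n. \<exists>l' D'. lyapunov_exponents \<theta> \<nu> (C n) = (l', D' - l') \<and> \<bar>l' - l\<bar> \<le> e \<and> \<bar>D'\<bar> \<le> e) sequentially"
    if e: "e > 0" for e
  proof -
    have e2: "e / 2 > 0" using e by simp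
    obtain n0 where n0: "\<And>n t v. n \<ge> n0 \<Longrightarrow> v \<noteq> 0 \<Longrightarrow> \<bar>ES lf n t v - real n * l\<bar> \<le> real n * (e / 2)"
      using l[OF e2] by blast
    define N where "N = max n0 1"
    have N: "N \<ge> n0" "N \<ge> 1" by (auto simp: N_def)
    obtain d1 where d1: "d1 > 0" "\<And>B'. (\<And>i t. i \<le> k \<Longrightarrow> norm (B' i t - B i t) < d1) \<Longrightarrow> contracting k \<theta> \<nu> B'"
      using contracting_stable[OF SL contr] by metis
    obtain d2 where d2: "d2 > 0" "\<And>B' w t v. (\<And>i t. i \<le> k \<Longrightarrow> norm (B' i t - B i t) < d2) \<Longrightarrow> w \<in> words k N \<Longrightarrow> v \<noteq> 0 \<Longrightarrow>
      det (wmat \<theta> B' t w) \<noteq> 0 \<and>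
      \<bar>ln (norm (wmat \<theta> B' t w *v v) / norm v) - ln (norm (M t w *v v) / norm v)\<bar> \<le> e / 2 \<and> \<bar>ln \<bar>det (wmat \<theta> B' t w)\<bar>\<bar> \<le> e / 2"
      using ln_wmat_perturb[OF SL e2, of N] by metis
    have "eventually (\<lambda>n. \<forall>i\<le>k. \<forall>t. norm (C n i t - B i t) < min d1 d2) sequentially"
      by (rule conv) (use d1 d2 in auto)
    then show ?thesis
    proof eventually_elim
      case (elim n)
      interpret C: cocycle k \<theta> \<nu> "C n" by (rule C)
      have cn: "contracting k \<theta> \<nu> (C n)" by (rule d1(2)) (use elim in auto)
      obtain l' D' where lD': "C.exps l' D'" using C.contracting_exponents[OF cn a] by blast
      note l' = C.expsD(1,2)[OF lD'] and D' = C.expsD(4,5)[OF lD'] and ex' = C.expsD(7)[OF lD']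
      have d: "\<bar>C.S C.lf t v w - S lf t v w\<bar> \<le> e / 2" "\<bar>C.S C.df t v w\<bar> \<le> e / 2"
        if "w \<in> words k N" "v \<noteq> 0" for w t v
        using d2(2)[of "C n" w v t] elim that C.S_ln[OF that] C.S_det[OF that(1)] S_ln[OF that] by auto
      have dl: "\<bar>C.ES C.lf N t v - ES lf N t v\<bar> \<le> e / 2" if "v \<noteq> 0" for t v
        unfolding EW_diff[symmetric] by (rule E_abs_le) (use d that in auto)
      have dD: "\<bar>C.ES C.df N t v\<bar> \<le> e / 2" if "v \<noteq> 0" for t v
        by (rule E_abs_le) (use d that in auto)
      have Ne: "e / 2 \<le> real N * (e / 2)" using N(2) e by (simp add: mult_le_cancel_right1)
      have "real N * l' \<le> real N * l + real N * e"
      proof (rule l'(1))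
        fix t v assume v: "v \<noteq> (0::real^2)"
        show "C.ES C.lf N t v \<le> real N * l + real N * e"
          using n0[OF N(1) v, of t] dl[OF v, of t] Ne by linarith
      qed
      moreover have "real N * l - real N * e \<le> real N * l'"
      proof (rule l'(2))
        fix t v assume v: "v \<noteq> (0::real^2)"
        show "real N * l - real N * e \<le> C.ES C.lf N t v"
          using n0[OF N(1) v, of t] dl[OF v, of t] Ne by linarith
      qed
      ultimately have "real N * \<bar>l' - l\<bar> \<le> real N * e" unfolding abs_if by (simp add: algebra_simps)
      then have 1: "\<bar>l' - l\<bar> \<le> e" using N(2) by simp
      have dD': "\<bar>C.ES C.df N t v\<bar> \<le> real N * e" if "v \<noteq> 0" for t v
        using dD[OF that, of t] Ne e by linarith
      have "real N * D' \<le> real N * e" by (rule D'(1)) (use dD' in \<open>simp add: abs_le_iff\<close>)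
      moreover have "- (real N * e) \<le> real N * D'" by (rule D'(2)) (use dD' in \<open>simp add: abs_le_iff minus_le_iff\<close>)
      ultimately have "real N * \<bar>D'\<bar> \<le> real N * e" unfolding abs_if by simp
      then have 2: "\<bar>D'\<bar> \<le> e" using N(2) by simp
      show ?case using lyapunov_exponents_eq[OF ex'] 1 2 by blast
    qed
  qed
  have le: "lyapunov_exponents \<theta> \<nu> B = (l, - l)" using lyapunov_exponents_eq[OF ex] D0 by simp
  show ?thesis
  proof (rule tendstoI)
    fix e :: real assume e: "e > 0"
    then have e4: "e / 4 > 0" by simp
    show "eventually (\<lambda>n. dist (lyapunov_exponents \<theta> \<nu> (C n)) (lyapunov_exponents \<theta> \<nu> B) < e) sequentially"
      using lim[OF e4]
    proof eventually_elim
      case (elim n)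
      then obtain l' D' where l': "lyapunov_exponents \<theta> \<nu> (C n) = (l', D' - l')" "\<bar>l' - l\<bar> \<le> e / 4" "\<bar>D'\<bar> \<le> e / 4" by blast
      have "dist (l', D' - l') (l, - l) \<le> \<bar>l' - l\<bar> + \<bar>D' - l' + l\<bar>"
        unfolding dist_Pair_Pair dist_real_def
        by (rule order_trans[OF sqrt_sum_squares_le_sum_abs]) simp
      also have "\<dots> < e" using l'(2,3) e by (auto simp: abs_if split: if_splits)
      finally show ?case using l'(1) le by simp
    qed
  qed
qed

text \<open>For determinant one the exponents sum to at least 0, and the gap makes the upper one
  strictly larger than half of the sum.\<close>

lemma contracting_positive:
  assumes SL: "\<And>i t. i \<le> k \<Longrightarrow> det (B i t) = 1" and contr: "contracting k \<theta> \<nu> B"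
    and a: "a \<in> set_pmf \<nu>" "\<theta> a \<notin> \<rat>"
  shows "lyapunov_plus \<theta> \<nu> B > 0"
proof -
  obtain l D where lD: "exps l D" using contracting_exponents[OF contr a] by blast
  note D = expsD(4,5)[OF lD] and gap = expsD(6)[OF lD] and AE = expsD(8)[OF lD]
  have "0 \<le> real 1 * D"
  proof (rule D(2))
    fix t and v :: "real^2"
    show "0 \<le> ES df 1 t v" by (rule EW_nonneg) (auto simp: words_def length_Suc_conv SL)
  qed
  then show ?thesis using gap lyapunov_plus_eq[OF AE] by simp
qed

end

subsection \<open>The action on square-integrable functions\<close>

lemma distr_SL2:
  assumes "det (A::real^2^2) = 1"
  shows "distr lborel borel ((*v) A) = lborel"
proof (rule lborel_eqI[symmetric])
  have lin: "linear ((*v) (adj2 A))" by simp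
  have inv: "adj2 A *v (A *v x) = x" "A *v (adj2 A *v x) = x" for x
    using adj2_left[OF assms] adj2_right[OF assms] by (simp_all add: matrix_vector_mul_assoc)
  fix l u :: "real^2" assume lu: "\<And>b. b \<in> Basis \<Longrightarrow> l \<bullet> b \<le> u \<bullet> b"
  have pre: "(*v) A -` box l u = (*v) (adj2 A) ` box l u"
  proof (intro set_eqI iffI)
    fix x assume "x \<in> (*v) A -` box l u"
    then show "x \<in> (*v) (adj2 A) ` box l u" by (metis image_eqI inv(1) vimageD)
  next
    fix x assume "x \<in> (*v) (adj2 A) ` box l u"
    then show "x \<in> (*v) A -` box l u" by (auto simp: inv(2))
  qed
  have meas: "(*v) A \<in> borel \<rightarrow>\<^sub>M borel"
    by (intro borel_measurable_continuous_onI) (simp add: linear_continuous_on linear_linear)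
  have S: "(*v) (adj2 A) ` box l u \<in> lmeasurable"
    by (rule measurable_linear_image[OF lin]) simp
  have "emeasure (distr lborel borel ((*v) A)) (box l u) = emeasure lborel ((*v) (adj2 A) ` box l u)"
    using meas by (subst emeasure_distr) (auto simp: pre)
  also have "\<dots> = emeasure lebesgue ((*v) (adj2 A) ` box l u)"
    using measurable_sets[OF meas, of "box l u"] unfolding pre[symmetric] by (subst emeasure_completion) auto
  also have "\<dots> = ennreal (measure lebesgue ((*v) (adj2 A) ` box l u))"
    by (rule emeasure_eq_measure2[OF S])
  also have "measure lebesgue ((*v) (adj2 A) ` box l u) = measure lebesgue (box l u)"
    using measure_linear_image[OF lin, of "box l u"] assms by simp
  also have "ennreal (measure lebesgue (box l u)) = emeasure lborel (box l u)"
    using emeasure_eq_ennreal_measure[of lborel "box l u"] emeasure_lborel_box_finite[of l u] by simp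
  also have "\<dots> = (\<Prod>b\<in>Basis. (u - l) \<bullet> b)" using lu by (rule emeasure_lborel_box)
  finally show "emeasure (distr lborel borel ((*v) A)) (box l u) = (\<Prod>b\<in>Basis. (u - l) \<bullet> b)" .
qed simp

lemma mv_measurable [measurable]: "(*v) (A::real^2^2) \<in> borel \<rightarrow>\<^sub>M borel"
  by (intro borel_measurable_continuous_onI) (simp add: linear_continuous_on linear_linear)

lemma SL2_integral:
  fixes f :: "real^2 \<Rightarrow> real"
  assumes "det A = 1" and [measurable]: "f \<in> borel_measurable borel"
  shows "integrable lborel (\<lambda>x. f (A *v x)) \<longleftrightarrow> integrable lborel f"
    and "(\<integral>x. f (A *v x) \<partial>lborel) = (\<integral>x. f x \<partial>lborel)"
  using integrable_distr_eq[of "(*v) A" lborel borel f] integral_distr[of "(*v) A" lborel borel f]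
  by (simp_all add: distr_SL2[OF assms(1)])

section \<open>Square norms, almost invariance and ping-pong\<close>

definition L2 :: "(real^2 \<Rightarrow> real) \<Rightarrow> bool" where
  "L2 f \<longleftrightarrow> f \<in> borel_measurable borel \<and> integrable lborel (\<lambda>x. (f x)\<^sup>2)"

text \<open>The squared norm of a genuine function, without identification almost everywhere.
  Working with squares, \<open>(a + b)^2 \<le> 2 * a^2 + 2 * b^2\<close> replaces the triangle
  inequality, which is where the factors 2 below come from.\<close>

definition nsq :: "(real^2 \<Rightarrow> real) \<Rightarrow> real" where
  "nsq f = (\<integral>x. (f x)\<^sup>2 \<partial>lborel)"

lemma nsq_nonneg [simp]: "0 \<le> nsq f"
  unfolding nsq_def by (rule integral_nonneg_AE) simp

lemma L2_add: "L2 f \<Longrightarrow> L2 g \<Longrightarrow> L2 (\<lambda>x. f x + g x)"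
  and L2_cmult: "L2 f \<Longrightarrow> L2 (\<lambda>x. c * f x)"
  and L2_diff: "L2 f \<Longrightarrow> L2 g \<Longrightarrow> L2 (\<lambda>x. f x - g x)"
proof -
  have add: "L2 (\<lambda>x. f x + g x)" if "L2 f" "L2 g" for f g
    unfolding L2_def
  proof
    have [measurable]: "f \<in> borel_measurable borel" "g \<in> borel_measurable borel" using that by (auto simp: L2_def)
    show "(\<lambda>x. f x + g x) \<in> borel_measurable borel" by measurable
    show "integrable lborel (\<lambda>x. (f x + g x)\<^sup>2)"
    proof (rule Bochner_Integration.integrable_bound)
      show "integrable lborel (\<lambda>x. 2 * (f x)\<^sup>2 + 2 * (g x)\<^sup>2)" using that by (auto simp: L2_def)
      have "(a + b)\<^sup>2 \<le> 2 * a\<^sup>2 + 2 * b\<^sup>2" for a b :: real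
        using zero_le_power2[of "a - b"] by (simp add: power2_eq_square algebra_simps)
      then show "AE x in lborel. norm ((f x + g x)\<^sup>2) \<le> norm (2 * (f x)\<^sup>2 + 2 * (g x)\<^sup>2)"
        by (intro AE_I2) (auto intro: order_trans)
    qed measurable
  qed
  have mult: "L2 (\<lambda>x. c * f x)" if "L2 f" for c f
    using that by (auto simp: L2_def power_mult_distrib)
  show "L2 f \<Longrightarrow> L2 g \<Longrightarrow> L2 (\<lambda>x. f x + g x)" by (rule add)
  show "L2 f \<Longrightarrow> L2 (\<lambda>x. c * f x)" by (rule mult)
  show "L2 f \<Longrightarrow> L2 g \<Longrightarrow> L2 (\<lambda>x. f x - g x)" using add[OF _ mult[of g "-1"], of f] by simp
qed

lemma L2_comp: "det A = 1 \<Longrightarrow> L2 f \<Longrightarrow> L2 (\<lambda>x. f (A *v x))"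
  using SL2_integral(1)[of A "\<lambda>x. (f x)\<^sup>2"] by (auto simp: L2_def intro!: measurable_compose[OF mv_measurable])

lemma nsq_comp: "det A = 1 \<Longrightarrow> L2 f \<Longrightarrow> nsq (\<lambda>x. f (A *v x)) = nsq f"
  unfolding nsq_def using SL2_integral(2)[of A "\<lambda>x. (f x)\<^sup>2"] by (auto simp: L2_def)

lemma L2_sum: "finite I \<Longrightarrow> (\<And>i. i \<in> I \<Longrightarrow> L2 (f i)) \<Longrightarrow> L2 (\<lambda>x. \<Sum>i\<in>I. f i x)"
proof (induction I rule: finite_induct)
  case empty then show ?case by (simp add: L2_def)
next
  case (insert i I) then show ?case using L2_add[of "f i"] by simp
qed

lemma nsq_add_le: "L2 f \<Longrightarrow> L2 g \<Longrightarrow> nsq (\<lambda>x. f x + g x) \<le> 2 * nsq f + 2 * nsq g"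
proof -
  assume f: "L2 f" and g: "L2 g"
  have "(a + b)\<^sup>2 \<le> 2 * a\<^sup>2 + 2 * b\<^sup>2" for a b :: real
    using zero_le_power2[of "a - b"] by (simp add: power2_eq_square algebra_simps)
  then have "nsq (\<lambda>x. f x + g x) \<le> (\<integral>x. 2 * (f x)\<^sup>2 + 2 * (g x)\<^sup>2 \<partial>lborel)"
    unfolding nsq_def using f g L2_add[OF f g] by (intro integral_mono) (auto simp: L2_def)
  also have "\<dots> = 2 * nsq f + 2 * nsq g" unfolding nsq_def using f g by (simp add: L2_def)
  finally show ?thesis .
qed

definition disp :: "(real^2 \<Rightarrow> real) \<Rightarrow> real^2^2 \<Rightarrow> real" where
  "disp f A = nsq (\<lambda>x. f (A *v x) - f x)"

lemma disp_mult:
  assumes "L2 f" "det A = 1" "det B = 1"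
  shows "disp f (A ** B) \<le> 2 * disp f A + 2 * disp f B"
proof -
  have 1: "L2 (\<lambda>x. f (A *v x) - f x)" and 2: "L2 (\<lambda>x. f (B *v x) - f x)"
    using assms by (auto intro!: L2_diff L2_comp)
  have "disp f (A ** B) = nsq (\<lambda>x. (f (A *v (B *v x)) - f (B *v x)) + (f (B *v x) - f x))"
    by (simp add: disp_def matrix_vector_mul_assoc)
  also have "\<dots> \<le> 2 * nsq (\<lambda>x. f (A *v (B *v x)) - f (B *v x)) + 2 * nsq (\<lambda>x. f (B *v x) - f x)"
    using L2_comp[OF assms(3) 1] 2 by (rule nsq_add_le)
  also have "nsq (\<lambda>x. f (A *v (B *v x)) - f (B *v x)) = disp f A"
    unfolding disp_def by (rule nsq_comp[OF assms(3) 1])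
  finally show ?thesis by (simp add: disp_def)
qed

lemma disp_adj2:
  assumes "L2 f" "det A = 1"
  shows "disp f (adj2 A) = disp f A"
proof -
  have 1: "L2 (\<lambda>x. f (adj2 A *v x) - f x)" using assms by (auto intro!: L2_diff L2_comp)
  have "disp f (adj2 A) = nsq (\<lambda>x. f (adj2 A *v (A *v x)) - f (A *v x))"
    unfolding disp_def by (rule nsq_comp[OF assms(2) 1, symmetric])
  also have "\<dots> = disp f A"
    using adj2_left[OF assms(2)] by (simp add: disp_def matrix_vector_mul_assoc nsq_def power2_commute)
  finally show ?thesis .
qed

text \<open>A ping-pong certificate: the cones that \<open>g\<close>, \<open>h\<close> and their
  inverses expand by at most the factor \<open>m\<close> are pairwise disjoint. It is established
  with \<open>m = 2\<close> at one fibre, which leaves room for \<open>m = 1\<close> at neighbouring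
  fibres.\<close>

definition cert :: "real \<Rightarrow> real^2^2 \<Rightarrow> real^2^2 \<Rightarrow> bool" where
  "cert m g h \<longleftrightarrow> (\<forall>x. x \<noteq> 0 \<longrightarrow>
     (of_bool (norm (g *v x) \<le> m * norm x) + of_bool (norm (adj2 g *v x) \<le> m * norm x)
      + of_bool (norm (h *v x) \<le> m * norm x) + of_bool (norm (adj2 h *v x) \<le> m * norm x) :: real) \<le> 1)"

text \<open>If \<open>f\<close> is almost invariant under \<open>g\<close>, then almost all of the mass of \<open>f\<^sup>2\<close> lies in the two cones
  contracted by \<open>g\<close> and by \<open>g\<^sup>-\<^sup>1\<close>, because \<open>g\<close> maps the complement of the first into the second.\<close>

lemma cone_mass:
  assumes f: "L2 f" and g: "det g = 1"
  shows "3/4 * nsq f - 4 * disp f g \<le> (\<integral>x. (of_bool (norm (g *v x) \<le> norm x) + of_bool (norm (adj2 g *v x) \<le> norm x)) * (f x)\<^sup>2 \<partial>lborel)"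
proof -
  have [measurable]: "f \<in> borel_measurable borel" and fi: "integrable lborel (\<lambda>x. (f x)\<^sup>2)" using f by (auto simp: L2_def)
  define s where "s x = (of_bool (norm (g *v x) \<le> norm x) :: real)" for x
  \<comment> \<open>Strict, so that \<open>v\<close> after \<open>g\<close> is exactly the
    complement of \<open>s\<close>; \<open>u\<close> is the closed version that occurs in the
    claim.\<close>
  define v where "v x = (of_bool (norm (adj2 g *v x) < norm x) :: real)" for x
  define u where "u x = (of_bool (norm (adj2 g *v x) \<le> norm x) :: real)" for x
  have sm [measurable]: "s \<in> borel_measurable borel" unfolding s_def by measurable
  have vm [measurable]: "v \<in> borel_measurable borel" unfolding v_def by measurable
  have um [measurable]: "u \<in> borel_measurable borel" unfolding u_def by measurable
  have b: "0 \<le> s x" "s x \<le> 1" "0 \<le> v x" "v x \<le> u x" "v x \<le> 1" "0 \<le> u x" "u x \<le> 1" for x by (auto simp: s_def v_def u_def)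
  have int: "integrable lborel (\<lambda>x. h x * (f x)\<^sup>2)" if [measurable]: "h \<in> borel_measurable borel" and "\<And>x. \<bar>h x\<bar> \<le> 1" for h
    by (rule Bochner_Integration.integrable_bound[OF fi]) (use that in \<open>auto simp: abs_mult mult_left_le_one_le\<close>)
  have vg: "v (g *v x) = 1 - s x" for x
    using adj2_left[OF g] by (simp add: v_def s_def matrix_vector_mul_assoc)
  have fg: "integrable lborel (\<lambda>x. (f (g *v x))\<^sup>2)" using L2_comp[OF g f] by (simp add: L2_def)
  have d: "integrable lborel (\<lambda>x. (f (g *v x) - f x)\<^sup>2)" using L2_diff[OF L2_comp[OF g f] f] by (simp add: L2_def)
  have i1: "integrable lborel (\<lambda>x. v x * (f x)\<^sup>2)" using b by (intro int) (auto simp: abs_le_iff intro: order_trans)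
  have i2: "integrable lborel (\<lambda>x. v (g *v x) * (f (g *v x))\<^sup>2)"
    using SL2_integral(1)[OF g, of "\<lambda>x. v x * (f x)\<^sup>2"] i1 by simp
  have i3: "integrable lborel (\<lambda>x. s x * (f x)\<^sup>2)" using b by (intro int) (auto simp: abs_le_iff)
  have i4: "integrable lborel (\<lambda>x. u x * (f x)\<^sup>2)" using b by (intro int) (auto simp: abs_le_iff intro: order_trans)
  have "(\<integral>x. (f x)\<^sup>2 - s x * (f x)\<^sup>2 - 4 * (f (g *v x) - f x)\<^sup>2 - 1/8 * (f (g *v x))\<^sup>2 - 1/8 * (f x)\<^sup>2 \<partial>lborel)
     \<le> (\<integral>x. v (g *v x) * (f (g *v x))\<^sup>2 \<partial>lborel)"
  proof (rule integral_mono)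
    show "integrable lborel (\<lambda>x. (f x)\<^sup>2 - s x * (f x)\<^sup>2 - 4 * (f (g *v x) - f x)\<^sup>2 - 1/8 * (f (g *v x))\<^sup>2 - 1/8 * (f x)\<^sup>2)"
      using fi i3 d fg by auto
    show "integrable lborel (\<lambda>x. v (g *v x) * (f (g *v x))\<^sup>2)" by (rule i2)
    fix x
    define p q where "p = f (g *v x)" and "q = f x"
    \<comment> \<open>Young's inequality for \<open>(q - p) * (q + p)\<close>, weighted so that the
      terms without \<open>p - q\<close> integrate to only \<open>1/4 * nsq f\<close>.\<close>
    have "(2 * (p - q) + (p + q) / 4)\<^sup>2 = 4 * (p - q)\<^sup>2 + (p\<^sup>2 - q\<^sup>2) + 1/16 * (p + q)\<^sup>2"
      by (simp add: power2_eq_square field_simps)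
    then have "q\<^sup>2 - p\<^sup>2 \<le> 4 * (p - q)\<^sup>2 + 1/16 * (p + q)\<^sup>2"
      using zero_le_power2[of "2 * (p - q) + (p + q) / 4"] by linarith
    also have "\<dots> \<le> 4 * (p - q)\<^sup>2 + 1/8 * p\<^sup>2 + 1/8 * q\<^sup>2"
      using zero_le_power2[of "p - q"] by (simp add: power2_eq_square algebra_simps)
    finally have *: "q\<^sup>2 - p\<^sup>2 \<le> 4 * (p - q)\<^sup>2 + 1/8 * p\<^sup>2 + 1/8 * q\<^sup>2" .
    have "(1 - s x) * (q\<^sup>2 - p\<^sup>2) \<le> 4 * (p - q)\<^sup>2 + 1/8 * p\<^sup>2 + 1/8 * q\<^sup>2"
      using * by (cases "norm (g *v x) \<le> norm x") (auto simp: s_def)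
    then show "(f x)\<^sup>2 - s x * (f x)\<^sup>2 - 4 * (f (g *v x) - f x)\<^sup>2 - 1/8 * (f (g *v x))\<^sup>2 - 1/8 * (f x)\<^sup>2 \<le> v (g *v x) * (f (g *v x))\<^sup>2"
      unfolding vg p_def q_def by (simp add: algebra_simps)
  qed
  also have "(\<integral>x. v (g *v x) * (f (g *v x))\<^sup>2 \<partial>lborel) = (\<integral>x. v x * (f x)\<^sup>2 \<partial>lborel)"
    by (rule SL2_integral(2)[OF g]) measurable
  also have "\<dots> \<le> (\<integral>x. u x * (f x)\<^sup>2 \<partial>lborel)"
    using i1 i4 b by (intro integral_mono mult_right_mono) auto
  finally have le: "(\<integral>x. (f x)\<^sup>2 - s x * (f x)\<^sup>2 - 4 * (f (g *v x) - f x)\<^sup>2 - 1/8 * (f (g *v x))\<^sup>2 - 1/8 * (f x)\<^sup>2 \<partial>lborel)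
     \<le> (\<integral>x. u x * (f x)\<^sup>2 \<partial>lborel)" .
  have "(\<integral>x. (f x)\<^sup>2 - s x * (f x)\<^sup>2 - 4 * (f (g *v x) - f x)\<^sup>2 - 1/8 * (f (g *v x))\<^sup>2 - 1/8 * (f x)\<^sup>2 \<partial>lborel)
    = nsq f - (\<integral>x. s x * (f x)\<^sup>2 \<partial>lborel) - 4 * disp f g - 1/8 * nsq (\<lambda>x. f (g *v x)) - 1/8 * nsq f"
    unfolding nsq_def disp_def using fi i3 d fg by simp
  also have "nsq (\<lambda>x. f (g *v x)) = nsq f" by (rule nsq_comp[OF g f])
  finally have "3/4 * nsq f - 4 * disp f g \<le> (\<integral>x. s x * (f x)\<^sup>2 \<partial>lborel) + (\<integral>x. u x * (f x)\<^sup>2 \<partial>lborel)"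
    using le by simp
  also have "\<dots> = (\<integral>x. (s x + u x) * (f x)\<^sup>2 \<partial>lborel)" using i3 i4 by (simp add: distrib_right)
  finally show ?thesis by (simp add: s_def u_def)
qed

text \<open>Up to displacements, the cones of \<open>g\<close> and of \<open>h\<close> each carry
  3/4 of the mass of \<open>f\<close>. As the four cones are disjoint they carry at most the whole
  mass, so the excess of one half must be paid by the displacements.\<close>

lemma cert_gap:
  assumes f: "L2 f" and g: "det g = 1" "det h = 1" and c: "cert 1 g h"
  shows "nsq f \<le> 8 * (disp f g + disp f h)"
proof -
  have [measurable]: "f \<in> borel_measurable borel" and fi: "integrable lborel (\<lambda>x. (f x)\<^sup>2)" using f by (auto simp: L2_def)
  define c where "c g x = (of_bool (norm (g *v x) \<le> norm x) + of_bool (norm (adj2 g *v x) \<le> norm x) :: real)" for g and x :: "real^2"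
  have [measurable]: "c g \<in> borel_measurable borel" for g unfolding c_def by measurable
  have i: "integrable lborel (\<lambda>x. c g x * (f x)\<^sup>2)" for g
  proof (rule Bochner_Integration.integrable_bound[of _ "\<lambda>x. 2 * (f x)\<^sup>2"])
    show "AE x in lborel. norm (c g x * (f x)\<^sup>2) \<le> norm (2 * (f x)\<^sup>2)"
      by (intro AE_I2) (auto simp: c_def abs_mult intro!: mult_right_mono)
  qed (use fi in auto)
  have "3/2 * nsq f - 4 * (disp f g + disp f h) \<le> (\<integral>x. c g x * (f x)\<^sup>2 \<partial>lborel) + (\<integral>x. c h x * (f x)\<^sup>2 \<partial>lborel)"
    using cone_mass[OF f g(1)] cone_mass[OF f g(2)] unfolding c_def by simp
  also have "\<dots> = (\<integral>x. (c g x + c h x) * (f x)\<^sup>2 \<partial>lborel)" using i by (simp add: distrib_right)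
  also have "\<dots> \<le> nsq f"
    unfolding nsq_def
  proof (rule integral_mono_AE)
    \<comment> \<open>\<open>cert\<close> says nothing about the origin, where all four indicators
      are 1.\<close>
    have "AE x in lborel. x \<noteq> (0::real^2)"
      by (rule AE_I[of _ _ "{0}"]) auto
    then show "AE x in lborel. (c g x + c h x) * (f x)\<^sup>2 \<le> (f x)\<^sup>2"
    proof eventually_elim
      case (elim x)
      then have "c g x + c h x \<le> 1" using c by (simp add: cert_def c_def add_ac)
      then show ?case using mult_right_mono[of "c g x + c h x" 1 "(f x)\<^sup>2"] by simp
    qed
  qed (use i fi in \<open>simp_all add: distrib_right\<close>)
  finally show ?thesis by simp
qed

text \<open>On an eigenline a matrix of determinant one and its inverse act by reciprocal factors,
  so one of the two does not expand. A common eigenvector would lie in one cone of \<open>g\<close>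
  and in one of \<open>h\<close>.\<close>

lemma cert_no_common_line:
  assumes "cert 1 g h" "det g = 1" "det h = 1" "x \<noteq> 0"
  shows "cross (g *v x) x \<noteq> 0 \<or> cross (h *v x) x \<noteq> 0"
proof (rule ccontr)
  assume "\<not> ?thesis"
  then have z: "cross (g *v x) x = 0" "cross (h *v x) x = 0" by auto
  have one: "norm (g *v x) \<le> norm x \<or> norm (adj2 g *v x) \<le> norm x" if "cross (g *v x) x = 0" "det g = 1" for g
  proof -
    obtain y where y: "cross x y = 1"
    proof
      have "x$1 * x$1 + x$2 * x$2 \<noteq> 0" using assms(4) by (auto simp: vec_eq_iff forall_2 sum_power2_eq_zero_iff simp flip: power2_eq_square)
      then show "cross x (vector [- x$2 / (x$1 * x$1 + x$2 * x$2), x$1 / (x$1 * x$1 + x$2 * x$2)]) = 1"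
        by (simp add: cross_def add_divide_distrib[symmetric])
    qed
    have "g *v x = cross (g *v x) y *\<^sub>R x" using cross_decomp[of x y "g *v x"] y that(1) cross_swap[of "g *v x" x] by simp
    then obtain c where c: "g *v x = c *\<^sub>R x" by blast
    have x: "x = c *\<^sub>R (adj2 g *v x)"
      using adj2_left[OF that(2)] arg_cong[OF c, of "(*v) (adj2 g)"] by (simp add: matrix_vector_mul_assoc matrix_vector_mult_scaleR)
    have nx: "norm x = \<bar>c\<bar> * norm (adj2 g *v x)" using arg_cong[OF x, of norm] by simp
    show ?thesis
    proof (cases "\<bar>c\<bar> \<le> 1")
      case True
      then show ?thesis using c mult_right_mono[of "\<bar>c\<bar>" 1 "norm x"] by simp
    next
      case False
      then show ?thesis using nx mult_right_mono[of 1 "\<bar>c\<bar>" "norm (adj2 g *v x)"] by simp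
    qed
  qed
  have "(of_bool (norm (g *v x) \<le> 1 * norm x) + of_bool (norm (adj2 g *v x) \<le> 1 * norm x)
      + of_bool (norm (h *v x) \<le> 1 * norm x) + of_bool (norm (adj2 h *v x) \<le> 1 * norm x) :: real) \<le> 1"
    using assms(1,4) unfolding cert_def by blast
  then show False using one[OF z(1) assms(2)] one[OF z(2) assms(3)] by (auto simp: of_bool_def split: if_splits)
qed

subsection \<open>Non-degenerate cocycles are contracting\<close>

locale SL_cocycle = cocycle +
  assumes B_SL: "\<And>i t. i \<le> k \<Longrightarrow> det (B i t) = 1"
begin

lemma M_SL: "w \<in> words k n \<Longrightarrow> det (M t w) = 1"
proof (induction w arbitrary: n t)
  case (Cons i w)
  then have "i \<le> k" "w \<in> words k (length w)" by (auto simp: words_def)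
  then show ?case using Cons.IH B_SL by (simp add: det_mul)
qed simp

text \<open>The four words share their weight \<open>p\<close> and total rotation \<open>\<Theta>\<close>, so that their products can be compared
  over the same end point.\<close>

definition nondeg :: "nat \<Rightarrow> real \<Rightarrow> real \<Rightarrow> real \<Rightarrow> real \<Rightarrow> bool" where
  "nondeg len \<Theta> C \<xi> p \<longleftrightarrow> 0 < p \<and> 0 < C \<and> 0 < \<xi> \<and> (\<forall>s. \<exists>w :: nat \<Rightarrow> nat list.
     (\<forall>i\<le>3. w i \<in> words k len \<and> wt \<nu> (w i) = p \<and> sum_list (map \<theta> (w i)) = \<Theta>) \<and> inj_on w {..3} \<and>
     (\<forall>f. L2 f \<longrightarrow> nsq f \<le> C * (\<Sum>i\<in>{1..3}. nsq (\<lambda>x. f (M s (w i) *v x) - f (M s (w 0) *v x)))) \<and>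
     (\<forall>v. norm v = 1 \<longrightarrow> \<xi> \<le> (\<Sum>i\<in>{1..3}. (cross (M s (w i) *v v) (M s (w 0) *v v))\<^sup>2)))"

lemma nondegE:
  assumes "nondeg len \<Theta> C \<xi> p"
  shows "\<exists>w :: nat \<Rightarrow> nat list.
     (\<forall>i\<le>3. w i \<in> words k len) \<and> (\<forall>i\<le>3. wt \<nu> (w i) = p) \<and> (\<forall>i\<le>3. sum_list (map \<theta> (w i)) = \<Theta>) \<and> inj_on w {..3} \<and>
     (\<forall>f. L2 f \<longrightarrow> nsq f \<le> C * (\<Sum>i\<in>{1..3}. nsq (\<lambda>x. f (M s (w i) *v x) - f (M s (w 0) *v x)))) \<and>
     (\<forall>v. norm v = 1 \<longrightarrow> \<xi> \<le> (\<Sum>i\<in>{1..3}. (cross (M s (w i) *v v) (M s (w 0) *v v))\<^sup>2))"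
proof -
  obtain w :: "nat \<Rightarrow> nat list" where w: "(\<forall>i\<le>3. w i \<in> words k len \<and> wt \<nu> (w i) = p \<and> sum_list (map \<theta> (w i)) = \<Theta>) \<and> inj_on w {..3} \<and>
     (\<forall>f. L2 f \<longrightarrow> nsq f \<le> C * (\<Sum>i\<in>{1..3}. nsq (\<lambda>x. f (M s (w i) *v x) - f (M s (w 0) *v x)))) \<and>
     (\<forall>v. norm v = 1 \<longrightarrow> \<xi> \<le> (\<Sum>i\<in>{1..3}. (cross (M s (w i) *v v) (M s (w 0) *v v))\<^sup>2))"
    using assms[unfolded nondeg_def, THEN conjunct2, THEN conjunct2, THEN conjunct2, THEN spec[of _ s]] by (rule exE)
  then show ?thesis by (intro exI[of _ w]) simp
qed

text \<open>Along a nearly minimizing direction, all words with a common end point lead to nearly minimizing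
  directions over the same fibre; as two such directions cannot be close, the minimum is not very negative.\<close>

lemma ES_lower_bound:
  assumes nd: "nondeg len \<Theta> C \<xi> p"
  shows "\<exists>c. \<forall>n t v. v \<noteq> 0 \<longrightarrow> c \<le> ES lf n t v"
proof -
  interpret L: observable k \<theta> \<nu> B lf "ln Lam" "2 * Lam\<^sup>2" using observable_ln by (simp add: observable_def)
  define F where "F = ln Lam"
  have F0: "0 \<le> F" using Lam_ge_1 by (simp add: F_def)
  have bound: "\<bar>ES lf n t v\<bar> \<le> real n * F" if "v \<noteq> 0" for n t v using L.ES_bound[OF that] by (simp add: F_def)
  \<comment> \<open>If the mean excess over the minimum is at most
    \<open>1 + 2 * real len * F\<close>, the excess after a single word of weight \<open>p\<close>
    is at most \<open>K\<close>, because no word has negative excess.\<close>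
  define K where "K = (1 + 2 * real len * F) / p"
  \<comment> \<open>One of the three squared cross products is at least \<open>\<xi> / 3\<close>,
    and each image of a unit vector has norm at most \<open>Lam ^ len\<close>.\<close>
  define \<zeta> where "\<zeta> = sqrt (\<xi> / 3) / (Lam ^ len * Lam ^ len)"
  have p: "0 < p" and \<xi>: "0 < \<xi>" using nd by (auto simp: nondeg_def)
  have \<zeta>: "\<zeta> > 0" using \<xi> Lam_ge_1 by (simp add: \<zeta>_def)
  \<comment> \<open>Chosen against the final inequality
    \<open>ln \<zeta> \<le> 2 * a m + 2 * K\<close>; the 1 makes the contradiction strict.\<close>
  define c where "c = ln \<zeta> / 2 - K - 1"
  \<comment> \<open>For determinant one the norms of two images multiply to at least the area that
    the vectors span, so two directions at a definite angle cannot both shrink.\<close>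
  have pair: "ln (pd x y) \<le> ES lf m t x + ES lf m t y" if xy: "cross x y \<noteq> 0" for x y t m
  proof -
    have x: "x \<noteq> 0" and y: "y \<noteq> 0" using xy by (auto simp: cross_def)
    have "ln (pd x y) \<le> E m (\<lambda>u. S lf t x u + S lf t y u)"
    proof (rule E_ge)
      fix u assume u: "u \<in> words k m"
      have nx: "norm (M t u *v x) > 0" "norm (M t u *v y) > 0" using M_nz[OF u] x y by auto
      have "\<bar>cross x y\<bar> \<le> norm (M t u *v x) * norm (M t u *v y)"
        using abs_cross_le[of "M t u *v x" "M t u *v y"] by (simp add: cross_mv M_SL[OF u])
      then have "pd x y \<le> (norm (M t u *v x) / norm x) * (norm (M t u *v y) / norm y)"
        using x y by (simp add: pd_def field_simps)
      moreover have "0 < pd x y" using xy x y by (simp add: pd_def)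
      ultimately have "ln (pd x y) \<le> ln ((norm (M t u *v x) / norm x) * (norm (M t u *v y) / norm y))" by (intro ln_mono) auto
      also have "\<dots> = S lf t x u + S lf t y u"         unfolding S_ln[OF u x] S_ln[OF u y] using nx x y by (simp add: ln_mult ln_div)
      finally show "ln (pd x y) \<le> S lf t x u + S lf t y u" .
    qed
    then show ?thesis by (simp add: EW_add)
  qed
  have "c \<le> ES lf m t v" if v: "v \<noteq> 0" for m t v
  proof (rule ccontr)
    define R where "R n = {ES lf n t v | t v. v \<noteq> 0}" for n
    define a where "a n = Inf (R n)" for n
    have bdd: "bdd_below (R n)" for n
      by (rule bdd_belowI[of _ "- (real n * F)"]) (use bound in \<open>auto simp: R_def abs_le_iff minus_le_iff\<close>)
    have ne: "R n \<noteq> {}" for n unfolding R_def using v by blast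
    have a_le: "a n \<le> ES lf n t v" if "v \<noteq> 0" for n t v
      unfolding a_def by (rule cInf_lower[OF _ bdd]) (use that in \<open>auto simp: R_def\<close>)
    assume "\<not> c \<le> ES lf m t v"
    then have am: "a m < c" using a_le[OF v, of m t] by linarith
    have step: "a (m + len) \<le> a m + real len * F"
    proof -
      have "a (m + len) - real len * F \<le> x" if "x \<in> R m" for x
      proof -
        obtain t v where tv: "v \<noteq> 0" "x = ES lf m t v" using \<open>x \<in> R m\<close> by (auto simp: R_def)
        have "E m (\<lambda>u. ES lf len (T t u) (M t u *v v)) \<le> real len * F"
          by (rule E_le) (use bound M_nz tv in \<open>auto simp: abs_le_iff\<close>)
        then have "ES lf (m + len) t v \<le> x + real len * F" using tv by (simp add: ES_add)
        then show ?thesis using a_le[OF tv(1), of "m + len" t] by linarith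
      qed
      then have "a (m + len) - real len * F \<le> a m" unfolding a_def[of m] using ne by (intro cInf_greatest)
      then show ?thesis by simp
    qed
    obtain x where x: "x \<in> R (m + len)" "x < a (m + len) + 1"
      using cInf_lessD[OF ne, of "m + len" "a (m + len) + 1"] by (auto simp: a_def)
    obtain s v0 where v0: "v0 \<noteq> 0" "x = ES lf (m + len) s v0" using x(1) by (auto simp: R_def)
    define v1 where "v1 = v0 /\<^sub>R norm v0"
    obtain w :: "nat \<Rightarrow> nat list" where w: "\<And>i. i \<le> 3 \<Longrightarrow> w i \<in> words k len" "\<And>i. i \<le> 3 \<Longrightarrow> wt \<nu> (w i) = p"
      "\<And>i. i \<le> 3 \<Longrightarrow> sum_list (map \<theta> (w i)) = \<Theta>"
      and cr: "\<And>v. norm v = 1 \<Longrightarrow> \<xi> \<le> (\<Sum>i\<in>{1..3}. (cross (M s (w i) *v v) (M s (w 0) *v v))\<^sup>2)"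
      using nondegE[OF nd, of s] by blast
    have near: "ES lf m (s + \<Theta>) (M s (w i) *v v0) \<le> a m + K" if i: "i \<le> 3" for i
    proof -
      have nn: "0 \<le> ES lf m (T s u) (M s u *v v0) - a m" if "u \<in> words k len" for u
        using a_le[OF M_nz[OF that v0(1)]] by simp
      have "wt \<nu> (w i) * (ES lf m (T s (w i)) (M s (w i) *v v0) - a m) \<le> E len (\<lambda>u. ES lf m (T s u) (M s u *v v0) - a m)"
        by (rule wt_le_EW[where F="\<lambda>u. ES lf m (T s u) (M s u *v v0) - a m"]) (use nn w(1)[OF i] in auto)
      also have "\<dots> = ES lf (len + m) s v0 - ES lf len s v0 - a m" by (simp add: EW_diff ES_add)
      also have "\<dots> \<le> 1 + 2 * real len * F"
        using x(2) v0(2) bound[OF v0(1), of len s] step by (simp add: add.commute abs_le_iff)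
      finally have "p * (ES lf m (s + \<Theta>) (M s (w i) *v v0) - a m) \<le> 1 + 2 * real len * F"
        using w(2,3)[OF i] by (simp add: wend_def)
      then show ?thesis using p by (simp add: K_def field_simps)
    qed
    have "norm v1 = 1" using v0 by (simp add: v1_def)
    have "\<exists>i\<in>{1..3}. \<xi> / 3 \<le> (cross (M s (w i) *v v1) (M s (w 0) *v v1))\<^sup>2"
    proof (rule ccontr)
      assume "\<not> ?thesis"
      then have "\<And>i. i \<in> {1..3} \<Longrightarrow> (cross (M s (w i) *v v1) (M s (w 0) *v v1))\<^sup>2 < \<xi> / 3"
        by (meson not_le)
      then have "(\<Sum>i\<in>{1..3}. (cross (M s (w i) *v v1) (M s (w 0) *v v1))\<^sup>2) < (\<Sum>i\<in>{1..3::nat}. \<xi> / 3)"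
        by (intro sum_strict_mono) auto
      then show False using cr[OF \<open>norm v1 = 1\<close>] by simp
    qed
    then obtain i where i: "1 \<le> i" "i \<le> 3" "\<xi> / 3 \<le> (cross (M s (w i) *v v1) (M s (w 0) *v v1))\<^sup>2" by auto
    define y z where "y = M s (w i) *v v0" and "z = M s (w 0) *v v0"
    have cyz: "cross y z = (norm v0)\<^sup>2 * cross (M s (w i) *v v1) (M s (w 0) *v v1)"
      using v0 by (simp add: y_def z_def v1_def matrix_vector_mult_scaleR cross_scale power2_eq_square field_simps)
    have "sqrt (\<xi> / 3) \<le> \<bar>cross (M s (w i) *v v1) (M s (w 0) *v v1)\<bar>"
      using real_sqrt_le_mono[OF i(3)] by simp
    then have cge: "(norm v0)\<^sup>2 * sqrt (\<xi> / 3) \<le> \<bar>cross y z\<bar>" unfolding cyz abs_mult by (simp add: mult_left_mono)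
    then have cpos: "\<bar>cross y z\<bar> > 0" using \<xi> v0 by (smt (verit) divide_pos_pos mult_pos_pos real_sqrt_gt_zero zero_less_norm_iff zero_less_power)
    have nyz: "norm y \<le> Lam ^ len * norm v0" "norm z \<le> Lam ^ len * norm v0" "y \<noteq> 0" "z \<noteq> 0"
      using M_bounds(1)[OF w(1)] M_nz[OF w(1) v0(1)] i by (auto simp: y_def z_def)
    have "\<zeta> \<le> pd y z"
    proof -
      have "\<zeta> = ((norm v0)\<^sup>2 * sqrt (\<xi> / 3)) / ((Lam ^ len * norm v0) * (Lam ^ len * norm v0))"
        using v0 by (simp add: \<zeta>_def power2_eq_square)
      also have "\<dots> \<le> \<bar>cross y z\<bar> / (norm y * norm z)"
        using cge nyz \<xi> Lam_ge_1 by (intro frac_le mult_mono) auto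
      finally show ?thesis by (simp add: pd_def)
    qed
    then have "ln \<zeta> \<le> ln (pd y z)" using \<zeta> by (intro ln_mono) auto
    also have "\<dots> \<le> ES lf m (s + \<Theta>) y + ES lf m (s + \<Theta>) z" using cpos by (intro pair) auto
    also have "\<dots> \<le> 2 * a m + 2 * K" using near[OF i(2)] near[of 0] by (simp add: y_def z_def)
    finally show False using am by (simp add: c_def)
  qed
  then show ?thesis by blast
qed

text \<open>The square of a mean is the mean of the squares minus the variance. The variance
  contains the differences between the four distinguished words, which end over the common fibre
  \<open>s + \<Theta>\<close>, and there the assumed gap bounds them from below. Summing over start
  fibres loses nothing, as a fixed word translates fibres injectively.\<close>

lemma gap_step:
  assumes nd: "nondeg len \<Theta> C \<xi> p" and fin: "finite Q" "finite Q'"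
    and Q': "\<And>s u. s \<in> Q \<Longrightarrow> u \<in> words k len \<Longrightarrow> T s u \<in> Q'" and G: "\<And>s. L2 (G s)"
  defines "c \<equiv> min p (p / (6 * C))"
  shows "(\<Sum>s\<in>Q. nsq (\<lambda>x. E len (\<lambda>u. G (T s u) (M s u *v x)))) \<le> (1 - c) * (\<Sum>s\<in>Q'. nsq (G s))"
proof -
  have p: "0 < p" and C: "0 < C" using nd by (auto simp: nondeg_def)
  have L2X: "L2 (\<lambda>x. G (T s u) (M s u *v x))" if "u \<in> words k len" for s u
    by (rule L2_comp[OF M_SL[OF that] G])
  have one: "nsq (\<lambda>x. E len (\<lambda>u. G (T s u) (M s u *v x))) \<le> E len (\<lambda>u. nsq (G (T s u))) - p / (6 * C) * nsq (G (s + \<Theta>))" for s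
  proof -
    obtain w :: "nat \<Rightarrow> nat list" where w: "\<And>i. i \<le> 3 \<Longrightarrow> w i \<in> words k len" "\<And>i. i \<le> 3 \<Longrightarrow> wt \<nu> (w i) = p"
      "\<And>i. i \<le> 3 \<Longrightarrow> sum_list (map \<theta> (w i)) = \<Theta>" "inj_on w {..3}"
      and gp: "\<And>f. L2 f \<Longrightarrow> nsq f \<le> C * (\<Sum>i\<in>{1..3}. nsq (\<lambda>x. f (M s (w i) *v x) - f (M s (w 0) *v x)))"
      using nondegE[OF nd, of s] by blast
    define X where "X u x = G (T s u) (M s u *v x)" for u x
    have LX: "L2 (X u)" if "u \<in> words k len" for u using L2X[OF that] by (simp add: X_def[abs_def])
    have pw: "(E len (\<lambda>u. X u x))\<^sup>2 \<le> E len (\<lambda>u. (X u x)\<^sup>2) - p / 6 * (\<Sum>i\<in>{1..3}. (X (w i) x - X (w 0) x)\<^sup>2)" for x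
    proof -
      define m where "m = E len (\<lambda>u. X u x)"
      have var: "E len (\<lambda>u. (X u x - m)\<^sup>2) = E len (\<lambda>u. (X u x)\<^sup>2) - m\<^sup>2"
      proof -
        have "E len (\<lambda>u. (X u x - m)\<^sup>2) = E len (\<lambda>u. ((X u x)\<^sup>2 - (2 * m) * X u x) + m\<^sup>2)"
          by (rule EW_cong) (simp add: power2_eq_square algebra_simps)
        also have "\<dots> = E len (\<lambda>u. (X u x)\<^sup>2) - (2 * m) * m + m\<^sup>2"
          unfolding EW_add EW_diff EW_cmult by (simp add: m_def)
        finally show ?thesis by (simp add: power2_eq_square)
      qed
      define d where "d i = (X (w i) x - m)\<^sup>2" for i
      have "p * (\<Sum>i\<le>3. d i) = (\<Sum>u\<in>w ` {..3}. wt \<nu> u * (X u x - m)\<^sup>2)"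
        using w by (simp add: sum.reindex sum_distrib_left d_def)
      also have "\<dots> \<le> E len (\<lambda>u. (X u x - m)\<^sup>2)"
        unfolding EW_def using w(1) by (intro sum_mono2) auto
      finally have 1: "p * (\<Sum>i\<le>3. d i) \<le> E len (\<lambda>u. (X u x)\<^sup>2) - m\<^sup>2" using var by simp
      have sq: "(a - b)\<^sup>2 \<le> 2 * (a - m)\<^sup>2 + 2 * (b - m)\<^sup>2" for a b :: real
        using zero_le_power2[of "(a - m) + (b - m)"] by (simp add: power2_eq_square algebra_simps)
      \<comment> \<open>Each difference costs \<open>2 * d i + 2 * d 0\<close>, so
        \<open>d 0\<close> is counted six times; this is the 6 in \<open>c\<close>.\<close>
      have "(\<Sum>i\<in>{1..3}. (X (w i) x - X (w 0) x)\<^sup>2) \<le> (\<Sum>i\<in>{1..3}. 2 * d i + 2 * d 0)"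
        unfolding d_def by (intro sum_mono sq)
      also have "\<dots> \<le> 6 * (\<Sum>i\<le>3. d i)"
        by (simp add: numeral_3_eq_3 d_def sum.atLeast_Suc_atMost)
      finally have "p / 6 * (\<Sum>i\<in>{1..3}. (X (w i) x - X (w 0) x)\<^sup>2) \<le> p / 6 * (6 * (\<Sum>i\<le>3. d i))"
        using p by (intro mult_left_mono) auto
      then show ?thesis using 1 by (simp add: m_def)
    qed
    have i1: "integrable lborel (\<lambda>x. (X u x)\<^sup>2)" if "u \<in> words k len" for u using LX[OF that] by (simp add: L2_def)
    have i2: "integrable lborel (\<lambda>x. (X (w i) x - X (w 0) x)\<^sup>2)" if "i \<le> 3" for i
      using L2_diff[OF LX[OF w(1)[OF that]] LX[OF w(1)[of 0]]] by (simp add: L2_def)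
    have LE: "L2 (\<lambda>x. E len (\<lambda>u. X u x))"
      unfolding EW_def by (intro L2_sum L2_cmult LX) auto
    have i4: "integrable lborel (\<lambda>x. E len (\<lambda>u. (X u x)\<^sup>2))" unfolding EW_def using i1 by simp
    have i5: "integrable lborel (\<lambda>x. \<Sum>i\<in>{1..3}. (X (w i) x - X (w 0) x)\<^sup>2)" using i2 by (intro Bochner_Integration.integrable_sum) auto
    have "nsq (\<lambda>x. E len (\<lambda>u. X u x)) \<le> (\<integral>x. E len (\<lambda>u. (X u x)\<^sup>2) - p / 6 * (\<Sum>i\<in>{1..3}. (X (w i) x - X (w 0) x)\<^sup>2) \<partial>lborel)"
      unfolding nsq_def using pw LE i4 i5 by (intro integral_mono) (auto simp: L2_def)
    also have "\<dots> = (\<integral>x. E len (\<lambda>u. (X u x)\<^sup>2) \<partial>lborel) - p / 6 * (\<integral>x. (\<Sum>i\<in>{1..3}. (X (w i) x - X (w 0) x)\<^sup>2) \<partial>lborel)"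
      using i4 i5 by simp
    also have "(\<integral>x. E len (\<lambda>u. (X u x)\<^sup>2) \<partial>lborel) = E len (\<lambda>u. nsq (X u))"
      unfolding EW_def nsq_def using i1 by (simp add: Bochner_Integration.integral_sum)
    also have "\<dots> = E len (\<lambda>u. nsq (G (T s u)))"
      by (rule EW_cong) (simp add: X_def[abs_def] nsq_comp[OF M_SL G])
    also have "(\<integral>x. (\<Sum>i\<in>{1..3}. (X (w i) x - X (w 0) x)\<^sup>2) \<partial>lborel) = (\<Sum>i\<in>{1..3}. nsq (\<lambda>x. X (w i) x - X (w 0) x))"
      unfolding nsq_def using i2 by (intro Bochner_Integration.integral_sum) auto
    also have "\<dots> = (\<Sum>i\<in>{1..3}. nsq (\<lambda>x. G (s + \<Theta>) (M s (w i) *v x) - G (s + \<Theta>) (M s (w 0) *v x)))"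
      using w(3) by (intro sum.cong) (auto simp: X_def wend_def)
    finally have "nsq (\<lambda>x. E len (\<lambda>u. X u x)) \<le> E len (\<lambda>u. nsq (G (T s u)))
       - p / 6 * (\<Sum>i\<in>{1..3}. nsq (\<lambda>x. G (s + \<Theta>) (M s (w i) *v x) - G (s + \<Theta>) (M s (w 0) *v x)))" .
    moreover have "p / 6 * (nsq (G (s + \<Theta>)) / C) \<le> p / 6 * (\<Sum>i\<in>{1..3}. nsq (\<lambda>x. G (s + \<Theta>) (M s (w i) *v x) - G (s + \<Theta>) (M s (w 0) *v x)))"
      using gp[OF G, of "s + \<Theta>"] p C by (intro mult_left_mono) (auto simp: field_simps)
    ultimately show ?thesis by (simp add: X_def)
  qed
  obtain w0 where w0: "w0 \<in> words k len" "wt \<nu> w0 = p" "sum_list (map \<theta> w0) = \<Theta>"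
    using nondegE[OF nd, of 0] by blast
  \<comment> \<open>Of the total mass \<open>V\<close>, the part \<open>A\<close> lies over end
    fibres of the distinguished words and loses the proportion \<open>p / (6 * C)\<close> by the
    gap. The rest is missed by the word \<open>w0\<close> of weight \<open>p\<close>. Either way the
    proportion \<open>c\<close> is lost.\<close>
  define V where "V = (\<Sum>s\<in>Q'. nsq (G s))"
  define A where "A = (\<Sum>s\<in>Q. nsq (G (s + \<Theta>)))"
  have part: "(\<Sum>s\<in>Q. nsq (G (T s u))) \<le> V" if u: "u \<in> words k len" for u
  proof -
    have "(\<Sum>s\<in>Q. nsq (G (T s u))) = (\<Sum>s\<in>(\<lambda>s. T s u) ` Q. nsq (G s))"
      by (subst sum.reindex) (auto simp: inj_on_def wend_def)
    also have "\<dots> \<le> V" unfolding V_def using Q' u fin by (intro sum_mono2) auto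
    finally show ?thesis .
  qed
  have AV: "A \<le> V" using part[OF w0(1)] w0(3) by (simp add: A_def wend_def)
  have V0: "0 \<le> V" "0 \<le> A" unfolding V_def A_def by (auto intro: sum_nonneg)
  have "(\<Sum>s\<in>Q. E len (\<lambda>u. nsq (G (T s u)))) = (\<Sum>u\<in>words k len. wt \<nu> u * (\<Sum>s\<in>Q. nsq (G (T s u))))"
    unfolding EW_def by (subst sum.swap) (simp add: sum_distrib_left)
  also have "\<dots> = wt \<nu> w0 * A + (\<Sum>u\<in>words k len - {w0}. wt \<nu> u * (\<Sum>s\<in>Q. nsq (G (T s u))))"
    using w0 by (subst sum.remove[of _ w0]) (auto simp: A_def wend_def)
  also have "\<dots> \<le> p * A + (\<Sum>u\<in>words k len - {w0}. wt \<nu> u * V)"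
    using part w0 by (intro add_mono sum_mono mult_left_mono) auto
  also have "(\<Sum>u\<in>words k len - {w0}. wt \<nu> u * V) = (1 - p) * V"
    using sum.remove[of "words k len" w0 "wt \<nu>"] w0 sum_wt[of len] by (simp add: sum_distrib_right[symmetric])
  finally have tot: "(\<Sum>s\<in>Q. E len (\<lambda>u. nsq (G (T s u)))) \<le> p * A + (1 - p) * V" .
  have "(\<Sum>s\<in>Q. nsq (\<lambda>x. E len (\<lambda>u. G (T s u) (M s u *v x)))) \<le> (\<Sum>s\<in>Q. E len (\<lambda>u. nsq (G (T s u))) - p / (6 * C) * nsq (G (s + \<Theta>)))"
    by (intro sum_mono one)
  also have "\<dots> = (\<Sum>s\<in>Q. E len (\<lambda>u. nsq (G (T s u)))) - p / (6 * C) * A"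
    by (simp add: sum_subtractf A_def sum_distrib_left)
  also have "\<dots> \<le> V - p * (V - A) - p / (6 * C) * A" using tot by (simp add: algebra_simps)
  also have "\<dots> \<le> V - c * (V - A) - c * A"
  proof -
    have "c \<le> p" "c \<le> p / (6 * C)" by (simp_all add: c_def)
    then have "c * (V - A) \<le> p * (V - A)" "c * A \<le> p / (6 * C) * A" using AV V0 by (intro mult_right_mono; simp)+
    then show ?thesis by linarith
  qed
  also have "\<dots> = (1 - c) * V" by (simp add: algebra_simps)
  finally show ?thesis by (simp add: V_def)
qed

section \<open>From the spectral gap to exponential growth\<close>

lemma L2_ball: "L2 (\<lambda>x::real^2. of_bool (norm x \<le> R))"
  and nsq_ball: "nsq (\<lambda>x::real^2. of_bool (norm x \<le> R)) = measure lborel (cball (0::real^2) R)"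
proof -
  have eq: "(\<lambda>x::real^2. of_bool (norm x \<le> R)) = (indicator (cball 0 R) :: real^2 \<Rightarrow> real)"
    by (auto simp: indicator_def fun_eq_iff)
  have sq: "(indicator (cball 0 R) x :: real)\<^sup>2 = indicator (cball 0 R) x" for x :: "real^2" by (simp add: indicator_def)
  show "L2 (\<lambda>x::real^2. of_bool (norm x \<le> R))"
    unfolding L2_def eq sq by (auto intro!: emeasure_bounded_finite borel_measurable_indicator)
  show "nsq (\<lambda>x::real^2. of_bool (norm x \<le> R)) = measure lborel (cball (0::real^2) R)"
    unfolding nsq_def eq sq by simp
qed

text \<open>The backward recursion starts with the indicator of the disc of radius \<open>R\<close>
  over every fibre of \<open>Q'\<close> and peels off blocks from the front. \<open>Q'\<close> only
  has to contain all end fibres, so its cardinality is the price of working over many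
  fibres.\<close>

lemma gap_iterate:
  assumes nd: "nondeg len \<Theta> C \<xi> p"
  defines "c \<equiv> min p (p / (6 * C))"
  shows "finite Q \<Longrightarrow> finite Q' \<Longrightarrow> (\<And>s w. s \<in> Q \<Longrightarrow> w \<in> words k (m * len) \<Longrightarrow> T s w \<in> Q') \<Longrightarrow> c \<le> 1 \<Longrightarrow>
    (\<Sum>s\<in>Q. nsq (\<lambda>x. Prob (m * len) (\<lambda>w. norm (M s w *v x) \<le> R))) \<le> (1 - c) ^ m * (real (card Q') * measure lborel (cball (0::real^2) R))"
proof (induction m arbitrary: Q)
  case 0
  have "Q \<subseteq> Q'" using 0(3)[of _ "[]"] by auto
  then have "real (card Q) \<le> real (card Q')" using 0(2) by (simp add: card_mono)
  then show ?case by (simp add: Prob_def nsq_ball mult_right_mono)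
next
  case (Suc m)
  define Q1 where "Q1 = (\<lambda>(s, u). T s u) ` (Q \<times> words k len)"
  define G where "G s x = Prob (m * len) (\<lambda>w. norm (M s w *v x) \<le> R)" for s x
  have LG: "L2 (G s)" for s
    unfolding G_def Prob_def EW_def
    by (intro L2_sum L2_cmult L2_comp[OF M_SL L2_ball]) auto
  have eq: "Prob (Suc m * len) (\<lambda>w. norm (M s w *v x) \<le> R) = E len (\<lambda>u. G (T s u) (M s u *v x))" for s x
    by (simp add: Prob_def G_def EW_append M_append_mv)
  have "(\<Sum>s\<in>Q. nsq (\<lambda>x. Prob (Suc m * len) (\<lambda>w. norm (M s w *v x) \<le> R))) \<le> (1 - c) * (\<Sum>s\<in>Q1. nsq (G s))"
    unfolding eq c_def by (rule gap_step[OF nd Suc.prems(1) _ _ LG]) (use Suc.prems(1) in \<open>auto simp: Q1_def\<close>)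
  also have "\<dots> \<le> (1 - c) * ((1 - c) ^ m * (real (card Q') * measure lborel (cball (0::real^2) R)))"
    unfolding G_def
  proof (intro mult_left_mono Suc.IH)
    fix s w assume s: "s \<in> Q1" and w: "w \<in> words k (m * len)"
    obtain s0 u where "s0 \<in> Q" "u \<in> words k len" "s = T s0 u" using s by (auto simp: Q1_def)
    then show "T s w \<in> Q'" using Suc.prems(3)[of s0 "u @ w"] words_append[of u k len w "m * len"] w by simp
  qed (use Suc.prems in \<open>auto simp: Q1_def\<close>)
  finally show ?case by (simp add: mult.assoc)
qed

text \<open>Rotations commute, so the end point depends only on how often each letter occurs, and
  there are polynomially many such counts.\<close>

lemma wend_count:
  assumes "w \<in> words k n"
  shows "T t w \<in> (\<lambda>c. t + (\<Sum>i\<le>k. real (c i) * \<theta> i)) ` (PiE {..k} (\<lambda>_. {..n}))"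
proof -
  have *: "T t w = t + (\<Sum>i\<le>k. real (count_list w i) * \<theta> i) \<and> (\<forall>i. count_list w i \<le> n)"
    using assms
  proof (induction w arbitrary: t n)
    case (Cons j w)
    then have j: "j \<le> k" and w: "w \<in> words k (n - 1)" and n: "n = Suc (n - 1)" by (auto simp: words_def)
    have "(\<Sum>i\<le>k. real (count_list (j # w) i) * \<theta> i) = (\<Sum>i\<le>k. (if i = j then \<theta> i else 0) + real (count_list w i) * \<theta> i)"
      by (intro sum.cong) (auto simp: algebra_simps)
    also have "\<dots> = \<theta> j + (\<Sum>i\<le>k. real (count_list w i) * \<theta> i)" using j by (simp add: sum.distrib)
    finally have "T t (j # w) = t + (\<Sum>i\<le>k. real (count_list (j # w) i) * \<theta> i)"
      using Cons.IH[OF w, of "t + \<theta> j"] by simp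
    moreover have "count_list (j # w) i \<le> n" for i
      using Cons.IH[OF w, of t] by (subst n) (auto intro: le_SucI)
    ultimately show ?case by blast
  qed (auto simp: words_def)
  show ?thesis
    by (rule image_eqI[of _ _ "\<lambda>i\<in>{..k}. count_list w i"]) (use * in auto)
qed

text \<open>A function that is at least \<open>q\<close> on a disc of radius \<open>\<delta>\<close>
  has squared norm at least \<open>q^2\<close> times its area, and \<open>gap_iterate\<close> bounds
  this norm from above; the area of the unit disc cancels.\<close>

lemma ball_estimate:
  assumes nd: "nondeg len \<Theta> C \<xi> p"
  defines "c \<equiv> min p (p / (6 * C))"
  assumes c1: "c \<le> 1" and n: "n = m * len" and R: "0 \<le> R" and \<delta>: "0 < \<delta>"
    and q: "\<And>x. norm (x - v) \<le> \<delta> \<Longrightarrow> q \<le> Prob n (\<lambda>w. norm (M t w *v x) \<le> R)" and q0: "0 \<le> q"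
  shows "q\<^sup>2 * \<delta>\<^sup>2 \<le> (1 - c) ^ m * (real (n + 1) ^ (k + 1) * R\<^sup>2)"
proof -
  define Q' where "Q' = (\<lambda>c. t + (\<Sum>i\<le>k. real (c i) * \<theta> i)) ` (PiE {..k} (\<lambda>_. {..n}))"
  have fQ: "finite Q'" unfolding Q'_def by (intro finite_imageI finite_PiE) auto
  have "card Q' \<le> card (PiE {..k} (\<lambda>_. {..n}))" unfolding Q'_def by (intro card_image_le finite_PiE) auto
  also have "\<dots> = (n + 1) ^ (k + 1)" by (simp add: card_PiE)
  finally have cQ: "real (card Q') \<le> real (n + 1) ^ (k + 1)" by (metis of_nat_le_iff of_nat_power)
  define P where "P x = Prob n (\<lambda>w. norm (M t w *v x) \<le> R)" for x
  have LP: "L2 P"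
    unfolding P_def Prob_def EW_def by (intro L2_sum L2_cmult L2_comp[OF M_SL L2_ball]) auto
  define u where "u = unit_ball_vol (real 2)"
  have u: "u > 0" by (simp add: u_def)
  have vol: "measure lborel (cball y r) = u * r\<^sup>2" if "0 \<le> r" for y :: "real^2" and r
    using content_cball[OF that, of y] by (simp add: u_def)
  have "q\<^sup>2 * (u * \<delta>\<^sup>2) = (\<integral>x. q\<^sup>2 * indicator (cball v \<delta>) x \<partial>lborel)"
    using vol[of \<delta> v] \<delta> by simp
  also have "\<dots> \<le> nsq P"
    unfolding nsq_def
  proof (rule integral_mono)
    show "integrable lborel (\<lambda>x. q\<^sup>2 * indicator (cball v \<delta>) x)" by (auto intro!: integrable_mult_right emeasure_bounded_finite)
    show "integrable lborel (\<lambda>x. (P x)\<^sup>2)" using LP by (simp add: L2_def)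
    fix x show "q\<^sup>2 * indicator (cball v \<delta>) x \<le> (P x)\<^sup>2"
      using q[of x] q0 by (auto simp: indicator_def P_def dist_norm norm_minus_commute intro!: power_mono)
  qed
  also have "nsq P = (\<Sum>s\<in>{t}. nsq (\<lambda>x. Prob (m * len) (\<lambda>w. norm (M s w *v x) \<le> R)))"
    by (simp add: P_def[abs_def] n)
  also have "\<dots> \<le> (1 - c) ^ m * (real (card Q') * measure lborel (cball (0::real^2) R))"
    unfolding c_def by (rule gap_iterate[OF nd]) (use fQ wend_count c1 in \<open>auto simp: Q'_def n c_def\<close>)
  also have "\<dots> \<le> (1 - c) ^ m * (real (n + 1) ^ (k + 1) * (u * R\<^sup>2))"
    unfolding vol[OF R] using c1 u by (intro mult_left_mono mult_right_mono cQ) auto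
  finally have "u * (q\<^sup>2 * \<delta>\<^sup>2) \<le> u * ((1 - c) ^ m * (real (n + 1) ^ (k + 1) * R\<^sup>2))" by (simp add: mult_ac)
  then show ?thesis using u by simp
qed

lemma words_take: "w \<in> words k n \<Longrightarrow> j \<le> n \<Longrightarrow> take j w \<in> words k j"
  by (auto simp: words_def dest: in_set_takeD)

text \<open>The cross product of \<open>v\<close> and \<open>x\<close> is preserved along the word,
  so by \<open>slope_step\<close> every letter changes the slope by at most
  \<open>Lam * \<bar>cross v x\<bar> / r^2\<close>, as long as the images of \<open>v\<close> stay
  above \<open>r\<close>.\<close>

lemma slope_growth:
  assumes w: "w \<in> words k n" and v: "norm v = 1" and r: "r > 0"
    and good: "\<And>j. j \<le> n \<Longrightarrow> r \<le> norm (M t (take j w) *v v)"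
  shows "\<bar>slope (M t w *v v) (M t w *v x) - slope v x\<bar> \<le> real n * (Lam * \<bar>cross v x\<bar> / r\<^sup>2)"
proof -
  have "\<bar>slope (M t (take j w) *v v) (M t (take j w) *v x) - slope v x\<bar> \<le> real j * (Lam * \<bar>cross v x\<bar> / r\<^sup>2)" if "j \<le> n" for j
    using that
  proof (induction j)
    case (Suc j)
    define i where "i = w ! j"
    have len: "length w = n" using w by (simp add: words_def)
    then have tk: "take (Suc j) w = take j w @ [i]" using Suc.prems by (simp add: i_def take_Suc_conv_app_nth)
    have i: "i \<le> k" using w Suc.prems len nth_mem[of j w] by (auto simp: words_def i_def simp del: nth_mem)
    define s where "s = T t (take j w)"
    have Mv: "M t (take (Suc j) w) *v y = B i s *v (M t (take j w) *v y)" for y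
      unfolding tk M_append_mv by (simp add: s_def)
    have wj: "take j w \<in> words k j" using words_take[OF w] Suc.prems by simp
    let ?p = "M t (take j w) *v v" and ?q = "M t (take j w) *v x"
    have p: "r \<le> norm ?p" "r \<le> norm (B i s *v ?p)" using good[of j] good[of "Suc j"] Suc.prems Mv by auto
    have "\<bar>slope (B i s *v ?p) (B i s *v ?q) - slope ?p ?q\<bar> \<le> Lam * \<bar>cross ?p ?q\<bar> / (norm ?p * norm (B i s *v ?p))"
      by (rule slope_step[OF B_le[OF i]]) (use p r in auto)
    also have "cross ?p ?q = cross v x" by (simp add: cross_mv M_SL[OF wj])
    also have "Lam * \<bar>cross v x\<bar> / (norm ?p * norm (B i s *v ?p)) \<le> Lam * \<bar>cross v x\<bar> / (r * r)"
      using p r Lam_ge_1 by (intro divide_left_mono mult_mono mult_pos_pos) auto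
    finally have st: "\<bar>slope (B i s *v ?p) (B i s *v ?q) - slope ?p ?q\<bar> \<le> Lam * \<bar>cross v x\<bar> / r\<^sup>2"
      by (simp add: power2_eq_square)
    have "\<bar>slope ?p ?q - slope v x\<bar> \<le> real j * (Lam * \<bar>cross v x\<bar> / r\<^sup>2)" using Suc.IH Suc.prems by simp
    with st show ?case unfolding Mv of_nat_Suc distrib_right mult_1_left by linarith
  qed simp
  from this[of n] w show ?thesis by (simp add: words_def)
qed

lemma Prob_prefix: "j \<le> n \<Longrightarrow> Prob n (\<lambda>w. P (take j w)) = Prob j P"
proof -
  assume "j \<le> n"
  then have n: "n = j + (n - j)" by simp
  have "Prob n (\<lambda>w. P (take j w)) = E j (\<lambda>u. E (n - j) (\<lambda>w. of_bool (P (take j (u @ w)))))"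
    unfolding Prob_def by (subst n) (rule EW_append)
  also have "\<dots> = E j (\<lambda>u. of_bool (P u))"
    by (rule EW_cong) (simp add: words_def)
  finally show ?thesis by (simp add: Prob_def)
qed

lemma Prob_ex_le: "Prob n (\<lambda>w. \<exists>j\<le>(m::nat). P j w) \<le> (\<Sum>j\<le>m. Prob n (P j))"
proof (induction m)
  case (Suc m)
  have "Prob n (\<lambda>w. \<exists>j\<le>Suc m. P j w) \<le> Prob n (\<lambda>w. (\<exists>j\<le>m. P j w) \<or> P (Suc m) w)"
    by (rule Prob_mono) (auto simp: le_Suc_eq)
  also have "\<dots> \<le> Prob n (\<lambda>w. \<exists>j\<le>m. P j w) + Prob n (P (Suc m))" by (rule Prob_disj)
  finally show ?case using Suc by simp
qed (simp add: Prob_mono)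

text \<open>Giving each of the \<open>d\<close> factors a \<open>d\<close>-th root of
  \<open>r ^ m\<close> reduces the claim to the case of a linear factor.\<close>

lemma poly_geometric_tendsto_0:
  fixes r Q :: real
  assumes "0 < r" "r < 1"
  shows "(\<lambda>m. r ^ m * (Q * real (m + 1)) ^ d) \<longlonglongrightarrow> 0"
proof (cases "d = 0")
  case True then show ?thesis using assms by (simp add: LIMSEQ_realpow_zero)
next
  case False
  define x where "x = root d r"
  have x: "0 < x" "x < 1" "x ^ d = r" using assms False by (auto simp: x_def real_root_gt_zero)
  have "(\<lambda>m. (Q * (real m * x ^ m + x ^ m)) ^ d) \<longlonglongrightarrow> (Q * (0 + 0)) ^ d"
    using x by (intro tendsto_intros powser_times_n_limit_0 LIMSEQ_realpow_zero) auto
  moreover have "(Q * (real m * x ^ m + x ^ m)) ^ d = r ^ m * (Q * real (m + 1)) ^ d" for m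
  proof -
    have "Q * (real m * x ^ m + x ^ m) = x ^ m * (Q * real (m + 1))" by (simp add: algebra_simps)
    moreover have "(x ^ m) ^ d = r ^ m" unfolding x(3)[symmetric] by (simp add: power_mult[symmetric] mult.commute)
    ultimately show ?thesis by (simp only: power_mult_distrib)
  qed
  ultimately show ?thesis using False by (simp add: power_0_left)
qed

text \<open>By the lower bound, with high probability the norm of \<open>v\<close> does not become exponentially small, and
  then all vectors of a small disc around \<open>v\<close> grow no faster than \<open>v\<close>; but the spectral gap makes it
  exponentially unlikely that the vectors of a disc all stay bounded.\<close>

lemma nondeg_expanding:
  assumes nd: "nondeg len \<Theta> C \<xi> p"
  obtains n \<epsilon> where "n \<ge> 1" "\<epsilon> > 0" "\<And>t v. v \<noteq> 0 \<Longrightarrow> real n * \<epsilon> \<le> ES lf n t v"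
proof -
  interpret L: observable k \<theta> \<nu> B lf "ln Lam" "2 * Lam\<^sup>2" using observable_ln by (simp add: observable_def)
  define F where "F = ln Lam"
  have F0: "0 \<le> F" using Lam_ge_1 by (simp add: F_def)
  have p: "0 < p" and C: "0 < C" using nd by (auto simp: nondeg_def)
  define c where "c = min p (p / (6 * C))"
  obtain w0 where w0: "\<And>i. i \<le> (3::nat) \<Longrightarrow> w0 i \<in> words k len" "inj_on w0 {..3}" "\<And>i. i \<le> 3 \<Longrightarrow> wt \<nu> (w0 i) = p"
    using nondegE[OF nd, of 0] by blast
  have len: "len \<ge> 1"
  proof (rule ccontr)
    assume "\<not> len \<ge> 1"
    then have "len = 0" by simp
    then have "w0 0 = w0 1" using w0(1)[of 0] w0(1)[of 1] by (simp add: words_def)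
    then show False using inj_onD[OF w0(2), of 0 1] by simp
  qed
  have "p \<le> 1" using wt_le_EW[of k len "\<lambda>_. 1" "w0 0" \<nu>] w0(1)[of 0] w0(3)[of 0] by simp
  then have c: "0 < c" "c \<le> 1" using p C by (auto simp: c_def)
  \<comment> \<open>\<open>1 - c\<close> may vanish; the maximum keeps the logarithm below
    meaningful.\<close>
  define r where "r = max (1 - c) (1/2)"
  have r: "0 < r" "r < 1" "0 \<le> 1 - c" "1 - c \<le> r" using c by (auto simp: r_def)
  \<comment> \<open>The gap is split in two: one factor \<open>\<rho> ^ m\<close> compensates the
    exponential \<open>exp (8 * \<epsilon> * real n)\<close>, the other one beats the polynomial
    factors.\<close>
  define \<rho> where "\<rho> = sqrt r"
  have \<rho>: "0 < \<rho>" "\<rho> < 1" "\<rho> * \<rho> = r" using r by (auto simp: \<rho>_def real_sqrt_lt_1_iff)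
  define \<epsilon> where "\<epsilon> = - ln \<rho> / (8 * len)"
  have \<epsilon>: "\<epsilon> > 0" using \<rho> len by (auto simp: \<epsilon>_def field_simps)
  have e\<rho>: "exp (8 * \<epsilon> * real (m * len)) * \<rho> ^ m = 1" for m
  proof -
    have "8 * \<epsilon> * real (m * len) = - (real m * ln \<rho>)" using len by (simp add: \<epsilon>_def)
    moreover have "\<rho> ^ m = exp (real m * ln \<rho>)" using \<rho> by (simp add: exp_of_nat_mult)
    ultimately show ?thesis by (simp add: exp_minus)
  qed
  \<comment> \<open>A lower bound independent of \<open>n\<close> becomes a mean of at least
    \<open>- \<epsilon> / 4\<close> per letter once \<open>N\<close> is large, so the moment bound
    makes small norms improbable.\<close>
  obtain c0 where c0: "\<And>n t v. v \<noteq> 0 \<Longrightarrow> c0 \<le> ES lf n t v" using ES_lower_bound[OF nd] by blast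
  obtain N0 :: nat where N0: "- c0 * 4 / \<epsilon> \<le> real N0" using real_arch_simple by blast
  define N where "N = Suc N0"
  have N: "N \<ge> 1" "- c0 * 4 / \<epsilon> \<le> real N" using N0 by (auto simp: N_def)
  have mean: "real N * (- \<epsilon> / 4) \<le> ES lf N t v" if "v \<noteq> 0" for t v
  proof -
    have "- c0 * 4 \<le> real N * \<epsilon>" using N(2) \<epsilon> by (simp only: pos_divide_le_eq)
    then show ?thesis using c0[OF that, of N t] by simp
  qed
  have e4: "\<epsilon> / 4 > 0" using \<epsilon> by simp
  obtain \<sigma> C1 where \<sigma>: "0 < \<sigma>" "\<sigma> \<le> 1" "0 < C1"
    and mom: "\<And>n t v. v \<noteq> 0 \<Longrightarrow> E n (\<lambda>w. exp (- \<sigma> * S lf t v w)) \<le> C1 * exp (- \<sigma> * (- \<epsilon> / 4 - \<epsilon> / 4) * real n)"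
    using moment_bound[of lf "ln Lam" N "- \<epsilon> / 4" "\<epsilon> / 4", OF L.f_bound N(1) mean e4] by blast
  define bad where "bad n t v w \<longleftrightarrow> (\<exists>j\<le>n. norm (M t (take j w) *v v) < exp (- \<epsilon> * real n))" for n t v w
  have Pbad: "Prob n (bad n t v) \<le> C1 * (real (n + 1) * exp (- \<sigma> * \<epsilon> / 2) ^ n)" if v: "norm v = 1" for n t v
  proof -
    have v0: "v \<noteq> 0" using v by auto
    have one: "Prob j (\<lambda>w. norm (M t w *v v) < exp (- \<epsilon> * real n)) \<le> C1 * exp (- \<sigma> * \<epsilon> / 2) ^ n" if j: "j \<le> n" for j
    proof -
      have "Prob j (\<lambda>w. norm (M t w *v v) < exp (- \<epsilon> * real n)) \<le> E j (\<lambda>w. exp (- \<sigma> * S lf t v w)) / exp (\<sigma> * \<epsilon> * real n)"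
      proof (rule Prob_markov)
        fix w assume w: "w \<in> words k j" and lt: "norm (M t w *v v) < exp (- \<epsilon> * real n)"
        have "ln (norm (M t w *v v)) \<le> ln (exp (- \<epsilon> * real n))" using lt M_nz[OF w v0] by (intro ln_mono) auto
        then have "S lf t v w \<le> - \<epsilon> * real n" unfolding S_ln[OF w v0] using v by simp
        then have "\<sigma> * S lf t v w \<le> \<sigma> * (- \<epsilon> * real n)" using \<sigma> by (intro mult_left_mono) auto
        then show "exp (\<sigma> * \<epsilon> * real n) \<le> exp (- \<sigma> * S lf t v w)" by simp
      qed auto
      also have "\<dots> \<le> (C1 * exp (\<sigma> * \<epsilon> / 2 * real n)) / exp (\<sigma> * \<epsilon> * real n)"
      proof (intro divide_right_mono order_trans[OF mom[OF v0]] mult_left_mono)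
        have "\<sigma> * \<epsilon> / 2 * real j \<le> \<sigma> * \<epsilon> / 2 * real n" using j \<sigma> \<epsilon> by (intro mult_left_mono) auto
        then show "exp (- \<sigma> * (- \<epsilon> / 4 - \<epsilon> / 4) * real j) \<le> exp (\<sigma> * \<epsilon> / 2 * real n)" by simp
      qed (use \<sigma> in auto)
      also have "\<dots> = C1 * exp (- \<sigma> * \<epsilon> / 2) ^ n"
      proof -
        have "exp (\<sigma> * \<epsilon> / 2 * real n) = exp (- \<sigma> * \<epsilon> / 2) ^ n * exp (\<sigma> * \<epsilon> * real n)"
          by (simp add: exp_of_nat_mult[symmetric] exp_add[symmetric] field_simps)
        then show ?thesis by simp
      qed
      finally show ?thesis .
    qed
    have "Prob n (bad n t v) \<le> (\<Sum>j\<le>n. Prob n (\<lambda>w. norm (M t (take j w) *v v) < exp (- \<epsilon> * real n)))"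
      unfolding bad_def[abs_def] by (rule Prob_ex_le)
    also have "\<dots> \<le> (\<Sum>j\<le>n. C1 * exp (- \<sigma> * \<epsilon> / 2) ^ n)"
    proof (rule sum_mono)
      fix j assume "j \<in> {..n}"
      then show "Prob n (\<lambda>w. norm (M t (take j w) *v v) < exp (- \<epsilon> * real n)) \<le> C1 * exp (- \<sigma> * \<epsilon> / 2) ^ n"
        using one[of j] Prob_prefix[of j n "\<lambda>w. norm (M t w *v v) < exp (- \<epsilon> * real n)"] by simp
    qed
    also have "\<dots> = C1 * (real (n + 1) * exp (- \<sigma> * \<epsilon> / 2) ^ n)" by simp
    finally show ?thesis .
  qed
  define Q where "Q = real len + 3 + real len * Lam"
  have Q: "Q \<ge> 1" using Lam_ge_1 by (simp add: Q_def add_increasing2)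
  define slow where "slow n t v w \<longleftrightarrow> \<not> bad n t v w \<and> norm (M t w *v v) \<le> exp (\<epsilon> * real n)" for n t v w
  have Pslow: "(Prob n (slow n t v))\<^sup>2 \<le> \<rho> ^ m * (Q * real (m + 1)) ^ (k + 3)"
    if v: "norm v = 1" and n: "n = m * len" for n m t v
  proof -
    define q where "q = Prob n (slow n t v)"
    \<comment> \<open>Small even against the square of the threshold
      \<open>exp (- \<epsilon> * real n)\<close>, so that slopes over the disc grow only linearly in
      \<open>n\<close>. In the end \<open>\<delta>^2\<close> contributes 6 and \<open>R^2\<close>
      contributes 2 to the exponent \<open>8 * \<epsilon> * real n\<close>.\<close>
    define \<delta> where "\<delta> = exp (- 3 * \<epsilon> * real n)"
    define R where "R = (3 + real n * Lam) * exp (\<epsilon> * real n)"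
    have R0: "R \<ge> 0" using Lam_ge_1 by (simp add: R_def)
    have v0: "v \<noteq> 0" using v by auto
    have qx: "q \<le> Prob n (\<lambda>w. norm (M t w *v x) \<le> R)" if x: "norm (x - v) \<le> \<delta>" for x
      unfolding q_def
    proof (rule Prob_mono)
      fix w assume w: "w \<in> words k n" and sl: "slow n t v w"
      define r where "r = exp (- \<epsilon> * real n)"
      have good: "\<And>j. j \<le> n \<Longrightarrow> r \<le> norm (M t (take j w) *v v)" using sl by (auto simp: slow_def bad_def r_def not_less)
      have \<delta>1: "\<delta> \<le> 1" using \<epsilon> by (simp add: \<delta>_def)
      have "cross v x = cross v (x - v)" by (simp add: cross_def algebra_simps)
      then have cr: "\<bar>cross v x\<bar> \<le> \<delta>" using abs_cross_le[of v "x - v"] v x by simp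
      have sv: "\<bar>slope v x\<bar> \<le> 2"
      proof -
        have "\<bar>slope v x\<bar> \<le> norm x" using Cauchy_Schwarz_ineq2[of v x] v by (simp add: slope_def)
        also have "\<dots> \<le> norm v + norm (x - v)" by (rule norm_triangle_sub)
        finally show ?thesis using v x \<delta>1 by simp
      qed
      have "real n * (Lam * \<bar>cross v x\<bar> / r\<^sup>2) \<le> real n * (Lam * \<delta> / r\<^sup>2)"
        using cr Lam_ge_1 by (intro mult_left_mono divide_right_mono) auto
      also have "\<delta> / r\<^sup>2 = exp (- \<epsilon> * real n)"
        by (simp add: \<delta>_def r_def power2_eq_square exp_add[symmetric] exp_diff[symmetric])
      then have "real n * (Lam * \<delta> / r\<^sup>2) = real n * (Lam * exp (- \<epsilon> * real n))" by (metis times_divide_eq_right)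
      also have "\<dots> \<le> real n * (Lam * 1)" using \<epsilon> Lam_ge_1 by (intro mult_left_mono) auto
      finally have sl1: "\<bar>slope (M t w *v v) (M t w *v x)\<bar> \<le> 2 + real n * Lam"
        using slope_growth[OF w v _ good, of x] sv by (simp add: r_def)
      have rn: "r \<le> norm (M t w *v v)" using good[of n] w by (simp add: words_def)
      have "norm (M t w *v x) \<le> \<bar>slope (M t w *v v) (M t w *v x)\<bar> * norm (M t w *v v) + \<bar>cross v x\<bar> / norm (M t w *v v)"
        using norm_le_slope[OF M_nz[OF w v0], of "M t w *v x" t] by (simp add: cross_mv M_SL[OF w])
      also have "\<dots> \<le> (2 + real n * Lam) * exp (\<epsilon> * real n) + \<delta> / r"
        using sl1 sl rn cr Lam_ge_1 by (intro add_mono mult_mono frac_le) (auto simp: slow_def r_def \<delta>_def)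
      also have "\<delta> / r \<le> exp (\<epsilon> * real n)" using \<epsilon> by (simp add: \<delta>_def r_def exp_diff[symmetric])
      finally show "norm (M t w *v x) \<le> R" by (simp add: R_def algebra_simps)
    qed
    have \<delta>0: "0 < \<delta>" by (simp add: \<delta>_def)
    have q0: "0 \<le> q" unfolding q_def by (rule Prob_nonneg)
    have "q\<^sup>2 * \<delta>\<^sup>2 \<le> (1 - c) ^ m * (real (n + 1) ^ (k + 1) * R\<^sup>2)"
      unfolding c_def by (rule ball_estimate[OF nd _ n R0 \<delta>0 qx q0]) (use c in \<open>auto simp: c_def\<close>)
    also have "\<dots> \<le> r ^ m * (real (n + 1) ^ (k + 1) * R\<^sup>2)" using r by (intro mult_right_mono power_mono) auto
    finally have le: "q\<^sup>2 * \<delta>\<^sup>2 * exp (6 * \<epsilon> * real n) \<le> r ^ m * (real (n + 1) ^ (k + 1) * R\<^sup>2) * exp (6 * \<epsilon> * real n)"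
      by (intro mult_right_mono) auto
    have "\<delta>\<^sup>2 * exp (6 * \<epsilon> * real n) = 1" by (simp add: \<delta>_def power2_eq_square exp_add[symmetric])
    then have eq1: "q\<^sup>2 * \<delta>\<^sup>2 * exp (6 * \<epsilon> * real n) = q\<^sup>2" by (simp add: mult.assoc)
    have eq2: "r ^ m * (real (n + 1) ^ (k + 1) * R\<^sup>2) * exp (6 * \<epsilon> * real n)
      = \<rho> ^ m * (real (n + 1) ^ (k + 1) * (3 + real n * Lam)\<^sup>2) * (exp (8 * \<epsilon> * real (m * len)) * \<rho> ^ m)"
      unfolding R_def n[symmetric] \<rho>(3)[symmetric] by (simp add: power2_eq_square power_mult_distrib exp_add[symmetric] mult_ac algebra_simps)
    have "q\<^sup>2 \<le> \<rho> ^ m * (real (n + 1) ^ (k + 1) * (3 + real n * Lam)\<^sup>2)"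
      using le unfolding eq1 eq2 e\<rho> mult_1_right .
    also have "\<dots> \<le> \<rho> ^ m * ((Q * real (m + 1)) ^ (k + 1) * (Q * real (m + 1))\<^sup>2)"
    proof (intro mult_left_mono mult_mono power_mono)
      have Q1: "real len \<le> Q" "3 \<le> Q" "real len * Lam \<le> Q" using Lam_ge_1 by (auto simp: Q_def)
      have "real m * real len \<le> real m * Q" "real m * (real len * Lam) \<le> real m * Q"
        using Q1 by (auto intro: mult_left_mono)
      moreover have "real n = real m * real len" "Q * real (m + 1) = real m * Q + Q" by (simp_all add: n algebra_simps)
      ultimately show "real (n + 1) \<le> Q * real (m + 1)" "3 + real n * Lam \<le> Q * real (m + 1)"
        using Q1 by (simp_all add: mult.assoc)
    qed (use \<rho> Q Lam_ge_1 in auto)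
    also have "\<dots> = \<rho> ^ m * (Q * real (m + 1)) ^ (k + 3)"
      by (simp add: power_add[symmetric] numeral_3_eq_3 power2_eq_square mult_ac)
    finally show ?thesis by (simp add: q_def)
  qed
  \<comment> \<open>On bad or slow words up to \<open>real n * (\<epsilon> + F)\<close> is lost; two
    such events of probability \<open>\<kappa>\<close> together cost half of
    \<open>real n * \<epsilon>\<close>.\<close>
  define \<kappa> where "\<kappa> = \<epsilon> / (4 * (\<epsilon> + F))"
  have \<kappa>: "\<kappa> > 0" using \<epsilon> F0 by (simp add: \<kappa>_def)
  have "eventually (\<lambda>m. \<rho> ^ m * (Q * real (m + 1)) ^ (k + 3) < \<kappa>\<^sup>2) sequentially"
    using poly_geometric_tendsto_0[OF \<rho>(1,2)] \<kappa> by (intro order_tendstoD(2)) auto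
  then obtain m1 where m1: "\<And>m. m \<ge> m1 \<Longrightarrow> \<rho> ^ m * (Q * real (m + 1)) ^ (k + 3) < \<kappa>\<^sup>2" unfolding eventually_sequentially by blast
  have "(\<lambda>n. exp (- \<sigma> * \<epsilon> / 2) ^ n * (C1 * real (n + 1)) ^ 1) \<longlonglongrightarrow> 0"
    using \<sigma> \<epsilon> by (intro poly_geometric_tendsto_0) auto
  then have "eventually (\<lambda>n. exp (- \<sigma> * \<epsilon> / 2) ^ n * (C1 * real (n + 1)) ^ 1 < \<kappa>) sequentially"
    using \<kappa> by (rule order_tendstoD(2))
  then obtain n1 where n1: "\<And>n. n \<ge> n1 \<Longrightarrow> exp (- \<sigma> * \<epsilon> / 2) ^ n * (C1 * real (n + 1)) ^ 1 < \<kappa>" unfolding eventually_sequentially by blast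
  define m where "m = max (max m1 n1) 1"
  define n where "n = m * len"
  have mn: "m \<ge> m1" "n \<ge> n1" "n \<ge> 1"
    using len mult_le_mono2[of 1 len m] by (auto simp: m_def n_def)
  have unit: "real n * (\<epsilon> / 2) \<le> ES lf n t v" if v: "norm v = 1" for t v
  proof -
    have v0: "v \<noteq> 0" using v by auto
    have b: "Prob n (bad n t v) \<le> \<kappa>" using Pbad[OF v, of n t] n1[OF mn(2)] by (simp add: mult_ac)
    have "(Prob n (slow n t v))\<^sup>2 \<le> \<kappa>\<^sup>2" using Pslow[OF v n_def, of t] m1[OF mn(1)] by simp
    then have s: "Prob n (slow n t v) \<le> \<kappa>" using \<kappa> power2_le_imp_le less_imp_le by blast
    have "E n (\<lambda>w. real n * \<epsilon> - (real n * (\<epsilon> + F)) * (of_bool (bad n t v w) + of_bool (slow n t v w))) \<le> ES lf n t v"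
    proof (rule EW_mono)
      fix w assume w: "w \<in> words k n"
      have Sb: "\<bar>S lf t v w\<bar> \<le> real n * F"         using S_bound[of lf "ln Lam", OF L.f_bound w v0] by (simp add: F_def)
      show "real n * \<epsilon> - (real n * (\<epsilon> + F)) * (of_bool (bad n t v w) + of_bool (slow n t v w)) \<le> S lf t v w"
      proof (cases "bad n t v w \<or> slow n t v w")
        case True
        then have "1 \<le> (of_bool (bad n t v w) + of_bool (slow n t v w) :: real)" by auto
        then have "real n * (\<epsilon> + F) * 1 \<le> (real n * (\<epsilon> + F)) * (of_bool (bad n t v w) + of_bool (slow n t v w))"
          using \<epsilon> F0 by (intro mult_left_mono) auto
        then show ?thesis using Sb by (simp add: algebra_simps abs_le_iff)
      next
        case False
        then have "exp (\<epsilon> * real n) < norm (M t w *v v)" by (auto simp: slow_def)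
        then have "ln (exp (\<epsilon> * real n)) \<le> ln (norm (M t w *v v))" by (intro ln_mono) auto
        then show ?thesis using False v unfolding S_ln[OF w v0] by (simp add: mult.commute)
      qed
    qed
    then have "real n * \<epsilon> - (real n * (\<epsilon> + F)) * (Prob n (bad n t v) + Prob n (slow n t v)) \<le> ES lf n t v"
      unfolding EW_diff EW_cmult EW_add Prob_def by simp
    moreover have "(real n * (\<epsilon> + F)) * (Prob n (bad n t v) + Prob n (slow n t v)) \<le> (real n * (\<epsilon> + F)) * (2 * \<kappa>)"
      using b s \<epsilon> F0 by (intro mult_left_mono) auto
    moreover have "(real n * (\<epsilon> + F)) * (2 * \<kappa>) = real n * \<epsilon> / 2"
    proof -
      define G where "G = \<epsilon> + F"
      have "G > 0" using \<epsilon> F0 by (simp add: G_def)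
      then show ?thesis by (simp add: \<kappa>_def G_def[symmetric])
    qed
    ultimately show ?thesis by linarith
  qed
  show thesis
  proof (rule that[OF mn(3) half_gt_zero[OF \<epsilon>]])
    fix t v assume v: "v \<noteq> (0::real^2)"
    define u where "u = v /\<^sub>R norm v"
    have u: "norm u = 1" "u \<noteq> 0" using v by (auto simp: u_def)
    have "ES lf n t v = ES lf n t u"
    proof (rule EW_cong)
      fix w assume w: "w \<in> words k n"
      show "S lf t v w = S lf t u w"
        unfolding S_ln[OF w v] S_ln[OF w u(2)] using v
        by (simp add: u_def matrix_vector_mult_scaleR divide_inverse mult.commute)
    qed
    then show "real n * (\<epsilon> / 2) \<le> ES lf n t v" using unit[OF u(1), of t] by (simp only:)
  qed
qed

text \<open>For determinant one the projective derivative is \<open>exp (- 2 * S lf t v w)\<close>,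
  so its power \<open>\<sigma> / 2\<close> is the exponential moment, which decays because the means
  of \<open>lf\<close> grow at a positive rate.\<close>

lemma nondeg_contracting:
  assumes nd: "nondeg len \<Theta> C \<xi> p"
  shows "contracting k \<theta> \<nu> B"
proof -
  interpret L: observable k \<theta> \<nu> B lf "ln Lam" "2 * Lam\<^sup>2" using observable_ln by (simp add: observable_def)
  obtain n \<epsilon> where n: "n \<ge> 1" "\<epsilon> > 0" "\<And>t v. v \<noteq> 0 \<Longrightarrow> real n * \<epsilon> \<le> ES lf n t v"
    using nondeg_expanding[OF nd] by blast
  have e2: "\<epsilon> / 2 > 0" using n(2) by simp
  obtain \<sigma> C1 where \<sigma>: "0 < \<sigma>" "\<sigma> \<le> 1" "0 < C1"
    and mom: "\<And>n t v. v \<noteq> 0 \<Longrightarrow> E n (\<lambda>w. exp (- \<sigma> * S lf t v w)) \<le> C1 * exp (- \<sigma> * (\<epsilon> - \<epsilon> / 2) * real n)"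
    using moment_bound[of lf "ln Lam" n \<epsilon> "\<epsilon> / 2", OF L.f_bound n(1) n(3) e2] by blast
  have "(\<lambda>m. C1 * exp (- \<sigma> * \<epsilon> / 2) ^ m) \<longlonglongrightarrow> C1 * 0"
    using \<sigma> n(2) by (intro tendsto_intros LIMSEQ_realpow_zero) auto
  then have "eventually (\<lambda>m. C1 * exp (- \<sigma> * \<epsilon> / 2) ^ m < 1/2) sequentially"
    by (intro order_tendstoD(2)) auto
  then obtain m where m: "C1 * exp (- \<sigma> * \<epsilon> / 2) ^ m < 1/2" unfolding eventually_sequentially by blast
  have "E m (\<lambda>w. (\<bar>det (M t w)\<bar> * (norm v)\<^sup>2 / (norm (M t w *v v))\<^sup>2) powr (\<sigma> / 2)) \<le> 1/2" if v: "v \<noteq> 0" for t v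
  proof -
    have "E m (\<lambda>w. (\<bar>det (M t w)\<bar> * (norm v)\<^sup>2 / (norm (M t w *v v))\<^sup>2) powr (\<sigma> / 2)) = E m (\<lambda>w. exp (- \<sigma> * S lf t v w))"
    proof (rule EW_cong)
      fix w assume w: "w \<in> words k m"
      have nz: "norm (M t w *v v) > 0" using M_nz[OF w v] by simp
      define y where "y = norm (M t w *v v) / norm v"
      have y: "y > 0" using nz v by (simp add: y_def)
      have "\<bar>det (M t w)\<bar> * (norm v)\<^sup>2 / (norm (M t w *v v))\<^sup>2 = exp (- 2 * ln y)"
      proof -
        have "exp (- 2 * ln y) = 1 / y\<^sup>2"
          using y exp_double[of "ln y"] by (simp add: exp_minus divide_inverse)
        then show ?thesis using nz v by (simp add: M_SL[OF w] y_def power_divide)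
      qed
      then show "(\<bar>det (M t w)\<bar> * (norm v)\<^sup>2 / (norm (M t w *v v))\<^sup>2) powr (\<sigma> / 2) = exp (- \<sigma> * S lf t v w)"
        unfolding S_ln[OF w v] y_def[symmetric] by (simp add: powr_def)
    qed
    also have "\<dots> \<le> C1 * exp (- \<sigma> * (\<epsilon> - \<epsilon> / 2) * real m)" by (rule mom[OF v])
    also have "\<dots> = C1 * exp (- \<sigma> * \<epsilon> / 2) ^ m" by (simp add: exp_of_nat_mult[symmetric] mult_ac)
    finally show ?thesis using m by simp
  qed
  then show ?thesis
    unfolding contracting_def using \<sigma> by (intro exI[of _ m] exI[of _ "\<sigma> / 2"] exI[of _ "1/2"]) auto
qed

end

subsection \<open>Loops\<close>

lemma adj2_diff: "adj2 (A - B) = adj2 A - adj2 B"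
  by (intro mat2_eqI) simp_all

lemma continuous_on_adj2 [continuous_intros]:
  "continuous_on S f \<Longrightarrow> continuous_on S (\<lambda>x. adj2 (f x))"
proof -
  assume f: "continuous_on S f"
  have eq: "adj2 M = (\<chi> i j. if i = j then (if i = 1 then M$2$2 else M$1$1) else - M$i$j)" for M
    by (rule mat2_eqI) simp_all
  have "continuous_on S (\<lambda>x. if i = j then (if i = 1 then f x$2$2 else f x$1$1) else - f x$i$j)" for i j
    by (cases "i = j"; cases "i = 1") (auto intro!: continuous_intros f)
  then show ?thesis unfolding eq by (intro continuous_on_vec_lambda)
qed

lemma continuous_on_mm2 [continuous_intros]:
  fixes f g :: "'a::topological_space \<Rightarrow> real^2^2"
  shows "continuous_on S f \<Longrightarrow> continuous_on S g \<Longrightarrow> continuous_on S (\<lambda>x. f x ** g x)"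
  unfolding matrix_matrix_mult_def by (intro continuous_on_vec_lambda continuous_intros)

lemma continuous_on_mv2 [continuous_intros]:
  fixes f :: "'a::topological_space \<Rightarrow> real^2^2"
  shows "continuous_on S f \<Longrightarrow> continuous_on S g \<Longrightarrow> continuous_on S (\<lambda>x. f x *v g x)"
  unfolding matrix_vector_mult_def by (intro continuous_on_vec_lambda continuous_intros)

text \<open>A perturbation of norm below 1 moves the image of \<open>x\<close> by at most
  \<open>norm x\<close>, which is the distance between the margins 2 and 1; adjugates are perturbed
  by the same amount.\<close>

lemma cert_mono:
  assumes "cert 2 g h" "norm (g' - g) < 1" "norm (h' - h) < 1"
  shows "cert 1 g' h'"
  unfolding cert_def
proof (intro allI impI)
  fix x :: "real^2" assume x: "x \<noteq> 0"
  have *: "norm (g *v x) \<le> 2 * norm x" if "norm (g' *v x) \<le> 1 * norm x" "norm (g' - g) < 1" for g g' :: "real^2^2"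
  proof -
    have "norm (g *v x) \<le> norm (g' *v x) + norm ((g' - g) *v x)"
      using norm_triangle_ineq4[of "g' *v x" "(g' - g) *v x"] by (simp add: matrix_vector_mult_diff_rdistrib)
    moreover have "norm ((g' - g) *v x) \<le> norm (g' - g) * norm x" by (rule mv_norm_le)
    moreover have "\<dots> \<le> 1 * norm x" using that(2) by (intro mult_right_mono) auto
    ultimately show ?thesis using that(1) by simp
  qed
  have adj: "norm (adj2 g' - adj2 g) < 1" "norm (adj2 h' - adj2 h) < 1"
    using assms(2,3) unfolding adj2_diff[symmetric] by simp_all
  have "(of_bool (norm (g' *v x) \<le> 1 * norm x) + of_bool (norm (adj2 g' *v x) \<le> 1 * norm x)
      + of_bool (norm (h' *v x) \<le> 1 * norm x) + of_bool (norm (adj2 h' *v x) \<le> 1 * norm x) :: real)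
    \<le> of_bool (norm (g *v x) \<le> 2 * norm x) + of_bool (norm (adj2 g *v x) \<le> 2 * norm x)
      + of_bool (norm (h *v x) \<le> 2 * norm x) + of_bool (norm (adj2 h *v x) \<le> 2 * norm x)"
    using *[OF _ assms(2)] *[OF _ assms(3)] *[OF _ adj(1)] *[OF _ adj(2)] by (intro add_mono) auto
  also have "\<dots> \<le> 1" using assms(1) x unfolding cert_def by blast
  finally show "(of_bool (norm (g' *v x) \<le> 1 * norm x) + of_bool (norm (adj2 g' *v x) \<le> 1 * norm x)
      + of_bool (norm (h' *v x) \<le> 1 * norm x) + of_bool (norm (adj2 h' *v x) \<le> 1 * norm x) :: real) \<le> 1" .
qed

text \<open>The letter \<open>b\<close> at position \<open>i\<close> among three letters
  \<open>a\<close>. Letter counts do not depend on \<open>i\<close>, while \<open>b\<close> is read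
  at the fibre shifted by \<open>i * \<theta> a\<close>.\<close>

definition uword :: "nat \<Rightarrow> nat \<Rightarrow> nat \<Rightarrow> nat list" where
  "uword a b i = replicate i a @ [b] @ replicate (3 - i) a"

locale two_letters = SL_cocycle +
  fixes a b :: nat
  assumes ab: "a \<noteq> b" "a \<in> set_pmf \<nu>" "b \<in> set_pmf \<nu>" and irr: "\<theta> a \<notin> \<rat>"
begin

lemma ab_k: "a \<le> k" "b \<le> k"
  using ab supp by auto

lemma replicate_words: "replicate j a \<in> words k j"
  using ab_k by (auto simp: words_def)

lemma uword_words: "i \<le> 3 \<Longrightarrow> uword a b i \<in> words k 4"
  using ab_k by (auto simp: words_def uword_def)

lemma wt_replicate: "wt \<nu> (replicate j a) = pmf \<nu> a ^ j"
  by (simp add: wt_def)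

abbreviation "U i t \<equiv> M t (uword a b i)"
definition "X i t = adj2 (U 0 t) ** U i t"

lemma M_cont: "w \<in> words k n \<Longrightarrow> continuous_on UNIV (\<lambda>t. M t w)"
proof (induction w arbitrary: n)
  case (Cons i w)
  then have i: "i \<le> k" and w: "w \<in> words k (n - 1)" by (auto simp: words_def)
  have "continuous_on UNIV (\<lambda>t. M (t + \<theta> i) w)"
    by (rule continuous_on_compose2[OF Cons.IH[OF w]]) (auto intro!: continuous_intros)
  then show ?case using B_cont[OF i] by (auto intro!: continuous_intros)
qed simp

lemma U_SL: "i \<le> 3 \<Longrightarrow> det (U i t) = 1"
  by (rule M_SL[OF uword_words])

lemma X_SL: "i \<le> 3 \<Longrightarrow> det (X i t) = 1"
  using U_SL by (simp add: X_def det_mul)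

lemma U_X: "U 0 t ** X i t = U i t"
  unfolding X_def matrix_mul_assoc using adj2_right[OF U_SL[of 0]] by simp

text \<open>Stands for the group words in \<open>X 1\<close>, \<open>X 2\<close>, \<open>X 3\<close>
  and records only what is needed of them: displacements are controlled by those of the
  \<open>X i\<close>, uniformly in the fibre, and a common eigenline of the \<open>X i\<close> is an
  eigenline.\<close>

definition loop :: "(real \<Rightarrow> real^2^2) \<Rightarrow> bool" where
  "loop g \<longleftrightarrow> continuous_on UNIV g \<and> (\<forall>t. det (g t) = 1) \<and>
     (\<exists>K\<ge>0. \<forall>t f. L2 f \<longrightarrow> disp f (g t) \<le> K * (\<Sum>i\<in>{1..3}. disp f (X i t))) \<and>
     (\<forall>t v. v \<noteq> 0 \<longrightarrow> (\<forall>i\<in>{1..3}. cross (X i t *v v) v = 0) \<longrightarrow> cross (g t *v v) v = 0)"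

lemma loop_X:
  assumes "i \<in> {1..3}"
  shows "loop (X i)"
  unfolding loop_def
proof (intro conjI allI impI)
  show "continuous_on UNIV (X i)"
    unfolding X_def[abs_def] by (intro continuous_intros M_cont[OF uword_words]) (use assms in auto)
  show "det (X i t) = 1" for t using X_SL assms by auto
  have "disp f (X i t) \<le> 1 * (\<Sum>i\<in>{1..3}. disp f (X i t))" for f t
    using assms member_le_sum[of i "{1..3}" "\<lambda>i. disp f (X i t)"] by (simp add: disp_def)
  then show "\<exists>K\<ge>0. \<forall>t f. L2 f \<longrightarrow> disp f (X i t) \<le> K * (\<Sum>i\<in>{1..3}. disp f (X i t))"
    by (intro exI[of _ 1]) auto
qed (use assms in auto)

lemma eigenline:
  assumes "cross (g *v v) v = 0" "v \<noteq> 0"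
  obtains c where "g *v v = c *\<^sub>R v"
proof
  show "g *v v = slope v (g *v v) *\<^sub>R v"
    using slope_decomp[OF assms(2), of "g *v v"] assms(1) cross_swap[of "g *v v" v] by simp
qed

lemma loop_mult:
  assumes g: "loop g" and h: "loop h"
  shows "loop (\<lambda>t. g t ** h t)"
  unfolding loop_def
proof (intro conjI allI impI)
  have dg: "\<And>t. det (g t) = 1" and dh: "\<And>t. det (h t) = 1" using g h by (auto simp: loop_def)
  show "continuous_on UNIV (\<lambda>t. g t ** h t)" using g h by (auto simp: loop_def intro!: continuous_intros)
  show "det (g t ** h t) = 1" for t using dg dh by (simp add: det_mul)
  obtain K1 where K1: "K1 \<ge> 0" "\<And>t f. L2 f \<Longrightarrow> disp f (g t) \<le> K1 * (\<Sum>i\<in>{1..3}. disp f (X i t))" using g by (auto simp: loop_def)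
  obtain K2 where K2: "K2 \<ge> 0" "\<And>t f. L2 f \<Longrightarrow> disp f (h t) \<le> K2 * (\<Sum>i\<in>{1..3}. disp f (X i t))" using h by (auto simp: loop_def)
  have "disp f (g t ** h t) \<le> (2 * K1 + 2 * K2) * (\<Sum>i\<in>{1..3}. disp f (X i t))" if "L2 f" for t f
    using disp_mult[OF that dg dh, of t t] K1(2)[OF that, of t] K2(2)[OF that, of t] by (simp add: algebra_simps)
  then show "\<exists>K\<ge>0. \<forall>t f. L2 f \<longrightarrow> disp f (g t ** h t) \<le> K * (\<Sum>i\<in>{1..3}. disp f (X i t))"
    using K1(1) K2(1) by (intro exI[of _ "2 * K1 + 2 * K2"]) auto
  fix t v assume v: "v \<noteq> (0::real^2)" and X: "\<forall>i\<in>{1..3}. cross (X i t *v v) v = 0"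
  have "cross (h t *v v) v = 0" "cross (g t *v v) v = 0" using g h v X by (auto simp: loop_def)
  then obtain c where "h t *v v = c *\<^sub>R v" using eigenline v by metis
  then have "(g t ** h t) *v v = c *\<^sub>R (g t *v v)" by (simp add: matrix_vector_mul_assoc[symmetric] matrix_vector_mult_scaleR)
  then show "cross ((g t ** h t) *v v) v = 0" using \<open>cross (g t *v v) v = 0\<close> by (simp add: cross_scale)
qed

lemma loop_adj2:
  assumes g: "loop g"
  shows "loop (\<lambda>t. adj2 (g t))"
  unfolding loop_def
proof (intro conjI allI impI)
  have dg: "\<And>t. det (g t) = 1" using g by (auto simp: loop_def)
  show "continuous_on UNIV (\<lambda>t. adj2 (g t))" using g by (auto simp: loop_def intro!: continuous_intros)
  show "det (adj2 (g t)) = 1" for t using dg by simp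
  show "\<exists>K\<ge>0. \<forall>t f. L2 f \<longrightarrow> disp f (adj2 (g t)) \<le> K * (\<Sum>i\<in>{1..3}. disp f (X i t))"
    using g dg by (auto simp: loop_def disp_adj2)
  fix t v assume v: "v \<noteq> (0::real^2)" and X: "\<forall>i\<in>{1..3}. cross (X i t *v v) v = 0"
  have "cross (g t *v v) v = 0" using g v X by (auto simp: loop_def)
  moreover have "cross (g t *v (adj2 (g t) *v v)) (g t *v v) = cross (adj2 (g t) *v v) v"
    unfolding cross_mv using dg by simp
  moreover have "g t *v (adj2 (g t) *v v) = v" using adj2_right[OF dg] by (simp add: matrix_vector_mul_assoc)
  ultimately show "cross (adj2 (g t) *v v) v = 0" using cross_swap[of v "g t *v v"] by simp
qed

text \<open>By continuity the certificate persists with margin 1 on a closed interval around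
  \<open>t0\<close>. There \<open>cert_gap\<close> and the displacement bounds of loops give
  \<open>C\<close>; \<open>\<xi>\<close> is the minimum of a continuous function over fibres and
  unit vectors, positive because a common eigenline is excluded.\<close>

lemma window:
  assumes g: "loop g" and h: "loop h" and c: "cert 2 (g t0) (h t0)"
  obtains \<eta> C \<xi> where "\<eta> > 0" "C > 0" "\<xi> > 0"
    "\<And>t f z. \<bar>t - of_int z - t0\<bar> < \<eta> \<Longrightarrow> L2 f \<Longrightarrow> nsq f \<le> C * (\<Sum>i\<in>{1..3}. nsq (\<lambda>x. f (U i t *v x) - f (U 0 t *v x)))"
    "\<And>t v z. \<bar>t - of_int z - t0\<bar> < \<eta> \<Longrightarrow> norm v = 1 \<Longrightarrow> \<xi> \<le> (\<Sum>i\<in>{1..3}. (cross (U i t *v v) (U 0 t *v v))\<^sup>2)"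
proof -
  interpret L: observable k \<theta> \<nu> B lf "ln Lam" "2 * Lam\<^sup>2" using observable_ln by (simp add: observable_def)
  have per: "U i (t + of_int z) = U i t" if "i \<le> 3" for i t z by (rule L.M_per[OF uword_words[OF that]])
  have dg: "\<And>t. det (g t) = 1" "\<And>t. det (h t) = 1" using g h by (auto simp: loop_def)
  have "\<exists>d>0. \<forall>t. \<bar>t - t0\<bar> < d \<longrightarrow> norm (g t - g t0) < 1" if "loop g" for g
  proof -
    have "continuous (at t0) g" using that by (auto simp: loop_def continuous_on_eq_continuous_at)
    then show ?thesis unfolding continuous_at_eps_delta dist_norm by (auto dest: spec[of _ 1])
  qed
  then obtain d1 d2 where d: "d1 > 0" "d2 > 0" "\<And>t. \<bar>t - t0\<bar> < d1 \<Longrightarrow> norm (g t - g t0) < 1" "\<And>t. \<bar>t - t0\<bar> < d2 \<Longrightarrow> norm (h t - h t0) < 1"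
    using g h by metis
  define \<eta> where "\<eta> = min d1 d2 / 2"
  have \<eta>: "\<eta> > 0" using d by (simp add: \<eta>_def)
  have cert1: "cert 1 (g t) (h t)" if "\<bar>t - t0\<bar> \<le> \<eta>" for t
    using that d by (intro cert_mono[OF c] d) (auto simp: \<eta>_def)
  obtain K1 where K1: "K1 \<ge> 0" "\<And>t f. L2 f \<Longrightarrow> disp f (g t) \<le> K1 * (\<Sum>i\<in>{1..3}. disp f (X i t))" using g by (auto simp: loop_def)
  obtain K2 where K2: "K2 \<ge> 0" "\<And>t f. L2 f \<Longrightarrow> disp f (h t) \<le> K2 * (\<Sum>i\<in>{1..3}. disp f (X i t))" using h by (auto simp: loop_def)
  define C where "C = 8 * (K1 + K2) + 1"
  have C: "C > 0" using K1 K2 by (simp add: C_def)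
  have gap: "nsq f \<le> C * (\<Sum>i\<in>{1..3}. nsq (\<lambda>x. f (U i t *v x) - f (U 0 t *v x)))"
    if t: "\<bar>t - t0\<bar> \<le> \<eta>" and f: "L2 f" for t f
  proof -
    \<comment> \<open>Composition with \<open>U 0 t\<close> turns the displacement of
      \<open>f'\<close> under \<open>X i t\<close> into the difference of \<open>f\<close> along
      \<open>U i t\<close> and \<open>U 0 t\<close>.\<close>
    define f' where "f' x = f (U 0 t *v x)" for x
    have f': "L2 f'" unfolding f'_def[abs_def] by (rule L2_comp[OF U_SL f]) simp
    have "nsq f = nsq f'" unfolding f'_def[abs_def] by (rule nsq_comp[OF U_SL f, symmetric]) simp
    also have "\<dots> \<le> 8 * (disp f' (g t) + disp f' (h t))" by (rule cert_gap[OF f' dg cert1[OF t]])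
    also have "\<dots> \<le> 8 * (K1 * (\<Sum>i\<in>{1..3}. disp f' (X i t)) + K2 * (\<Sum>i\<in>{1..3}. disp f' (X i t)))"
      using K1(2)[OF f'] K2(2)[OF f'] by (intro mult_left_mono add_mono) auto
    also have "\<dots> \<le> C * (\<Sum>i\<in>{1..3}. disp f' (X i t))"
    proof -
      have "0 \<le> (\<Sum>i\<in>{1..3}. disp f' (X i t))" by (intro sum_nonneg) (simp add: disp_def)
      then show ?thesis by (simp add: C_def algebra_simps)
    qed
    also have "(\<Sum>i\<in>{1..3}. disp f' (X i t)) = (\<Sum>i\<in>{1..3}. nsq (\<lambda>x. f (U i t *v x) - f (U 0 t *v x)))"
      by (intro sum.cong refl) (simp add: disp_def f'_def matrix_vector_mul_assoc U_X)
    finally show ?thesis .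
  qed
  define G where "G = (\<lambda>p::real \<times> (real^2). \<Sum>i\<in>{1..3}. (cross (U i (fst p) *v snd p) (U 0 (fst p) *v snd p))\<^sup>2)"
  have Gc: "continuous_on UNIV G"
  proof -
    have "continuous_on UNIV (\<lambda>p::real \<times> (real^2). U i (fst p))" if "i \<le> 3" for i
      by (intro continuous_on_compose2[OF M_cont[OF uword_words[OF that]]] continuous_intros) auto
    then show ?thesis unfolding G_def cross_def by (intro continuous_intros continuous_on_component) auto
  qed
  define D where "D = {t0 - \<eta>..t0 + \<eta>} \<times> sphere (0::real^2) 1"
  have Dc: "compact D" unfolding D_def by (intro compact_Times) auto
  have "(t0, axis 1 1) \<in> D" using \<eta> by (simp add: D_def norm_axis_1)
  then have Dne: "D \<noteq> {}" by blast
  obtain q where q: "q \<in> D" "\<And>p. p \<in> D \<Longrightarrow> G q \<le> G p"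
    using continuous_attains_inf[OF Dc Dne continuous_on_subset[OF Gc subset_UNIV]] by blast
  have Gq: "G q > 0"
  proof (rule ccontr)
    assume "\<not> G q > 0"
    then have "G q \<le> 0" by simp
    then have z: "(cross (U i (fst q) *v snd q) (U 0 (fst q) *v snd q))\<^sup>2 = 0" if "i \<in> {1..3}" for i
      using that member_le_sum[of i "{1..3}" "\<lambda>i. (cross (U i (fst q) *v snd q) (U 0 (fst q) *v snd q))\<^sup>2"]
      unfolding G_def by (smt (verit) zero_le_power2 finite_atLeastAtMost)
    define t v where "t = fst q" and "v = snd q"
    have v: "v \<noteq> 0" and t: "\<bar>t - t0\<bar> \<le> \<eta>" using q(1) by (auto simp: D_def t_def v_def)
    have "cross (X i t *v v) v = 0" if i: "i \<in> {1..3}" for i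
    proof -
      have "cross (U 0 t *v (X i t *v v)) (U 0 t *v v) = 0"
        using z[OF i] by (simp add: t_def v_def matrix_vector_mul_assoc U_X)
      then show ?thesis unfolding cross_mv using U_SL[of 0 t] by simp
    qed
    then have "cross (g t *v v) v = 0" "cross (h t *v v) v = 0" using g h v by (auto simp: loop_def)
    then show False using cert_no_common_line[OF cert1[OF t] dg v] by simp
  qed
  have cr: "G q \<le> (\<Sum>i\<in>{1..3}. (cross (U i t *v v) (U 0 t *v v))\<^sup>2)" if "\<bar>t - t0\<bar> \<le> \<eta>" "norm v = 1" for t v
  proof -
    have "t0 - \<eta> \<le> t" "t \<le> t0 + \<eta>" using that(1) by linarith+
    then have "(t, v) \<in> D" using that(2) by (simp add: D_def)
    then show ?thesis using q(2)[of "(t, v)"] by (simp add: G_def)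
  qed
  have sh: "U i t = U i (t - of_int z)" if "i \<le> 3" for i t z using per[OF that, of "t - of_int z" z] by simp
  show thesis
  proof (rule that[OF \<eta> C Gq])
    fix t f z assume t: "\<bar>t - of_int z - t0\<bar> < \<eta>" and f: "L2 f"
    show "nsq f \<le> C * (\<Sum>i\<in>{1..3}. nsq (\<lambda>x. f (U i t *v x) - f (U 0 t *v x)))"
      using gap[OF less_imp_le[OF t] f] sh[of _ t z] by simp
  next
    fix t z and v :: "real^2" assume t: "\<bar>t - of_int z - t0\<bar> < \<eta>" and v: "norm v = 1"
    show "G q \<le> (\<Sum>i\<in>{1..3}. (cross (U i t *v v) (U 0 t *v v))\<^sup>2)"
      using cr[OF less_imp_le[OF t] v] sh[of _ t z] by simp
  qed
qed

text \<open>The distinguished words are padded by \<open>j\<close> letters \<open>a\<close> in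
  front, which lead from the given fibre into the window, and by \<open>J - j\<close> letters
  \<open>a\<close> behind, so that length, weight and total rotation do not depend on the start
  fibre.\<close>

lemma cert_contracting:
  assumes g: "loop g" and h: "loop h" and c: "cert 2 (g t0) (h t0)"
  shows "contracting k \<theta> \<nu> B"
proof -
  obtain \<eta> C \<xi> where \<eta>: "\<eta> > 0" "C > 0" "\<xi> > 0"
    and gap: "\<And>t f z. \<bar>t - of_int z - t0\<bar> < \<eta> \<Longrightarrow> L2 f \<Longrightarrow> nsq f \<le> C * (\<Sum>i\<in>{1..3}. nsq (\<lambda>x. f (U i t *v x) - f (U 0 t *v x)))"
    and cr: "\<And>t v z. \<bar>t - of_int z - t0\<bar> < \<eta> \<Longrightarrow> norm v = 1 \<Longrightarrow> \<xi> \<le> (\<Sum>i\<in>{1..3}. (cross (U i t *v v) (U 0 t *v v))\<^sup>2)"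
    using window[OF assms] by blast
  obtain J :: nat where J: "\<And>s t. \<exists>j\<le>J. \<exists>z::int. \<bar>s + real j * \<theta> a - of_int z - t\<bar> < \<eta>"
    using irrational_orbit_dense[OF irr \<eta>(1)] by blast
  define p where "p = pmf \<nu> a ^ (J + 3) * pmf \<nu> b"
  define \<Theta> where "\<Theta> = real (J + 3) * \<theta> a + \<theta> b"
  \<comment> \<open>The prefix shrinks unit vectors at most by the factor \<open>Lam ^ J\<close>,
    and squared cross products are homogeneous of degree four.\<close>
  define \<xi>' where "\<xi>' = \<xi> / (Lam ^ J) ^ 4"
  have p: "p > 0" using ab by (simp add: p_def pmf_positive)
  have LJ: "Lam ^ J \<ge> 1" using Lam_ge_1 by simp
  have "Lam > 0" using Lam_ge_1 by simp
  then have \<xi>': "\<xi>' > 0" using \<eta>(3) by (simp add: \<xi>'_def)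
  have "nondeg (J + 4) \<Theta> C \<xi>' p"
    unfolding nondeg_def
  proof (intro conjI allI)
    fix s
    obtain j z where j: "j \<le> J" "\<bar>s + real j * \<theta> a - of_int z - t0\<bar> < \<eta>" using J by blast
    define \<tau> where "\<tau> = s + real j * \<theta> a"
    define w where "w i = replicate j a @ uword a b i @ replicate (J - j) a" for i
    define P where "P = M s (replicate j a)"
    define R where "R = M (\<tau> + 3 * \<theta> a + \<theta> b) (replicate (J - j) a)"
    have PSL: "det P = 1" and RSL: "det R = 1" unfolding P_def R_def by (rule M_SL[OF replicate_words])+
    have T1: "T s (replicate j a) = \<tau>" by (simp add: wend_def sum_list_replicate \<tau>_def)
    have T2: "T \<tau> (uword a b i) = \<tau> + 3 * \<theta> a + \<theta> b" if "i \<le> 3" for i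
      using that by (simp add: wend_def sum_list_replicate uword_def of_nat_diff algebra_simps)
    have Mw: "M s (w i) *v v = R *v (U i \<tau> *v (P *v v))" if "i \<le> 3" for i v
      unfolding w_def M_append_mv T1 T2[OF that] by (simp add: P_def R_def)
    have one: "w i \<in> words k (J + 4) \<and> wt \<nu> (w i) = p \<and> sum_list (map \<theta> (w i)) = \<Theta>" if i: "i \<le> 3" for i
    proof (intro conjI)
      show "w i \<in> words k (J + 4)" using ab_k j i by (auto simp: words_def w_def uword_def)
      have e: "j + (i + (3 - i + (J - j))) = J + 3" using i j by simp
      have "wt \<nu> (w i) = pmf \<nu> b * (pmf \<nu> a ^ (j + (i + (3 - i + (J - j)))))"
        by (simp add: w_def uword_def wt_replicate power_add mult_ac)
      then show "wt \<nu> (w i) = p" unfolding e by (simp add: p_def)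
      show "sum_list (map \<theta> (w i)) = \<Theta>" using i j
        by (simp add: w_def uword_def sum_list_replicate \<Theta>_def of_nat_diff algebra_simps)
    qed
    have inj: "inj_on w {..3}"
    proof (rule inj_onI)
      fix i i' :: nat assume eq: "w i = w i'"
      \<comment> \<open>The number of leading letters \<open>a\<close> is \<open>j + i\<close>, from
        which \<open>i\<close> is recovered.\<close>
      have tw: "length (takeWhile (\<lambda>x. x = a) (w i)) = j + i" for i
        using ab(1) by (simp add: w_def uword_def takeWhile_append)
      have "j + i = j + i'" using tw[of i] tw[of i'] unfolding eq by (rule trans[OF sym])
      then show "i = i'" by (rule add_left_imp_eq)
    qed
    have gp: "nsq f \<le> C * (\<Sum>i\<in>{1..3}. nsq (\<lambda>x. f (M s (w i) *v x) - f (M s (w 0) *v x)))" if f: "L2 f" for f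
    proof -
      \<comment> \<open>The suffix acts by the same \<open>R\<close> for all four words and is
        absorbed into the function; the prefix \<open>P\<close> is a change of variables that
        preserves \<open>nsq\<close>.\<close>
      define f' where "f' x = f (R *v x)" for x
      have f': "L2 f'" unfolding f'_def[abs_def] by (rule L2_comp[OF RSL f])
      have "nsq f = nsq f'" unfolding f'_def[abs_def] by (rule nsq_comp[OF RSL f, symmetric])
      also have "\<dots> \<le> C * (\<Sum>i\<in>{1..3}. nsq (\<lambda>x. f' (U i \<tau> *v x) - f' (U 0 \<tau> *v x)))"
        using gap[OF _ f'] j(2) unfolding \<tau>_def by blast
      also have "(\<Sum>i\<in>{1..3}. nsq (\<lambda>x. f' (U i \<tau> *v x) - f' (U 0 \<tau> *v x)))
          = (\<Sum>i\<in>{1..3}. nsq (\<lambda>x. f (M s (w i) *v x) - f (M s (w 0) *v x)))"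
      proof (intro sum.cong refl)
        fix i :: nat assume "i \<in> {1..3}"
        then have i: "i \<le> 3" by simp
        have "L2 (\<lambda>x. f' (U i \<tau> *v x) - f' (U 0 \<tau> *v x))"
          using L2_diff[OF L2_comp[OF U_SL[OF i] f'] L2_comp[OF U_SL[of 0] f']] by simp
        from nsq_comp[OF PSL this] show "nsq (\<lambda>x. f' (U i \<tau> *v x) - f' (U 0 \<tau> *v x)) = nsq (\<lambda>x. f (M s (w i) *v x) - f (M s (w 0) *v x))"
          by (simp add: Mw[OF i] Mw[of 0] f'_def)
      qed
      finally show ?thesis .
    qed
    have cp: "\<xi>' \<le> (\<Sum>i\<in>{1..3}. (cross (M s (w i) *v v) (M s (w 0) *v v))\<^sup>2)" if v: "norm v = 1" for v
    proof -
      define v' where "v' = P *v v"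
      define u where "u = v' /\<^sub>R norm v'"
      have "1 \<le> Lam ^ j * norm v'" using M_bounds(2)[OF replicate_words, of v j s] v by (simp add: v'_def P_def)
      also have "\<dots> \<le> Lam ^ J * norm v'" using j(1) Lam_ge_1 by (intro mult_right_mono power_increasing) auto
      finally have nv: "1 / Lam ^ J \<le> norm v'" using LJ by (simp add: field_simps)
      have v0: "norm v' > 0" using nv LJ by (smt (verit) divide_pos_pos)
      then have u: "norm u = 1" by (simp add: u_def)
      have vu: "v' = norm v' *\<^sub>R u" using v0 by (simp add: u_def)
      have "(\<Sum>i\<in>{1..3}. (cross (M s (w i) *v v) (M s (w 0) *v v))\<^sup>2) = (\<Sum>i\<in>{1..3}. (norm v') ^ 4 * (cross (U i \<tau> *v u) (U 0 \<tau> *v u))\<^sup>2)"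
      proof (intro sum.cong refl)
        fix i :: nat assume "i \<in> {1..3}"
        then have i: "i \<le> 3" by simp
        have "cross (M s (w i) *v v) (M s (w 0) *v v) = cross (U i \<tau> *v v') (U 0 \<tau> *v v')"
          unfolding Mw[OF i] Mw[of 0, simplified] cross_mv[of R] RSL by (simp add: v'_def)
        also have "\<dots> = (norm v')\<^sup>2 * cross (U i \<tau> *v u) (U 0 \<tau> *v u)"
          by (subst (1 2) vu) (simp add: matrix_vector_mult_scaleR cross_scale power2_eq_square)
        finally show "(cross (M s (w i) *v v) (M s (w 0) *v v))\<^sup>2 = (norm v') ^ 4 * (cross (U i \<tau> *v u) (U 0 \<tau> *v u))\<^sup>2"
          by (simp add: power_mult_distrib power_mult[symmetric])
      qed
      also have "\<dots> = (norm v') ^ 4 * (\<Sum>i\<in>{1..3}. (cross (U i \<tau> *v u) (U 0 \<tau> *v u))\<^sup>2)" by (simp add: sum_distrib_left)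
      also have "\<dots> \<ge> (1 / Lam ^ J) ^ 4 * \<xi>"
        using nv LJ \<eta>(3) cr[OF _ u] j(2) unfolding \<tau>_def by (intro mult_mono power_mono) auto
      finally show ?thesis by (simp add: \<xi>'_def power_divide)
    qed
    show "\<exists>w :: nat \<Rightarrow> nat list. (\<forall>i\<le>3. w i \<in> words k (J + 4) \<and> wt \<nu> (w i) = p \<and> sum_list (map \<theta> (w i)) = \<Theta>) \<and>
      inj_on w {..3} \<and> (\<forall>f. L2 f \<longrightarrow> nsq f \<le> C * (\<Sum>i\<in>{1..3}. nsq (\<lambda>x. f (M s (w i) *v x) - f (M s (w 0) *v x)))) \<and>
      (\<forall>v. norm v = 1 \<longrightarrow> \<xi>' \<le> (\<Sum>i\<in>{1..3}. (cross (M s (w i) *v v) (M s (w 0) *v v))\<^sup>2))"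
      using one inj gp cp by (intro exI[of _ w]) blast
  qed (use p \<eta> \<xi>' in auto)
  then show ?thesis by (rule nondeg_contracting)
qed

end

subsection \<open>Perturbing pairs and triples of matrices\<close>

definition tr2 :: "real^2^2 \<Rightarrow> real" where
  "tr2 M = M$1$1 + M$2$2"

text \<open>Nilpotency, by the Cayley-Hamilton theorem.\<close>

definition nil2 :: "real^2^2 \<Rightarrow> bool" where
  "nil2 N \<longleftrightarrow> tr2 N = 0 \<and> det N = 0"

lemma tr2_commute: "tr2 (A ** B) = tr2 (B ** A)"
  by (simp add: tr2_def mm2 algebra_simps)

lemma det_unipotent: "nil2 N \<Longrightarrow> det (mat 1 + c *\<^sub>R N) = 1"
proof -
  assume "nil2 N"
  then have 1: "N$2$2 = - N$1$1" "N$1$1 * N$2$2 = N$1$2 * N$2$1" by (auto simp: nil2_def tr2_def det_2)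
  have "det (mat 1 + c *\<^sub>R N) = 1 + c * (N$1$1 + N$2$2) + c * c * (N$1$1 * N$2$2 - N$1$2 * N$2$1)"
    by (simp add: det_2 algebra_simps)
  then show ?thesis using 1 by simp
qed

section \<open>Hyperbolic matrices and ping-pong\<close>

definition mpow :: "real^2^2 \<Rightarrow> nat \<Rightarrow> real^2^2" where
  "mpow Z n = (((**) Z) ^^ n) (mat 1)"

lemma mpow_simps [simp]: "mpow Z 0 = mat 1" "mpow Z (Suc n) = Z ** mpow Z n"
  by (simp_all add: mpow_def)

lemma det_mpow: "det Z = 1 \<Longrightarrow> det (mpow Z n) = 1"
  by (induction n) (simp_all add: det_mul)

lemma mpow_eigen: "Z *v e = c *\<^sub>R e \<Longrightarrow> mpow Z n *v e = c ^ n *\<^sub>R e"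
  by (induction n) (simp_all add: matrix_vector_mul_assoc[symmetric] matrix_vector_mult_scaleR)

lemma adj2_eigen:
  assumes "det g = 1" "g *v e = c *\<^sub>R e" "c \<noteq> 0"
  shows "adj2 g *v e = (1 / c) *\<^sub>R e"
proof -
  have "c *\<^sub>R (adj2 g *v e) = e"
    using adj2_left[OF assms(1)] arg_cong[OF assms(2), of "(*v) (adj2 g)"]
    by (simp add: matrix_vector_mul_assoc matrix_vector_mult_scaleR)
  then have "(1 / c) *\<^sub>R (c *\<^sub>R (adj2 g *v e)) = (1 / c) *\<^sub>R e" by simp
  then show ?thesis using assms(3) by simp
qed

lemma eigenvector_ex:
  assumes "det Z = 1" "\<mu>\<^sup>2 - tr2 Z * \<mu> + 1 = 0"
  shows "\<exists>e. e \<noteq> 0 \<and> Z *v e = \<mu> *\<^sub>R e"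
proof -
  have "det (Z - \<mu> *\<^sub>R mat 1) = 0"
    using assms by (simp add: det_2 tr2_def power2_eq_square algebra_simps)
  then obtain e where "e \<noteq> 0" "(Z - \<mu> *\<^sub>R mat 1) *v e = 0"
    using matrix_left_invertible_ker[of "Z - \<mu> *\<^sub>R mat 1"] invertible_det_nz[of "Z - \<mu> *\<^sub>R mat 1"]
    by (auto simp: invertible_left_inverse)
  moreover have "(Z - \<mu> *\<^sub>R mat 1) *v e = Z *v e - \<mu> *\<^sub>R e"
    by (simp add: vec_eq_iff forall_2 mv2 algebra_simps)
  ultimately show ?thesis by auto
qed

lemma hyperbolic_eigenvectors:
  assumes Z: "det Z = 1" and tr: "\<bar>tr2 Z\<bar> > 2"
  obtains l e f where "\<bar>l\<bar> > 1" "Z *v e = l *\<^sub>R e" "Z *v f = (1 / l) *\<^sub>R f" "cross e f \<noteq> 0"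
proof -
  define t where "t = tr2 Z"
  have t2: "t\<^sup>2 - 4 > 0"
    using tr abs_square_less_1[of "2 / t"] by (simp add: t_def power_divide field_simps)
  define d where "d = sqrt (t\<^sup>2 - 4)"
  have d: "d > 0" "d\<^sup>2 = t\<^sup>2 - 4" using t2 by (auto simp: d_def)
  \<comment> \<open>The sign of the root follows that of the trace, which selects the eigenvalue of
    larger modulus.\<close>
  define l where "l = (if t > 0 then (t + d) / 2 else (t - d) / 2)"
  have l1: "\<bar>l\<bar> > 1" using tr d by (auto simp: l_def t_def)
  have q: "l\<^sup>2 - t * l + 1 = 0" using d(2) by (simp add: l_def power2_eq_square field_simps)
  have l0: "l \<noteq> 0" using l1 by auto
  have "(1 / l)\<^sup>2 - t * (1 / l) + 1 = (l\<^sup>2 - t * l + 1) / l\<^sup>2" using l0 by (simp add: field_simps power2_eq_square)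
  then have q': "(1 / l)\<^sup>2 - t * (1 / l) + 1 = 0" using q by simp
  obtain e where e: "e \<noteq> 0" "Z *v e = l *\<^sub>R e" using eigenvector_ex[OF Z] q unfolding t_def by blast
  obtain f where f: "f \<noteq> 0" "Z *v f = (1 / l) *\<^sub>R f" using eigenvector_ex[OF Z] q' unfolding t_def by blast
  have "cross e f \<noteq> 0"
  proof
    assume "cross e f = 0"
    then have "f = slope e f *\<^sub>R e" using slope_decomp[OF e(1), of f] by simp
    then obtain c where c: "f = c *\<^sub>R e" by blast
    have "Z *v f = l *\<^sub>R f" using e(2) by (simp add: c matrix_vector_mult_scaleR)
    then have "l *\<^sub>R f = (1 / l) *\<^sub>R f" using f(2) by (rule trans[OF sym])
    then have "l = 1 / l" using f(1) scaleR_right_imp_eq by blast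
    then have "l * l = 1" using l0 by (simp add: field_simps)
    moreover have "1 < \<bar>l\<bar> * \<bar>l\<bar>" using l1 by (rule less_1_mult[OF _ l1])
    ultimately show False by (simp add: abs_mult[symmetric])
  qed
  then show thesis using that l1 e(2) f(2) by blast
qed

text \<open>Applying \<open>g\<close> preserves the cross product of \<open>x\<close> with the
  eigenvector \<open>y\<close> but multiplies \<open>y\<close> by \<open>c\<close>. For small
  \<open>c\<close> a vector that is not expanded much must therefore be nearly parallel to
  \<open>y\<close>.\<close>

lemma cone_cross:
  assumes "det g = 1" "g *v y = c *\<^sub>R y" "norm (g *v x) \<le> 2 * norm x"
  shows "\<bar>cross x y\<bar> \<le> 2 * \<bar>c\<bar> * (norm x * norm y)"
proof -
  have "cross x y = cross (g *v x) (g *v y)" using assms(1) by (simp add: cross_mv)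
  also have "\<dots> = c * cross (g *v x) y" unfolding assms(2) by (rule cross_scale)
  finally have "\<bar>cross x y\<bar> = \<bar>c\<bar> * \<bar>cross (g *v x) y\<bar>" by (simp add: abs_mult)
  also have "\<dots> \<le> \<bar>c\<bar> * ((2 * norm x) * norm y)"
    using abs_cross_le[of "g *v x" y] mult_right_mono[OF assms(3) norm_ge_zero[of y]] by (intro mult_left_mono) auto
  finally show ?thesis by simp
qed

text \<open>Two lines close to a third one are close to each other: \<open>cross_decomp\<close>
  expresses \<open>x\<close> times \<open>cross y z\<close> through the two small cross
  products.\<close>

lemma cross_exclusive:
  assumes "\<bar>cross x y\<bar> \<le> \<eta> * (norm x * norm y)" "\<bar>cross x z\<bar> \<le> \<eta> * (norm x * norm z)" "x \<noteq> 0"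
  shows "\<bar>cross y z\<bar> \<le> 2 * \<eta> * (norm y * norm z)"
proof -
  have "\<bar>cross y z\<bar> * norm x = norm (cross x z *\<^sub>R y + cross y x *\<^sub>R z)"
    unfolding cross_decomp[of y z x, symmetric] by simp
  also have "\<dots> \<le> \<bar>cross x z\<bar> * norm y + \<bar>cross x y\<bar> * norm z"
    using norm_triangle_ineq[of "cross x z *\<^sub>R y" "cross y x *\<^sub>R z"] cross_swap[of y x] by simp
  also have "\<dots> \<le> (\<eta> * (norm x * norm z)) * norm y + (\<eta> * (norm x * norm y)) * norm z"
    using assms by (intro add_mono mult_right_mono) auto
  also have "\<dots> = (2 * \<eta> * (norm y * norm z)) * norm x" by (simp add: algebra_simps)
  finally show ?thesis using assms(3) by simp
qed

text \<open>By \<open>cone_cross\<close> the cones of the \<open>n\<close>-th power of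
  \<open>Z\<close>, of its conjugate by \<open>K\<close> and of their inverses shrink to the lines
  of \<open>f\<close>, \<open>e\<close>, \<open>K *v f\<close>, \<open>K *v e\<close>. The
  assumptions make these four lines distinct; \<open>P\<close> lists their six pairs, and
  \<open>n\<close> is large enough to separate all of them.\<close>

lemma hyperbolic_cert:
  assumes Z: "det Z = 1" and K: "det K = 1" and l: "\<bar>l\<bar> > 1"
    and e: "Z *v e = l *\<^sub>R e" and f: "Z *v f = (1 / l) *\<^sub>R f" and ef: "cross e f \<noteq> 0"
    and gen: "cross (K *v e) e \<noteq> 0" "cross (K *v e) f \<noteq> 0" "cross (K *v f) e \<noteq> 0" "cross (K *v f) f \<noteq> 0"
  shows "\<exists>n. cert 2 (mpow Z n) (K ** mpow Z n ** adj2 K)"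
proof -
  have l0: "l \<noteq> 0" using l by auto
  define c where "c n = 1 / \<bar>l\<bar> ^ n" for n
  define P where "P = {(f, e), (f, K *v f), (f, K *v e), (e, K *v f), (e, K *v e), (K *v f, K *v e)}"
  have nz: "cross y z \<noteq> 0" if "(y, z) \<in> P" for y z
    using that gen ef cross_swap[of f e] cross_swap[of "K *v f" f] cross_swap[of "K *v e" f] cross_swap[of "K *v f" e] cross_swap[of "K *v e" e]
      cross_mv[of K f e] K by (auto simp: P_def)
  have lim: "(\<lambda>n. 4 * c n * (norm y * norm z)) \<longlonglongrightarrow> 4 * 0 * (norm y * norm z)" for y z :: "real^2"
    unfolding c_def power_one_over[symmetric] using l by (intro tendsto_intros LIMSEQ_realpow_zero) auto
  have "eventually (\<lambda>n. \<forall>(y, z)\<in>P. 4 * c n * (norm y * norm z) < \<bar>cross y z\<bar>) sequentially"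
  proof -
    have "eventually (\<lambda>n. 4 * c n * (norm y * norm z) < \<bar>cross y z\<bar>) sequentially" if "(y, z) \<in> P" for y z
      by (rule order_tendstoD(2)[OF lim]) (use nz[OF that] in simp)
    then show ?thesis by (intro eventually_ball_finite) (auto simp: P_def)
  qed
  then obtain n where n: "\<And>y z. (y, z) \<in> P \<Longrightarrow> 4 * c n * (norm y * norm z) < \<bar>cross y z\<bar>"
    unfolding eventually_sequentially by fastforce
  define g where "g = mpow Z n"
  define h where "h = K ** g ** adj2 K"
  have dg: "det g = 1" unfolding g_def by (rule det_mpow[OF Z])
  have dh: "det h = 1" using K dg by (simp add: h_def det_mul)
  have KK: "adj2 K *v (K *v x) = x" for x using adj2_left[OF K] by (simp add: matrix_vector_mul_assoc)
  have ge: "g *v e = l ^ n *\<^sub>R e" and gf: "g *v f = (1 / l) ^ n *\<^sub>R f" unfolding g_def using mpow_eigen e f by blast+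
  have he: "h *v (K *v e) = l ^ n *\<^sub>R (K *v e)" and hf: "h *v (K *v f) = (1 / l) ^ n *\<^sub>R (K *v f)"
    by (simp_all add: h_def matrix_vector_mul_assoc[symmetric] KK ge gf matrix_vector_mult_scaleR)
  have age: "adj2 g *v e = (1 / l ^ n) *\<^sub>R e" by (rule adj2_eigen[OF dg ge]) (use l0 in simp)
  have ahe: "adj2 h *v (K *v e) = (1 / l ^ n) *\<^sub>R (K *v e)" by (rule adj2_eigen[OF dh he]) (use l0 in simp)
  have cn: "\<bar>(1 / l) ^ n\<bar> = c n" "\<bar>1 / l ^ n\<bar> = c n" by (simp_all add: c_def power_abs power_one_over)
  have "cert 2 g h"
    unfolding cert_def
  proof (intro allI impI)
    fix x :: "real^2" assume x: "x \<noteq> 0"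
    have dag: "det (adj2 g) = 1" "det (adj2 h) = 1" using dg dh by simp_all
    have 1: "\<bar>cross x f\<bar> \<le> 2 * c n * (norm x * norm f)" if "norm (g *v x) \<le> 2 * norm x"
      using cone_cross[OF dg gf that] unfolding cn .
    have 2: "\<bar>cross x e\<bar> \<le> 2 * c n * (norm x * norm e)" if "norm (adj2 g *v x) \<le> 2 * norm x"
      using cone_cross[OF dag(1) age that] unfolding cn .
    have 3: "\<bar>cross x (K *v f)\<bar> \<le> 2 * c n * (norm x * norm (K *v f))" if "norm (h *v x) \<le> 2 * norm x"
      using cone_cross[OF dh hf that] unfolding cn .
    have 4: "\<bar>cross x (K *v e)\<bar> \<le> 2 * c n * (norm x * norm (K *v e))" if "norm (adj2 h *v x) \<le> 2 * norm x"
      using cone_cross[OF dag(2) ahe that] unfolding cn .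
    have ex: False if "\<bar>cross x y\<bar> \<le> 2 * c n * (norm x * norm y)" "\<bar>cross x z\<bar> \<le> 2 * c n * (norm x * norm z)" "(y, z) \<in> P" for y z
      using cross_exclusive[OF that(1,2) x] n[OF that(3)] by simp
    have "\<not> (norm (g *v x) \<le> 2 * norm x \<and> norm (adj2 g *v x) \<le> 2 * norm x)"
      "\<not> (norm (g *v x) \<le> 2 * norm x \<and> norm (h *v x) \<le> 2 * norm x)"
      "\<not> (norm (g *v x) \<le> 2 * norm x \<and> norm (adj2 h *v x) \<le> 2 * norm x)"
      "\<not> (norm (adj2 g *v x) \<le> 2 * norm x \<and> norm (h *v x) \<le> 2 * norm x)"
      "\<not> (norm (adj2 g *v x) \<le> 2 * norm x \<and> norm (adj2 h *v x) \<le> 2 * norm x)"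
      "\<not> (norm (h *v x) \<le> 2 * norm x \<and> norm (adj2 h *v x) \<le> 2 * norm x)"
      using ex[OF 1 2] ex[OF 1 3] ex[OF 1 4] ex[OF 2 3] ex[OF 2 4] ex[OF 3 4] by (auto simp: P_def)
    then show "(of_bool (norm (g *v x) \<le> 2 * norm x) + of_bool (norm (adj2 g *v x) \<le> 2 * norm x)
      + of_bool (norm (h *v x) \<le> 2 * norm x) + of_bool (norm (adj2 h *v x) \<le> 2 * norm x) :: real) \<le> 1"
      by (auto simp: of_bool_def)
  qed
  then show ?thesis unfolding g_def h_def by blast
qed

section \<open>Small perturbations that reach general position\<close>

lemma small_avoiding:
  fixes F :: "real set"
  assumes "finite F" "\<eta> > 0"
  obtains \<delta> where "0 < \<delta>" "\<delta> < \<eta>" "\<delta> \<notin> F"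
proof -
  have "infinite {0<..<\<eta>}" using assms(2) by (simp add: infinite_Ioo)
  then have "infinite ({0<..<\<eta>} - F)" using assms(1) by simp
  then have "{0<..<\<eta>} - F \<noteq> {}" by (metis finite.emptyI)
  then obtain x where "x \<in> {0<..<\<eta>} - F" by blast
  then show thesis using that[of x] by simp
qed

text \<open>For \<open>d = 0\<close> the excluded value is the default \<open>0\<close> of the
  quotient, and the claim rests on \<open>c \<noteq> 0\<close>.\<close>

lemma affine_nonzero:
  fixes c d \<delta> :: real
  assumes "c \<noteq> 0 \<or> d \<noteq> 0" "\<delta> \<noteq> - c / d"
  shows "c + \<delta> * d \<noteq> 0"
proof
  assume *: "c + \<delta> * d = 0"
  show False
  proof (cases "d = 0")
    case False
    then have "\<delta> = - c / d" using * by (simp add: field_simps)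
    then show False using assms(2) by blast
  qed (use * assms(1) in auto)
qed

definition E12 :: "real^2^2" where "E12 = vector [vector [0, 1], vector [0, 0]]"
definition E21 :: "real^2^2" where "E21 = vector [vector [0, 0], vector [1, 0]]"

lemma E_nth [simp]: "E12$1$1 = 0" "E12$1$2 = 1" "E12$2$1 = 0" "E12$2$2 = 0"
  "E21$1$1 = 0" "E21$1$2 = 0" "E21$2$1 = 1" "E21$2$2 = 0"
  by (simp_all add: E12_def E21_def)

text \<open>Prepares \<open>perturb_trace\<close>, where this entry is the derivative of the trace
  in the direction \<open>E21\<close>. By determinant one the first row of \<open>X\<close> does not
  vanish, so the entry is not identically zero in \<open>\<delta>\<close>.\<close>

lemma perturb_offdiag:
  assumes "det X = 1" "\<eta> > 0"
  shows "\<exists>\<delta>. \<bar>\<delta>\<bar> < \<eta> \<and> (X ** (mat 1 + \<delta> *\<^sub>R E12))$1$2 \<noteq> 0"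
proof -
  obtain \<delta> where \<delta>: "0 < \<delta>" "\<delta> < \<eta>" "\<delta> \<noteq> - X$1$2 / X$1$1" using small_avoiding[of "{- X$1$2 / X$1$1}" \<eta>] assms(2) by auto
  have "X$1$2 \<noteq> 0 \<or> X$1$1 \<noteq> 0" using assms(1) by (auto simp: det_2)
  then have "X$1$2 + \<delta> * X$1$1 \<noteq> 0" using \<delta>(3) by (rule affine_nonzero)
  then show ?thesis using \<delta> by (intro exI[of _ \<delta>]) (simp add: mm2 algebra_simps)
qed

lemma perturb_trace:
  assumes "X$1$2 \<noteq> 0" "\<eta> > 0"
  shows "\<exists>\<delta>. \<bar>\<delta>\<bar> < \<eta> \<and> \<bar>tr2 (X ** (mat 1 + \<delta> *\<^sub>R E21))\<bar> \<noteq> 2"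
proof -
  obtain \<delta> where \<delta>: "0 < \<delta>" "\<delta> < \<eta>" "\<delta> \<noteq> - (tr2 X - 2) / X$1$2" "\<delta> \<noteq> - (tr2 X + 2) / X$1$2"
    using small_avoiding[of "{- (tr2 X - 2) / X$1$2, - (tr2 X + 2) / X$1$2}" \<eta>] assms(2) by auto
  have "tr2 X - 2 + \<delta> * X$1$2 \<noteq> 0" "tr2 X + 2 + \<delta> * X$1$2 \<noteq> 0"
    using affine_nonzero[OF _ \<delta>(3)] affine_nonzero[OF _ \<delta>(4)] assms(1) by auto
  moreover have "tr2 (X ** (mat 1 + \<delta> *\<^sub>R E21)) = tr2 X + \<delta> * X$1$2" by (simp add: tr2_def mm2 algebra_simps)
  ultimately show ?thesis using \<delta>(1,2) by (intro exI[of _ \<delta>]) auto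
qed

text \<open>An elliptic matrix is conjugate to a rotation \<open>R\<close> by an angle with sine \<open>h\<close>, and the trace of the
  commutator of \<open>R\<close> with \<open>Y\<close> is \<open>2 + h\<^sup>2 (|Y|\<^sup>2 - 2)\<close>, where \<open>|Y|\<^sup>2 = 2\<close> only for rotations.\<close>

lemma perturb_commutator:
  assumes X: "det X = 1" "\<bar>tr2 X\<bar> < 2" and Y: "det Y = 1"
  shows "\<exists>N. nil2 N \<and> (\<forall>\<eta>>0. \<exists>\<delta>. \<bar>\<delta>\<bar> < \<eta> \<and>
     2 < tr2 (X ** (Y ** (mat 1 + \<delta> *\<^sub>R N)) ** adj2 X ** adj2 (Y ** (mat 1 + \<delta> *\<^sub>R N))))"
proof -
  define p q r s where "p = X$1$1" and "q = X$1$2" and "r = X$2$1" and "s = X$2$2"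
  have d: "p * s - q * r = 1" using X(1) by (simp add: det_2 p_def q_def r_def s_def)
  have t: "(p + s)\<^sup>2 < 4" using X(2) abs_square_less_1[of "(p + s) / 2"] by (simp add: tr2_def p_def s_def power_divide)
  have q0: "q \<noteq> 0"
  proof
    assume "q = 0"
    then have "p * s = 1" using d by simp
    moreover have "4 * (p * s) \<le> (p + s)\<^sup>2" using zero_le_power2[of "p - s"] by (simp add: power2_eq_square algebra_simps)
    ultimately show False using t by simp
  qed
  define \<sigma> where "\<sigma> = sqrt (4 - (p + s)\<^sup>2)"
  have \<sigma>: "\<sigma> > 0" "\<sigma> * \<sigma> = 4 - (p + s)\<^sup>2" using t by (auto simp: \<sigma>_def)
  \<comment> \<open>The columns are the real and the imaginary part of an eigenvector for the
    eigenvalue \<open>c + i h\<close>, so in this basis \<open>X\<close> becomes the rotation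
    \<open>R\<close>.\<close>
  define P :: "real^2^2" where "P = vector [vector [2 * q, 0], vector [s - p, \<sigma>]]"
  have P [simp]: "P$1$1 = 2 * q" "P$1$2 = 0" "P$2$1 = s - p" "P$2$2 = \<sigma>" by (simp_all add: P_def)
  define c h where "c = (p + s) / 2" and "h = \<sigma> / 2"
  define R :: "real^2^2" where "R = vector [vector [c, h], vector [- h, c]]"
  have R [simp]: "R$1$1 = c" "R$1$2 = h" "R$2$1 = - h" "R$2$2 = c" by (simp_all add: R_def)
  have XP: "X ** P = P ** R"
  proof (rule mat2_eqI)
    show "(X ** P)$2$1 = (P ** R)$2$1"
      using d \<sigma>(2) by (simp add: mm2 flip: p_def q_def r_def s_def) (simp add: c_def h_def power2_eq_square field_simps)
  qed (simp_all add: mm2 c_def h_def field_simps flip: p_def q_def r_def s_def)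
  define D where "D = det P"
  have D0: "D \<noteq> 0" using q0 \<sigma>(1) by (simp add: D_def det_2)
  define Q where "Q = (1 / D) *\<^sub>R adj2 P"
  have PQ: "P ** Q = mat 1" "Q ** P = mat 1"
    using q0 \<sigma>(1) by (auto intro!: mat2_eqI simp: mm2 Q_def D_def det_2 field_simps)
  have conj: "adj2 (P ** W ** Q) = P ** adj2 W ** Q" for W
    using D0 by (intro mat2_eqI) (simp_all add: mm2 Q_def field_simps)
  have XR: "X = P ** R ** Q" using XP PQ(1) by (metis matrix_mul_assoc matrix_mul_rid)
  \<comment> \<open>Conjugated back, so that the perturbation of \<open>Yh\<close> in the adapted
    basis is along \<open>E12\<close>.\<close>
  define N where "N = P ** E12 ** Q"
  have mid: "(P ** A ** Q) ** (P ** B ** Q) = P ** (A ** B) ** Q" for A B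
    by (metis (no_types, lifting) PQ(2) matrix_mul_assoc matrix_mul_rid)
  have trc: "tr2 (P ** W ** Q) = tr2 W" for W
    by (metis PQ(2) matrix_mul_assoc matrix_mul_lid tr2_commute)
  have dc: "det (P ** W ** Q) = det W" for W
    using arg_cong[OF PQ(1), of det] by (simp add: det_mul)
  have nil: "nil2 N" unfolding nil2_def N_def trc dc by (simp add: tr2_def det_2)
  define Yh where "Yh = Q ** Y ** P"
  have Yc: "Y = P ** Yh ** Q" unfolding Yh_def by (metis PQ(1) matrix_mul_assoc matrix_mul_lid matrix_mul_rid)
  have dY: "det Yh = 1" using Y dc[of Yh] Yc by simp
  have ch: "c * c + h * h = 1" using \<sigma>(2) by (simp add: c_def h_def power2_eq_square field_simps)
  have key: "tr2 (R ** W ** adj2 R ** adj2 W) = 2 + h * h * ((W$1$1 - W$2$2)\<^sup>2 + (W$1$2 + W$2$1)\<^sup>2)" if "det W = 1" for W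
  proof -
    have dW: "W$1$1 * W$2$2 - W$1$2 * W$2$1 = 1" using that by (simp add: det_2)
    have "tr2 (R ** W ** adj2 R ** adj2 W) = 2 * (c * c + h * h) * (W$1$1 * W$2$2 - W$1$2 * W$2$1) + h * h * ((W$1$1 - W$2$2)\<^sup>2 + (W$1$2 + W$2$1)\<^sup>2)"
      by (simp add: tr2_def mm2 power2_eq_square algebra_simps)
    then show ?thesis unfolding ch dW by simp
  qed
  have "\<exists>\<delta>. \<bar>\<delta>\<bar> < \<eta> \<and> 2 < tr2 (X ** (Y ** (mat 1 + \<delta> *\<^sub>R N)) ** adj2 X ** adj2 (Y ** (mat 1 + \<delta> *\<^sub>R N)))" if \<eta>: "\<eta> > 0" for \<eta>
  proof -
    obtain \<delta> where \<delta>: "0 < \<delta>" "\<delta> < \<eta>" "\<delta> \<noteq> - (Yh$1$2 + Yh$2$1) / Yh$1$1" "\<delta> \<noteq> - (Yh$1$1 - Yh$2$2) / (- Yh$2$1)"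
      using small_avoiding[of "{- (Yh$1$2 + Yh$2$1) / Yh$1$1, - (Yh$1$1 - Yh$2$2) / (- Yh$2$1)}" \<eta>] \<eta> by auto
    define W where "W = Yh ** (mat 1 + \<delta> *\<^sub>R E12)"
    have W: "W$1$1 = Yh$1$1" "W$1$2 = Yh$1$2 + \<delta> * Yh$1$1" "W$2$1 = Yh$2$1" "W$2$2 = Yh$2$2 + \<delta> * Yh$2$1"
      by (simp_all add: W_def mm2 algebra_simps)
    have "det (mat 1 + \<delta> *\<^sub>R E12) = 1" by (rule det_unipotent) (simp add: nil2_def tr2_def det_2)
    then have dW: "det W = 1" using dY by (simp add: W_def det_mul)
    have one: "mat 1 + \<delta> *\<^sub>R N = P ** (mat 1 + \<delta> *\<^sub>R E12) ** Q"
    proof -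
      have "P ** (mat 1 + \<delta> *\<^sub>R E12) ** Q = P ** Q + \<delta> *\<^sub>R (P ** E12 ** Q)"
        by (intro mat2_eqI) (simp_all add: mm2 algebra_simps)
      then show ?thesis by (simp add: N_def PQ)
    qed
    have Y': "Y ** (mat 1 + \<delta> *\<^sub>R N) = P ** W ** Q" unfolding one by (subst Yc) (simp add: mid W_def)
    have "tr2 (X ** (Y ** (mat 1 + \<delta> *\<^sub>R N)) ** adj2 X ** adj2 (Y ** (mat 1 + \<delta> *\<^sub>R N))) = tr2 (R ** W ** adj2 R ** adj2 W)"
      unfolding Y' XR conj mid trc ..
    also have "\<dots> = 2 + h * h * ((W$1$1 - W$2$2)\<^sup>2 + (W$1$2 + W$2$1)\<^sup>2)" by (rule key[OF dW])
    also have "\<dots> > 2"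
    proof -
      \<comment> \<open>Both squares vanish only if \<open>W\<close> has the shape of a rotation.
        Whichever entry of the first column of \<open>Yh\<close> is non-zero, one of the two terms
        depends on \<open>\<delta>\<close>, and the chosen \<open>\<delta>\<close> avoids its
        zero.\<close>
      have "(W$1$1 - W$2$2)\<^sup>2 + (W$1$2 + W$2$1)\<^sup>2 > 0"
      proof (cases "Yh$1$1 = 0")
        case False
        then have "(Yh$1$2 + Yh$2$1) + \<delta> * Yh$1$1 \<noteq> 0" using \<delta>(3) by (intro affine_nonzero) auto
        then have "W$1$2 + W$2$1 \<noteq> 0" by (simp add: W algebra_simps)
        then show ?thesis by (simp add: add_nonneg_pos)
      next
        case True
        then have "Yh$2$1 \<noteq> 0" using dY by (auto simp: det_2)
        then have "(Yh$1$1 - Yh$2$2) + \<delta> * (- Yh$2$1) \<noteq> 0" using \<delta>(4) by (intro affine_nonzero) auto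
        then have "W$1$1 - W$2$2 \<noteq> 0" by (simp add: W algebra_simps)
        then show ?thesis by (simp add: add_pos_nonneg)
      qed
      then show ?thesis using \<sigma>(1) by (simp add: h_def)
    qed
    finally show ?thesis using \<delta>(1,2) by (intro exI[of _ \<delta>]) auto
  qed
  then show ?thesis using nil by blast
qed

text \<open>For \<open>N *v x = cross n x *\<^sub>R n\<close> the four cross products are affine in
  \<open>\<delta>\<close>, with slope \<open>cross n x * cross (K *v n) y\<close>. These slopes are
  non-zero once \<open>n\<close> avoids the lines of \<open>e\<close>, \<open>f\<close> and of their
  preimages under \<open>K\<close>, so each cross product vanishes for one \<open>\<delta>\<close>
  only.\<close>

lemma perturb_transversal:
  assumes K: "det K = 1" and ef: "cross e f \<noteq> 0"
  shows "\<exists>N. nil2 N \<and> (\<forall>\<eta>>0. \<exists>\<delta>. \<bar>\<delta>\<bar> < \<eta> \<and>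
     (\<forall>x\<in>{e, f}. \<forall>y\<in>{e, f}. cross ((K ** (mat 1 + \<delta> *\<^sub>R N)) *v x) y \<noteq> 0))"
proof -
  define V where "V = {e, f, adj2 K *v e, adj2 K *v f}"
  have e0: "e \<noteq> 0" "f \<noteq> 0" using ef by (auto simp: cross_def)
  have dK: "det (adj2 K) \<noteq> 0" using K by simp
  have V0: "v \<noteq> 0" if "v \<in> V" for v
    using that e0 det_nz_mv[OF dK e0(1)] det_nz_mv[OF dK e0(2)] unfolding V_def by (elim insertE emptyE) simp_all
  have "finite ((\<lambda>v. v$2 / v$1) ` V)" by (simp add: V_def)
  then obtain t where t: "t \<notin> (\<lambda>v. v$2 / v$1) ` V" using ex_new_if_finite[OF infinite_UNIV_char_0] by blast
  define n :: "real^2" where "n = vector [1, t]"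
  have n [simp]: "n$1 = 1" "n$2 = t" by (simp_all add: n_def)
  have nV: "cross n v \<noteq> 0" if "v \<in> V" for v
  proof
    assume "cross n v = 0"
    then have v2: "v$2 = t * v$1" by (simp add: cross_def)
    then have "v$1 \<noteq> 0" using V0[OF that] by (auto simp: vec_eq_iff forall_2)
    then have "t = v$2 / v$1" using v2 by simp
    then show False using t that by blast
  qed
  define N :: "real^2^2" where "N = vector [vector [- t, 1], vector [- (t * t), t]]"
  have Nn [simp]: "N$1$1 = - t" "N$1$2 = 1" "N$2$1 = - (t * t)" "N$2$2 = t" by (simp_all add: N_def)
  have nil: "nil2 N" by (simp add: nil2_def tr2_def det_2)
  have Nx: "N *v x = cross n x *\<^sub>R n" for x by (simp add: vec_eq_iff forall_2 mv2 cross_def algebra_simps)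
  have Kn: "cross (K *v n) y \<noteq> 0" if "y \<in> {e, f}" for y
  proof -
    have "cross (K *v n) y = cross (K *v n) (K *v (adj2 K *v y))" using adj2_right[OF K] by (simp add: matrix_vector_mul_assoc)
    also have "\<dots> = cross n (adj2 K *v y)" by (simp add: cross_mv K)
    finally show ?thesis using nV[of "adj2 K *v y"] that by (auto simp: V_def)
  qed
  have ex: "\<exists>\<delta>. \<bar>\<delta>\<bar> < \<eta> \<and> (\<forall>x\<in>{e, f}. \<forall>y\<in>{e, f}. cross ((K ** (mat 1 + \<delta> *\<^sub>R N)) *v x) y \<noteq> 0)" if \<eta>: "\<eta> > 0" for \<eta>
  proof -
    define b where "b x y = - cross (K *v x) y / (cross n x * cross (K *v n) y)" for x y
    obtain \<delta> where \<delta>: "0 < \<delta>" "\<delta> < \<eta>" "\<delta> \<notin> (\<lambda>(x, y). b x y) ` ({e, f} \<times> {e, f})"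
      using small_avoiding[of "(\<lambda>(x, y). b x y) ` ({e, f} \<times> {e, f})" \<eta>] \<eta> by auto
    have "cross ((K ** (mat 1 + \<delta> *\<^sub>R N)) *v x) y \<noteq> 0" if xy: "x \<in> {e, f}" "y \<in> {e, f}" for x y
    proof -
      have "(K ** (mat 1 + \<delta> *\<^sub>R N)) *v x = K *v x + \<delta> *\<^sub>R (K *v (N *v x))"
        by (simp add: vec_eq_iff forall_2 mv2 mm2 algebra_simps)
      also have "\<dots> = K *v x + (\<delta> * cross n x) *\<^sub>R (K *v n)"
        unfolding Nx by (simp add: matrix_vector_mult_scaleR)
      finally have "cross ((K ** (mat 1 + \<delta> *\<^sub>R N)) *v x) y = cross (K *v x + (\<delta> * cross n x) *\<^sub>R (K *v n)) y" by simp
      then have "cross ((K ** (mat 1 + \<delta> *\<^sub>R N)) *v x) y = cross (K *v x) y + \<delta> * (cross n x * cross (K *v n) y)"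
        unfolding cross_def by (simp add: algebra_simps)
      moreover have "cross n x * cross (K *v n) y \<noteq> 0" using nV[of x] Kn[OF xy(2)] xy by (auto simp: V_def)
      moreover have "\<delta> \<noteq> b x y" using \<delta>(3) xy by force
      ultimately show ?thesis using affine_nonzero[of "cross (K *v x) y" "cross n x * cross (K *v n) y" \<delta>] by (simp add: b_def)
    qed
    then show ?thesis using \<delta>(1,2) by (intro exI[of _ \<delta>]) auto
  qed
  show ?thesis using nil ex by blast
qed

subsection \<open>Trigonometric polynomials\<close>

text \<open>One class of perturbations for every regularity: it is closed under products and
  derivatives, and its members extend to entire functions that are bounded on strips, which the
  analytic topology requires.\<close>

inductive_set trig :: "(real \<Rightarrow> real) set" where
  trig_const: "(\<lambda>_. c) \<in> trig"
| trig_cos: "(\<lambda>t. cos (2 * pi * t)) \<in> trig"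
| trig_sin: "(\<lambda>t. sin (2 * pi * t)) \<in> trig"
| trig_add: "f \<in> trig \<Longrightarrow> g \<in> trig \<Longrightarrow> (\<lambda>t. f t + g t) \<in> trig"
| trig_mult: "f \<in> trig \<Longrightarrow> g \<in> trig \<Longrightarrow> (\<lambda>t. f t * g t) \<in> trig"

lemma trig_periodic: "f \<in> trig \<Longrightarrow> f (t + 1) = f t"
proof (induction rule: trig.induct)
  case trig_cos
  have "cos (2 * pi * (t + 1)) = cos (2 * pi * t + 2 * pi)" by (simp add: algebra_simps)
  then show ?case by simp
next
  case trig_sin
  have "sin (2 * pi * (t + 1)) = sin (2 * pi * t + 2 * pi)" by (simp add: algebra_simps)
  then show ?case by simp
qed auto

lemma trig_deriv: "f \<in> trig \<Longrightarrow> \<exists>f'\<in>trig. \<forall>t. (f has_vector_derivative f' t) (at t)"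
proof (induction rule: trig.induct)
  case (trig_const c)
  show ?case by (intro bexI[of _ "\<lambda>_. 0"] trig.trig_const) auto
next
  case trig_cos
  have "(\<lambda>t. (- 2 * pi) * sin (2 * pi * t)) \<in> trig" by (intro trig.trig_mult trig.trig_sin trig.trig_const)
  moreover have "((\<lambda>t. cos (2 * pi * t)) has_vector_derivative (- 2 * pi) * sin (2 * pi * t)) (at t)" for t
    unfolding has_real_derivative_iff_has_vector_derivative[symmetric] by (auto intro!: derivative_eq_intros)
  ultimately show ?case by (intro bexI[of _ "\<lambda>t. (- 2 * pi) * sin (2 * pi * t)"]) auto
next
  case trig_sin
  have "(\<lambda>t. (2 * pi) * cos (2 * pi * t)) \<in> trig" by (intro trig.trig_mult trig.trig_cos trig.trig_const)
  moreover have "((\<lambda>t. sin (2 * pi * t)) has_vector_derivative (2 * pi) * cos (2 * pi * t)) (at t)" for t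
    unfolding has_real_derivative_iff_has_vector_derivative[symmetric] by (auto intro!: derivative_eq_intros)
  ultimately show ?case by (intro bexI[of _ "\<lambda>t. (2 * pi) * cos (2 * pi * t)"]) auto
next
  case (trig_add f g)
  then obtain f' g' where "f' \<in> trig" "g' \<in> trig" and d: "\<And>t. (f has_vector_derivative f' t) (at t)" "\<And>t. (g has_vector_derivative g' t) (at t)"
    by blast
  then have "(\<lambda>t. f' t + g' t) \<in> trig" by (intro trig.trig_add)
  moreover have "((\<lambda>t. f t + g t) has_vector_derivative f' t + g' t) (at t)" for t
    by (rule has_vector_derivative_add[OF d])
  ultimately show ?case by (intro bexI[of _ "\<lambda>t. f' t + g' t"]) auto
next
  case (trig_mult f g)
  then obtain f' g' where t: "f' \<in> trig" "g' \<in> trig" and d: "\<And>t. (f has_vector_derivative f' t) (at t)" "\<And>t. (g has_vector_derivative g' t) (at t)"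
    by blast
  then have "(\<lambda>t. f t * g' t + f' t * g t) \<in> trig" using trig_mult by (intro trig.trig_add trig.trig_mult)
  moreover have "((\<lambda>t. f t * g t) has_vector_derivative f t * g' t + f' t * g t) (at t)" for t
    by (rule has_vector_derivative_mult[OF d])
  ultimately show ?case by (intro bexI[of _ "\<lambda>t. f t * g' t + f' t * g t"]) auto
qed

text \<open>Squaring removes the sign change of \<open>sin (pi * (t - c))\<close> under
  \<open>t + 1\<close>. The result has period 1 and vanishes exactly at the translates of
  \<open>c\<close> by integers.\<close>

lemma trig_bump: "(\<lambda>t. (sin (pi * (t - c)))\<^sup>2) \<in> trig"
proof -
  have "(\<lambda>t. 1 / 2 + ((- cos (2 * pi * c) / 2) * cos (2 * pi * t) + (- sin (2 * pi * c) / 2) * sin (2 * pi * t))) \<in> trig"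
    by (intro trig.intros)
  moreover have "(sin (pi * (t - c)))\<^sup>2 = 1 / 2 + ((- cos (2 * pi * c) / 2) * cos (2 * pi * t) + (- sin (2 * pi * c) / 2) * sin (2 * pi * t))" for t
  proof -
    have "cos (2 * pi * t - 2 * pi * c) = 1 - 2 * (sin (pi * (t - c)))\<^sup>2"
      using cos_double_sin[of "pi * (t - c)"] by (simp add: algebra_simps)
    then have "cos (2 * pi * t) * cos (2 * pi * c) + sin (2 * pi * t) * sin (2 * pi * c) = 1 - 2 * (sin (pi * (t - c)))\<^sup>2"
      by (simp only: cos_diff)
    then show ?thesis by (simp add: field_simps)
  qed
  ultimately show ?thesis by simp
qed

lemma trig_prod: "(\<And>i. i \<in> I \<Longrightarrow> f i \<in> trig) \<Longrightarrow> (\<lambda>t. \<Prod>i\<in>I. f i t) \<in> trig"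
proof (induction I rule: infinite_finite_induct)
  case (insert i I)
  have "(\<lambda>t. f i t * (\<Prod>i\<in>I. f i t)) \<in> trig" using insert by (intro trig.trig_mult) auto
  then show ?case using insert by simp
qed (simp_all add: trig.trig_const)

lemma norm_cos_sin_le: "norm (cos (w::complex)) \<le> exp \<bar>Im w\<bar>" "norm (sin (w::complex)) \<le> exp \<bar>Im w\<bar>"
proof -
  have e: "norm (exp (\<i> * w)) \<le> exp \<bar>Im w\<bar>" "norm (exp (- (\<i> * w))) \<le> exp \<bar>Im w\<bar>" by auto
  show "norm (cos w) \<le> exp \<bar>Im w\<bar>"
    using norm_triangle_mono[OF e] by (simp add: cos_exp_eq norm_divide)
  have "norm (exp (\<i> * w) - exp (- (\<i> * w))) \<le> exp \<bar>Im w\<bar> + exp \<bar>Im w\<bar>"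
    by (rule order_trans[OF norm_triangle_ineq4 add_mono[OF e]])
  then show "norm (sin w) \<le> exp \<bar>Im w\<bar>"
    by (simp add: sin_exp_eq norm_divide norm_mult)
qed

lemma trig_holo: "f \<in> trig \<Longrightarrow> \<exists>F. F holomorphic_on UNIV \<and> (\<forall>t. F (of_real t) = of_real (f t)) \<and> (\<forall>\<rho>. \<exists>C. \<forall>z\<in>strip \<rho>. norm (F z) \<le> C)"
proof (induction rule: trig.induct)
  case (trig_const c)
  show ?case by (intro exI[of _ "\<lambda>_. of_real c"]) auto
next
  case trig_cos
  have "norm (cos (2 * of_real pi * z)) \<le> exp (2 * pi * \<rho>)" if "z \<in> strip \<rho>" for z \<rho>
    using norm_cos_sin_le(1)[of "2 * of_real pi * z"] that
    by (auto simp: strip_def abs_mult elim!: order_trans)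
  then show ?case
    by (intro exI[of _ "\<lambda>z. cos (2 * of_real pi * z)"]) (auto intro!: holomorphic_intros simp: cos_of_real[symmetric] simp del: cos_of_real)
next
  case trig_sin
  have "norm (sin (2 * of_real pi * z)) \<le> exp (2 * pi * \<rho>)" if "z \<in> strip \<rho>" for z \<rho>
    using norm_cos_sin_le(2)[of "2 * of_real pi * z"] that
    by (auto simp: strip_def abs_mult elim!: order_trans)
  then show ?case
    by (intro exI[of _ "\<lambda>z. sin (2 * of_real pi * z)"]) (auto intro!: holomorphic_intros simp: sin_of_real[symmetric] simp del: sin_of_real)
next
  case (trig_add f g)
  then obtain F G where F: "F holomorphic_on UNIV" "\<forall>t. F (of_real t) = of_real (f t)" "\<forall>\<rho>. \<exists>C. \<forall>z\<in>strip \<rho>. norm (F z) \<le> C"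
    and G: "G holomorphic_on UNIV" "\<forall>t. G (of_real t) = of_real (g t)" "\<forall>\<rho>. \<exists>C. \<forall>z\<in>strip \<rho>. norm (G z) \<le> C" by blast
  have "\<exists>C. \<forall>z\<in>strip \<rho>. norm (F z + G z) \<le> C" for \<rho>
  proof -
    obtain C D where "\<forall>z\<in>strip \<rho>. norm (F z) \<le> C" "\<forall>z\<in>strip \<rho>. norm (G z) \<le> D" using F(3) G(3) by meson
    then show ?thesis by (intro exI[of _ "C + D"]) (auto intro: norm_triangle_mono)
  qed
  then show ?case using F G by (intro exI[of _ "\<lambda>z. F z + G z"]) (auto intro!: holomorphic_intros)
next
  case (trig_mult f g)
  then obtain F G where F: "F holomorphic_on UNIV" "\<forall>t. F (of_real t) = of_real (f t)" "\<forall>\<rho>. \<exists>C. \<forall>z\<in>strip \<rho>. norm (F z) \<le> C"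
    and G: "G holomorphic_on UNIV" "\<forall>t. G (of_real t) = of_real (g t)" "\<forall>\<rho>. \<exists>C. \<forall>z\<in>strip \<rho>. norm (G z) \<le> C" by blast
  have "\<exists>C. \<forall>z\<in>strip \<rho>. norm (F z * G z) \<le> C" for \<rho>
  proof -
    obtain C D where "\<forall>z\<in>strip \<rho>. norm (F z) \<le> C" "\<forall>z\<in>strip \<rho>. norm (G z) \<le> D" using F(3) G(3) by meson
    then have "\<forall>z\<in>strip \<rho>. norm (F z * G z) \<le> \<bar>C\<bar> * \<bar>D\<bar>" by (force simp: norm_mult intro!: mult_mono)
    then show ?thesis by blast
  qed
  then show ?case using F G by (intro exI[of _ "\<lambda>z. F z * G z"]) (auto intro!: holomorphic_intros)
qed

subsection \<open>Differentiability of finite order\<close>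

definition hoelder :: "real \<Rightarrow> (real \<Rightarrow> 'a::real_normed_vector) \<Rightarrow> bool" where
  "hoelder \<alpha> f \<longleftrightarrow> (\<exists>K. \<forall>t u. norm (f t - f u) \<le> K * \<bar>t - u\<bar> powr \<alpha>)"

text \<open>\<open>C\<^sup>n\<^sup>+\<^sup>\<alpha>\<close> regularity by recursion on \<open>n\<close>, which avoids Leibniz' formula for products.\<close>

fun smo :: "nat \<Rightarrow> real \<Rightarrow> (real \<Rightarrow> 'a::real_normed_vector) \<Rightarrow> bool" where
  "smo 0 \<alpha> f \<longleftrightarrow> continuous_on UNIV f \<and> (\<alpha> > 0 \<longrightarrow> hoelder \<alpha> f)"
| "smo (Suc n) \<alpha> f \<longleftrightarrow> (\<forall>t. f differentiable (at t)) \<and> smo n \<alpha> (\<lambda>t. vector_derivative f (at t))"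

lemma iter_deriv_simps: "iter_deriv 0 f = f" "iter_deriv (Suc j) f = iter_deriv j (\<lambda>t. vector_derivative f (at t))"
  by (simp_all add: iter_deriv_def funpow_Suc_right del: funpow.simps(2))

lemma smo_iff: "smo n \<alpha> f \<longleftrightarrow> (\<forall>j<n. \<forall>t. iter_deriv j f differentiable (at t)) \<and>
    continuous_on UNIV (iter_deriv n f) \<and> (\<alpha> > 0 \<longrightarrow> hoelder \<alpha> (iter_deriv n f))"
proof (induction n arbitrary: f)
  case (Suc n)
  have "(\<forall>j<Suc n. P j) \<longleftrightarrow> P 0 \<and> (\<forall>j<n. P (Suc j))" for P :: "nat \<Rightarrow> bool" by (auto simp: less_Suc_eq_0_disj)
  then show ?case by (simp add: Suc iter_deriv_simps)
qed (simp add: iter_deriv_simps)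

lemma finite_order_smo: "finite_order s f \<longleftrightarrow> smo (nat \<lfloor>s\<rfloor>) (frac s) f"
  by (simp add: finite_order_def smo_iff hoelder_def)

lemma differentiable_vd: "f differentiable (at t) \<longleftrightarrow> (f has_vector_derivative vector_derivative f (at t)) (at t)"
  for f :: "real \<Rightarrow> 'a::real_normed_vector"
  by (metis differentiableI_vector vector_derivative_works)

lemma smo_SucI:
  assumes "\<And>t. (f has_vector_derivative f' t) (at t)" "smo n \<alpha> f'"
  shows "smo (Suc n) \<alpha> f"
proof -
  have "(\<lambda>t. vector_derivative f (at t)) = f'" using assms(1) by (auto intro: vector_derivative_at)
  then show ?thesis using assms by (auto intro: differentiableI_vector)
qed

lemma smo_SucD:
  assumes "smo (Suc n) \<alpha> f"
  shows "(f has_vector_derivative vector_derivative f (at t)) (at t)" "smo n \<alpha> (\<lambda>t. vector_derivative f (at t))"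
  using assms by (auto simp: differentiable_vd)

lemma hoelder_add: "hoelder \<alpha> f \<Longrightarrow> hoelder \<alpha> g \<Longrightarrow> hoelder \<alpha> (\<lambda>t. f t + g t)"
proof -
  assume "hoelder \<alpha> f" "hoelder \<alpha> g"
  then obtain K L where KL: "\<And>t u. norm (f t - f u) \<le> K * \<bar>t - u\<bar> powr \<alpha>" "\<And>t u. norm (g t - g u) \<le> L * \<bar>t - u\<bar> powr \<alpha>"
    unfolding hoelder_def by blast
  have "norm ((f t + g t) - (f u + g u)) \<le> (K + L) * \<bar>t - u\<bar> powr \<alpha>" for t u
    using norm_triangle_mono[OF KL(1)[of t u] KL(2)[of t u]] by (simp add: algebra_simps)
  then show ?thesis unfolding hoelder_def by blast
qed

lemma hoelder_linear: "bounded_linear L \<Longrightarrow> hoelder \<alpha> f \<Longrightarrow> hoelder \<alpha> (\<lambda>t. L (f t))"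
proof -
  assume L: "bounded_linear L" and "hoelder \<alpha> f"
  then obtain K where K: "\<And>t u. norm (f t - f u) \<le> K * \<bar>t - u\<bar> powr \<alpha>" unfolding hoelder_def by blast
  obtain C where C: "C > 0" "\<And>x. norm (L x) \<le> norm x * C" using bounded_linear.pos_bounded[OF L] by blast
  have "norm (L (f t) - L (f u)) \<le> (C * K) * \<bar>t - u\<bar> powr \<alpha>" for t u
  proof -
    have "norm (L (f t) - L (f u)) \<le> norm (f t - f u) * C"
      using C(2)[of "f t - f u"] by (simp add: linear_diff[OF bounded_linear.linear[OF L]])
    also have "\<dots> \<le> (K * \<bar>t - u\<bar> powr \<alpha>) * C" using C(1) K by (intro mult_right_mono) auto
    finally show ?thesis by (simp add: ac_simps)
  qed
  then show ?thesis unfolding hoelder_def by blast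
qed

lemma smo_add: "smo n \<alpha> f \<Longrightarrow> smo n \<alpha> g \<Longrightarrow> smo n \<alpha> (\<lambda>t. f t + g t)"
proof (induction n arbitrary: f g)
  case (Suc n)
  show ?case
    by (rule smo_SucI[OF has_vector_derivative_add[OF smo_SucD(1)[OF Suc.prems(1)] smo_SucD(1)[OF Suc.prems(2)]]])
       (rule Suc.IH[OF smo_SucD(2)[OF Suc.prems(1)] smo_SucD(2)[OF Suc.prems(2)]])
qed (auto intro!: continuous_intros hoelder_add)

lemma smo_linear: "bounded_linear L \<Longrightarrow> smo n \<alpha> f \<Longrightarrow> smo n \<alpha> (\<lambda>t. L (f t))"
proof (induction n arbitrary: f)
  case 0
  then show ?case using bounded_linear.continuous_on[OF 0(1), of UNIV f] hoelder_linear[OF 0(1), of \<alpha> f] by auto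
next
  case (Suc n)
  show ?case
    by (rule smo_SucI[OF bounded_linear.has_vector_derivative[OF Suc.prems(1) smo_SucD(1)[OF Suc.prems(2)]]])
       (rule Suc.IH[OF Suc.prems(1) smo_SucD(2)[OF Suc.prems(2)]])
qed

lemma has_vector_derivative_shift:
  fixes f :: "real \<Rightarrow> 'a::real_normed_vector"
  assumes "(f has_vector_derivative D) (at (t + c))"
  shows "((\<lambda>x. f (x + c)) has_vector_derivative D) (at t)"
proof -
  have "((\<lambda>x. x + c) has_vector_derivative 1) (at t)" by (auto intro!: derivative_eq_intros)
  from vector_diff_chain_at[OF this assms] show ?thesis by (simp add: o_def)
qed

lemma vector_derivative_periodic:
  fixes f :: "real \<Rightarrow> 'a::real_normed_vector"
  assumes per: "\<And>t. f (t + 1) = f t"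
  shows "vector_derivative f (at (t + 1)) = vector_derivative f (at t)"
proof -
  have "f (t - 1) = f t" for t using per[of "t - 1"] by simp
  then have "(f has_vector_derivative D) (at (t + 1)) \<longleftrightarrow> (f has_vector_derivative D) (at t)" for D
    using has_vector_derivative_shift[of f D t 1] has_vector_derivative_shift[of f D "t + 1" "- 1"] by (auto simp: per)
  then show ?thesis by (simp add: vector_derivative_def)
qed

lemma iter_deriv_periodic: "(\<And>t. f (t + 1) = f t) \<Longrightarrow> iter_deriv j f (t + 1) = iter_deriv j f t"
proof (induction j arbitrary: f)
  case (Suc j)
  then show ?case by (simp add: iter_deriv_simps vector_derivative_periodic)
qed (simp add: iter_deriv_simps)

lemma periodic_norm_bound:
  fixes f :: "real \<Rightarrow> 'a::real_normed_vector"
  assumes "continuous_on UNIV f" "\<And>t. f (t + 1) = f t"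
  shows "\<exists>B. \<forall>t. norm (f t) \<le> B"
  using periodic_bounded[of f, OF assms] by (auto simp: bounded_iff)

lemma periodic_lipschitz:
  fixes f :: "real \<Rightarrow> 'a::real_normed_vector"
  assumes per: "\<And>t. f (t + 1) = f t" and d: "\<And>t. (f has_vector_derivative f' t) (at t)" and c: "continuous_on UNIV f'"
  shows "\<exists>K. \<forall>t u. norm (f t - f u) \<le> K * \<bar>t - u\<bar>"
proof -
  have f': "f' = (\<lambda>t. vector_derivative f (at t))" using d by (auto intro: vector_derivative_at[symmetric])
  have "f' (t + 1) = f' t" for t unfolding f' by (rule vector_derivative_periodic) (rule per)
  from periodic_norm_bound[of f', OF c this] obtain K where K: "\<And>t. norm (f' t) \<le> K" by blast
  have "norm (f t - f u) \<le> K * \<bar>t - u\<bar>" for t u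
  proof -
    have "norm (f t - f u) \<le> K * norm (t - u)"
    proof (rule differentiable_bound[of UNIV f "\<lambda>x h. h *\<^sub>R f' x"])
      show "onorm (\<lambda>h. h *\<^sub>R f' x) \<le> K" for x
        using K[of x] by (intro onorm_le) (simp add: mult.commute[of K] mult_left_mono)
    qed (use d in \<open>auto simp: has_vector_derivative_def\<close>)
    then show ?thesis by simp
  qed
  then show ?thesis by blast
qed

text \<open>The Lipschitz bound dominates at distances up to 1, and boundedness of \<open>f\<close>
  at larger ones.\<close>

lemma periodic_hoelder:
  fixes f :: "real \<Rightarrow> 'a::real_normed_vector"
  assumes per: "\<And>t. f (t + 1) = f t" and d: "\<And>t. (f has_vector_derivative f' t) (at t)" and c: "continuous_on UNIV f'"
    and \<alpha>: "0 < \<alpha>" "\<alpha> \<le> 1"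
  shows "hoelder \<alpha> f"
proof -
  obtain K where K: "\<And>t u. norm (f t - f u) \<le> K * \<bar>t - u\<bar>" using periodic_lipschitz[of f f', OF per d c] by blast
  have "continuous_on UNIV f" using d by (auto intro!: continuous_at_imp_continuous_on has_vector_derivative_continuous)
  from periodic_norm_bound[of f, OF this per] obtain B where B: "\<And>t. norm (f t) \<le> B" by blast
  have K0: "K \<ge> 0" using order_trans[OF norm_ge_zero K[of 0 1]] by simp
  have B0: "B \<ge> 0" using B[of 0] norm_ge_zero[of "f 0"] by linarith
  have "norm (f t - f u) \<le> (K + 2 * B) * \<bar>t - u\<bar> powr \<alpha>" for t u
  proof (cases "\<bar>t - u\<bar> \<le> 1")
    case True
    have "\<bar>t - u\<bar> \<le> \<bar>t - u\<bar> powr \<alpha>" using True \<alpha> powr_mono'[of \<alpha> 1 "\<bar>t - u\<bar>"] by (cases "t = u") auto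
    then have "K * \<bar>t - u\<bar> \<le> K * \<bar>t - u\<bar> powr \<alpha>" using K0 by (rule mult_left_mono)
    also have "\<dots> \<le> (K + 2 * B) * \<bar>t - u\<bar> powr \<alpha>" using B0 by (intro mult_right_mono) auto
    finally show ?thesis using K[of t u] by linarith
  next
    case False
    have "norm (f t - f u) \<le> B + B" using norm_triangle_ineq4[of "f t" "f u"] B[of t] B[of u] by linarith
    also have "\<dots> \<le> (K + 2 * B) * 1" using K0 by simp
    also have "\<dots> \<le> (K + 2 * B) * \<bar>t - u\<bar> powr \<alpha>" using False K0 B0 \<alpha> by (intro mult_left_mono ge_one_powr_ge_zero) auto
    finally show ?thesis .
  qed
  then show ?thesis unfolding hoelder_def by blast
qed

lemma smo_continuous: "smo n \<alpha> f \<Longrightarrow> continuous_on UNIV f"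
  by (cases n) (auto intro!: continuous_at_imp_continuous_on differentiable_imp_continuous_within)

text \<open>Needed for the product rule, in which \<open>f\<close> itself stands beside its
  derivative; periodicity provides the Hoelder bound on the whole line.\<close>

lemma smo_down:
  assumes "\<And>t. f (t + 1) = f t" "0 \<le> \<alpha>" "\<alpha> < 1" "smo (Suc n) \<alpha> f"
  shows "smo n \<alpha> f"
  using assms
proof (induction n arbitrary: f)
  case 0
  then show ?case
    using periodic_hoelder[of f "\<lambda>t. vector_derivative f (at t)" \<alpha>] smo_SucD[OF 0(4)] smo_continuous[OF 0(4)] by auto
next
  case (Suc n)
  have 1: "(\<lambda>t. vector_derivative f (at t)) (t + 1) = (\<lambda>t. vector_derivative f (at t)) t" for t
    using vector_derivative_periodic Suc.prems(1) by blast
  have "smo n \<alpha> (\<lambda>t. vector_derivative f (at t))"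
    by (rule Suc.IH[OF 1 Suc.prems(2,3) smo_SucD(2)[OF Suc.prems(4)]])
  then show ?case using Suc.prems(4) by simp
qed

lemma smo_trig_mult:
  fixes f :: "real \<Rightarrow> 'a::real_normed_vector"
  assumes "\<phi> \<in> trig" "\<And>t. f (t + 1) = f t" "0 \<le> \<alpha>" "\<alpha> < 1" "smo n \<alpha> f"
  shows "smo n \<alpha> (\<lambda>t. \<phi> t *\<^sub>R f t)"
  using assms
proof (induction n arbitrary: f \<phi>)
  case 0
  obtain \<phi>' where \<phi>': "\<phi>' \<in> trig" "\<And>t. (\<phi> has_vector_derivative \<phi>' t) (at t)" using trig_deriv[OF 0(1)] by blast
  obtain \<phi>'' where \<phi>'': "\<And>t. (\<phi>' has_vector_derivative \<phi>'' t) (at t)" using trig_deriv[OF \<phi>'(1)] by blast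
  have c: "continuous_on UNIV \<phi>" "continuous_on UNIV \<phi>'"
    using \<phi>' \<phi>'' by (auto intro!: continuous_at_imp_continuous_on has_vector_derivative_continuous)
  have "hoelder \<alpha> (\<lambda>t. \<phi> t *\<^sub>R f t)" if \<alpha>: "\<alpha> > 0"
  proof -
    have "hoelder \<alpha> \<phi>" by (rule periodic_hoelder[of \<phi> \<phi>', OF trig_periodic[OF 0(1)] \<phi>'(2) c(2)]) (use \<alpha> 0 in auto)
    then obtain K where K: "\<And>t u. norm (\<phi> t - \<phi> u) \<le> K * \<bar>t - u\<bar> powr \<alpha>" unfolding hoelder_def by blast
    obtain L where L: "\<And>t u. norm (f t - f u) \<le> L * \<bar>t - u\<bar> powr \<alpha>" using 0(5) \<alpha> unfolding smo.simps hoelder_def by blast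
    have "continuous_on UNIV f" using 0(5) by simp
    from periodic_norm_bound[of f, OF this 0(2)] obtain B where B: "\<And>t. norm (f t) \<le> B" by blast
    from periodic_norm_bound[of \<phi>, OF c(1) trig_periodic[OF 0(1)]] obtain C where C: "\<And>t. norm (\<phi> t) \<le> C" by blast
    have "norm (\<phi> t *\<^sub>R f t - \<phi> u *\<^sub>R f u) \<le> (C * L + K * B) * \<bar>t - u\<bar> powr \<alpha>" for t u
    proof -
      have "\<phi> t *\<^sub>R f t - \<phi> u *\<^sub>R f u = \<phi> t *\<^sub>R (f t - f u) + (\<phi> t - \<phi> u) *\<^sub>R f u" by (simp add: algebra_simps)
      also have "norm \<dots> \<le> norm (\<phi> t) * norm (f t - f u) + norm (\<phi> t - \<phi> u) * norm (f u)"
        by (rule order_trans[OF norm_triangle_ineq]) simp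
      also have "\<dots> \<le> C * (L * \<bar>t - u\<bar> powr \<alpha>) + (K * \<bar>t - u\<bar> powr \<alpha>) * B"
        using order_trans[OF norm_ge_zero C[of t]] order_trans[OF norm_ge_zero K[of t u]]
        by (intro add_mono mult_mono K L B C norm_ge_zero)
      finally show ?thesis by (simp add: algebra_simps)
    qed
    then show ?thesis unfolding hoelder_def by blast
  qed
  then show ?case using 0 c by (auto intro!: continuous_intros)
next
  case (Suc n)
  obtain \<phi>' where \<phi>': "\<phi>' \<in> trig" "\<And>t. (\<phi> has_vector_derivative \<phi>' t) (at t)" using trig_deriv[OF Suc.prems(1)] by blast
  let ?f' = "\<lambda>t. vector_derivative f (at t)"
  have d: "((\<lambda>t. \<phi> t *\<^sub>R f t) has_vector_derivative \<phi> t *\<^sub>R ?f' t + \<phi>' t *\<^sub>R f t) (at t)" for t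
    using has_vector_derivative_scaleR[OF _ smo_SucD(1)[OF Suc.prems(5)], of \<phi> "\<phi>' t"] \<phi>'(2)[of t]
    by (simp add: has_real_derivative_iff_has_vector_derivative)
  have p: "?f' (t + 1) = ?f' t" for t using vector_derivative_periodic Suc.prems(2) by blast
  have "smo n \<alpha> (\<lambda>t. \<phi> t *\<^sub>R ?f' t)"
    by (rule Suc.IH[of \<phi> ?f', OF Suc.prems(1) p Suc.prems(3,4) smo_SucD(2)[OF Suc.prems(5)]])
  moreover have "smo n \<alpha> (\<lambda>t. \<phi>' t *\<^sub>R f t)"
    by (rule Suc.IH[of \<phi>' f, OF \<phi>'(1) Suc.prems(2,3,4) smo_down[of f, OF Suc.prems(2-5)]])
  ultimately have "smo n \<alpha> (\<lambda>t. \<phi> t *\<^sub>R ?f' t + \<phi>' t *\<^sub>R f t)" by (rule smo_add)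
  then show ?case by (rule smo_SucI[OF d])
qed

lemma iter_deriv_add_scaleR:
  assumes "smo n \<alpha> f" "smo n \<alpha> g" "j \<le> n"
  shows "iter_deriv j (\<lambda>t. f t + c *\<^sub>R g t) = (\<lambda>t. iter_deriv j f t + c *\<^sub>R iter_deriv j g t)"
  using assms
proof (induction j arbitrary: f g n)
  case (Suc j)
  then obtain m where m: "n = Suc m" "j \<le> m" by (cases n) auto
  note f = smo_SucD[OF Suc.prems(1)[unfolded m]] and g = smo_SucD[OF Suc.prems(2)[unfolded m]]
  have "((\<lambda>t. f t + c *\<^sub>R g t) has_vector_derivative vector_derivative f (at t) + c *\<^sub>R vector_derivative g (at t)) (at t)" for t
    using f(1)[of t] g(1)[of t] by (auto intro!: derivative_eq_intros)
  then have "(\<lambda>t. vector_derivative (\<lambda>t. f t + c *\<^sub>R g t) (at t)) = (\<lambda>t. vector_derivative f (at t) + c *\<^sub>R vector_derivative g (at t))"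
    by (auto intro: vector_derivative_at)
  then show ?case using Suc.IH[OF f(2) g(2) m(2)] by (simp add: iter_deriv_simps)
qed (simp add: iter_deriv_simps)

lemma smo_iter_bounded:
  fixes f :: "real \<Rightarrow> 'a::real_normed_vector"
  assumes "smo n \<alpha> f" "\<And>t. f (t + 1) = f t" "j \<le> n"
  shows "\<exists>C. \<forall>t. norm (iter_deriv j f t) \<le> C"
proof -
  have "continuous_on UNIV (iter_deriv j f)"
    using assms(1,3) unfolding smo_iff
    by (cases "j = n") (auto intro!: continuous_at_imp_continuous_on differentiable_imp_continuous_within)
  moreover have "iter_deriv j f (t + 1) = iter_deriv j f t" for t by (rule iter_deriv_periodic) (rule assms(2))
  ultimately show ?thesis by (rule periodic_norm_bound)
qed

text \<open>Differentiation and increments are linear, so moving by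
  \<open>\<delta> *\<^sub>R G\<close> costs at most \<open>\<bar>\<delta>\<bar>\<close> times bounds
  of \<open>G\<close>. Most of the work is to show that the suprema in \<open>C_dist\<close> are
  taken over bounded sets, as otherwise they have no meaning.\<close>

lemma C_dist_perturb:
  fixes f A G :: "real \<Rightarrow> 'a::real_normed_vector"
  assumes s: "0 \<le> s" and fin: "finite_order s f" "finite_order s A" "finite_order s G"
    and per: "\<And>t. f (t + 1) = f t" "\<And>t. A (t + 1) = A t" "\<And>t. G (t + 1) = G t"
  shows "\<exists>c. \<forall>\<delta>. C_dist s f (\<lambda>t. A t + \<delta> *\<^sub>R G t) \<le> C_dist s f A + \<bar>\<delta>\<bar> * c"
proof -
  define n where "n = nat \<lfloor>s\<rfloor>"
  define \<alpha> where "\<alpha> = frac s"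
  note sm = fin[unfolded finite_order_smo n_def[symmetric] \<alpha>_def[symmetric]]
  have "\<exists>C. \<forall>j\<le>n. \<forall>t. norm (iter_deriv j G t) \<le> C j" using smo_iter_bounded[OF sm(3) per(3)] by metis
  then obtain C where C: "\<And>j t. j \<le> n \<Longrightarrow> norm (iter_deriv j G t) \<le> C j" by blast
  have eq: "iter_deriv j (\<lambda>t. A t + \<delta> *\<^sub>R G t) t = iter_deriv j A t + \<delta> *\<^sub>R iter_deriv j G t" if "j \<le> n" for j t \<delta>
    using iter_deriv_add_scaleR[OF sm(2,3) that] by metis
  have 1: "(SUP t. norm (iter_deriv j f t - iter_deriv j (\<lambda>t. A t + \<delta> *\<^sub>R G t) t))
      \<le> (SUP t. norm (iter_deriv j f t - iter_deriv j A t)) + \<bar>\<delta>\<bar> * C j" if j: "j \<le> n" for j \<delta>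
  proof (rule cSUP_least)
    fix t
    obtain Bf BA where "\<And>t. norm (iter_deriv j f t) \<le> Bf" "\<And>t. norm (iter_deriv j A t) \<le> BA"
      using smo_iter_bounded[OF sm(1) per(1) j] smo_iter_bounded[OF sm(2) per(2) j] by blast
    then have "norm (iter_deriv j f t - iter_deriv j A t) \<le> Bf + BA" for t
      by (meson norm_triangle_ineq4 add_mono order_trans)
    then have "bdd_above (range (\<lambda>t. norm (iter_deriv j f t - iter_deriv j A t)))" by (auto intro!: bdd_aboveI)
    then have "norm (iter_deriv j f t - iter_deriv j A t) \<le> (SUP t. norm (iter_deriv j f t - iter_deriv j A t))"
      by (rule cSUP_upper[OF UNIV_I])
    moreover have "norm (\<delta> *\<^sub>R iter_deriv j G t) \<le> \<bar>\<delta>\<bar> * C j" using C[OF j] by (simp add: mult_left_mono)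
    ultimately show "norm (iter_deriv j f t - iter_deriv j (\<lambda>t. A t + \<delta> *\<^sub>R G t) t)
      \<le> (SUP t. norm (iter_deriv j f t - iter_deriv j A t)) + \<bar>\<delta>\<bar> * C j"
      unfolding eq[OF j] diff_diff_add[symmetric] using norm_triangle_ineq4[of "iter_deriv j f t - iter_deriv j A t" "\<delta> *\<^sub>R iter_deriv j G t"]
      by linarith
  qed simp
  define P :: "(real \<times> real) set" where "P = {(t, u). t \<noteq> u}"
  define q where "q = (\<lambda>A t u. norm ((iter_deriv n f t - iter_deriv n A t) - (iter_deriv n f u - iter_deriv n A u)) / \<bar>t - u\<bar> powr \<alpha>)"
  have 2: "\<exists>K. \<forall>\<delta>. (SUP (t, u) \<in> P. q (\<lambda>t. A t + \<delta> *\<^sub>R G t) t u) \<le> (SUP (t, u) \<in> P. q A t u) + \<bar>\<delta>\<bar> * K" if "\<alpha> > 0"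
  proof -
    have "\<And>g. smo n \<alpha> g \<Longrightarrow> hoelder \<alpha> (iter_deriv n g)" using that by (simp add: smo_iff)
    then obtain Kf KA KG where K: "\<And>t u. norm (iter_deriv n f t - iter_deriv n f u) \<le> Kf * \<bar>t - u\<bar> powr \<alpha>"
      "\<And>t u. norm (iter_deriv n A t - iter_deriv n A u) \<le> KA * \<bar>t - u\<bar> powr \<alpha>"
      "\<And>t u. norm (iter_deriv n G t - iter_deriv n G u) \<le> KG * \<bar>t - u\<bar> powr \<alpha>"
      using sm unfolding hoelder_def by meson
    have ub: "q A t u \<le> Kf + KA" if "(t, u) \<in> P" for t u
    proof -
      have "\<bar>t - u\<bar> powr \<alpha> > 0" using that by (simp add: P_def)
      moreover have "norm ((iter_deriv n f t - iter_deriv n A t) - (iter_deriv n f u - iter_deriv n A u)) \<le> (Kf + KA) * \<bar>t - u\<bar> powr \<alpha>"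
      proof -
        have "(iter_deriv n f t - iter_deriv n A t) - (iter_deriv n f u - iter_deriv n A u) = (iter_deriv n f t - iter_deriv n f u) - (iter_deriv n A t - iter_deriv n A u)"
          by simp
        then show ?thesis
          using order_trans[OF norm_triangle_ineq4 add_mono[OF K(1,2)[of t u]]] by (simp only: distrib_right)
      qed
      ultimately show ?thesis by (simp add: q_def divide_le_eq)
    qed
    have "(SUP (t, u) \<in> P. q (\<lambda>t. A t + \<delta> *\<^sub>R G t) t u) \<le> (SUP (t, u) \<in> P. q A t u) + \<bar>\<delta>\<bar> * KG" for \<delta>
    proof (rule cSUP_least)
      have "(0, 1) \<in> P" by (simp add: P_def)
      then show "P \<noteq> {}" by blast
      fix p assume p: "p \<in> P"
      obtain t u where tu: "p = (t, u)" by (cases p)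
      have pos: "\<bar>t - u\<bar> powr \<alpha> > 0" using p tu by (simp add: P_def)
      have "bdd_above ((\<lambda>(t, u). q A t u) ` P)" using ub by (auto intro!: bdd_aboveI)
      then have up: "q A t u \<le> (SUP (t, u) \<in> P. q A t u)" using cSUP_upper[OF p, of "\<lambda>(t, u). q A t u"] tu by simp
      have "q (\<lambda>t. A t + \<delta> *\<^sub>R G t) t u = norm (((iter_deriv n f t - iter_deriv n A t) - (iter_deriv n f u - iter_deriv n A u)) - \<delta> *\<^sub>R (iter_deriv n G t - iter_deriv n G u)) / \<bar>t - u\<bar> powr \<alpha>"
      proof -
        have *: "x - (a + \<delta> *\<^sub>R g) - (y - (b + \<delta> *\<^sub>R h)) = (x - a - (y - b)) - \<delta> *\<^sub>R (g - h)" for x y a b g h :: 'a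
          by (simp add: algebra_simps)
        show ?thesis unfolding q_def eq[OF order_refl] * ..
      qed
      also have "\<dots> \<le> (norm ((iter_deriv n f t - iter_deriv n A t) - (iter_deriv n f u - iter_deriv n A u)) + \<bar>\<delta>\<bar> * (KG * \<bar>t - u\<bar> powr \<alpha>)) / \<bar>t - u\<bar> powr \<alpha>"
      proof (intro divide_right_mono order_trans[OF norm_triangle_ineq4] add_left_mono)
        show "norm (\<delta> *\<^sub>R (iter_deriv n G t - iter_deriv n G u)) \<le> \<bar>\<delta>\<bar> * (KG * \<bar>t - u\<bar> powr \<alpha>)"
          using mult_left_mono[OF K(3)[of t u], of "\<bar>\<delta>\<bar>"] by simp
      qed simp
      also have "\<dots> = q A t u + \<bar>\<delta>\<bar> * KG" using pos by (simp add: q_def field_simps)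
      finally show "(case p of (t, u) \<Rightarrow> q (\<lambda>t. A t + \<delta> *\<^sub>R G t) t u) \<le> (SUP (t, u) \<in> P. q A t u) + \<bar>\<delta>\<bar> * KG" using up tu by simp
    qed
    then show ?thesis by blast
  qed
  have C_eq: "C_dist s f B = (\<Sum>j\<le>n. SUP t. norm (iter_deriv j f t - iter_deriv j B t)) + (if \<alpha> > 0 then SUP (t, u) \<in> P. q B t u else 0)" for B
    by (simp add: C_dist_def n_def \<alpha>_def P_def q_def Let_def)
  have s1: "(\<Sum>j\<le>n. SUP t. norm (iter_deriv j f t - iter_deriv j (\<lambda>t. A t + \<delta> *\<^sub>R G t) t))
     \<le> (\<Sum>j\<le>n. SUP t. norm (iter_deriv j f t - iter_deriv j A t)) + \<bar>\<delta>\<bar> * (\<Sum>j\<le>n. C j)" for \<delta>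
    unfolding sum_distrib_left sum.distrib[symmetric] by (intro sum_mono 1) simp
  show ?thesis
  proof (cases "\<alpha> > 0")
    case True
    then obtain K where K: "\<And>\<delta>. (SUP (t, u) \<in> P. q (\<lambda>t. A t + \<delta> *\<^sub>R G t) t u) \<le> (SUP (t, u) \<in> P. q A t u) + \<bar>\<delta>\<bar> * K" using 2 by blast
    have "C_dist s f (\<lambda>t. A t + \<delta> *\<^sub>R G t) \<le> C_dist s f A + \<bar>\<delta>\<bar> * ((\<Sum>j\<le>n. C j) + K)" for \<delta>
      unfolding C_eq distrib_left using True add_mono[OF s1[of \<delta>] K[of \<delta>]] by simp
    then show ?thesis by blast
  next
    case False
    then have "C_dist s f (\<lambda>t. A t + \<delta> *\<^sub>R G t) \<le> C_dist s f A + \<bar>\<delta>\<bar> * (\<Sum>j\<le>n. C j)" for \<delta>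
      unfolding C_eq using s1[of \<delta>] by simp
    then show ?thesis by blast
  qed
qed

subsection \<open>Analytic maps\<close>

text \<open>Convergence at real points arbitrarily close to distance \<open>e\<close> from the
  centre forces convergence in the whole complex disc.\<close>

lemma local_holomorphic_extension:
  fixes f :: "real \<Rightarrow> real"
  assumes e: "e > 0" and a: "\<And>t. \<bar>t - t0\<bar> < e \<Longrightarrow> (\<lambda>n. a n * (t - t0) ^ n) sums f t"
  shows "\<exists>H. H holomorphic_on ball (of_real t0) e \<and> (\<forall>t. \<bar>t - t0\<bar> < e \<longrightarrow> H (of_real t) = of_real (f t))"
proof -
  define H where "H z = (\<Sum>n. of_real (a n) * (z - of_real t0) ^ n)" for z :: complex
  have "(\<lambda>n. of_real (a n) * (z - of_real t0) ^ n) sums H z" if z: "z \<in> ball (of_real t0) e" for z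
  proof -
    define x where "x = (norm (z - of_real t0) + e) / 2"
    have nz: "norm (z - of_real t0) < e" using z by (simp add: dist_norm norm_minus_commute)
    have x: "norm (z - of_real t0) < x" "0 \<le> x" "x < e" using nz e by (simp_all add: x_def)
    have "(\<lambda>n. a n * (t0 + x - t0) ^ n) sums f (t0 + x)" using x by (intro a) simp
    then have "summable (\<lambda>n. a n * x ^ n)" by (simp add: sums_iff)
    then have "summable (\<lambda>n. complex_of_real (a n * x ^ n))" by (rule summable_of_real)
    then have "summable (\<lambda>n. complex_of_real (a n) * of_real x ^ n)" by simp
    then have "summable (\<lambda>n. of_real (a n) * (z - of_real t0) ^ n)" by (rule powser_inside) (use x in simp)
    then show ?thesis unfolding H_def by (rule summable_sums)
  qed
  then have "H holomorphic_on ball (of_real t0) e" by (rule power_series_holomorphic)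
  moreover have "H (of_real t) = of_real (f t)" if "\<bar>t - t0\<bar> < e" for t
  proof -
    have "(\<lambda>n. complex_of_real (a n * (t - t0) ^ n)) sums of_real (f t)" using a[OF that] by (simp only: sums_of_real_iff)
    then have "(\<lambda>n. complex_of_real (a n) * (of_real t - of_real t0) ^ n) sums of_real (f t)" by simp
    then show ?thesis unfolding H_def by (rule sums_unique[symmetric])
  qed
  ultimately show ?thesis by blast
qed

text \<open>The intersection of two discs with real centres is connected and, with \<open>z\<close>,
  contains \<open>Re z\<close>, at which real points accumulate. There both extensions equal
  \<open>f\<close>, so the identity theorem applies.\<close>

lemma extensions_agree:
  fixes x y \<epsilon> :: real
  assumes H: "H holomorphic_on ball (of_real x) \<epsilon>" "\<And>t. \<bar>t - x\<bar> < \<epsilon> \<Longrightarrow> H (of_real t) = of_real (f t)"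
    and G: "G holomorphic_on ball (of_real y) \<epsilon>" "\<And>t. \<bar>t - y\<bar> < \<epsilon> \<Longrightarrow> G (of_real t) = of_real (f t)"
    and z: "z \<in> ball (of_real x) \<epsilon>" "z \<in> ball (of_real y) \<epsilon>"
  shows "H z = G z"
proof -
  define S where "S = ball (complex_of_real x) \<epsilon> \<inter> ball (of_real y) \<epsilon>"
  have re: "complex_of_real (Re z) \<in> ball (of_real c) \<epsilon>" if "z \<in> ball (of_real c) \<epsilon>" for c
  proof -
    have "\<bar>Re (z - of_real c)\<bar> \<le> norm (z - of_real c)" by (rule abs_Re_le_cmod)
    moreover have "norm (z - of_real c) < \<epsilon>" using that by (simp add: dist_norm norm_minus_commute)
    moreover have "norm (complex_of_real (Re z) - of_real c) = \<bar>Re z - c\<bar>" by (metis norm_of_real of_real_diff)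
    ultimately show ?thesis by (simp add: dist_norm norm_minus_commute)
  qed
  have S: "open S" "connected S" "of_real (Re z) \<in> S" "z \<in> S"
    using z re by (auto simp: S_def intro!: convex_connected convex_Int)
  obtain \<eta> where \<eta>: "\<eta> > 0" "ball (of_real (Re z)) \<eta> \<subseteq> S" using S(1,3) by (meson openE)
  define U where "U = {w \<in> S. Im w = 0}"
  have "complex_of_real (Re z) islimpt U"
    unfolding islimpt_approachable
  proof (intro allI impI)
    fix e :: real assume e: "0 < e"
    define d where "d = min e \<eta> / 2"
    have d: "0 < d" "d < e" "d < \<eta>" using e \<eta> by (auto simp: d_def)
    have dist: "dist (complex_of_real (Re z + d)) (of_real (Re z)) = d" using d by (simp add: dist_norm)
    then have "complex_of_real (Re z + d) \<in> ball (of_real (Re z)) \<eta>" using d by (simp add: dist_commute)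
    then have "complex_of_real (Re z + d) \<in> U" using \<eta>(2) by (auto simp: U_def)
    moreover have "complex_of_real (Re z + d) \<noteq> of_real (Re z)" using d(1) by (simp only: of_real_eq_iff)
    ultimately show "\<exists>x'\<in>U. x' \<noteq> complex_of_real (Re z) \<and> dist x' (of_real (Re z)) < e" using dist d(2) by metis
  qed
  moreover have "H w - G w = 0" if "w \<in> U" for w
  proof -
    have w: "w \<in> S" "w = of_real (Re w)" using that by (auto simp: U_def complex_eq_iff)
    have "\<bar>Re w - c\<bar> < \<epsilon>" if "w \<in> ball (of_real c) \<epsilon>" for c
      using that abs_Re_le_cmod[of "w - of_real c"] by (simp add: dist_norm norm_minus_commute)
    then have "H (of_real (Re w)) = of_real (f (Re w))" "G (of_real (Re w)) = of_real (f (Re w))"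
      using w(1) by (auto simp: S_def intro!: H G)
    then show ?thesis using w(2) by simp
  qed
  moreover have "(\<lambda>w. H w - G w) holomorphic_on S"
    using H(1) G(1) by (auto simp: S_def intro!: holomorphic_intros intro: holomorphic_on_subset)
  ultimately have "H z - G z = 0"
    using analytic_continuation[of "\<lambda>w. H w - G w" S U "of_real (Re z)" z] S by (auto simp: U_def)
  then show ?thesis by simp
qed

text \<open>A Lebesgue number of the cover of one period by discs of convergence is a common radius
  \<open>\<epsilon>\<close> for local extensions around all real points. They agree on overlaps and
  glue to a periodic function on a strip; halving the strip makes it bounded.\<close>

lemma periodic_analytic_extension:
  fixes f :: "real \<Rightarrow> real"
  assumes per: "\<And>t. f (t + 1) = f t"
    and an: "\<And>t0. \<exists>e>0. \<exists>a. \<forall>t. \<bar>t - t0\<bar> < e \<longrightarrow> (\<lambda>n. a n * (t - t0) ^ n) sums f t"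
  shows "\<exists>\<rho>>0. \<exists>F C. F holomorphic_on strip \<rho> \<and> (\<forall>z\<in>strip \<rho>. norm (F z) \<le> C) \<and> (\<forall>t. F (of_real t) = of_real (f t))"
proof -
  define ext where "ext x \<epsilon> H \<longleftrightarrow> H holomorphic_on ball (complex_of_real x) \<epsilon> \<and> (\<forall>t. \<bar>t - x\<bar> < \<epsilon> \<longrightarrow> H (of_real t) = of_real (f t))" for x \<epsilon> H
  have "\<exists>e>0. \<exists>H. ext t e H" for t
  proof -
    obtain e a where ea: "e > 0" "\<forall>u. \<bar>u - t\<bar> < e \<longrightarrow> (\<lambda>n. a n * (u - t) ^ n) sums f u" using an[of t] by blast
    then show ?thesis using local_holomorphic_extension[of e t a f] unfolding ext_def by blast
  qed
  then have "\<forall>t. \<exists>e. e > 0 \<and> (\<exists>H. ext t e H)" by blast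
  from choice[OF this] obtain e where e: "\<And>t. e t > 0" "\<And>t. \<exists>H. ext t (e t) H" by blast
  have "compact (complex_of_real ` {0..1})" by (intro compact_continuous_image continuous_intros) auto
  moreover have "complex_of_real ` {0..1} \<subseteq> \<Union> ((\<lambda>t. ball (of_real t) (e t)) ` UNIV)"
  proof
    fix z assume "z \<in> complex_of_real ` {0..1}"
    then obtain t where "z = of_real t" by blast
    then have "z \<in> ball (of_real t) (e t)" using e(1)[of t] by simp
    then show "z \<in> \<Union> ((\<lambda>t. ball (of_real t) (e t)) ` UNIV)" by blast
  qed
  moreover have "open G" if "G \<in> (\<lambda>t. ball (complex_of_real t) (e t)) ` UNIV" for G using that by auto
  ultimately have "\<exists>\<epsilon>>0. \<forall>z \<in> complex_of_real ` {0..1}. \<exists>G \<in> (\<lambda>t. ball (of_real t) (e t)) ` UNIV. ball z \<epsilon> \<subseteq> G"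
    by (rule Heine_Borel_lemma) (assumption, blast)
  then obtain \<epsilon> where \<epsilon>: "\<epsilon> > 0" "\<And>z. z \<in> complex_of_real ` {0..1} \<Longrightarrow> \<exists>G \<in> (\<lambda>t. ball (of_real t) (e t)) ` UNIV. ball z \<epsilon> \<subseteq> G"
    by blast
  have sub: "\<bar>t - y\<bar> < d" if "ball (complex_of_real x) \<epsilon> \<subseteq> ball (of_real y) d" "\<bar>t - x\<bar> < \<epsilon>" for t x y d
  proof -
    have "complex_of_real t \<in> ball (of_real x) \<epsilon>" using that(2) by (simp add: dist_norm abs_minus_commute flip: of_real_diff)
    then have "complex_of_real t \<in> ball (of_real y) d" using that(1) by blast
    then show ?thesis by (simp add: dist_norm abs_minus_commute flip: of_real_diff)
  qed
  have shift: "ext x \<epsilon> (\<lambda>z. H (z + of_int m))" if "ext (x + of_int m) \<epsilon> H" for x m H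
    unfolding ext_def
  proof (intro conjI allI impI)
    have "H \<circ> (\<lambda>z. z + of_int m) holomorphic_on ball (complex_of_real x) \<epsilon>"
      by (rule holomorphic_on_compose_gen[where t = "ball (of_real (x + of_int m)) \<epsilon>"])
         (use that in \<open>auto simp: ext_def dist_norm intro!: holomorphic_intros\<close>)
    then show "(\<lambda>z. H (z + of_int m)) holomorphic_on ball (complex_of_real x) \<epsilon>" by (simp add: o_def)
    fix t :: real assume "\<bar>t - x\<bar> < \<epsilon>"
    then have "\<bar>(t + of_int m) - (x + of_int m)\<bar> < \<epsilon>" by simp
    then have "H (of_real (t + of_int m)) = of_real (f (t + of_int m))" using that unfolding ext_def by blast
    then show "H (of_real t + of_int m) = of_real (f t)" using periodic_int[of f, OF per] by simp
  qed
  have "\<exists>H. ext x \<epsilon> H" for x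
  proof -
    have "complex_of_real (frac x) \<in> complex_of_real ` {0..1}" by (auto simp: frac_lt_1 less_imp_le)
    from \<epsilon>(2)[OF this] obtain t where t: "ball (complex_of_real (frac x)) \<epsilon> \<subseteq> ball (of_real t) (e t)" by blast
    obtain H where "ext t (e t) H" using e(2) by blast
    then have "ext (x + of_int (- \<lfloor>x\<rfloor>)) \<epsilon> H"
      using t sub[OF t] unfolding ext_def by (auto simp: frac_def intro: holomorphic_on_subset)
    then show ?thesis using shift by blast
  qed
  then have "\<forall>x. \<exists>H. ext x \<epsilon> H" by blast
  from choice[OF this] obtain H where H: "\<And>x. ext x \<epsilon> (H x)" by blast
  have agree: "G z = G' z" if "ext x \<epsilon> G" "ext y \<epsilon> G'" "z \<in> ball (of_real x) \<epsilon>" "z \<in> ball (of_real y) \<epsilon>" for x y G G' z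
    using extensions_agree[of G x \<epsilon> f G' y z] that unfolding ext_def by blast
  \<comment> \<open>Every \<open>z\<close> uses the extension centred at its own real part; outside
    the strip the value is a default.\<close>
  define F where "F z = (if z \<in> strip \<epsilon> then H (Re z) z else 0)" for z
  have in_ball: "z \<in> ball (of_real (Re z)) \<epsilon>" if "z \<in> strip \<epsilon>" for z
    using that by (simp add: strip_def dist_norm cmod_def)
  have Fper: "F (z + 1) = F z" for z
  proof (cases "z \<in> strip \<epsilon>")
    case True
    then have "H (Re z) z = H (Re z + of_int 1) (z + of_int 1)"
      by (intro agree[OF H shift[OF H]] in_ball)
    then show ?thesis using True by (simp add: F_def strip_def)
  qed (simp add: F_def strip_def)
  have open_strip: "open (strip \<epsilon>)" unfolding strip_def by (intro open_Collect_less continuous_intros)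
  have F_holo: "F holomorphic_on strip \<epsilon>"
    unfolding holomorphic_on_open[OF open_strip]
  proof
    fix z assume z: "z \<in> strip \<epsilon>"
    define V where "V = ball (complex_of_real (Re z)) \<epsilon> \<inter> strip \<epsilon>"
    have V: "open V" "z \<in> V" using open_strip z in_ball[OF z] by (auto simp: V_def)
    have "H (Re z) holomorphic_on V" using H[of "Re z"] by (auto simp: V_def ext_def intro: holomorphic_on_subset)
    moreover have "H (Re z) w = F w" if "w \<in> V" for w
      using that agree[OF H H _ in_ball, of w "Re z"] by (simp add: V_def F_def)
    ultimately have "F holomorphic_on V" by (rule holomorphic_transform)
    then show "\<exists>f'. (F has_field_derivative f') (at z)" using V by (metis holomorphic_on_open)
  qed
  \<comment> \<open>A compact rectangle that meets every orbit of \<open>z \<mapsto> z + 1\<close>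
    in the narrower strip.\<close>
  define K where "K = cbox (Complex 0 (- \<epsilon> / 2)) (Complex 1 (\<epsilon> / 2))"
  have "K \<subseteq> strip \<epsilon>" using \<epsilon>(1) by (auto simp: K_def in_cbox_complex_iff strip_def)
  then have "continuous_on K F" using F_holo holomorphic_on_imp_continuous_on continuous_on_subset by blast
  then have "bounded (F ` K)" by (intro compact_imp_bounded compact_continuous_image) (simp_all add: K_def)
  then obtain C where C: "\<And>z. z \<in> K \<Longrightarrow> norm (F z) \<le> C" by (auto simp: bounded_iff)
  have "norm (F z) \<le> C" if z: "z \<in> strip (\<epsilon> / 2)" for z
  proof -
    have "F (z + of_real (0 + of_int (- \<lfloor>Re z\<rfloor>))) = F (z + of_real 0)"
      by (rule periodic_int[of "\<lambda>x. F (z + of_real x)"]) (use Fper in \<open>simp add: add.assoc[symmetric]\<close>)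
    moreover have "z + of_real (0 + of_int (- \<lfloor>Re z\<rfloor>)) \<in> K"
    proof -
      have "0 \<le> Re z - of_int \<lfloor>Re z\<rfloor>" "Re z - of_int \<lfloor>Re z\<rfloor> \<le> 1" by linarith+
      then show ?thesis using z by (auto simp: K_def in_cbox_complex_iff strip_def)
    qed
    ultimately show ?thesis using C by (metis add.right_neutral of_real_0)
  qed
  moreover have "F holomorphic_on strip (\<epsilon> / 2)" by (rule holomorphic_on_subset[OF F_holo]) (use \<epsilon>(1) in \<open>auto simp: strip_def\<close>)
  moreover have "F (of_real t) = of_real (f t)" for t using H[of t] \<epsilon>(1) by (simp add: F_def strip_def ext_def)
  ultimately show ?thesis using \<epsilon>(1) by (intro exI[of _ "\<epsilon> / 2"]) auto
qed

lemma holo_ext_bounded: "holo_ext \<rho> f F \<Longrightarrow> \<exists>C. \<forall>z\<in>strip \<rho>. norm (F z) \<le> C"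
  by (auto simp: holo_ext_def bounded_iff)

lemma norm_matrix_bound:
  fixes M :: "complex^2^2"
  assumes "\<And>i j. norm (M$i$j) \<le> C i j"
  shows "norm M \<le> (\<Sum>i\<in>UNIV. \<Sum>j\<in>UNIV. C i j)"
proof -
  have l1: "norm x \<le> (\<Sum>i\<in>UNIV. norm (x$i))" for x :: "'x::real_normed_vector^2"
    unfolding norm_vec_def by (rule L2_set_le_sum) simp
  have "norm M \<le> (\<Sum>i\<in>UNIV. norm (M$i))" by (rule l1)
  also have "\<dots> \<le> (\<Sum>i\<in>UNIV. \<Sum>j\<in>UNIV. norm (M$i$j))" by (intro sum_mono l1)
  also have "\<dots> \<le> (\<Sum>i\<in>UNIV. \<Sum>j\<in>UNIV. C i j)" by (intro sum_mono assms)
  finally show ?thesis .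
qed

lemma norm_entry_le: "norm (M$i$j) \<le> norm (M :: 'x::real_normed_vector^2^2)"
  by (rule order_trans[OF Finite_Cartesian_Product.norm_nth_le Finite_Cartesian_Product.norm_nth_le])

lemma real_analytic_holo_ext:
  fixes A :: "real \<Rightarrow> real^2^2"
  assumes an: "real_analytic A" and per: "\<And>t. A (t + 1) = A t"
  shows "\<exists>\<rho>>0. \<exists>F. holo_ext \<rho> A F"
proof -
  have "\<exists>\<rho>>0. \<exists>F C. F holomorphic_on strip \<rho> \<and> (\<forall>z\<in>strip \<rho>. norm (F z) \<le> C) \<and> (\<forall>t. F (of_real t) = of_real (A t $ i $ j))" for i j
  proof (rule periodic_analytic_extension)
    fix t0
    obtain e a where e: "e > 0" "\<And>t. \<bar>t - t0\<bar> < e \<Longrightarrow> (\<lambda>n. (t - t0) ^ n *\<^sub>R a n) sums A t"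
      using an unfolding real_analytic_def by blast
    have bl: "bounded_linear (\<lambda>M :: real^2^2. M $ i $ j)"
      using bounded_linear_compose[OF bounded_linear_vec_nth bounded_linear_vec_nth] by blast
    have "(\<lambda>n. a n $ i $ j * (t - t0) ^ n) sums (A t $ i $ j)" if "\<bar>t - t0\<bar> < e" for t
      using bounded_linear.sums[OF bl e(2)[OF that]] by (simp add: mult.commute)
    then show "\<exists>e>0. \<exists>a. \<forall>t. \<bar>t - t0\<bar> < e \<longrightarrow> (\<lambda>n. a n * (t - t0) ^ n) sums (A t $ i $ j)"
      using e(1) by (intro exI[of _ e] conjI exI[of _ "\<lambda>n. a n $ i $ j"]) auto
  qed (simp add: per)
  then have "\<forall>i j. \<exists>\<rho> F C. \<rho> > 0 \<and> F holomorphic_on strip \<rho> \<and> (\<forall>z\<in>strip \<rho>. norm (F z) \<le> C) \<and> (\<forall>t. F (of_real t) = of_real (A t $ i $ j))"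
    by blast
  then obtain \<rho> F C where *: "\<And>i j. \<rho> i j > 0" "\<And>i j. F i j holomorphic_on strip (\<rho> i j)"
    "\<And>i j z. z \<in> strip (\<rho> i j) \<Longrightarrow> norm (F i j z) \<le> C i j" "\<And>i j t. F i j (of_real t) = of_real (A t $ i $ j)"
    by metis
  define \<sigma> where "\<sigma> = Min ((\<lambda>(i, j). \<rho> i j) ` UNIV)"
  have "\<sigma> \<in> (\<lambda>(i, j). \<rho> i j) ` UNIV" unfolding \<sigma>_def by (rule Min_in) auto
  then have \<sigma>0: "\<sigma> > 0" using *(1) by auto
  have \<sigma>: "\<sigma> \<le> \<rho> i j" for i j unfolding \<sigma>_def by (rule Min_le) auto
  have sub: "strip \<sigma> \<subseteq> strip (\<rho> i j)" for i j using \<sigma>[of i j] by (auto simp: strip_def)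
  define G :: "complex \<Rightarrow> complex^2^2" where "G z = (\<chi> i j. F i j z)" for z
  have "norm (G z) \<le> (\<Sum>i\<in>UNIV. \<Sum>j\<in>UNIV. C i j)" if "z \<in> strip \<sigma>" for z
    using subsetD[OF sub that] *(3) by (intro norm_matrix_bound) (simp add: G_def)
  then have "bounded (G ` strip \<sigma>)" by (auto simp: bounded_iff)
  moreover have "(\<lambda>z. G z $ i $ j) holomorphic_on strip \<sigma>" for i j
    using holomorphic_on_subset[OF *(2) sub] by (simp add: G_def)
  ultimately have "holo_ext \<sigma> A G" unfolding holo_ext_def using *(4) by (simp add: G_def)
  then show ?thesis using \<sigma>0 by blast
qed

lemma holo_ext_real_analytic:
  assumes F: "holo_ext \<rho> f F" and \<rho>: "\<rho> > 0"
  shows "real_analytic f"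
  unfolding real_analytic_def
proof
  fix t0 :: real
  define c where "c n i j = (deriv ^^ n) (\<lambda>z. F z $ i $ j) (of_real t0) / fact n" for n i j
  \<comment> \<open>The extension is real on the real axis; taking real parts avoids proving that
    the Taylor coefficients are real.\<close>
  define a :: "nat \<Rightarrow> real^2^2" where "a n = (\<chi> i j. Re (c n i j))" for n
  have sub: "ball (complex_of_real t0) \<rho> \<subseteq> strip \<rho>"
  proof
    fix z assume "z \<in> ball (complex_of_real t0) \<rho>"
    then show "z \<in> strip \<rho>" using abs_Im_le_cmod[of "z - of_real t0"] by (simp add: strip_def dist_norm norm_minus_commute)
  qed
  have "(\<lambda>n. (t - t0) ^ n *\<^sub>R a n) sums f t" if t: "\<bar>t - t0\<bar> < \<rho>" for t
  proof -
    have "complex_of_real t \<in> ball (of_real t0) \<rho>" using t by (simp add: dist_norm abs_minus_commute flip: of_real_diff)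
    then have "(\<lambda>n. c n i j * (of_real t - of_real t0) ^ n) sums (F (of_real t) $ i $ j)" for i j
      unfolding c_def using F sub
      by (intro holomorphic_power_series[of _ _ \<rho>]) (auto simp: holo_ext_def intro: holomorphic_on_subset)
    then have "(\<lambda>n. Re (c n i j * of_real ((t - t0) ^ n))) sums Re (of_real (f t $ i $ j))" for i j
      using F unfolding holo_ext_def by (intro sums_Re) simp
    then have s: "(\<lambda>n. (t - t0) ^ n * Re (c n i j)) sums (f t $ i $ j)" for i j by (simp add: mult.commute)
    show ?thesis
      unfolding sums_def
    proof (intro vec_tendstoI)
      fix i j
      show "(\<lambda>n. (\<Sum>m<n. (t - t0) ^ m *\<^sub>R a m) $ i $ j) \<longlonglongrightarrow> f t $ i $ j"
        using s[of i j] by (simp add: sums_def a_def)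
    qed
  qed
  then show "\<exists>e>0. \<exists>a. \<forall>t. \<bar>t - t0\<bar> < e \<longrightarrow> (\<lambda>n. (t - t0) ^ n *\<^sub>R a n) sums f t" using \<rho> by blast
qed

lemma holo_ext_trig_mult:
  assumes F: "holo_ext \<rho> A F" and \<phi>: "\<phi> \<in> trig"
  shows "\<exists>H. holo_ext \<rho> (\<lambda>t. \<phi> t *\<^sub>R (A t ** N)) H"
proof -
  obtain \<Phi> where \<Phi>: "\<Phi> holomorphic_on UNIV" "\<And>t. \<Phi> (of_real t) = of_real (\<phi> t)" and "\<exists>C. \<forall>z\<in>strip \<rho>. norm (\<Phi> z) \<le> C"
    using trig_holo[OF \<phi>] by blast
  then obtain C where C: "\<And>z. z \<in> strip \<rho> \<Longrightarrow> norm (\<Phi> z) \<le> C" by blast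
  obtain B where B: "\<And>z. z \<in> strip \<rho> \<Longrightarrow> norm (F z) \<le> B" using holo_ext_bounded[OF F] by blast
  define H :: "complex \<Rightarrow> complex^2^2" where "H z = (\<chi> i j. \<Phi> z * (F z $ i $ 1 * of_real (N$1$j) + F z $ i $ 2 * of_real (N$2$j)))" for z
  have "norm (H z) \<le> (\<Sum>i\<in>(UNIV::2 set). \<Sum>j\<in>UNIV. C * (B * \<bar>N$1$j\<bar> + B * \<bar>N$2$j\<bar>))" if z: "z \<in> strip \<rho>" for z
  proof (rule norm_matrix_bound)
    fix i j
    have "norm (F z $ i $ 1 * of_real (N$1$j) + F z $ i $ 2 * of_real (N$2$j)) \<le> B * \<bar>N$1$j\<bar> + B * \<bar>N$2$j\<bar>"
      using norm_entry_le[of "F z" i] B[OF z]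
      by (intro norm_triangle_mono) (auto simp: norm_mult intro!: mult_right_mono intro: order_trans)
    then show "norm (H z $ i $ j) \<le> C * (B * \<bar>N$1$j\<bar> + B * \<bar>N$2$j\<bar>)"
      using C[OF z] order_trans[OF norm_ge_zero C[OF z]] by (simp add: H_def norm_mult mult_mono)
  qed
  then have "bounded (H ` strip \<rho>)" by (auto simp: bounded_iff)
  moreover have "(\<lambda>z. H z $ i $ j) holomorphic_on strip \<rho>" for i j
    using F holomorphic_on_subset[OF \<Phi>(1)] by (auto simp: H_def holo_ext_def intro!: holomorphic_intros)
  ultimately have "holo_ext \<rho> (\<lambda>t. \<phi> t *\<^sub>R (A t ** N)) H"
    using F unfolding holo_ext_def by (auto simp: H_def \<Phi>(2) mm2 forall_2)
  then show ?thesis by blast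
qed

lemma holo_ext_add_scaleR:
  assumes F: "holo_ext \<rho> A F" and H: "holo_ext \<rho> G H"
  shows "holo_ext \<rho> (\<lambda>t. A t + \<delta> *\<^sub>R G t) (\<lambda>z. F z + \<delta> *\<^sub>R H z)"
proof -
  obtain B C where "\<And>z. z \<in> strip \<rho> \<Longrightarrow> norm (F z) \<le> B" "\<And>z. z \<in> strip \<rho> \<Longrightarrow> norm (H z) \<le> C"
    using holo_ext_bounded[OF F] holo_ext_bounded[OF H] by blast
  then have "norm (F z + \<delta> *\<^sub>R H z) \<le> B + \<bar>\<delta>\<bar> * C" if "z \<in> strip \<rho>" for z
    using that by (intro norm_triangle_mono) (auto intro!: mult_left_mono)
  then have "bounded ((\<lambda>z. F z + \<delta> *\<^sub>R H z) ` strip \<rho>)" by (auto simp: bounded_iff)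
  then show ?thesis
    using F H unfolding holo_ext_def
    by (auto simp: scaleR_conv_of_real[where 'a = complex] intro!: holomorphic_intros)
qed

subsection \<open>Perturbation inside an open set of tuples\<close>

text \<open>For nilpotent \<open>N\<close> the right factor is unipotent, so determinant one is kept
  exactly, for every size of \<open>\<delta>\<close>, while the family remains affine in
  \<open>\<delta>\<close>.\<close>

definition pert :: "(real \<Rightarrow> real) \<Rightarrow> real^2^2 \<Rightarrow> real \<Rightarrow> (real \<Rightarrow> real^2^2) \<Rightarrow> real \<Rightarrow> real^2^2" where
  "pert \<phi> N \<delta> A t = A t ** (mat 1 + (\<delta> * \<phi> t) *\<^sub>R N)"

lemma pert_eq: "pert \<phi> N \<delta> A = (\<lambda>t. A t + \<delta> *\<^sub>R (\<phi> t *\<^sub>R (A t ** N)))"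
proof
  show "pert \<phi> N \<delta> A t = A t + \<delta> *\<^sub>R (\<phi> t *\<^sub>R (A t ** N))" for t
    unfolding pert_def by (rule mat2_eqI) (simp_all add: mm2 algebra_simps)
qed

lemma bounded_linear_mult_right:
  fixes N :: "real^2^2"
  shows "bounded_linear (\<lambda>A :: real^2^2. A ** N)"
  unfolding linear_conv_bounded_linear[symmetric]
proof (rule linearI)
  show "(A + B) ** N = A ** N + B ** N" for A B :: "real^2^2" by (rule mat2_eqI) (simp_all add: mm2 algebra_simps)
  show "(c *\<^sub>R A) ** N = c *\<^sub>R (A ** N)" for c and A :: "real^2^2" by (rule mat2_eqI) (simp_all add: mm2 algebra_simps)
qed

lemma finite_order_pert_direction:
  fixes A :: "real \<Rightarrow> real^2^2" and N :: "real^2^2"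
  assumes "finite_order s A" "\<And>t. A (t + 1) = A t" "\<phi> \<in> trig"
  shows "finite_order s (\<lambda>t. \<phi> t *\<^sub>R (A t ** N))"
proof -
  have "smo (nat \<lfloor>s\<rfloor>) (frac s) (\<lambda>t. A t ** N)"
    using assms(1) smo_linear[OF bounded_linear_mult_right] unfolding finite_order_smo by blast
  then show ?thesis
    unfolding finite_order_smo by (intro smo_trig_mult assms(3)) (auto simp: frac_lt_1 assms(2))
qed

lemma pert_mem:
  assumes A: "A \<in> circle_maps r SL2" and \<phi>: "\<phi> \<in> trig" and N: "nil2 N"
  shows "pert \<phi> N \<delta> A \<in> circle_maps r SL2"
proof -
  have per: "\<And>t. A (t + 1) = A t" and SL: "\<And>t. det (A t) = 1" and cl: "of_class r A"
    using A by (auto simp: circle_maps_def SL2_def)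
  have "of_class r (pert \<phi> N \<delta> A)"
  proof (cases r)
    case (Order q)
    have "finite_order s (pert \<phi> N \<delta> A)" if "0 \<le> s" "ennreal s \<le> q" for s
    proof -
      have fo: "finite_order s A" using cl that by (simp add: Order)
      have "finite_order s (\<lambda>t. A t + \<delta> *\<^sub>R (\<phi> t *\<^sub>R (A t ** N)))"
        using fo finite_order_pert_direction[OF fo per \<phi>] unfolding finite_order_smo
        by (intro smo_add smo_linear[OF bounded_linear_scaleR_right])
      then show ?thesis unfolding pert_eq .
    qed
    then show ?thesis by (simp add: Order)
  next
    case Analytic
    have "real_analytic A" using cl by (simp add: Analytic)
    from real_analytic_holo_ext[OF this per] obtain \<rho> F where F: "\<rho> > 0" "holo_ext \<rho> A F" by blast
    obtain H where "holo_ext \<rho> (\<lambda>t. \<phi> t *\<^sub>R (A t ** N)) H" using holo_ext_trig_mult[OF F(2) \<phi>] by blast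
    from holo_ext_real_analytic[OF holo_ext_add_scaleR[OF F(2) this] F(1)] show ?thesis
      by (simp add: Analytic pert_eq)
  qed
  moreover have "pert \<phi> N \<delta> A (t + 1) = pert \<phi> N \<delta> A t" for t by (simp add: pert_def per trig_periodic[OF \<phi>])
  moreover have "det (pert \<phi> N \<delta> A t) = 1" for t by (simp add: pert_def det_mul SL det_unipotent[OF N])
  ultimately show ?thesis by (simp add: circle_maps_def SL2_def)
qed

lemma small_multiple:
  fixes c d :: real
  assumes "d > 0"
  shows "\<exists>\<eta>>0. \<forall>\<delta>. \<bar>\<delta>\<bar> < \<eta> \<longrightarrow> \<bar>\<delta>\<bar> * c < d"
proof (intro exI[of _ "d / (\<bar>c\<bar> + 1)"] conjI allI impI)
  show "0 < d / (\<bar>c\<bar> + 1)" using assms by simp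
  fix \<delta> :: real assume "\<bar>\<delta>\<bar> < d / (\<bar>c\<bar> + 1)"
  then have "\<bar>\<delta>\<bar> * (\<bar>c\<bar> + 1) < d" by (simp add: less_divide_eq)
  moreover have "\<bar>\<delta>\<bar> * c \<le> \<bar>\<delta>\<bar> * (\<bar>c\<bar> + 1)" by (intro mult_left_mono) auto
  ultimately show "\<bar>\<delta>\<bar> * c < d" by linarith
qed

text \<open>For finite or infinite order the property passes through unions and finite
  intersections, which leaves the subbasic balls to \<open>C_dist_perturb\<close>. In the analytic
  case openness is tested at one width at which \<open>A\<close> extends, where the direction of the
  perturbation is bounded.\<close>

lemma pert_open:
  assumes W: "openin (C_topology r (circle_maps r SL2)) W" and A: "A \<in> W" and \<phi>: "\<phi> \<in> trig" and N: "nil2 N"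
  shows "\<exists>\<eta>>0. \<forall>\<delta>. \<bar>\<delta>\<bar> < \<eta> \<longrightarrow> pert \<phi> N \<delta> A \<in> W"
proof (cases r)
  case (Order q)
  have "generate_topology_on {{g \<in> circle_maps r SL2. C_dist s f g < \<epsilon>} | s f \<epsilon>. 0 \<le> s \<and> ennreal s \<le> q \<and> f \<in> circle_maps r SL2 \<and> 0 < \<epsilon>} W"
    using W by (simp add: Order openin_topology_generated_by_iff)
  then show ?thesis
    using A
  proof (induction rule: generate_topology_on.induct)
    case (Int a b)
    then obtain \<eta> \<eta>' where "\<eta> > 0" "\<forall>\<delta>. \<bar>\<delta>\<bar> < \<eta> \<longrightarrow> pert \<phi> N \<delta> A \<in> a" "\<eta>' > 0" "\<forall>\<delta>. \<bar>\<delta>\<bar> < \<eta>' \<longrightarrow> pert \<phi> N \<delta> A \<in> b" by blast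
    then show ?case by (intro exI[of _ "min \<eta> \<eta>'"]) auto
  next
    case (UN K)
    then show ?case by blast
  next
    case (Basis V)
    then obtain s f \<epsilon> where V: "V = {g \<in> circle_maps r SL2. C_dist s f g < \<epsilon>}" and s: "0 \<le> s" "ennreal s \<le> q" and f: "f \<in> circle_maps r SL2"
      by blast
    have A': "A \<in> circle_maps r SL2" "C_dist s f A < \<epsilon>" using Basis(2) by (auto simp: V)
    have per: "\<And>t. A (t + 1) = A t" "\<And>t. f (t + 1) = f t" and fo: "finite_order s A" "finite_order s f"
      using A'(1) f s by (auto simp: circle_maps_def Order)
    have perG: "\<phi> (t + 1) *\<^sub>R (A (t + 1) ** N) = \<phi> t *\<^sub>R (A t ** N)" for t by (simp add: per trig_periodic[OF \<phi>])
    obtain c where c: "\<And>\<delta>. C_dist s f (pert \<phi> N \<delta> A) \<le> C_dist s f A + \<bar>\<delta>\<bar> * c"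
      using C_dist_perturb[OF s(1) fo(2,1) finite_order_pert_direction[OF fo(1) per(1) \<phi>, of N] per(2,1) perG] unfolding pert_eq by blast
    obtain \<eta> where \<eta>: "\<eta> > 0" "\<forall>\<delta>. \<bar>\<delta>\<bar> < \<eta> \<longrightarrow> \<bar>\<delta>\<bar> * c < \<epsilon> - C_dist s f A"
      using small_multiple[of "\<epsilon> - C_dist s f A" c] A'(2) by auto
    have "pert \<phi> N \<delta> A \<in> V" if "\<bar>\<delta>\<bar> < \<eta>" for \<delta>
    proof -
      have "\<bar>\<delta>\<bar> * c < \<epsilon> - C_dist s f A" using \<eta>(2) that by blast
      then show ?thesis using c[of \<delta>] pert_mem[OF A'(1) \<phi> N] by (simp add: V)
    qed
    then show ?case using \<eta>(1) by blast
  qed simp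
next
  case Analytic
  have W': "analytic_open (circle_maps r SL2) W" using W by (simp only: Analytic openin_C_topology_Analytic)
  then have A': "A \<in> circle_maps r SL2" using A by (auto simp: analytic_open_def)
  then have "real_analytic A" and per: "\<And>t. A (t + 1) = A t" by (auto simp: circle_maps_def Analytic)
  from real_analytic_holo_ext[OF this] obtain \<rho> F where F: "\<rho> > 0" "holo_ext \<rho> A F" by blast
  obtain H where H: "holo_ext \<rho> (\<lambda>t. \<phi> t *\<^sub>R (A t ** N)) H" using holo_ext_trig_mult[OF F(2) \<phi>] by blast
  obtain \<epsilon> where \<epsilon>: "\<epsilon> > 0" "\<And>g G. g \<in> circle_maps r SL2 \<Longrightarrow> holo_ext \<rho> g G \<Longrightarrow> \<forall>z\<in>strip \<rho>. norm (F z - G z) < \<epsilon> \<Longrightarrow> g \<in> W"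
    using conjunct2[OF W'[unfolded analytic_open_def], THEN spec, THEN mp, OF F(1), THEN bspec, OF A, THEN spec, THEN mp, OF F(2)]
    by blast
  obtain C where C: "\<And>z. z \<in> strip \<rho> \<Longrightarrow> norm (H z) \<le> C" using holo_ext_bounded[OF H] by blast
  obtain \<eta> where \<eta>: "\<eta> > 0" "\<forall>\<delta>. \<bar>\<delta>\<bar> < \<eta> \<longrightarrow> \<bar>\<delta>\<bar> * C < \<epsilon>" using small_multiple[OF \<epsilon>(1)] by blast
  have "pert \<phi> N \<delta> A \<in> W" if "\<bar>\<delta>\<bar> < \<eta>" for \<delta>
  proof (rule \<epsilon>(2)[OF pert_mem[OF A' \<phi> N]])
    show "holo_ext \<rho> (pert \<phi> N \<delta> A) (\<lambda>z. F z + \<delta> *\<^sub>R H z)" unfolding pert_eq by (rule holo_ext_add_scaleR[OF F(2) H])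
    show "\<forall>z\<in>strip \<rho>. norm (F z - (F z + \<delta> *\<^sub>R H z)) < \<epsilon>"
    proof
      fix z assume "z \<in> strip \<rho>"
      from mult_left_mono[OF C[OF this], of "\<bar>\<delta>\<bar>"] have "norm (F z - (F z + \<delta> *\<^sub>R H z)) \<le> \<bar>\<delta>\<bar> * C" by simp
      also have "\<dots> < \<epsilon>" using \<eta>(2) that by blast
      finally show "norm (F z - (F z + \<delta> *\<^sub>R H z)) < \<epsilon>" .
    qed
  qed
  then show ?thesis using \<eta>(1) by blast
qed

lemma pert_open_tuple:
  assumes V: "openin (tuple_topology r k r SL2) V" and A: "A \<in> V" and b: "b \<le> k" and \<phi>: "\<phi> \<in> trig" and N: "nil2 N"
  shows "\<exists>\<eta>>0. \<forall>\<delta>. \<bar>\<delta>\<bar> < \<eta> \<longrightarrow> A(b := pert \<phi> N \<delta> (A b)) \<in> V"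
proof -
  obtain W where W: "\<And>i. i \<le> k \<Longrightarrow> openin (C_topology r (circle_maps r SL2)) (W i)" "A \<in> PiE {..k} W" "PiE {..k} W \<subseteq> V"
    using V A unfolding openin_product_topology_alt by (metis (no_types, lifting) atMost_iff)
  have "A b \<in> W b" using W(2) b by (auto simp: PiE_iff)
  from pert_open[OF W(1)[OF b] this \<phi> N] obtain \<eta> where \<eta>: "\<eta> > 0" "\<forall>\<delta>. \<bar>\<delta>\<bar> < \<eta> \<longrightarrow> pert \<phi> N \<delta> (A b) \<in> W b" by blast
  have "A(b := pert \<phi> N \<delta> (A b)) \<in> V" if "\<bar>\<delta>\<bar> < \<eta>" for \<delta>
  proof -
    have "A(b := pert \<phi> N \<delta> (A b)) \<in> PiE {..k} W" using W(2) b \<eta>(2) that by (auto simp: PiE_iff extensional_def)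
    then show ?thesis using W(3) by blast
  qed
  then show ?thesis using \<eta>(1) by blast
qed

lemma circle_maps_continuous:
  assumes "A \<in> circle_maps r V"
  shows "continuous_on UNIV A"
proof (cases r)
  case (Order q)
  have "finite_order 0 A" using assms by (simp add: circle_maps_def Order)
  then show ?thesis by (simp add: finite_order_def iter_deriv_simps)
next
  case Analytic
  then have "real_analytic A" "\<And>t. A (t + 1) = A t" using assms by (auto simp: circle_maps_def)
  from real_analytic_holo_ext[OF this] obtain \<rho> F where \<rho>: "\<rho> > 0" and F: "holo_ext \<rho> A F" by blast
  have "continuous_on UNIV (\<lambda>t. A t $ i $ j)" for i j
  proof -
    have "continuous_on (strip \<rho>) (\<lambda>z. F z $ i $ j)" using F by (simp add: holo_ext_def holomorphic_on_imp_continuous_on)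
    then have "continuous_on UNIV (\<lambda>t. F (of_real t) $ i $ j)"
      by (rule continuous_on_compose2) (use \<rho> in \<open>auto simp: strip_def intro!: continuous_intros\<close>)
    then have "continuous_on UNIV (\<lambda>t. Re (F (of_real t) $ i $ j))" by (rule continuous_on_Re)
    then show ?thesis using F by (simp add: holo_ext_def)
  qed
  then have "continuous_on UNIV (\<lambda>t. \<chi> i j. A t $ i $ j)" by (intro continuous_on_vec_lambda)
  then show ?thesis by simp
qed

subsection \<open>The \<open>C\<^sup>0\<close> topology on tuples\<close>

lemma tuples_cocycle:
  assumes "A \<in> tuples k r V" "set_pmf \<nu> \<subseteq> {..k}" "\<And>M. M \<in> V \<Longrightarrow> det M \<noteq> 0"
  shows "cocycle k \<nu> A"
proof
  fix i assume "i \<le> k"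
  then have A: "A i \<in> circle_maps r V" using assms(1) by (auto simp: PiE_iff)
  show "continuous_on UNIV (A i)" by (rule circle_maps_continuous[OF A])
  show "A i (t + 1) = A i t" "det (A i t) \<noteq> 0" for t using A assms(3) by (auto simp: circle_maps_def)
qed (rule assms(2))

lemma norm_le_C_dist_0:
  assumes f: "f \<in> circle_maps r V" and g: "g \<in> circle_maps r V"
  shows "norm (f t - g t) \<le> C_dist 0 f g"
proof -
  have "continuous_on UNIV (\<lambda>t. f t - g t)"
    using circle_maps_continuous[OF f] circle_maps_continuous[OF g] by (intro continuous_intros)
  moreover have "f (t + 1) - g (t + 1) = f t - g t" for t using f g by (simp add: circle_maps_def)
  ultimately obtain C where "\<And>t. norm (f t - g t) \<le> C" using periodic_norm_bound[of "\<lambda>t. f t - g t"] by blast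
  then have "bdd_above (range (\<lambda>t. norm (f t - g t)))" by (auto intro!: bdd_aboveI)
  then have "norm (f t - g t) \<le> (SUP t. norm (f t - g t))" by (rule cSUP_upper[OF UNIV_I])
  then show ?thesis by (simp add: C_dist_def iter_deriv_simps)
qed

lemma C0_ball:
  assumes A: "A \<in> tuples k r V" and \<delta>: "\<delta> > 0"
  shows "\<exists>W. openin (tuple_topology (Order 0) k r V) W \<and> A \<in> W \<and>
     (\<forall>B\<in>W. \<forall>i\<le>k. \<forall>t. norm (B i t - A i t) < \<delta>)"
proof (intro exI conjI ballI allI impI)
  let ?W = "PiE {..k} (\<lambda>i. {g \<in> circle_maps r V. C_dist 0 (A i) g < \<delta>})"
  have Ai: "A i \<in> circle_maps r V" if "i \<le> k" for i using A that by (auto simp: PiE_iff)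
  have "openin (C_topology (Order 0) (circle_maps r V)) {g \<in> circle_maps r V. C_dist 0 (A i) g < \<delta>}" if "i \<le> k" for i
    unfolding C_topology.simps openin_topology_generated_by_iff
    using Ai[OF that] \<delta>
    by (intro generate_topology_on.Basis CollectI exI[of _ "0::real"] exI[of _ "A i"] exI[of _ \<delta>]) simp
  then show "openin (tuple_topology (Order 0) k r V) ?W" by (simp add: openin_PiE)
  show "A \<in> ?W" using A \<delta> by (auto simp: PiE_iff C_dist_def)
  fix B i t assume B: "B \<in> ?W" and i: "i \<le> k"
  then have Bi: "B i \<in> circle_maps r V" "C_dist 0 (A i) (B i) < \<delta>" by (auto simp: PiE_iff)
  then show "norm (B i t - A i t) < \<delta>"
    using norm_le_C_dist_0[OF Ai[OF i] Bi(1), of t] by (simp add: norm_minus_commute)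
qed

lemma openin_contracting:
  assumes "set_pmf \<nu> \<subseteq> {..k}"
  shows "openin (tuple_topology (Order 0) k r SL2) {A \<in> tuples k r SL2. contracting k \<theta> \<nu> A}"
proof (subst openin_subopen, intro ballI)
  fix A assume "A \<in> {A \<in> tuples k r SL2. contracting k \<theta> \<nu> A}"
  then have A: "A \<in> tuples k r SL2" and c: "contracting k \<theta> \<nu> A" by auto
  interpret cocycle k \<theta> \<nu> A by (rule tuples_cocycle[OF A assms]) (simp add: SL2_def)
  have "det (A i t) = 1" if "i \<le> k" for i t using A that by (auto simp: PiE_iff circle_maps_def SL2_def)
  from contracting_stable[OF this c] obtain \<delta> where \<delta>: "\<delta> > 0"
    "\<And>B. (\<And>i t. i \<le> k \<Longrightarrow> norm (B i t - A i t) < \<delta>) \<Longrightarrow> contracting k \<theta> \<nu> B" by blast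
  obtain W where W: "openin (tuple_topology (Order 0) k r SL2) W" "A \<in> W" "\<forall>B\<in>W. \<forall>i\<le>k. \<forall>t. norm (B i t - A i t) < \<delta>"
    using C0_ball[OF A \<delta>(1)] by blast
  have "W \<subseteq> tuples k r SL2" using openin_subset[OF W(1)] by (simp only: topspace_tuple_topology)
  moreover have "contracting k \<theta> \<nu> B" if "B \<in> W" for B by (rule \<delta>(2)) (use W(3) that in blast)
  ultimately show "\<exists>W. openin (tuple_topology (Order 0) k r SL2) W \<and> A \<in> W \<and> W \<subseteq> {A \<in> tuples k r SL2. contracting k \<theta> \<nu> A}"
    using W(1,2) by blast
qed

lemma contracting_C0_continuity_point:
  assumes A: "A \<in> tuples k r SL2" and c: "contracting k \<theta> \<nu> A" and supp: "set_pmf \<nu> \<subseteq> {..k}"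
    and a: "a \<in> set_pmf \<nu>" "\<theta> a \<notin> \<rat>"
  shows "C0_continuity_point \<theta> \<nu> k r A"
  unfolding C0_continuity_point_def
proof (intro allI impI)
  fix B assume B: "\<forall>n. B n \<in> tuples k r GL2" and lim: "limitin (tuple_topology (Order 0) k r GL2) B A sequentially"
  interpret cocycle k \<theta> \<nu> A by (rule tuples_cocycle[OF A supp]) (simp add: SL2_def)
  have det1: "det (A i t) = 1" if "i \<le> k" for i t using A that by (auto simp: PiE_iff circle_maps_def SL2_def)
  have "cocycle k \<nu> (B n)" for n
    by (rule tuples_cocycle[OF B[rule_format] supp]) (simp add: GL2_def invertible_det_nz)
  moreover have "eventually (\<lambda>n. \<forall>i\<le>k. \<forall>t. norm (B n i t - A i t) < \<delta>) sequentially" if \<delta>: "\<delta> > 0" for \<delta>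
  proof -
    have "A \<in> tuples k r GL2"
      using lim unfolding limitin_def topspace_tuple_topology by blast
    from C0_ball[OF this \<delta>] obtain W where W: "openin (tuple_topology (Order 0) k r GL2) W" "A \<in> W"
      "\<And>B i t. B \<in> W \<Longrightarrow> i \<le> k \<Longrightarrow> norm (B i t - A i t) < \<delta>" by blast
    have "eventually (\<lambda>n. B n \<in> W) sequentially" using lim W(1,2) unfolding limitin_def by blast
    then show ?thesis by eventually_elim (use W(3) in blast)
  qed
  ultimately show "(\<lambda>n. lyapunov_exponents \<theta> \<nu> (B n)) \<longlonglongrightarrow> lyapunov_exponents \<theta> \<nu> A"
    by (intro lyapunov_exponents_continuous[OF det1 c a])
qed

subsection \<open>Density of contracting tuples\<close>

text \<open>The return \<open>X i\<close> at fibre 0, stated for arbitrary tuples so that a tuple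
  and its perturbation can be compared.\<close>

definition ret :: "(nat \<Rightarrow> real) \<Rightarrow> nat \<Rightarrow> nat \<Rightarrow> (nat \<Rightarrow> real \<Rightarrow> real^2^2) \<Rightarrow> nat \<Rightarrow> real^2^2" where
  "ret \<theta> a b A i = adj2 (wmat \<theta> A 0 (uword a b 0)) ** wmat \<theta> A 0 (uword a b i)"

lemma wmat_replicate: "a \<noteq> b \<Longrightarrow> wmat \<theta> (A(b := f)) t (replicate j a) = wmat \<theta> A t (replicate j a)"
  by (induction j arbitrary: t) simp_all

lemma wend_replicate: "wend \<theta> t (replicate j a) = t + real j * \<theta> a"
  by (simp add: wend_def sum_list_replicate)

lemma wmat_uword: "wmat \<theta> A 0 (uword a b i) =
    wmat \<theta> A (real i * \<theta> a + \<theta> b) (replicate (3 - i) a) ** A b (real i * \<theta> a) ** wmat \<theta> A 0 (replicate i a)"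
  by (simp add: uword_def wmat_append wend_replicate matrix_mul_assoc)

lemma sin_pi_eq_0: "sin (pi * x) = 0 \<Longrightarrow> x \<in> \<int>"
proof -
  assume "sin (pi * x) = 0"
  then obtain i :: int where "pi * x = of_int i * pi" using sin_zero_iff_int2 by blast
  then show ?thesis by simp
qed

text \<open>Word \<open>i\<close> reads \<open>A b\<close> at the point
  \<open>i * \<theta> a\<close>. The bump \<open>\<phi>\<close> vanishes at the other three such
  points, so only this word feels the perturbation. The index 0 is excluded because word 0 enters
  all returns.\<close>

lemma tuple_move:
  assumes V: "openin (tuple_topology r k r SL2) V" and A: "A \<in> V"
    and ab: "a \<le> k" "b \<le> k" "a \<noteq> b" "\<theta> a \<notin> \<rat>" and i: "i \<in> {1..3}" and N: "nil2 N"
  shows "\<exists>\<eta>>0. \<forall>\<delta>. \<bar>\<delta>\<bar> < \<eta> \<longrightarrow> (\<exists>A'\<in>V. (\<forall>j\<in>{1..3}. j \<noteq> i \<longrightarrow> ret \<theta> a b A' j = ret \<theta> a b A j) \<and>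
     ret \<theta> a b A' i = ret \<theta> a b A i ** (mat 1 + \<delta> *\<^sub>R N))"
proof -
  define \<phi> where "\<phi> t = (\<Prod>j\<in>{0..3} - {i}. (sin (pi * (t - real j * \<theta> a)))\<^sup>2)" for t
  have \<phi>: "\<phi> \<in> trig" unfolding \<phi>_def[abs_def] by (intro trig_prod trig_bump)
  have \<phi>0: "\<phi> (real j * \<theta> a) = 0" if "j \<le> 3" "j \<noteq> i" for j
    unfolding \<phi>_def using that by (intro prod_zero bexI[of _ j]) auto
  define c where "c = \<phi> (real i * \<theta> a)"
  \<comment> \<open>A zero would make \<open>(i - j) * \<theta> a\<close> an integer for some
    \<open>j \<noteq> i\<close>.\<close>
  have c0: "c \<noteq> 0"
  proof
    assume "c = 0"
    then obtain j where j: "j \<noteq> i" "sin (pi * (real i * \<theta> a - real j * \<theta> a)) = 0" by (auto simp: c_def \<phi>_def)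
    then have "real i * \<theta> a - real j * \<theta> a \<in> \<rat>" using sin_pi_eq_0 Ints_subset_Rats by blast
    then have "(real i * \<theta> a - real j * \<theta> a) / (real i - real j) \<in> \<rat>"
      by (rule Rats_divide[OF _ Rats_diff[OF Rats_of_nat Rats_of_nat]])
    moreover have "(real i * \<theta> a - real j * \<theta> a) / (real i - real j) = \<theta> a" using j(1) by (simp add: field_simps)
    ultimately show False using ab(4) by simp
  qed
  have At: "A \<in> tuples k r SL2" using openin_subset[OF V] A by (auto simp only: topspace_tuple_topology)
  have det1: "det (A i t) = 1" if "i \<le> k" for i t using At that by (auto simp: PiE_iff circle_maps_def SL2_def)
  define P where "P = wmat \<theta> A 0 (replicate i a)"
  have "det (wmat \<theta> A t (replicate j a)) = 1" for t j by (induction j arbitrary: t) (simp_all add: det_mul det1 ab)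
  then have dP: "det P = 1" by (simp add: P_def)
  \<comment> \<open>The factor is inserted after the prefix \<open>P\<close> of letters
    \<open>a\<close>; conjugation by \<open>P\<close> makes it appear as \<open>N\<close> at the
    right end of the whole product.\<close>
  define N' where "N' = P ** N ** adj2 P"
  have NP: "N' ** P = P ** N" unfolding N'_def using adj2_left[OF dP] by (simp flip: matrix_mul_assoc)
  have "tr2 N' = tr2 N" unfolding N'_def using tr2_commute[of "P ** N" "adj2 P"] adj2_left[OF dP] by (simp add: matrix_mul_assoc)
  then have N': "nil2 N'" using N dP by (simp add: nil2_def N'_def det_mul)
  from pert_open_tuple[OF V A ab(2) \<phi> N'] obtain \<eta> where \<eta>: "\<eta> > 0" "\<forall>\<delta>. \<bar>\<delta>\<bar> < \<eta> \<longrightarrow> A(b := pert \<phi> N' \<delta> (A b)) \<in> V" by blast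
  show ?thesis
  proof (intro exI[of _ "\<eta> * \<bar>c\<bar>"] conjI allI impI)
    show "0 < \<eta> * \<bar>c\<bar>" using \<eta> c0 by simp
    fix \<delta> assume "\<bar>\<delta>\<bar> < \<eta> * \<bar>c\<bar>"
    then have "\<bar>\<delta> / c\<bar> < \<eta>" using c0 by (simp add: divide_less_eq)
    define A' where "A' = A(b := pert \<phi> N' (\<delta> / c) (A b))"
    have A'V: "A' \<in> V" using \<eta>(2) \<open>\<bar>\<delta> / c\<bar> < \<eta>\<close> by (simp add: A'_def)
    have rep: "wmat \<theta> A' t (replicate j a) = wmat \<theta> A t (replicate j a)" for t j unfolding A'_def by (rule wmat_replicate[OF ab(3)])
    have A'b: "A' b (real j * \<theta> a) = A b (real j * \<theta> a) ** (mat 1 + (\<delta> / c * \<phi> (real j * \<theta> a)) *\<^sub>R N')" for j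
      by (simp add: A'_def pert_def)
    have same: "wmat \<theta> A' 0 (uword a b j) = wmat \<theta> A 0 (uword a b j)" if "j \<le> 3" "j \<noteq> i" for j
      unfolding wmat_uword rep A'b using \<phi>0[OF that] by simp
    have one: "(mat 1 + \<delta> *\<^sub>R N') ** P = P ** (mat 1 + \<delta> *\<^sub>R N)"
    proof -
      have "(mat 1 + \<delta> *\<^sub>R N') ** P = P + \<delta> *\<^sub>R (N' ** P)" by (rule mat2_eqI) (simp_all add: mm2 algebra_simps)
      also have "\<dots> = P ** (mat 1 + \<delta> *\<^sub>R N)" unfolding NP by (rule mat2_eqI) (simp_all add: mm2 algebra_simps)
      finally show ?thesis .
    qed
    have "wmat \<theta> A' 0 (uword a b i) = wmat \<theta> A 0 (uword a b i) ** (mat 1 + \<delta> *\<^sub>R N)"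
      unfolding wmat_uword rep A'b using c0 one
      by (simp add: c_def[symmetric] P_def[symmetric] matrix_mul_assoc[symmetric])
    then have "ret \<theta> a b A' i = ret \<theta> a b A i ** (mat 1 + \<delta> *\<^sub>R N)"
      using same[of 0] i by (simp add: ret_def matrix_mul_assoc)
    moreover have "ret \<theta> a b A' j = ret \<theta> a b A j" if "j \<in> {1..3}" "j \<noteq> i" for j
      using same[of 0] same[of j] that i by (simp add: ret_def)
    ultimately show "\<exists>A'\<in>V. (\<forall>j\<in>{1..3}. j \<noteq> i \<longrightarrow> ret \<theta> a b A' j = ret \<theta> a b A j) \<and>
     ret \<theta> a b A' i = ret \<theta> a b A i ** (mat 1 + \<delta> *\<^sub>R N)" using A'V by blast
  qed
qed

lemma (in two_letters) loop_mpow: "loop g \<Longrightarrow> loop (\<lambda>t. mpow (g t) n)"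
proof (induction n)
  case 0
  have "disp f (mat 1) = 0" for f by (simp add: disp_def nsq_def)
  then show ?case by (auto simp: loop_def sum_nonneg disp_def nsq_nonneg intro!: exI[of _ "0::real"])
qed (simp add: loop_mult)

text \<open>All moves stay in the open set \<open>V\<close>, and each changes a single return, so
  what has been achieved for the other returns survives.\<close>

lemma contracting_dense:
  assumes V: "openin (tuple_topology r k r SL2) V" and A: "A \<in> V" and supp: "set_pmf \<nu> \<subseteq> {..k}"
    and ab: "a \<noteq> b" "a \<in> set_pmf \<nu>" "b \<in> set_pmf \<nu>" "\<theta> a \<notin> \<rat>"
  shows "\<exists>A'\<in>V. contracting k \<theta> \<nu> A'"
proof -
  have k: "a \<le> k" "b \<le> k" using ab supp by auto
  let ?X = "ret \<theta> a b"
  have two: "two_letters k \<theta> \<nu> C a b" if C: "C \<in> V" for C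
  proof -
    have Ct: "C \<in> tuples k r SL2" using openin_subset[OF V] C by (auto simp only: topspace_tuple_topology)
    interpret cocycle k \<theta> \<nu> C by (rule tuples_cocycle[OF Ct supp]) (simp add: SL2_def)
    show ?thesis by unfold_locales (use Ct ab in \<open>auto simp: PiE_iff circle_maps_def SL2_def\<close>)
  qed
  have det1: "det (?X C i) = 1" if C: "C \<in> V" and i: "i \<le> 3" for C i
  proof -
    interpret two_letters k \<theta> \<nu> C a b by (rule two[OF C])
    show ?thesis using X_SL[OF i, of 0] by (simp add: X_def ret_def)
  qed
  have move: "\<exists>C'\<in>V. (\<forall>j\<in>{1..3}. j \<noteq> i \<longrightarrow> ?X C' j = ?X C j) \<and> Q (?X C' i)"
    if C: "C \<in> V" "i \<in> {1..3}" "nil2 N" and ex: "\<And>\<eta>. \<eta> > 0 \<Longrightarrow> \<exists>\<delta>. \<bar>\<delta>\<bar> < \<eta> \<and> Q (?X C i ** (mat 1 + \<delta> *\<^sub>R N))" for C i N Q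
  proof -
    obtain \<eta> where \<eta>: "\<eta> > 0" "\<forall>\<delta>. \<bar>\<delta>\<bar> < \<eta> \<longrightarrow> (\<exists>A'\<in>V. (\<forall>j\<in>{1..3}. j \<noteq> i \<longrightarrow> ?X A' j = ?X C j) \<and>
     ?X A' i = ?X C i ** (mat 1 + \<delta> *\<^sub>R N))"
      using tuple_move[where \<theta> = \<theta> and a = a and b = b, OF V C(1) k ab(1,4) C(2,3)] by blast
    obtain \<delta> where \<delta>: "\<bar>\<delta>\<bar> < \<eta>" "Q (?X C i ** (mat 1 + \<delta> *\<^sub>R N))" using ex[OF \<eta>(1)] by blast
    obtain A' where A': "A' \<in> V" "\<forall>j\<in>{1..3}. j \<noteq> i \<longrightarrow> ?X A' j = ?X C j" "?X A' i = ?X C i ** (mat 1 + \<delta> *\<^sub>R N)"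
      using \<eta>(2) \<delta>(1) by blast
    then show ?thesis using \<delta>(2) by (intro bexI[of _ A']) simp_all
  qed
  have nil: "nil2 E12" "nil2 E21" by (simp_all add: nil2_def tr2_def det_2)
  \<comment> \<open>This entry matters only because it lets the next move change the trace of the
    first return.\<close>
  obtain A1 where A1: "A1 \<in> V" "(?X A1 1)$1$2 \<noteq> 0"
    using move[of A 1 E12 "\<lambda>M. M$1$2 \<noteq> 0"] A nil perturb_offdiag[OF det1[OF A]] by auto
  obtain A2 where A2: "A2 \<in> V" "\<bar>tr2 (?X A2 1)\<bar> \<noteq> 2"
    using move[of A1 1 E21 "\<lambda>M. \<bar>tr2 M\<bar> \<noteq> 2"] A1 nil perturb_trace[OF A1(2)] by auto
  \<comment> \<open>If the first return is not hyperbolic, then by the choice of \<open>A2\<close>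
    it is elliptic, and its commutator with the second return can be made hyperbolic
    instead.\<close>
  define Z where "Z X Y = (if \<bar>tr2 X\<bar> > 2 then X else X ** Y ** adj2 X ** adj2 Y)" for X Y
  have "\<exists>A3\<in>V. \<bar>tr2 (Z (?X A3 1) (?X A3 2))\<bar> > 2"
  proof (cases "\<bar>tr2 (?X A2 1)\<bar> > 2")
    case True
    then show ?thesis using A2(1) by (intro bexI[of _ A2]) (simp_all add: Z_def)
  next
    case False
    then have lt: "\<bar>tr2 (?X A2 1)\<bar> < 2" using A2(2) by simp
    have d: "det (?X A2 1) = 1" "det (?X A2 2) = 1" using det1[OF A2(1)] by auto
    obtain N where N: "nil2 N" "\<And>\<eta>. \<eta> > 0 \<Longrightarrow> \<exists>\<delta>. \<bar>\<delta>\<bar> < \<eta> \<and>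
      2 < tr2 (?X A2 1 ** (?X A2 2 ** (mat 1 + \<delta> *\<^sub>R N)) ** adj2 (?X A2 1) ** adj2 (?X A2 2 ** (mat 1 + \<delta> *\<^sub>R N)))"
      using perturb_commutator[OF d(1) lt d(2)] by blast
    obtain A3 where A3: "A3 \<in> V" "\<forall>j\<in>{1..3}. j \<noteq> 2 \<longrightarrow> ?X A3 j = ?X A2 j"
      "2 < tr2 (?X A2 1 ** ?X A3 2 ** adj2 (?X A2 1) ** adj2 (?X A3 2))"
      using move[of A2 2 N "\<lambda>M. 2 < tr2 (?X A2 1 ** M ** adj2 (?X A2 1) ** adj2 M)"] A2(1) N by auto
    have "?X A3 1 = ?X A2 1" using A3(2) by simp
    then show ?thesis using A3(1,3) False by (intro bexI[of _ A3]) (auto simp: Z_def)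
  qed
  then obtain A3 where A3: "A3 \<in> V" "\<bar>tr2 (Z (?X A3 1) (?X A3 2))\<bar> > 2" by blast
  have dZ: "det (Z (?X A3 1) (?X A3 2)) = 1" using det1[OF A3(1)] by (simp add: Z_def det_mul)
  obtain l e f where ef: "\<bar>l\<bar> > 1" "Z (?X A3 1) (?X A3 2) *v e = l *\<^sub>R e" "Z (?X A3 1) (?X A3 2) *v f = (1 / l) *\<^sub>R f" "cross e f \<noteq> 0"
    using hyperbolic_eigenvectors[OF dZ A3(2)] by blast
  \<comment> \<open>The third return is brought into general position to the eigenlines of
    \<open>Z\<close>, so that conjugation by it yields the second ping-pong partner.\<close>
  have d3: "det (?X A3 3) = 1" using det1[OF A3(1)] by simp
  obtain N where N: "nil2 N" "\<And>\<eta>. \<eta> > 0 \<Longrightarrow> \<exists>\<delta>. \<bar>\<delta>\<bar> < \<eta> \<and>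
     (\<forall>x\<in>{e, f}. \<forall>y\<in>{e, f}. cross ((?X A3 3 ** (mat 1 + \<delta> *\<^sub>R N)) *v x) y \<noteq> 0)"
    using perturb_transversal[OF d3 ef(4)] by blast
  obtain A4 where A4: "A4 \<in> V" "\<forall>j\<in>{1..3}. j \<noteq> 3 \<longrightarrow> ?X A4 j = ?X A3 j"
    "\<forall>x\<in>{e, f}. \<forall>y\<in>{e, f}. cross (?X A4 3 *v x) y \<noteq> 0"
    using move[of A3 3 N "\<lambda>M. \<forall>x\<in>{e, f}. \<forall>y\<in>{e, f}. cross (M *v x) y \<noteq> 0"] A3(1) N by auto
  have eq: "?X A4 1 = ?X A3 1" "?X A4 2 = ?X A3 2" using A4(2) by simp_all
  have d4: "det (?X A4 3) = 1" using det1[OF A4(1)] by simp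
  obtain n where n: "cert 2 (mpow (Z (?X A3 1) (?X A3 2)) n) (?X A4 3 ** mpow (Z (?X A3 1) (?X A3 2)) n ** adj2 (?X A4 3))"
    using hyperbolic_cert[OF dZ d4 ef] A4(3) by auto
  interpret two_letters k \<theta> \<nu> A4 a b by (rule two[OF A4(1)])
  have X0: "X i 0 = ?X A4 i" for i by (simp add: X_def ret_def)
  \<comment> \<open>The case distinction in \<open>Z\<close> is frozen at fibre 0; made separately
    at each fibre it could destroy the continuity of \<open>z\<close>.\<close>
  define h where "h \<longleftrightarrow> \<bar>tr2 (?X A3 1)\<bar> > 2"
  define z where "z t = (if h then X 1 t else X 1 t ** X 2 t ** adj2 (X 1 t) ** adj2 (X 2 t))" for t
  have "loop z" unfolding z_def[abs_def] by (cases h) (auto intro!: loop_mult loop_adj2 loop_X)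
  then have g: "loop (\<lambda>t. mpow (z t) n)" by (rule loop_mpow)
  then have h: "loop (\<lambda>t. X 3 t ** mpow (z t) n ** adj2 (X 3 t))" by (intro loop_mult loop_adj2 loop_X) auto
  have z0: "z 0 = Z (?X A3 1) (?X A3 2)" unfolding z_def Z_def h_def X0 eq ..
  have "cert 2 (mpow (z 0) n) (X 3 0 ** mpow (z 0) n ** adj2 (X 3 0))" using n unfolding z0 X0 .
  then have "contracting k \<theta> \<nu> A4" by (rule cert_contracting[OF g h])
  then show ?thesis using A4(1) by blast
qed

subsection \<open>Ergodicity forces an irrational rotation in the support\<close>

lemma common_denominator:
  fixes \<theta> :: "nat \<Rightarrow> real"
  assumes "finite I" "\<And>i. i \<in> I \<Longrightarrow> \<theta> i \<in> \<rat>"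
  shows "\<exists>q::nat. q > 0 \<and> (\<forall>i\<in>I. real q * \<theta> i \<in> \<int>)"
  using assms
proof (induction rule: finite_induct)
  case empty
  show ?case by (intro exI[of _ "1::nat"]) simp
next
  case (insert i I)
  then obtain q :: nat where q: "q > 0" "\<forall>i\<in>I. real q * \<theta> i \<in> \<int>" by auto
  obtain m n where mn: "n > 0" "\<theta> i = real_of_int m / real_of_int n"
    using insert.prems[of i] by (auto elim: Rats_cases')
  have "real (nat n) * \<theta> i = of_int m" using mn by simp
  moreover have "real (nat n * q) * \<theta> i = real q * (real (nat n) * \<theta> i)" by simp
  ultimately have "real (nat n * q) * \<theta> i = of_nat q * of_int m" by simp
  then have "real (nat n * q) * \<theta> i \<in> \<int>" by (simp only: Ints_mult Ints_of_nat Ints_of_int)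
  moreover have "real (nat n * q) * \<theta> j \<in> \<int>" if "j \<in> I" for j
    using q(2) that Ints_mult[of "of_nat (nat n)" "real q * \<theta> j"] by (simp add: mult.assoc)
  ultimately show ?case using q(1) mn(1) by (intro exI[of _ "nat n * q"]) auto
qed

text \<open>If all rotations of positive weight had a common denominator \<open>q\<close>, they
  would preserve \<open>frac (real q * t)\<close>, and the part of the circle where this is below
  \<open>1 / 2\<close> would give an invariant set of intermediate measure.\<close>

lemma ergodic_irrational:
  assumes erg: "ergodic_system (base_measure \<nu>) (base_map \<theta>)" and fin: "finite (set_pmf \<nu>)"
  shows "\<exists>a\<in>set_pmf \<nu>. \<theta> a \<notin> \<rat>"
proof (rule ccontr)
  assume "\<not> ?thesis"
  then obtain q :: nat where q: "q > 0" "\<And>a. a \<in> set_pmf \<nu> \<Longrightarrow> real q * \<theta> a \<in> \<int>"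
    using common_denominator[OF fin, of \<theta>] by blast
  let ?P = "PiM UNIV (\<lambda>_::int. measure_pmf \<nu>)"
  let ?C = "restrict_space lborel {0..<1::real}"
  interpret P: product_prob_space "\<lambda>_::int. measure_pmf \<nu>" UNIV by unfold_locales
  interpret C: prob_space ?C by (rule prob_spaceI) (simp add: space_restrict_space emeasure_restrict_space)
  interpret B: prob_space "base_measure \<nu>" by (rule prob_space_base_measure)
  \<comment> \<open>Invariance in \<open>ergodic_system\<close> is exact and not up to null sets, so
    sequences that leave the support have to be removed.\<close>
  define Y where "Y = {x :: int \<Rightarrow> nat. \<forall>n. x n \<in> set_pmf \<nu>}"
  have Ysets: "Y \<in> sets ?P"
  proof -
    have "Y = (\<Inter>n. {x \<in> space ?P. x n \<in> set_pmf \<nu>})" by (auto simp: Y_def space_PiM)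
    also have "\<dots> \<in> sets ?P" by (intro sets.countable_INT' sets_Collect_single') auto
    finally show ?thesis .
  qed
  have "AE x in ?P. \<forall>n. x n \<in> set_pmf \<nu>"
    unfolding AE_all_countable by (intro allI P.AE_component) (auto simp: AE_measure_pmf)
  then have Y1: "emeasure ?P Y = 1" by (intro P.emeasure_eq_1_AE) (auto simp: Y_def Ysets[unfolded Y_def])
  have rect: "measure (base_measure \<nu>) (Y \<times> {c..<d}) = d - c" and rect_sets: "Y \<times> {c..<d} \<in> sets (base_measure \<nu>)"
    if "0 \<le> c" "c \<le> d" "d \<le> 1" for c d
  proof -
    have I: "{c..<d} \<in> sets ?C" using that by (auto simp: sets_restrict_space_iff)
    show "Y \<times> {c..<d} \<in> sets (base_measure \<nu>)" unfolding base_measure_def using Ysets I by (rule pair_measureI)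
    have "emeasure (base_measure \<nu>) (Y \<times> {c..<d}) = emeasure ?P Y * emeasure ?C {c..<d}"
      unfolding base_measure_def by (rule C.emeasure_pair_measure_Times[OF Ysets I])
    also have "emeasure ?C {c..<d} = ennreal (d - c)" using that by (subst emeasure_restrict_space) auto
    finally show "measure (base_measure \<nu>) (Y \<times> {c..<d}) = d - c" using that by (simp add: Y1 measure_def)
  qed
  define D where "D = Y \<times> {t \<in> {0..<1}. frac (real q * t) < 1 / 2}"
  have "{t \<in> {0..<1}. frac (real q * t) < 1 / 2} \<in> sets ?C"
    by (auto simp: sets_restrict_space_iff frac_def)
  then have D_sets: "D \<in> sets (base_measure \<nu>)" unfolding D_def base_measure_def using Ysets by (intro pair_measureI)
  have sp: "space (base_measure \<nu>) = UNIV \<times> {0..<1}"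
    by (simp add: base_measure_def space_pair_measure space_PiM space_restrict_space)
  have inv: "base_map \<theta> -` D \<inter> space (base_measure \<nu>) = D"
  proof -
    have "(\<lambda>n. x (n + 1)) \<in> Y \<longleftrightarrow> x \<in> Y" for x
    proof
      assume *: "(\<lambda>n. x (n + 1)) \<in> Y"
      have "x n \<in> set_pmf \<nu>" for n using *[unfolded Y_def mem_Collect_eq, rule_format, of "n - 1"] by simp
      then show "x \<in> Y" by (simp add: Y_def)
    qed (simp add: Y_def)
    moreover have "frac (real q * frac (t + \<theta> (x 0))) = frac (real q * t)" if "x \<in> Y" for x t
    proof -
      have "real q * \<theta> (x 0) \<in> \<int>" using q(2) that by (simp add: Y_def)
      then obtain m where m: "real q * \<theta> (x 0) = of_int m" by (elim Ints_cases)
      have "real q * frac (t + \<theta> (x 0)) = real q * t + of_int (m - int q * \<lfloor>t + \<theta> (x 0)\<rfloor>)"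
        using m by (simp add: frac_def algebra_simps)
      then show ?thesis by (simp add: frac_def)
    qed
    moreover have "0 \<le> frac u \<and> frac u < 1" for u :: real by (simp add: frac_lt_1)
    ultimately show ?thesis unfolding sp by (auto simp: D_def base_map_def)
  qed
  \<comment> \<open>The measure of \<open>D\<close> is not computed: one rectangle of measure
    \<open>1 / (2 * real q)\<close> inside and one outside already exclude the values 0 and
    1.\<close>
  have q1: "1 / real q \<le> 1" "0 < 1 / (2 * real q)" "1 / (2 * real q) \<le> 1 / real q" "1 / (2 * real q) \<le> 1"
    using q(1) by (auto simp: field_simps)
  have sub: "Y \<times> {0..<1 / (2 * real q)} \<subseteq> D"
  proof -
    have "frac (real q * t) < 1 / 2 \<and> t < 1" if "0 \<le> t" "t < 1 / (2 * real q)" for t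
    proof -
      have "real q * t < 1 / 2" using that q(1) by (simp add: field_simps)
      moreover have "0 \<le> real q * t" using that by simp
      ultimately have "frac (real q * t) = real q * t" by (simp add: frac_eq)
      then show ?thesis using \<open>real q * t < 1 / 2\<close> that(2) q1(4) by linarith
    qed
    then show ?thesis by (auto simp: D_def)
  qed
  have disj: "Y \<times> {1 / (2 * real q)..<1 / real q} \<inter> D = {}"
  proof -
    have "\<not> frac (real q * t) < 1 / 2" if "1 / (2 * real q) \<le> t" "t < 1 / real q" for t
    proof -
      have "1 / 2 \<le> real q * t" "real q * t < 1" using that q(1) by (simp_all add: field_simps)
      then have "frac (real q * t) = real q * t" by (simp add: frac_eq)
      then show ?thesis using \<open>1 / 2 \<le> real q * t\<close> by simp
    qed
    then show ?thesis by (auto simp: D_def)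
  qed
  have "1 / (2 * real q) \<le> measure (base_measure \<nu>) D"
    using B.finite_measure_mono[OF sub D_sets] rect[OF order_refl less_imp_le[OF q1(2)] q1(4)] by linarith
  moreover have "measure (base_measure \<nu>) D + 1 / (2 * real q) \<le> 1"
  proof -
    have "measure (base_measure \<nu>) (Y \<times> {1 / (2 * real q)..<1 / real q}) = 1 / (2 * real q)"
      using rect[OF less_imp_le[OF q1(2)] q1(3,1)] by (simp add: field_simps)
    moreover have "measure (base_measure \<nu>) (Y \<times> {1 / (2 * real q)..<1 / real q} \<union> D)
       = measure (base_measure \<nu>) (Y \<times> {1 / (2 * real q)..<1 / real q}) + measure (base_measure \<nu>) D"
      by (rule B.finite_measure_Union[OF rect_sets[OF less_imp_le[OF q1(2)] q1(3,1)] D_sets disj])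
    ultimately show ?thesis using B.prob_le_1[of "Y \<times> {1 / (2 * real q)..<1 / real q} \<union> D"] by linarith
  qed
  moreover have "measure (base_measure \<nu>) D = 0 \<or> measure (base_measure \<nu>) D = 1"
    using erg D_sets inv unfolding ergodic_system_def by blast
  ultimately show False using q1(2) by linarith
qed

theorem theorem1:
  fixes k :: nat and \<theta> :: "nat \<Rightarrow> real" and \<nu> :: "nat pmf" and r :: regularity
  assumes "\<forall>i\<le>k. 0 < \<theta> i \<and> \<theta> i \<le> 1"
    and "\<theta> 0 \<notin> \<rat>"
    and "set_pmf \<nu> \<subseteq> {..k}"
    and "\<forall>i\<le>k. pmf \<nu> i < 1"
    and "ergodic_system (base_measure \<nu>) (base_map \<theta>)"
  shows "\<exists>U. openin (tuple_topology (Order 0) k r SL2) U \<and>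
             tuple_topology r k r SL2 closure_of U = tuples k r SL2 \<and>
             (\<forall>A\<in>U. lyapunov_plus \<theta> \<nu> A > 0 \<and> C0_continuity_point \<theta> \<nu> k r A)"
proof -
  obtain a where a: "a \<in> set_pmf \<nu>" "\<theta> a \<notin> \<rat>"
    using ergodic_irrational[OF assms(5)] finite_subset[OF assms(3)] by auto
  \<comment> \<open>A second letter of positive weight is what makes different words with the same
    letter counts available.\<close>
  have "set_pmf \<nu> \<noteq> {a}"
  proof
    assume "set_pmf \<nu> = {a}"
    then have "\<nu> = return_pmf a" using set_pmf_subset_singleton[of \<nu> a] by simp
    then have "pmf \<nu> a = 1" by simp
    then show False using assms(3,4) a(1) by force
  qed
  then obtain b where b: "b \<in> set_pmf \<nu>" "a \<noteq> b" using a(1) by blast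
  let ?U = "{A \<in> tuples k r SL2. contracting k \<theta> \<nu> A}"
  have "tuple_topology r k r SL2 closure_of ?U = tuples k r SL2"
  proof
    show "tuple_topology r k r SL2 closure_of ?U \<subseteq> tuples k r SL2"
      using closure_of_subset_topspace[of "tuple_topology r k r SL2" ?U] by (simp only: topspace_tuple_topology)
    show "tuples k r SL2 \<subseteq> tuple_topology r k r SL2 closure_of ?U"
    proof
      fix A assume A: "A \<in> tuples k r SL2"
      have "\<exists>B. B \<in> ?U \<and> B \<in> V" if V: "A \<in> V" "openin (tuple_topology r k r SL2) V" for V
      proof -
        obtain B where B: "B \<in> V" "contracting k \<theta> \<nu> B"
          using contracting_dense[where \<theta> = \<theta> and a = a and b = b, OF V(2,1) assms(3) b(2) a(1) b(1) a(2)] by blast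
        moreover have "V \<subseteq> tuples k r SL2" using openin_subset[OF V(2)] by (simp only: topspace_tuple_topology)
        ultimately show ?thesis by blast
      qed
      then show "A \<in> tuple_topology r k r SL2 closure_of ?U"
        using A unfolding in_closure_of topspace_tuple_topology by blast
    qed
  qed
  moreover have "lyapunov_plus \<theta> \<nu> A > 0 \<and> C0_continuity_point \<theta> \<nu> k r A" if "A \<in> ?U" for A
  proof
    have A: "A \<in> tuples k r SL2" "contracting k \<theta> \<nu> A" using that by auto
    interpret cocycle k \<theta> \<nu> A by (rule tuples_cocycle[OF A(1) assms(3)]) (simp add: SL2_def)
    show "lyapunov_plus \<theta> \<nu> A > 0"
      by (rule contracting_positive[OF _ A(2) a]) (use A(1) in \<open>auto simp: PiE_iff circle_maps_def SL2_def\<close>)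
    show "C0_continuity_point \<theta> \<nu> k r A" by (rule contracting_C0_continuity_point[OF A assms(3) a])
  qed
  ultimately show ?thesis using openin_contracting[OF assms(3), of r \<theta>] by blast
qed

end
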